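(* Let $\{K_\rho:\rho>0\}$ be a family of Hermitian symmetric reproducing kernels acting on $L^2(\mathbb{C},dA)$, and suppose that there exist continuous functions $\phi_\rho:\mathbb{C}\to[0,\infty)$, $\rho>0$, such that $$|K_\rho(z,w)|\le \phi_\rho(z-w),\qquad z,w\in\mathbb{C},\ \rho>0,$$ and such that $$\sup_{\rho>0}\sup_{z\in\mathbb{C}}\tfrac1\rho\,\phi_\rho(z)<\infty,\qquad \sup_{\rho>0}\int_{\mathbb{C}}\phi_\rho\,dA<\infty,\qquad \lim_{\rho\to\infty}\rho\int_{\mathbb{C}}|z|^3\phi_\rho(z)\,dA(z)=0.$$ Let $\mathcal{X}_\rho$ be the determinantal point process on $\mathbb{C}$ with correlation kernel $K_\rho$. Let $f:\mathbb{C}\to\mathbb{R}$ be a compactly supported $C^3$ function and let $\mathrm{Tr}_\rho(f)=\sum_{x\in\mathcal{X}_\rho}f(x)$. Then, for every $k\ge 3$, the cumulant of order $k$ of the random variable $\mathrm{Tr}_\rho(f)$ tends to $0$ as $\rho\to\infty$. As a consequence: (i) If $\mathrm{Var}[\mathrm{Tr}_\rho(f)]\to\sigma^2$ as $\rho\to\infty$ for some finite $\sigma\ge 0$, then $\mathrm{Tr}_\rho(f)-\mathbb{E}[\mathrm{Tr}_\rho(f)]\to\mathcal{N}(0,\sigma^2)$ in distribution as $\rho\to\infty$ (in the degenerate case $\sigma=0$, this means that the limit variable is almost surely zero). (ii) If $\liminf_{\rho\to\infty}\mathrm{Var}[\mathrm{Tr}_\rho(f)]>0$, then $$\frac{\mathrm{Tr}_\rho(f)-\mathbb{E}[\mathrm{Tr}_\rho(f)]}{\sqrt{\mathrm{Var}[\mathrm{Tr}_\rho(f)]}}\to\mathcal{N}(0,1)$$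 in distribution as $\rho\to\infty$.
   Context: $dA$ is the Lebesgue (area) measure on $\mathbb{C}\simeq\mathbb{R}^2$. A Hermitian symmetric reproducing kernel acting on $L^2(\mathbb{C},dA)$ is a function $K:\mathbb{C}\times\mathbb{C}\to\mathbb{C}$ that is the reproducing kernel of a closed subspace $\mathcal{H}\subset L^2(\mathbb{C},dA)$ of functions on which point evaluations are continuous functionals; that is, $K$ is the integral kernel of the orthogonal projection $L^2(\mathbb{C},dA)\to\mathcal{H}$. In particular $K(z,w)=\overline{K(w,z)}$ and $K(z,w)=\int_{\mathbb{C}}K(z,u)K(u,w)\,dA(u)$ for all $z,w\in\mathbb{C}$. A simple point process $\mathcal{X}$ on $\mathbb{C}$ (a random integer-valued positive Radon measure $E\mapsto\mathcal{X}(E)$, almost surely assigning mass at most one to each singleton, identified with the random set of its points) is determinantal with correlation kernel $K$ if for each $n\in\mathbb{N}$ it has $n$-point correlation function (joint intensity) with respect to Lebesgue measure $\rho_n(x_1,\dots,x_n)=\det\big(K(x_k,x_j)\big)_{k,j=1,\dots,n}$; that is, $\mathbb{E}\big[\prod_{j=1}^n\mathcal{X}(E_j)\big]=\int_{E_1\times\cdots\times E_n}\rho_n\,dA(x_1)\cdots dA(x_n)$ for all mutually disjoint Borel sets $E_1,\dots,E_n$. Under the stated assumptions each operator with kernel $K_\rho$ is locally trace class, so by the Macchi–Soshnikov theorem there is a unique determinantal point process $\mathcal{X}_\rho$ with correlation kernel $K_\rho$. The cumulants $C_k$ of a random variable $X$ are defined by $\log\mathbb{E}[e^{tX}]=\sum_{k\ge1}C_k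 t^k/k!$. *)

theory Defs
  imports
    "HOL-Probability.Probability"
    "Jordan_Normal_Form.Determinant"
begin

section \<open>Reproducing kernels on the plane\<close>

definition L2_plane :: "(complex \<Rightarrow> complex) set" where
  "L2_plane = {f. f \<in> borel_measurable lborel \<and> integrable lborel (\<lambda>z. (cmod (f z))\<^sup>2)}"

definition L2_dist :: "(complex \<Rightarrow> complex) \<Rightarrow> (complex \<Rightarrow> complex) \<Rightarrow> real" where
  "L2_dist f g = sqrt (\<integral>z. (cmod (f z - g z))\<^sup>2 \<partial>lborel)"

text \<open>
  The elements of \<open>H\<close> are genuine functions, whereas \<open>L\<^sup>2\<close> consists of classes modulo null sets;
  hence the limit in the closedness clause is only required to have a representative in \<open>H\<close>.
  Continuity of the point evaluations implies that no two elements of \<open>H\<close> lie in the same class.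
\<close>

definition closed_subspace_cont_eval :: "(complex \<Rightarrow> complex) set \<Rightarrow> bool" where
  "closed_subspace_cont_eval H \<longleftrightarrow>
     H \<subseteq> L2_plane \<and>
     (\<lambda>_. 0) \<in> H \<and>
     (\<forall>f\<in>H. \<forall>g\<in>H. (\<lambda>z. f z + g z) \<in> H) \<and>
     (\<forall>c. \<forall>f\<in>H. (\<lambda>z. c * f z) \<in> H) \<and>
     (\<forall>F. \<forall>g\<in>L2_plane. (\<forall>n::nat. F n \<in> H) \<longrightarrow> (\<lambda>n. L2_dist (F n) g) \<longlonglongrightarrow> 0 \<longrightarrow>
        (\<exists>h\<in>H. AE z in lborel. h z = g z)) \<and>
     (\<forall>w. \<forall>F. \<forall>g\<in>H. (\<forall>n::nat. F n \<in> H) \<longrightarrow> (\<lambda>n. L2_dist (F n) g) \<longlonglongrightarrow> 0 \<longrightarrow>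
        (\<lambda>n. F n w) \<longlonglongrightarrow> g w)"

text \<open>
  Applying the reproducing identity to \<open>K(\<cdot>,w)\<close> gives \<open>K(z,w) = cnj (K(w,z))\<close>, so the identity
  also reads \<open>f(w) = \<integral> K(w,z) f(z) dA(z)\<close>: \<open>K\<close> is the integral kernel of the orthogonal
  projection onto \<open>H\<close>.
\<close>

definition reproducing_kernel :: "(complex \<Rightarrow> complex \<Rightarrow> complex) \<Rightarrow> bool" where
  "reproducing_kernel K \<longleftrightarrow>
     (\<exists>H. closed_subspace_cont_eval H \<and>
        (\<forall>w. (\<lambda>z. K z w) \<in> H) \<and>
        (\<forall>f\<in>H. \<forall>w. f w = (\<integral>z. f z * cnj (K z w) \<partial>lborel)))"


section \<open>Determinantal point processes on the plane\<close>

text \<open>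
  Radon measures on \<open>\<complex>\<close> are the Borel measures that are finite on compact sets.
\<close>

definition integer_radon_measure :: "complex measure \<Rightarrow> bool" where
  "integer_radon_measure \<mu> \<longleftrightarrow>
     sets \<mu> = sets borel \<and>
     (\<forall>E\<in>sets borel. emeasure \<mu> E \<in> range ennreal_of_enat) \<and>
     (\<forall>S. compact S \<longrightarrow> emeasure \<mu> S < \<infinity>)"

definition simple_point_process :: "'w measure \<Rightarrow> ('w \<Rightarrow> complex measure) \<Rightarrow> bool" where
  "simple_point_process M X \<longleftrightarrow>
     prob_space M \<and>
     (\<forall>\<omega>\<in>space M. integer_radon_measure (X \<omega>)) \<and>
     (\<forall>E\<in>sets borel. (\<lambda>\<omega>. emeasure (X \<omega>) E) \<in> borel_measurable M) \<and>
     (AE \<omega> in M. \<forall>x. emeasure (X \<omega>) {x} \<le> 1)"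

definition points :: "complex measure \<Rightarrow> complex set" where
  "points \<mu> = {x. emeasure \<mu> {x} \<noteq> 0}"

text \<open>
  Both sides may be infinite, hence the formulation in extended nonnegative reals.
\<close>

definition correlation_function ::
  "'w measure \<Rightarrow> ('w \<Rightarrow> complex measure) \<Rightarrow> nat \<Rightarrow> ((nat \<Rightarrow> complex) \<Rightarrow> real) \<Rightarrow> bool" where
  "correlation_function M X n r \<longleftrightarrow>
     (\<forall>E. (\<forall>j<n. E j \<in> sets borel) \<longrightarrow> disjoint_family_on E {..<n} \<longrightarrow>
        (\<integral>\<^sup>+\<omega>. (\<Prod>j<n. emeasure (X \<omega>) (E j)) \<partial>M) =
        (\<integral>\<^sup>+x\<in>PiE {..<n} E. ennreal (r x) \<partial>(PiM {..<n} (\<lambda>_. lborel))))"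

text \<open>
  For a reproducing kernel \<open>K\<close> the matrix below is a Gram matrix, so its determinant is a
  nonnegative real number and neither \<open>Re\<close> nor \<open>ennreal\<close> loses information.
\<close>

definition determinantal ::
  "'w measure \<Rightarrow> ('w \<Rightarrow> complex measure) \<Rightarrow> (complex \<Rightarrow> complex \<Rightarrow> complex) \<Rightarrow> bool" where
  "determinantal M X K \<longleftrightarrow>
     simple_point_process M X \<and>
     (\<forall>n. correlation_function M X n
        (\<lambda>x. Re (Determinant.det (Matrix.mat n n (\<lambda>(k, j). K (x k) (x j))))))"

definition Tr :: "('w \<Rightarrow> complex measure) \<Rightarrow> (complex \<Rightarrow> real) \<Rightarrow> 'w \<Rightarrow> real" where
  "Tr X f \<omega> = (\<Sum>\<^sub>\<infinity>x\<in>points (X \<omega>). f x)"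


section \<open>Smooth test functions\<close>

primrec C_k :: "nat \<Rightarrow> ('a::euclidean_space \<Rightarrow> real) \<Rightarrow> bool" where
  "C_k 0 f \<longleftrightarrow> continuous_on UNIV f"
| "C_k (Suc k) f \<longleftrightarrow>
     (\<forall>x. f differentiable (at x)) \<and> (\<forall>v. C_k k (\<lambda>x. frechet_derivative f (at x) v))"

definition compactly_supported :: "('a::topological_space \<Rightarrow> real) \<Rightarrow> bool" where
  "compactly_supported f \<longleftrightarrow> compact (closure {x. f x \<noteq> 0})"


section \<open>Cumulants and convergence in distribution\<close>

text \<open>
  The index \<open>0\<close> does not occur in the defining expansion; \<open>C 0 = 0\<close> is a normalisation that
  makes the sequence unique.
\<close>

definition has_cumulants :: "'w measure \<Rightarrow> ('w \<Rightarrow> real) \<Rightarrow> (nat \<Rightarrow> real) \<Rightarrow> bool" where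
  "has_cumulants M X C \<longleftrightarrow>
     C 0 = 0 \<and>
     (\<exists>\<delta>>0. \<forall>t. \<bar>t\<bar> < \<delta> \<longrightarrow>
        integrable M (\<lambda>\<omega>. exp (t * X \<omega>)) \<and>
        (\<lambda>k. C k * t ^ k / fact k) sums ln (\<integral>\<omega>. exp (t * X \<omega>) \<partial>M))"

definition cumulant :: "'w measure \<Rightarrow> ('w \<Rightarrow> real) \<Rightarrow> nat \<Rightarrow> real" where
  "cumulant M X = (THE C. has_cumulants M X C)"

text \<open>
  The point mass is treated separately because \<open>normal_density m 0\<close> is identically zero.
\<close>

definition normal_distribution :: "real \<Rightarrow> real \<Rightarrow> real measure" where
  "normal_distribution m \<sigma> =
     (if \<sigma> = 0 then return borel m else density lborel (normal_density m \<sigma>))"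

text \<open>
  This is \<^const>\<open>weak_conv_m\<close> with the filter \<^const>\<open>sequentially\<close> replaced by
  \<^const>\<open>at_top\<close> on the reals.
\<close>

definition weak_conv_at_top :: "(real \<Rightarrow> real measure) \<Rightarrow> real measure \<Rightarrow> bool" where
  "weak_conv_at_top \<mu> \<nu> \<longleftrightarrow>
     (\<forall>x. isCont (cdf \<nu>) x \<longrightarrow> ((\<lambda>\<rho>. cdf (\<mu> \<rho>) x) \<longlongrightarrow> cdf \<nu> x) at_top)"

end

theory Submission
  imports Defs "Jordan_Normal_Form.Char_Poly"
begin

text \<open>
  Fix \<open>\<rho>\<close>, write \<open>K\<close> for the kernel, \<open>T\<close> for the linear statistic and \<open>G = exp (t f) - 1\<close>. Since
  \<open>exp (t T)\<close> is the product of \<open>1 + G(x)\<close> over the points \<open>x\<close>, the definition of the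
  correlation functions turns \<open>F(t) = E exp (t T)\<close> into the Fredholm determinant of the kernel
  \<open>K(x,y) G(y)\<close>. Its logarithmic derivative is \<open>F'/F = \<integral> f(x) Q(x,x) dx\<close> with the tilted kernel
  \<open>Q = (1 + KG)\<^sup>-\<^sup>1 K (1 + G)\<close>. Because \<open>K\<close> is a projection, so is \<open>Q\<close>, although not a self-adjoint
  one, and \<open>Q' = Q f - Q f Q\<close>. These two identities convert derivatives of \<open>log F\<close> into integrals of
  increments of \<open>f\<close>:

  \<open>2 (log F)'' = \<integral>\<integral> (f(x) - f(y))\<^sup>2 Q(x,y) Q(y,x) dx dy\<close>,

  \<open>(log F)''' = \<integral>\<integral>\<integral> (f(x) - f(y))\<^sup>2 (f(x) - f(z)) Q(x,y) Q(y,z) Q(z,x) dx dy dz\<close>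

  (lemmas \<open>deriv_log_deriv\<close>, \<open>deriv2_log_deriv\<close>, \<open>deriv_Q_eq\<close>). The third derivative contains
  three increments of the Lipschitz function \<open>f\<close>, hence three powers of distances.

  The coefficients of \<open>Q\<close> as a power series in \<open>t\<close> arise from \<open>K\<close> by finitely many compositions
  and multiplications with bounded functions. Such operations preserve the three bounds that the
  hypotheses give for \<open>K\<close>: size \<open>O(\<rho>)\<close>, mass of rows and columns \<open>O(1)\<close>, third moment of rows and
  columns \<open>O(\<beta>)\<close> with \<open>\<beta> = \<integral> |z|\<^sup>3 \<phi>(z) dz\<close> (lemma \<open>Q_bound\<close>). In the triple integral one pays one
  third moment, one supremum, one mass and the area of the support of \<open>f\<close>. So every cumulant of
  order at least \<open>3\<close> is \<open>O(\<rho> \<beta>)\<close>, which tends to \<open>0\<close> (lemmas \<open>cyclic_increment_bound\<close>,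
  \<open>determinantal_cumulants\<close>).

  The Fredholm expansions are formal power series in \<open>t\<close>. As \<open>G\<close> has no constant term, every
  coefficient is a finite sum. The link with the probabilistic side is the differential equation
  \<open>F' = L F\<close>, which holds for the series of moments and the series \<open>L\<close> of cumulants alike. That the
  coefficients of \<open>F\<close> are those of the Fredholm determinant is Campbell's formula for tuples of
  distinct points (lemma \<open>campbell\<close>), proved by rounding the points to dyadic cells.

  For the limit theorems, vanishing of the higher cumulants makes all moments converge to those
  of the normal law, and the convergence of moments implies that of characteristic functions
  (lemma \<open>weak_conv_normal_if_cumulants\<close>).
\<close>

unbundle fps_syntax
unbundle no vec_syntax
no_notation vec_index (infixl "$" 100)

section \<open>Cumulants and moments\<close>

text \<open>
  If \<open>n\<close> is the least index of a nonzero coefficient, then \<open>H(z) / z\<^sup>n\<close> is continuous at \<open>0\<close> and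
  nonzero there.
\<close>

lemma fps_eq_0_if_eval_eventually_0:
  fixes H :: "real fps"
  assumes r: "fps_conv_radius H > 0" and z: "eventually (\<lambda>z. eval_fps H z = 0) (nhds 0)"
  shows "H = 0"
proof (rule ccontr)
  assume "H \<noteq> 0"
  define n where "n = subdegree H"
  have n: "H $ n \<noteq> 0" unfolding n_def using \<open>H \<noteq> 0\<close> by simp
  define S where "S = fps_shift n H"
  have r': "fps_conv_radius S > 0" using r by (simp add: S_def)
  have "eventually (\<lambda>z. z \<in> eball 0 (fps_conv_radius H)) (nhds (0::real))"
    using r by (intro eventually_nhds_in_open open_eball) (simp add: zero_ereal_def)
  with z have "eventually (\<lambda>z. z \<noteq> 0 \<longrightarrow> eval_fps S z = 0) (nhds 0)"
    by eventually_elim (auto simp: S_def n_def eval_fps_shift)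
  hence "eventually (\<lambda>z. eval_fps S z = 0) (at 0)"
    by (simp add: eventually_at_filter)
  hence "(eval_fps S \<longlongrightarrow> 0) (at 0)" by (rule tendsto_eventually)
  moreover have "(eval_fps S \<longlongrightarrow> eval_fps S 0) (at 0)"
    using continuous_eval_fps[of 0 S UNIV] r' by (auto simp: continuous_within zero_ereal_def)
  ultimately have "eval_fps S 0 = 0" using tendsto_unique[of "at (0::real)"] by auto
  thus False using n by (simp add: eval_fps_at_0 S_def)
qed

definition moment_fps :: "'w measure \<Rightarrow> ('w \<Rightarrow> real) \<Rightarrow> real fps" where
  "moment_fps M X = Abs_fps (\<lambda>k. (\<integral>\<omega>. X \<omega> ^ k \<partial>M) / fact k)"

lemma power_le_fact_exp:
  fixes y :: real assumes "0 \<le> y" shows "y ^ k \<le> fact k * exp y"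
proof -
  have "(\<lambda>n. y ^ n /\<^sub>R fact n) sums exp y" by (rule exp_converges)
  hence "(\<Sum>n\<in>{k}. y ^ n /\<^sub>R fact n) \<le> exp y"
    using sum_le_suminf[of "\<lambda>n. y ^ n /\<^sub>R fact n" "{k}"] assms by (simp add: sums_iff)
  thus ?thesis by (simp add: field_simps)
qed

lemma exp_abs_integrable:
  fixes X :: "'w \<Rightarrow> real"
  assumes "r > 0" "integrable M (\<lambda>\<omega>. exp (r * X \<omega>))" "integrable M (\<lambda>\<omega>. exp (- r * X \<omega>))"
  shows "X \<in> borel_measurable M" "integrable M (\<lambda>\<omega>. exp (r * \<bar>X \<omega>\<bar>))"
proof -
  have "(\<lambda>\<omega>. ln (exp (r * X \<omega>)) / r) \<in> borel_measurable M" using assms(2) by measurable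
  thus X: "X \<in> borel_measurable M" using assms(1) by simp
  have "exp (r * \<bar>x\<bar>) \<le> \<bar>exp (r * x) + exp (- r * x)\<bar>" for x :: real
    by (intro order_trans[OF _ abs_ge_self]) (auto simp: abs_if)
  thus "integrable M (\<lambda>\<omega>. exp (r * \<bar>X \<omega>\<bar>))"
    by (intro Bochner_Integration.integrable_bound[OF Bochner_Integration.integrable_add[OF assms(2,3)]])
       (use X in auto)
qed

lemma moments_integrable:
  fixes X :: "'w \<Rightarrow> real"
  assumes "r > 0" "X \<in> borel_measurable M" "integrable M (\<lambda>\<omega>. exp (r * \<bar>X \<omega>\<bar>))"
  shows "integrable M (\<lambda>\<omega>. \<bar>X \<omega>\<bar> ^ k)" "integrable M (\<lambda>\<omega>. X \<omega> ^ k)"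
proof -
  have *: "norm (\<bar>X \<omega>\<bar> ^ k) \<le> norm (fact k / r ^ k * exp (r * \<bar>X \<omega>\<bar>))" for \<omega>
  proof -
    have "r ^ k * \<bar>X \<omega>\<bar> ^ k \<le> fact k * exp (r * \<bar>X \<omega>\<bar>)"
      using power_le_fact_exp[of "r * \<bar>X \<omega>\<bar>" k] assms(1) by (simp add: power_mult_distrib)
    hence "\<bar>X \<omega>\<bar> ^ k \<le> fact k * exp (r * \<bar>X \<omega>\<bar>) / r ^ k"
      using assms(1) by (subst pos_le_divide_eq) (simp_all add: mult.commute)
    thus ?thesis using assms(1) by simp
  qed
  show "integrable M (\<lambda>\<omega>. \<bar>X \<omega>\<bar> ^ k)"
    by (rule Bochner_Integration.integrable_bound[OF integrable_mult_right[OF assms(3), of "fact k / r ^ k"]])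
       (use * assms(2) in auto)
  thus "integrable M (\<lambda>\<omega>. X \<omega> ^ k)"
    by (rule Bochner_Integration.integrable_bound) (use assms(2) in \<open>auto simp: power_abs\<close>)
qed

text \<open>
  The exponential series is integrated term by term, dominated by \<open>exp (r |X|)\<close>.
\<close>

lemma mgf_sums:
  assumes "r > 0" "X \<in> borel_measurable M" "integrable M (\<lambda>\<omega>. exp (r * \<bar>X \<omega>\<bar>))" "\<bar>t\<bar> \<le> r"
  shows "integrable M (\<lambda>\<omega>. exp (t * X \<omega>))"
    and "(\<lambda>k. moment_fps M X $ k * t ^ k) sums (\<integral>\<omega>. exp (t * X \<omega>) \<partial>M)"
proof -
  have le: "\<bar>t * X \<omega>\<bar> \<le> r * \<bar>X \<omega>\<bar>" for \<omega> using assms(4) by (simp add: abs_mult mult_right_mono)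
  have "exp (t * X \<omega>) \<le> exp (r * \<bar>X \<omega>\<bar>)" for \<omega> using le[of \<omega>] by simp
  thus "integrable M (\<lambda>\<omega>. exp (t * X \<omega>))"
    by (intro Bochner_Integration.integrable_bound[OF assms(3)]) (use assms(2) in auto)
  let ?f = "\<lambda>k \<omega>. (t * X \<omega>) ^ k /\<^sub>R fact k"
  have int: "integrable M (?f k)" for k
    using moments_integrable(2)[OF assms(1-3), of k] by (simp add: power_mult_distrib)
  have intn: "integrable M (\<lambda>\<omega>. norm (?f k \<omega>))" for k using int by (rule integrable_norm)
  have sn: "(\<lambda>k. norm (?f k \<omega>)) sums exp \<bar>t * X \<omega>\<bar>" for \<omega>
    using exp_converges[of "\<bar>t * X \<omega>\<bar>"] by (simp add: power_abs abs_mult)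
  have fin: "summable (\<lambda>k. \<integral>\<omega>. norm (?f k \<omega>) \<partial>M)"
  proof (rule summableI_nonneg_bounded)
    fix n
    have "(\<Sum>k<n. \<integral>\<omega>. norm (?f k \<omega>) \<partial>M) = (\<integral>\<omega>. (\<Sum>k<n. norm (?f k \<omega>)) \<partial>M)"
      using intn by (intro Bochner_Integration.integral_sum[symmetric]) auto
    also have "\<dots> \<le> (\<integral>\<omega>. exp (r * \<bar>X \<omega>\<bar>) \<partial>M)"
    proof (rule integral_mono)
      fix \<omega>
      have "(\<Sum>k<n. norm (?f k \<omega>)) \<le> exp \<bar>t * X \<omega>\<bar>"
        using sum_le_suminf[of "\<lambda>k. norm (?f k \<omega>)" "{..<n}"] sn[of \<omega>] by (simp add: sums_iff)
      also have "\<dots> \<le> exp (r * \<bar>X \<omega>\<bar>)" using le by simp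
      finally show "(\<Sum>k<n. norm (?f k \<omega>)) \<le> exp (r * \<bar>X \<omega>\<bar>)" .
    qed (use intn assms(3) in auto)
    finally show "(\<Sum>k<n. \<integral>\<omega>. norm (?f k \<omega>) \<partial>M) \<le> (\<integral>\<omega>. exp (r * \<bar>X \<omega>\<bar>) \<partial>M)" .
  qed auto
  have "(\<lambda>k. integral\<^sup>L M (?f k)) sums (\<integral>\<omega>. (\<Sum>k. ?f k \<omega>) \<partial>M)"
    by (rule sums_integral[OF int _ fin]) (use sn sums_summable in blast)
  moreover have "(\<Sum>k. ?f k \<omega>) = exp (t * X \<omega>)" for \<omega>
    by (rule sums_unique[OF exp_converges, symmetric])
  moreover have "integral\<^sup>L M (?f k) = moment_fps M X $ k * t ^ k" for k
    by (simp add: moment_fps_def power_mult_distrib field_simps)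
  ultimately show "(\<lambda>k. moment_fps M X $ k * t ^ k) sums (\<integral>\<omega>. exp (t * X \<omega>) \<partial>M)" by simp
qed

lemma mgf_has_fps_expansion:
  assumes "r > 0" "X \<in> borel_measurable M" "integrable M (\<lambda>\<omega>. exp (r * \<bar>X \<omega>\<bar>))"
  shows "(\<lambda>t. \<integral>\<omega>. exp (t * X \<omega>) \<partial>M) has_fps_expansion moment_fps M X"
proof (rule has_fps_expansionI)
  have "eventually (\<lambda>t. \<bar>t\<bar> < r) (nhds (0::real))"
    using assms(1) eventually_nhds_metric[of _ "0::real"] by auto
  thus "\<forall>\<^sub>F u in nhds 0. (\<lambda>n. moment_fps M X $ n * u ^ n) sums (\<integral>\<omega>. exp (u * X \<omega>) \<partial>M)"
    by eventually_elim (rule mgf_sums(2)[OF assms], simp)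
qed

lemma has_fps_expansion_ball:
  fixes f :: "real \<Rightarrow> real"
  assumes "f has_fps_expansion F"
  obtains r where "r > 0" "ereal r \<le> fps_conv_radius F" "\<And>t. \<bar>t\<bar> < r \<Longrightarrow> eval_fps F t = f t"
proof -
  from assms have pos: "fps_conv_radius F > 0" and ev: "eventually (\<lambda>z. eval_fps F z = f z) (nhds 0)"
    by (auto simp: has_fps_expansion_def)
  from ev obtain d where d: "d > 0" "\<And>t. \<bar>t\<bar> < d \<Longrightarrow> eval_fps F t = f t"
    by (auto simp: eventually_nhds_metric)
  obtain r' where r': "0 < ereal r'" "ereal r' < fps_conv_radius F" using ereal_dense2[OF pos] by auto
  have "ereal (min d r') \<le> ereal r'" by simp
  also have "\<dots> \<le> fps_conv_radius F" using r' by simp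
  finally show ?thesis using d r' by (intro that[of "min d r'"]) auto
qed

text \<open>
  Both directions between cumulants and moments go through the differential equation
  \<open>F' = G' F\<close> that expresses \<open>F = exp G\<close> for the exponential generating series \<open>F\<close> of
  the moments and \<open>G\<close> of the cumulants.
\<close>

lemma has_cumulants_imp_moment_fps:
  assumes "prob_space M" "has_cumulants M X C"
  obtains r where "r > 0" "X \<in> borel_measurable M" "integrable M (\<lambda>\<omega>. exp (r * \<bar>X \<omega>\<bar>))"
    "fps_deriv (moment_fps M X) = fps_deriv (Abs_fps (\<lambda>k. C k / fact k)) * moment_fps M X"
proof -
  interpret prob_space M by fact
  define G where "G = Abs_fps (\<lambda>k. C k / fact k)"
  let ?F = "moment_fps M X"
  from assms(2) obtain d where d: "d > 0" and i: "\<And>t. \<bar>t\<bar> < d \<Longrightarrow> integrable M (\<lambda>\<omega>. exp (t * X \<omega>))"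
    and s: "\<And>t. \<bar>t\<bar> < d \<Longrightarrow> (\<lambda>k. C k * t ^ k / fact k) sums ln (\<integral>\<omega>. exp (t * X \<omega>) \<partial>M)"
    unfolding has_cumulants_def by blast
  define r where "r = d / 2"
  have r: "r > 0" "r < d" using d by (auto simp: r_def)
  have X: "X \<in> borel_measurable M" and e: "integrable M (\<lambda>\<omega>. exp (r * \<bar>X \<omega>\<bar>))"
    using exp_abs_integrable[OF r(1) i i] r by auto
  have F: "(\<lambda>t. \<integral>\<omega>. exp (t * X \<omega>) \<partial>M) has_fps_expansion ?F"
    by (rule mgf_has_fps_expansion[OF r(1) X e])
  have "(\<lambda>t. ln (\<integral>\<omega>. exp (t * X \<omega>) \<partial>M)) has_fps_expansion G"
  proof (rule has_fps_expansionI)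
    have "eventually (\<lambda>t. \<bar>t\<bar> < d) (nhds (0::real))"
      using d eventually_nhds_metric[of _ "0::real"] by auto
    thus "\<forall>\<^sub>F u in nhds 0. (\<lambda>n. G $ n * u ^ n) sums ln (\<integral>\<omega>. exp (u * X \<omega>) \<partial>M)"
      by eventually_elim (use s in \<open>simp add: G_def\<close>)
  qed
  then obtain r2 where r2: "r2 > 0" "ereal r2 \<le> fps_conv_radius G"
    "\<And>t. \<bar>t\<bar> < r2 \<Longrightarrow> eval_fps G t = ln (\<integral>\<omega>. exp (t * X \<omega>) \<partial>M)"
    by (rule has_fps_expansion_ball) blast
  obtain r1 where r1: "r1 > 0" "ereal r1 \<le> fps_conv_radius ?F"
    "\<And>t. \<bar>t\<bar> < r1 \<Longrightarrow> eval_fps ?F t = (\<integral>\<omega>. exp (t * X \<omega>) \<partial>M)"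
    by (rule has_fps_expansion_ball[OF F]) blast
  define R where "R = min r (min r1 r2)"
  have R: "R > 0" using r r1 r2 by (auto simp: R_def)
  have radF: "ereal \<bar>t\<bar> < fps_conv_radius ?F" if "\<bar>t\<bar> < R" for t
    using that r1(2) by (intro less_le_trans[OF _ r1(2)]) (auto simp: R_def)
  have radG: "ereal \<bar>t\<bar> < fps_conv_radius G" if "\<bar>t\<bar> < R" for t
    using that r2(2) by (intro less_le_trans[OF _ r2(2)]) (auto simp: R_def)
  have pos: "(\<integral>\<omega>. exp (t * X \<omega>) \<partial>M) > 0" if "\<bar>t\<bar> < R" for t
  proof -
    have it: "integrable M (\<lambda>\<omega>. exp (t * X \<omega>))" using i r that by (auto simp: R_def)
    have "(\<integral>\<omega>. exp (t * X \<omega>) \<partial>M) \<noteq> 0"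
      using integral_nonneg_eq_0_iff_AE[OF it] by (auto simp: AE_False)
    thus ?thesis using Bochner_Integration.integral_nonneg[of M "\<lambda>\<omega>. exp (t * X \<omega>)"] by (simp add: order_less_le)
  qed
  have eq: "eval_fps ?F t = exp (eval_fps G t)" if "\<bar>t\<bar> < R" for t
    using r1(3)[of t] r2(3)[of t] pos[OF that] that by (auto simp: R_def)
  have deq: "eval_fps (fps_deriv ?F) t = eval_fps (fps_deriv G) t * eval_fps ?F t" if "\<bar>t\<bar> < R" for t
  proof -
    have 1: "(eval_fps ?F has_field_derivative eval_fps (fps_deriv ?F) t) (at t)"
      by (rule has_field_derivative_eval_fps) (use radF[OF that] in simp)
    have 2: "((\<lambda>t. exp (eval_fps G t)) has_field_derivative exp (eval_fps G t) * eval_fps (fps_deriv G) t) (at t)"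
      by (rule DERIV_fun_exp, rule has_field_derivative_eval_fps) (use radG[OF that] in simp)
    have "eventually (\<lambda>x. x \<in> {x. \<bar>x\<bar> < R}) (nhds t)"
      by (rule eventually_nhds_in_open) (use that in \<open>auto intro!: open_Collect_less continuous_intros\<close>)
    hence ev: "eventually (\<lambda>x. exp (eval_fps G x) = eval_fps ?F x) (nhds t)"
      by eventually_elim (simp add: eq)
    have 3: "(eval_fps ?F has_field_derivative exp (eval_fps G t) * eval_fps (fps_deriv G) t) (at t)"
      using 2 DERIV_cong_ev[OF refl ev refl] by simp
    show ?thesis using DERIV_unique[OF 1 3] eq[OF that] by (simp add: mult.commute)
  qed
  have rad: "ereal t < fps_conv_radius (fps_deriv ?F)" "ereal t < fps_conv_radius (fps_deriv G)"
    if "0 \<le> t" "t < R" for t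
    using radF[of t] radG[of t] that fps_conv_radius_deriv[of ?F] fps_conv_radius_deriv[of G]
    by (auto intro: less_le_trans)
  define H where "H = fps_deriv ?F - fps_deriv G * ?F"
  have "H = 0"
  proof (rule fps_eq_0_if_eval_eventually_0)
    have "0 < fps_conv_radius (fps_deriv ?F)" "0 < fps_conv_radius (fps_deriv G)" "0 < fps_conv_radius ?F"
      using rad[of 0] radF[of 0] R by (auto simp: zero_ereal_def)
    hence "0 < fps_conv_radius (fps_deriv ?F)" "0 < min (fps_conv_radius (fps_deriv G)) (fps_conv_radius ?F)" by simp_all
    hence "0 < min (fps_conv_radius (fps_deriv ?F)) (fps_conv_radius (fps_deriv G * ?F))"
      using less_le_trans[OF _ fps_conv_radius_mult] by simp
    also have "\<dots> \<le> fps_conv_radius H" unfolding H_def by (rule fps_conv_radius_diff)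
    finally show "fps_conv_radius H > 0" .
    have "eventually (\<lambda>t. \<bar>t\<bar> < R) (nhds (0::real))"
      using R eventually_nhds_metric[of _ "0::real"] by auto
    thus "\<forall>\<^sub>F z in nhds 0. eval_fps H z = 0"
    proof eventually_elim
      case (elim t)
      have "ereal \<bar>t\<bar> < fps_conv_radius (fps_deriv G * ?F)"
        using rad(2)[of "\<bar>t\<bar>"] radF[OF elim] elim by (intro less_le_trans[OF _ fps_conv_radius_mult]) auto
      thus ?case unfolding H_def using rad[of "\<bar>t\<bar>"] radF[OF elim] elim deq[OF elim]
        by (simp add: eval_fps_diff eval_fps_mult)
    qed
  qed
  thus ?thesis using that[OF r(1) X e] by (simp add: H_def G_def)
qed

lemma fps_conv_radius_integral0:
  fixes L :: "real fps"
  shows "fps_conv_radius (fps_integral0 L) \<ge> fps_conv_radius L"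
  unfolding fps_conv_radius_def[of "fps_integral0 L"]
proof (rule conv_radius_geI_ex')
  fix r :: real assume r: "0 < r" "ereal r < fps_conv_radius L"
  have "summable (\<lambda>n. norm (fps_nth L n * r ^ n))" using norm_summable_fps[of r L] r by simp
  hence "summable (\<lambda>n. r * norm (fps_nth L n * r ^ n))" by (rule summable_mult)
  hence "summable (\<lambda>n. fps_integral0 L $ Suc n * r ^ Suc n)"
  proof (rule summable_comparison_test')
    fix n :: nat assume "n \<ge> 0"
    have "\<bar>L $ n\<bar> * inverse (1 + real n) \<le> \<bar>L $ n\<bar> * 1"
      by (intro mult_left_mono) (auto simp: field_simps)
    hence "(\<bar>L $ n\<bar> * inverse (1 + real n)) * r ^ Suc n \<le> \<bar>L $ n\<bar> * r ^ Suc n"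
      using r(1) by (intro mult_right_mono) auto
    thus "norm (fps_integral0 L $ Suc n * r ^ Suc n) \<le> r * norm (fps_nth L n * r ^ n)"
      using r by (simp add: abs_mult algebra_simps)
  qed
  thus "summable (\<lambda>n. fps_integral0 L $ n * of_real r ^ n)" by (subst (asm) summable_Suc_iff) simp
qed

text \<open>
  A formal logarithmic derivative of the moment series suffices: \<open>L = F'/F\<close> has a positive
  radius of convergence because \<open>F\<close> has, and the antiderivative of \<open>L\<close> is \<open>ln F\<close> near \<open>0\<close>.
\<close>

lemma has_cumulants_from_moment_fps:
  assumes "prob_space M" "r > 0" "X \<in> borel_measurable M" "integrable M (\<lambda>\<omega>. exp (r * \<bar>X \<omega>\<bar>))"
    and L: "fps_deriv (moment_fps M X) = L * moment_fps M X"
  shows "has_cumulants M X (\<lambda>k. if k = 0 then 0 else fact (k - 1) * L $ (k - 1))"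
proof -
  interpret prob_space M by fact
  let ?F = "moment_fps M X"
  have F0: "?F $ 0 = 1" by (simp add: moment_fps_def prob_space)
  obtain r1 where r1: "r1 > 0" "ereal r1 \<le> fps_conv_radius ?F"
    "\<And>t. \<bar>t\<bar> < r1 \<Longrightarrow> eval_fps ?F t = (\<integral>\<omega>. exp (t * X \<omega>) \<partial>M)"
    by (rule has_fps_expansion_ball[OF mgf_has_fps_expansion[OF assms(2-4)]]) blast
  have Lradius: "fps_conv_radius L > 0"
  proof -
    have "L = fps_deriv ?F * inverse ?F" using L F0 by (simp add: mult.assoc inverse_mult_eq_1')
    moreover have "fps_conv_radius ?F > 0" using r1 by (metis ereal_less(2) less_le_trans)
    hence "fps_conv_radius (fps_deriv ?F) > 0" "fps_conv_radius (inverse ?F) > 0"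
      using fps_conv_radius_deriv[of ?F] fps_conv_radius_inverse_pos[of ?F] F0 by (auto intro: less_le_trans)
    hence "0 < min (fps_conv_radius (fps_deriv ?F)) (fps_conv_radius (inverse ?F))" by simp
    ultimately show ?thesis using less_le_trans[OF _ fps_conv_radius_mult] by simp
  qed
  then obtain r2 where r2: "0 < ereal r2" "ereal r2 < fps_conv_radius L" using ereal_dense2 by blast
  define G where "G = fps_integral0 L"
  have dG: "fps_deriv G = L" by (simp add: G_def fps_eq_iff del: of_nat_Suc)
  have Gradius: "ereal t < fps_conv_radius G" if "t < r2" for t
    using less_le_trans[OF order.strict_trans[OF _ r2(2)] fps_conv_radius_integral0[of L], of "ereal t"] that
    unfolding G_def by simp
  define R where "R = min r (min r1 r2)"
  have R: "R > 0" "R \<le> r" using assms(2) r1 r2 by (auto simp: R_def)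
  have radF: "ereal \<bar>t\<bar> < fps_conv_radius ?F" if "\<bar>t\<bar> < R" for t
    using that r1(2) by (intro less_le_trans[OF _ r1(2)]) (auto simp: R_def)
  have radG: "ereal \<bar>t\<bar> < fps_conv_radius G" if "\<bar>t\<bar> < R" for t using that by (auto simp: R_def Gradius)
  have radL: "ereal \<bar>t\<bar> < fps_conv_radius L" if "\<bar>t\<bar> < R" for t
    using that by (intro order.strict_trans[OF _ r2(2)]) (auto simp: R_def)
  \<comment> \<open>\<open>F exp (-G)\<close> has derivative \<open>0\<close>\<close>
  have FG: "eval_fps ?F t = exp (eval_fps G t)" if t: "\<bar>t\<bar> < R" for t
  proof -
    have "((\<lambda>t. eval_fps ?F t * exp (- eval_fps G t)) has_field_derivative 0) (at s)" if s: "\<bar>s\<bar> < R" for s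
    proof -
      have "eval_fps (fps_deriv ?F) s = eval_fps L s * eval_fps ?F s"
        unfolding L by (rule eval_fps_mult) (use radF[OF s] radL[OF s] in auto)
      moreover have "(eval_fps ?F has_field_derivative eval_fps (fps_deriv ?F) s) (at s)"
        by (rule has_field_derivative_eval_fps) (use radF[OF s] in simp)
      moreover have "(eval_fps G has_field_derivative eval_fps (fps_deriv G) s) (at s)"
        by (rule has_field_derivative_eval_fps) (use radG[OF s] in simp)
      ultimately show ?thesis by (auto intro!: derivative_eq_intros simp: dG algebra_simps)
    qed
    hence "\<exists>c. \<forall>s\<in>{-R<..<R}. eval_fps ?F s * exp (- eval_fps G s) = c"
      by (intro has_field_derivative_zero_constant) (auto intro: has_field_derivative_at_within)
    then obtain c where c: "\<And>s. \<bar>s\<bar> < R \<Longrightarrow> eval_fps ?F s * exp (- eval_fps G s) = c" by force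
    have "c = 1" using c[of 0] R by (simp add: eval_fps_at_0 F0 G_def)
    thus ?thesis using c[OF t] by (simp add: exp_minus field_simps)
  qed
  have "(\<lambda>k. (if k = 0 then 0 else fact (k - 1) * L $ (k - 1)) * t ^ k / fact k) sums ln (\<integral>\<omega>. exp (t * X \<omega>) \<partial>M)"
    if t: "\<bar>t\<bar> < R" for t
  proof -
    have "(\<lambda>k. G $ k * t ^ k) sums eval_fps G t" by (rule sums_eval_fps) (use radG[OF t] in simp)
    moreover have "G $ k * t ^ k = (if k = 0 then 0 else fact (k - 1) * L $ (k - 1)) * t ^ k / fact k" for k
      by (cases k) (simp_all add: G_def field_simps del: of_nat_Suc)
    moreover have "(\<integral>\<omega>. exp (t * X \<omega>) \<partial>M) = exp (eval_fps G t)" using FG[OF t] r1(3)[of t] t by (simp add: R_def)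
    ultimately show ?thesis by simp
  qed
  moreover have "integrable M (\<lambda>\<omega>. exp (t * X \<omega>))" if "\<bar>t\<bar> < R" for t
    using mgf_sums(1)[OF assms(2-4), of t] that R by simp
  ultimately show ?thesis unfolding has_cumulants_def using R(1) by auto
qed

text \<open>
  The coefficients of \<open>F' = G' F\<close>.
\<close>

lemma moment_recursion:
  assumes "prob_space M" "has_cumulants M X C"
  shows "(\<integral>\<omega>. X \<omega> ^ Suc n \<partial>M) = (\<Sum>j\<le>n. of_nat (n choose j) * C (Suc j) * (\<integral>\<omega>. X \<omega> ^ (n - j) \<partial>M))"
proof -
  obtain r where *: "fps_deriv (moment_fps M X) = fps_deriv (Abs_fps (\<lambda>k. C k / fact k)) * moment_fps M X"
    using has_cumulants_imp_moment_fps[OF assms] by metis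
  have "(\<integral>\<omega>. X \<omega> ^ Suc n \<partial>M) / fact n = fps_deriv (moment_fps M X) $ n"
    by (simp add: moment_fps_def field_simps del: of_nat_Suc)
  also have "\<dots> = (\<Sum>j\<le>n. C (Suc j) / fact j * ((\<integral>\<omega>. X \<omega> ^ (n - j) \<partial>M) / fact (n - j)))"
    unfolding * fps_mult_nth atLeast0AtMost
    by (rule sum.cong) (simp_all add: moment_fps_def field_simps del: of_nat_Suc)
  also have "\<dots> = (\<Sum>j\<le>n. of_nat (n choose j) * C (Suc j) * (\<integral>\<omega>. X \<omega> ^ (n - j) \<partial>M)) / fact n"
    unfolding sum_divide_distrib by (rule sum.cong) (auto simp: binomial_fact field_simps)
  finally show ?thesis by simp
qed

lemma has_cumulants_unique:
  assumes "prob_space M" "has_cumulants M X C" "has_cumulants M X D"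
  shows "C = D"
proof -
  interpret prob_space M by fact
  have "C n = D n" for n
  proof (induction n rule: less_induct)
    case (less n)
    show ?case
    proof (cases n)
      case 0 thus ?thesis using assms by (simp add: has_cumulants_def)
    next
      case (Suc m)
      have "(\<Sum>j\<le>m. of_nat (m choose j) * C (Suc j) * (\<integral>\<omega>. X \<omega> ^ (m - j) \<partial>M)) =
            (\<Sum>j\<le>m. of_nat (m choose j) * D (Suc j) * (\<integral>\<omega>. X \<omega> ^ (m - j) \<partial>M))"
        using moment_recursion[OF assms(1,2), of m] moment_recursion[OF assms(1,3), of m] by simp
      moreover have "(\<Sum>j<m. of_nat (m choose j) * C (Suc j) * (\<integral>\<omega>. X \<omega> ^ (m - j) \<partial>M)) =
            (\<Sum>j<m. of_nat (m choose j) * D (Suc j) * (\<integral>\<omega>. X \<omega> ^ (m - j) \<partial>M))"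
        using less Suc by (intro sum.cong) auto
      ultimately show ?thesis using Suc by (simp add: lessThan_Suc_atMost[symmetric] prob_space)
    qed
  qed
  thus ?thesis by auto
qed

lemma cumulant_eqI:
  assumes "prob_space M" "has_cumulants M X C"
  shows "cumulant M X = C"
  unfolding cumulant_def using assms has_cumulants_unique by (intro the_equality) blast+

text \<open>
  \<open>ln E exp (t s (X - c)) = ln E exp ((t s) X) - t s c\<close>, so centring affects the first cumulant
  only, and the cumulant of order \<open>k\<close> is homogeneous of degree \<open>k\<close>.
\<close>

lemma has_cumulants_affine:
  assumes "prob_space M" "has_cumulants M X C" "s \<noteq> 0"
  shows "has_cumulants M (\<lambda>\<omega>. s * (X \<omega> - C 1)) (\<lambda>k. if k = 1 then 0 else s ^ k * C k)"
proof -
  from assms(2) obtain d where d: "d > 0" and i: "\<And>t. \<bar>t\<bar> < d \<Longrightarrow> integrable M (\<lambda>\<omega>. exp (t * X \<omega>))"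
    and s: "\<And>t. \<bar>t\<bar> < d \<Longrightarrow> (\<lambda>k. C k * t ^ k / fact k) sums ln (\<integral>\<omega>. exp (t * X \<omega>) \<partial>M)"
    and C0: "C 0 = 0"
    unfolding has_cumulants_def by blast
  interpret prob_space M by fact
  have "integrable M (\<lambda>\<omega>. exp (t * (s * (X \<omega> - C 1)))) \<and>
     (\<lambda>k. (if k = 1 then 0 else s ^ k * C k) * t ^ k / fact k) sums ln (\<integral>\<omega>. exp (t * (s * (X \<omega> - C 1))) \<partial>M)"
    if t: "\<bar>t\<bar> < d / \<bar>s\<bar>" for t
  proof
    have ts: "\<bar>t * s\<bar> < d" using t assms(3) by (simp add: abs_mult field_simps)
    have e: "exp (t * (s * (X \<omega> - C 1))) = exp (- (t * s * C 1)) * exp (t * s * X \<omega>)" for \<omega>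
      by (simp add: exp_add[symmetric] algebra_simps)
    show "integrable M (\<lambda>\<omega>. exp (t * (s * (X \<omega> - C 1))))" unfolding e using i[OF ts] by simp
    have "(\<integral>\<omega>. exp (t * s * X \<omega>) \<partial>M) \<noteq> 0"
      using integral_nonneg_eq_0_iff_AE[OF i[OF ts]] by (auto simp: AE_False)
    hence pos: "(\<integral>\<omega>. exp (t * s * X \<omega>) \<partial>M) > 0" using Bochner_Integration.integral_nonneg[of M "\<lambda>\<omega>. exp (t * s * X \<omega>)"]
      by (simp add: order_less_le)
    have "(\<lambda>k. (if k = 1 then - (C 1 * (t * s)) else 0)) sums (- (C 1 * (t * s)))"
      using sums_single[of 1 "\<lambda>_. - (C 1 * (t * s))"] by simp
    from sums_add[OF this s[OF ts]]
    have "(\<lambda>k. (if k = 1 then - (C 1 * (t * s)) else 0) + C k * (t * s) ^ k / fact k) sums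
       (- (C 1 * (t * s)) + ln (\<integral>\<omega>. exp (t * s * X \<omega>) \<partial>M))" .
    moreover have "(if k = 1 then - (C 1 * (t * s)) else 0) + C k * (t * s) ^ k / fact k =
       (if k = 1 then 0 else s ^ k * C k) * t ^ k / fact k" for k by (simp add: power_mult_distrib)
    ultimately show "(\<lambda>k. (if k = 1 then 0 else s ^ k * C k) * t ^ k / fact k) sums
        ln (\<integral>\<omega>. exp (t * (s * (X \<omega> - C 1))) \<partial>M)"
      unfolding e using pos by (simp add: ln_mult mult.commute)
  qed
  moreover have "d / \<bar>s\<bar> > 0" using d assms(3) by simp
  ultimately show ?thesis unfolding has_cumulants_def using C0 by auto
qed

lemma cumulants_mean_variance:
  assumes "prob_space M" "has_cumulants M X C"
  shows "C 1 = prob_space.expectation M X" "C 2 = prob_space.variance M X"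
proof -
  interpret prob_space M by fact
  obtain r where r: "r > 0" "X \<in> borel_measurable M" "integrable M (\<lambda>\<omega>. exp (r * \<bar>X \<omega>\<bar>))"
    using has_cumulants_imp_moment_fps[OF assms] by metis
  show 1: "C 1 = expectation X" using moment_recursion[OF assms, of 0] by (simp add: prob_space)
  have "expectation (\<lambda>\<omega>. X \<omega> ^ 2) = C 1 * expectation X + C 2"
    using moment_recursion[OF assms, of 1] by (simp add: prob_space numeral_2_eq_2)
  moreover have "integrable M X" "integrable M (\<lambda>\<omega>. X \<omega> ^ 2)"
    using moments_integrable(2)[OF r, of 1] moments_integrable(2)[OF r, of 2] by auto
  ultimately show "C 2 = variance X" using 1 variance_eq[of X] by (simp add: power2_eq_square)
qed

section \<open>Convergence of cumulants implies convergence in distribution\<close>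

text \<open>
  The moments of the centred normal law of variance \<open>\<sigma>\<^sup>2\<close>; the recursion is integration by
  parts.
\<close>

fun gauss_moment :: "real \<Rightarrow> nat \<Rightarrow> real" where
  "gauss_moment \<sigma> 0 = 1"
| "gauss_moment \<sigma> (Suc 0) = 0"
| "gauss_moment \<sigma> (Suc (Suc n)) = real (Suc n) * \<sigma>\<^sup>2 * gauss_moment \<sigma> n"

lemma gauss_moment_odd: "gauss_moment \<sigma> (Suc (2 * m)) = 0"
  by (induction m) auto

lemma gauss_moment_even: "gauss_moment \<sigma> (2 * m) / fact (2 * m) = (\<sigma>\<^sup>2 / 2) ^ m / fact m"
proof (induction m)
  case (Suc m)
  have f: "(fact (2 * Suc m) :: real) = real (Suc (2 * m)) * (2 * real (Suc m)) * fact (2 * m)"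
    by (simp add: algebra_simps)
  have r: "N * s * g / (N * (2 * A) * F) = s / 2 / A * (g / F)" if "N \<noteq> 0" for N s g A F :: real
    using that by (simp add: field_simps)
  have "gauss_moment \<sigma> (2 * Suc m) / fact (2 * Suc m) =
      real (Suc (2 * m)) * \<sigma>\<^sup>2 * gauss_moment \<sigma> (2 * m) / (real (Suc (2 * m)) * (2 * real (Suc m)) * fact (2 * m))"
    by (subst f) simp
  also have "\<dots> = \<sigma>\<^sup>2 / 2 / real (Suc m) * ((\<sigma>\<^sup>2 / 2) ^ m / fact m)"
    unfolding Suc[symmetric] by (rule r) simp
  finally show ?case by simp
qed simp

lemma divide_real_scaleR: "x / y = x /\<^sub>R y" for x y :: real
  by (simp add: divide_inverse mult.commute)

text \<open>
  The Taylor polynomials of the characteristic function \<open>exp (- (\<sigma> t)\<^sup>2 / 2)\<close>, computed from the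
  moments.
\<close>

lemma gauss_char_partial_sum:
  "(\<Sum>k\<le>2 * m. (\<i> * complex_of_real t) ^ k / fact k * complex_of_real (gauss_moment \<sigma> k)) =
   complex_of_real (\<Sum>j\<le>m. (- ((\<sigma> * t)\<^sup>2 / 2)) ^ j /\<^sub>R fact j)"
proof (induction m)
  case (Suc m)
  have e: "(\<i> * complex_of_real t) ^ (2 * n) / fact (2 * n) * complex_of_real (gauss_moment \<sigma> (2 * n))
     = complex_of_real ((- ((\<sigma> * t)\<^sup>2 / 2)) ^ n /\<^sub>R fact n)" for n
  proof -
    have "(\<i> * complex_of_real t) ^ (2 * n) = complex_of_real ((- (t\<^sup>2)) ^ n)"
      unfolding power_mult by (simp add: power_mult_distrib)
    hence "(\<i> * complex_of_real t) ^ (2 * n) / fact (2 * n) * complex_of_real (gauss_moment \<sigma> (2 * n)) =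
       complex_of_real ((- (t\<^sup>2)) ^ n * (gauss_moment \<sigma> (2 * n) / fact (2 * n)))"
      by simp
    also have "(- (t\<^sup>2)) ^ n * (gauss_moment \<sigma> (2 * n) / fact (2 * n)) = (- (t\<^sup>2) * (\<sigma>\<^sup>2 / 2)) ^ n / fact n"
      unfolding gauss_moment_even power_mult_distrib by simp
    also have "- (t\<^sup>2) * (\<sigma>\<^sup>2 / 2) = - ((\<sigma> * t)\<^sup>2 / 2)" by (simp add: power_mult_distrib)
    also have "(- ((\<sigma> * t)\<^sup>2 / 2)) ^ n / fact n = (- ((\<sigma> * t)\<^sup>2 / 2)) ^ n /\<^sub>R fact n"
      by (rule divide_real_scaleR)
    finally show ?thesis .
  qed
  have *: "(\<Sum>k\<le>2 * Suc m. g k) = (\<Sum>k\<le>2 * m. g k) + g (Suc (2 * m)) + g (2 * Suc m)" for g :: "nat \<Rightarrow> complex"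
    by simp
  show ?case unfolding * Suc e[of "Suc m"] gauss_moment_odd by (simp del: power_Suc fact_Suc)
qed simp

lemma gauss_remainder_tendsto:
  "(\<lambda>m. 2 * \<bar>t\<bar> ^ (2 * m) / fact (2 * m) * gauss_moment \<sigma> (2 * m)) \<longlonglongrightarrow> 0"
proof -
  have "2 * \<bar>t\<bar> ^ (2 * m) / fact (2 * m) * gauss_moment \<sigma> (2 * m) = 2 * (((\<sigma> * t)\<^sup>2 / 2) ^ m /\<^sub>R fact m)" for m
  proof -
    have "\<bar>t\<bar> ^ (2 * m) * (gauss_moment \<sigma> (2 * m) / fact (2 * m)) = (t\<^sup>2 * (\<sigma>\<^sup>2 / 2)) ^ m / fact m"
      unfolding gauss_moment_even power_mult_distrib by (simp add: power_mult)
    also have "t\<^sup>2 * (\<sigma>\<^sup>2 / 2) = (\<sigma> * t)\<^sup>2 / 2" by (simp add: power_mult_distrib)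
    also have "((\<sigma> * t)\<^sup>2 / 2) ^ m / fact m = ((\<sigma> * t)\<^sup>2 / 2) ^ m /\<^sub>R fact m"
      by (rule divide_real_scaleR)
    finally show ?thesis by simp
  qed
  moreover have "(\<lambda>m. ((\<sigma> * t)\<^sup>2 / 2) ^ m /\<^sub>R fact m) \<longlonglongrightarrow> 0"
    using summable_LIMSEQ_zero[OF sums_summable[OF exp_converges[of "(\<sigma> * t)\<^sup>2 / 2"]]] .
  hence "(\<lambda>m. 2 * (((\<sigma> * t)\<^sup>2 / 2) ^ m /\<^sub>R fact m)) \<longlonglongrightarrow> 2 * 0" by (rule tendsto_mult_left)
  ultimately show ?thesis by simp
qed

lemma char_normal_distribution:
  assumes "\<sigma> \<ge> 0"
  shows "real_distribution (normal_distribution 0 \<sigma>)"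
    and "char (normal_distribution 0 \<sigma>) t = complex_of_real (exp (- ((\<sigma> * t)\<^sup>2 / 2)))"
proof -
  have "prob_space (normal_distribution 0 \<sigma>)"
    using assms prob_space_return[of 0 borel] prob_space_normal_density[of \<sigma> 0]
    by (auto simp: normal_distribution_def)
  thus "real_distribution (normal_distribution 0 \<sigma>)"
    by (auto simp: real_distribution_def real_distribution_axioms_def normal_distribution_def)
  show "char (normal_distribution 0 \<sigma>) t = complex_of_real (exp (- ((\<sigma> * t)\<^sup>2 / 2)))"
  proof (cases "\<sigma> = 0")
    case True
    thus ?thesis by (simp add: char_def normal_distribution_def integral_return)
  next
    case False
    hence s: "\<sigma> > 0" using assms by simp
    have "char (normal_distribution 0 \<sigma>) t = (\<integral>x. normal_density 0 \<sigma> x *\<^sub>R iexp (t * x) \<partial>lborel)"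
      unfolding char_def normal_distribution_def using False by (simp add: integral_density)
    also have "\<dots> = \<bar>\<sigma>\<bar> *\<^sub>R (\<integral>x. normal_density 0 \<sigma> (0 + \<sigma> * x) *\<^sub>R iexp (t * (0 + \<sigma> * x)) \<partial>lborel)"
      by (rule lborel_integral_real_affine) (use s in auto)
    also have "\<dots> = (\<integral>x. \<bar>\<sigma>\<bar> *\<^sub>R (normal_density 0 \<sigma> (0 + \<sigma> * x) *\<^sub>R iexp (t * (0 + \<sigma> * x))) \<partial>lborel)"
      by (rule integral_scaleR_right[symmetric])
    also have "\<dots> = (\<integral>x. std_normal_density x *\<^sub>R iexp (\<sigma> * t * x) \<partial>lborel)"
    proof (rule Bochner_Integration.integral_cong[OF refl])
      fix x :: real
      have "\<sigma> * normal_density 0 \<sigma> (\<sigma> * x) = std_normal_density x"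
        using s by (simp add: normal_density_def real_sqrt_mult power_mult_distrib field_simps)
      thus "\<bar>\<sigma>\<bar> *\<^sub>R (normal_density 0 \<sigma> (0 + \<sigma> * x) *\<^sub>R iexp (t * (0 + \<sigma> * x))) = std_normal_density x *\<^sub>R iexp (\<sigma> * t * x)"
        using s by (simp add: mult_ac)
    qed
    also have "\<dots> = char std_normal_distribution (\<sigma> * t)"
      unfolding char_def by (simp add: integral_density)
    finally show ?thesis by (simp add: char_std_normal_distribution)
  qed
qed

text \<open>
  In the limit of the moment recursion only the second cumulant survives, and the recursion
  becomes that of \<open>gauss_moment\<close>.
\<close>

lemma moments_tendsto_gauss:
  assumes ps: "\<And>i. prob_space (N i)" and cum: "\<And>i. has_cumulants (N i) (Y i) (C i)"
    and C1: "\<And>i. C i 1 = 0" and C2: "(\<lambda>i. C i 2) \<longlonglongrightarrow> \<sigma>\<^sup>2"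
    and C3: "\<And>k. k \<ge> 3 \<Longrightarrow> (\<lambda>i. C i k) \<longlonglongrightarrow> 0"
  shows "(\<lambda>i. \<integral>\<omega>. Y i \<omega> ^ n \<partial>N i) \<longlonglongrightarrow> gauss_moment \<sigma> n"
proof (induction n rule: less_induct)
  case (less n)
  show ?case
  proof (cases n)
    case 0
    have "(\<integral>\<omega>. Y i \<omega> ^ 0 \<partial>N i) = 1" for i using prob_space.prob_space[OF ps] by simp
    thus ?thesis using 0 by simp
  next
    case (Suc m)
    have lim: "(\<lambda>i. C i (Suc j)) \<longlonglongrightarrow> (if j = 1 then \<sigma>\<^sup>2 else 0)" for j
      using C1 C2 C3[of "Suc j"] by (cases "j = 0 \<or> j = 1") (auto simp: numeral_2_eq_2)
    have "(\<lambda>i. \<Sum>j\<le>m. of_nat (m choose j) * C i (Suc j) * (\<integral>\<omega>. Y i \<omega> ^ (m - j) \<partial>N i)) \<longlonglongrightarrow>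
       (\<Sum>j\<le>m. of_nat (m choose j) * (if j = 1 then \<sigma>\<^sup>2 else 0) * gauss_moment \<sigma> (m - j))"
      by (intro tendsto_intros lim less) (use Suc in auto)
    moreover have "(\<Sum>j\<le>m. of_nat (m choose j) * (if j = 1 then \<sigma>\<^sup>2 else 0) * gauss_moment \<sigma> (m - j)) = gauss_moment \<sigma> n"
    proof (cases m)
      case (Suc l)
      have "(\<Sum>j\<le>m. of_nat (m choose j) * (if j = 1 then \<sigma>\<^sup>2 else 0) * gauss_moment \<sigma> (m - j)) =
         (\<Sum>j\<in>{1}. of_nat (m choose j) * (if j = 1 then \<sigma>\<^sup>2 else 0) * gauss_moment \<sigma> (m - j))"
        by (rule sum.mono_neutral_right) (use Suc in auto)
      thus ?thesis using Suc \<open>n = Suc m\<close> by simp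
    qed (use \<open>n = Suc m\<close> in simp)
    ultimately show ?thesis unfolding Suc moment_recursion[OF ps cum] by simp
  qed
qed

text \<open>
  The method of moments for the normal law. The Taylor remainder of the characteristic function
  after \<open>2m\<close> terms is at most \<open>2 t\<^sup>2\<^sup>m E Y\<^sup>2\<^sup>m / (2m)!\<close>, which in the limit is
  \<open>2 (\<sigma>\<^sup>2 t\<^sup>2 / 2)\<^sup>m / m!\<close>; hence finitely many moments control the characteristic function
  at every point \<open>t\<close>.
\<close>

lemma weak_conv_normal_if_cumulants:
  assumes ps: "\<And>i. prob_space (N i)" and cum: "\<And>i. has_cumulants (N i) (Y i) (C i)"
    and C1: "\<And>i. C i 1 = 0" and C2: "(\<lambda>i. C i 2) \<longlonglongrightarrow> \<sigma>\<^sup>2"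
    and C3: "\<And>k. k \<ge> 3 \<Longrightarrow> (\<lambda>i. C i k) \<longlonglongrightarrow> 0" and s: "\<sigma> \<ge> 0"
  shows "weak_conv_m (\<lambda>i. distr (N i) borel (Y i)) (normal_distribution 0 \<sigma>)"
proof (rule levy_continuity)
  have Y: "Y i \<in> borel_measurable (N i)" and int: "integrable (N i) (\<lambda>\<omega>. Y i \<omega> ^ k)" for i k
    using has_cumulants_imp_moment_fps[OF ps cum, of i] moments_integrable(2) by metis+
  show "real_distribution (distr (N i) borel (Y i))" for i
    using prob_space.real_distribution_distr[OF ps Y] .
  show "real_distribution (normal_distribution 0 \<sigma>)" by (rule char_normal_distribution[OF s])
  fix t :: real
  let ?c = "\<lambda>i. char (distr (N i) borel (Y i)) t"
  let ?P = "\<lambda>i m. \<Sum>k\<le>2 * m. (\<i> * complex_of_real t) ^ k / fact k * complex_of_real (\<integral>\<omega>. Y i \<omega> ^ k \<partial>N i)"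
  let ?S = "\<lambda>m. complex_of_real (\<Sum>j\<le>m. (- ((\<sigma> * t)\<^sup>2 / 2)) ^ j /\<^sub>R fact j)"
  let ?R = "\<lambda>m. 2 * \<bar>t\<bar> ^ (2 * m) / fact (2 * m) * gauss_moment \<sigma> (2 * m)"
  let ?e = "complex_of_real (exp (- ((\<sigma> * t)\<^sup>2 / 2)))"
  have mom: "(\<lambda>i. \<integral>\<omega>. Y i \<omega> ^ n \<partial>N i) \<longlonglongrightarrow> gauss_moment \<sigma> n" for n
    using moments_tendsto_gauss[OF ps cum C1 C2 C3] by simp
  have S: "?S \<longlonglongrightarrow> ?e"
    using exp_converges[of "- ((\<sigma> * t)\<^sup>2 / 2)"] unfolding sums_def_le by (rule tendsto_of_real)
  have "?c \<longlonglongrightarrow> ?e"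
  proof (rule tendstoI)
    fix \<epsilon> :: real assume e: "\<epsilon> > 0"
    have "eventually (\<lambda>m. dist (?S m) ?e < \<epsilon> / 3 \<and> dist (?R m) 0 < \<epsilon> / 6) sequentially"
      using tendstoD[OF S, of "\<epsilon> / 3"] tendstoD[OF gauss_remainder_tendsto[of t \<sigma>], of "\<epsilon> / 6"] e
      by (intro eventually_conj) auto
    then obtain m where m: "dist (?S m) ?e < \<epsilon> / 3" "dist (?R m) 0 < \<epsilon> / 6"
      by (auto simp: eventually_sequentially)
    have "(\<lambda>i. ?P i m) \<longlonglongrightarrow> (\<Sum>k\<le>2 * m. (\<i> * complex_of_real t) ^ k / fact k * complex_of_real (gauss_moment \<sigma> k))"
      by (intro tendsto_intros mom)
    hence P: "(\<lambda>i. ?P i m) \<longlonglongrightarrow> ?S m" unfolding gauss_char_partial_sum .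
    have "(\<lambda>i. 2 * \<bar>t\<bar> ^ (2 * m) / fact (2 * m) * (\<integral>\<omega>. Y i \<omega> ^ (2 * m) \<partial>N i)) \<longlonglongrightarrow> ?R m"
      by (intro tendsto_intros mom)
    from tendstoD[OF this, of "\<epsilon> / 6"] tendstoD[OF P, of "\<epsilon> / 3"] e
    have "\<forall>\<^sub>F i in sequentially. dist (2 * \<bar>t\<bar> ^ (2 * m) / fact (2 * m) * (\<integral>\<omega>. Y i \<omega> ^ (2 * m) \<partial>N i)) (?R m) < \<epsilon> / 6 \<and>
        dist (?P i m) (?S m) < \<epsilon> / 3"
      by (intro eventually_conj) auto
    thus "\<forall>\<^sub>F i in sequentially. dist (?c i) ?e < \<epsilon>"
    proof eventually_elim
      case (elim i)
      have "dist (?c i) (?P i m) \<le> 2 * \<bar>t\<bar> ^ (2 * m) / fact (2 * m) * (\<integral>\<omega>. \<bar>Y i \<omega>\<bar> ^ (2 * m) \<partial>N i)"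
        unfolding dist_norm by (rule prob_space.char_approx1'[OF ps int Y refl])
      also have "(\<integral>\<omega>. \<bar>Y i \<omega>\<bar> ^ (2 * m) \<partial>N i) = (\<integral>\<omega>. Y i \<omega> ^ (2 * m) \<partial>N i)"
        by (simp add: power_mult)
      finally have "dist (?c i) (?P i m) < \<epsilon> / 3" using elim m(2) unfolding dist_real_def by linarith
      thus ?case using elim m(1) dist_triangle[of "?c i" ?e "?P i m"] dist_triangle[of "?P i m" ?e "?S m"] by linarith
    qed
  qed
  thus "?c \<longlonglongrightarrow> char (normal_distribution 0 \<sigma>) t" using char_normal_distribution(2)[OF s] by simp
qed

text \<open>
  Convergence along \<open>at_top\<close> is tested on sequences. All but finitely many terms of such a
  sequence satisfy \<open>P\<close>; the others may be replaced by a fixed parameter satisfying \<open>P\<close>.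
\<close>

lemma weak_conv_at_topI:
  assumes P: "eventually P at_top"
    and conv: "\<And>s. filterlim s at_top sequentially \<Longrightarrow> (\<And>i. P (s i)) \<Longrightarrow> weak_conv_m (\<lambda>i. \<mu> (s i)) \<nu>"
  shows "weak_conv_at_top \<mu> \<nu>"
  unfolding weak_conv_at_top_def
proof (intro allI impI)
  fix x assume x: "isCont (cdf \<nu>) x"
  show "((\<lambda>\<rho>. cdf (\<mu> \<rho>) x) \<longlongrightarrow> cdf \<nu> x) at_top"
  proof (rule tendsto_at_topI_sequentially)
    fix s :: "nat \<Rightarrow> real" assume s: "filterlim s at_top sequentially"
    have Ps: "\<forall>\<^sub>F i in sequentially. P (s i)" using filterlim_iff[THEN iffD1, OF s] P by blast
    obtain r where r: "P r" using eventually_happens[OF P] by auto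
    define s' where "s' i = (if P (s i) then s i else r)" for i
    have ev: "\<forall>\<^sub>F i in sequentially. s' i = s i" using Ps by eventually_elim (simp add: s'_def)
    hence "filterlim s' at_top sequentially" using s filterlim_cong[OF refl refl ev] by blast
    from conv[OF this] x r have "(\<lambda>i. cdf (\<mu> (s' i)) x) \<longlonglongrightarrow> cdf \<nu> x"
      by (auto simp: s'_def weak_conv_m_def weak_conv_def)
    thus "(\<lambda>i. cdf (\<mu> (s i)) x) \<longlonglongrightarrow> cdf \<nu> x"
      by (rule Lim_transform_eventually) (use ev in eventually_elim, simp)
  qed
qed

section \<open>Integer-valued Radon measures as point configurations\<close>

lemma integer_measure_cases:
  assumes "integer_radon_measure \<mu>" "E \<in> sets borel"
  shows "emeasure \<mu> E = 0 \<or> emeasure \<mu> E \<ge> 1"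
proof -
  from assms obtain n where n: "emeasure \<mu> E = ennreal_of_enat n"
    by (auto simp: integer_radon_measure_def)
  show ?thesis
  proof (cases n)
    case (enat k)
    thus ?thesis using n by (cases k) auto
  qed (use n in auto)
qed

lemma integer_measure_bounded_finite:
  assumes "integer_radon_measure \<mu>" "bounded B" "E \<in> sets borel" "E \<subseteq> B"
  shows "emeasure \<mu> E < \<infinity>"
proof -
  obtain r where "\<And>z. z \<in> B \<Longrightarrow> norm z \<le> r" using assms(2) by (auto simp: bounded_iff)
  hence "B \<subseteq> cball 0 r" by auto
  moreover have "sets \<mu> = sets borel" "emeasure \<mu> (cball 0 r) < \<infinity>"
    using assms(1) by (auto simp: integer_radon_measure_def)
  ultimately show ?thesis using assms(4) emeasure_mono[of E "cball 0 r" \<mu>] by (auto intro: le_less_trans)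
qed

text \<open>
  Every point that is not an atom has a neighbourhood of measure less than \<open>1\<close>, hence of
  measure \<open>0\<close>; by the Lindelof property countably many of these cover the complement of the atoms.
\<close>

lemma integer_measure_atomic:
  assumes "integer_radon_measure \<mu>"
  shows "open (- points \<mu>)" "emeasure \<mu> (- points \<mu>) = 0"
proof -
  have sets[simp]: "sets \<mu> = sets borel" using assms by (simp add: integer_radon_measure_def)
  define F where "F = {ball x r | x r. emeasure \<mu> (ball x r) = 0}"
  have ex: "\<exists>r>0. emeasure \<mu> (ball x r) = 0" if "x \<notin> points \<mu>" for x
  proof -
    let ?A = "\<lambda>n. ball x (1 / real (Suc n))"
    have "(\<lambda>n. emeasure \<mu> (?A n)) \<longlonglongrightarrow> emeasure \<mu> (\<Inter>n. ?A n)"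
    proof (rule Lim_emeasure_decseq)
      show "decseq ?A" unfolding decseq_def
        by (intro allI impI subset_ball divide_left_mono) auto
      show "emeasure \<mu> (?A n) \<noteq> \<infinity>" for n
        using integer_measure_bounded_finite[OF assms bounded_ball, of "?A n" x "1 / real (Suc n)"] by force
    qed auto
    moreover have "(\<Inter>n. ?A n) = {x}"
    proof -
      have "y = x" if "\<And>n. dist x y < 1 / real (Suc n)" for y
      proof (rule ccontr)
        assume "y \<noteq> x"
        hence "dist x y > 0" by simp
        then obtain n where "inverse (real (Suc n)) < dist x y" using reals_Archimedean by blast
        thus False using that[of n] by (simp add: inverse_eq_divide)
      qed
      thus ?thesis by auto
    qed
    ultimately have "(\<lambda>n. emeasure \<mu> (?A n)) \<longlonglongrightarrow> 0" using that by (simp add: points_def)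
    hence "\<forall>\<^sub>F n in sequentially. emeasure \<mu> (?A n) < 1" by (rule order_tendstoD) simp
    then obtain n where "emeasure \<mu> (?A n) < 1" by (auto simp: eventually_sequentially)
    hence "emeasure \<mu> (?A n) = 0" using integer_measure_cases[OF assms, of "?A n"] by auto
    thus ?thesis by (intro exI[of _ "1 / real (Suc n)"]) auto
  qed
  obtain F' where F': "F' \<subseteq> F" "countable F'" "\<Union>F' = \<Union>F" by (rule Lindelof[of F]) (auto simp: F_def)
  have null: "\<Union>F' \<in> null_sets \<mu>"
    using F' by (intro null_sets_UN'[of F' "\<lambda>x. x" \<mu>, simplified]) (auto simp: F_def null_sets_def)
  have "\<Union>F = - points \<mu>"
  proof
    show "- points \<mu> \<subseteq> \<Union>F"
    proof
      fix x assume "x \<in> - points \<mu>"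
      then obtain r where "r > 0" "emeasure \<mu> (ball x r) = 0" using ex by auto
      thus "x \<in> \<Union>F" unfolding F_def by (auto intro!: exI[of _ "ball x r"])
    qed
    show "\<Union>F \<subseteq> - points \<mu>"
    proof
      fix x assume "x \<in> \<Union>F"
      then obtain y r where "x \<in> ball y r" "emeasure \<mu> (ball y r) = 0" by (auto simp: F_def)
      hence "emeasure \<mu> {x} = 0" using emeasure_mono[of "{x}" "ball y r" \<mu>] by auto
      thus "x \<in> - points \<mu>" by (simp add: points_def)
    qed
  qed
  thus "emeasure \<mu> (- points \<mu>) = 0" using null F' by auto
  show "open (- points \<mu>)" using \<open>\<Union>F = - points \<mu>\<close>[symmetric] by (auto simp: F_def)
qed

text \<open>
  Each atom has mass at least \<open>1\<close>, so infinitely many of them contradict local finiteness.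
\<close>

lemma finite_points_bounded:
  assumes "integer_radon_measure \<mu>" "bounded B"
  shows "finite (points \<mu> \<inter> B)"
proof (rule ccontr)
  assume inf: "infinite (points \<mu> \<inter> B)"
  have sets[simp]: "sets \<mu> = sets borel" using assms by (simp add: integer_radon_measure_def)
  obtain r where "\<And>z. z \<in> B \<Longrightarrow> norm z \<le> r" using assms(2) by (auto simp: bounded_iff)
  hence r: "B \<subseteq> cball 0 r" by auto
  have "of_nat n \<le> emeasure \<mu> (cball 0 r)" for n
  proof -
    obtain F where F: "F \<subseteq> points \<mu> \<inter> B" "finite F" "card F = n"
      using infinite_arbitrarily_large[OF inf] by blast
    have "of_nat n = (\<Sum>x\<in>F. (1::ennreal))" using F by simp
    also have "\<dots> \<le> (\<Sum>x\<in>F. emeasure \<mu> {x})"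
    proof (rule sum_mono)
      fix x assume "x \<in> F"
      hence "emeasure \<mu> {x} \<noteq> 0" using F by (auto simp: points_def)
      thus "1 \<le> emeasure \<mu> {x}" using integer_measure_cases[OF assms(1), of "{x}"] by auto
    qed
    also have "\<dots> = emeasure \<mu> F" using F by (intro emeasure_eq_sum_singleton[symmetric]) auto
    also have "\<dots> \<le> emeasure \<mu> (cball 0 r)" using F r by (intro emeasure_mono) auto
    finally show ?thesis .
  qed
  hence "\<not> emeasure \<mu> (cball 0 r) < \<infinity>" using ennreal_Ex_less_of_nat leD by (metis infinity_ennreal_def)
  moreover have "emeasure \<mu> (cball 0 r) < \<infinity>" using assms(1) by (simp add: integer_radon_measure_def)
  ultimately show False by simp
qed

lemma emeasure_eq_sum_points:
  assumes "integer_radon_measure \<mu>" "bounded C" "C \<in> sets borel"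
  shows "emeasure \<mu> C = (\<Sum>x\<in>points \<mu> \<inter> C. emeasure \<mu> {x})"
proof -
  have sets[simp]: "sets \<mu> = sets borel" using assms by (simp add: integer_radon_measure_def)
  have fin: "finite (points \<mu> \<inter> C)" by (rule finite_points_bounded[OF assms(1,2)])
  have "emeasure \<mu> C = emeasure \<mu> (points \<mu> \<inter> C) + emeasure \<mu> (- points \<mu> \<inter> C)"
    using fin assms(3) integer_measure_atomic(1)[OF assms(1)]
    by (subst plus_emeasure) (auto simp: finite_imp_closed intro!: arg_cong[of _ _ "emeasure \<mu>"] sets.Int borel_open borel_closed)
  also have "emeasure \<mu> (- points \<mu> \<inter> C) = 0"
    using emeasure_mono[of "- points \<mu> \<inter> C" "- points \<mu>" \<mu>] integer_measure_atomic[OF assms(1)]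
    by (auto intro: borel_open)
  also have "emeasure \<mu> (points \<mu> \<inter> C) = (\<Sum>x\<in>points \<mu> \<inter> C. emeasure \<mu> {x})"
    using fin by (intro emeasure_eq_sum_singleton) auto
  finally show ?thesis by simp
qed

lemma emeasure_eq_0_iff_no_points:
  assumes "integer_radon_measure \<mu>" "bounded C" "C \<in> sets borel"
  shows "emeasure \<mu> C = 0 \<longleftrightarrow> points \<mu> \<inter> C = {}"
  unfolding emeasure_eq_sum_points[OF assms] using finite_points_bounded[OF assms(1,2)]
  by (auto simp: points_def)

lemma emeasure_eq_card_points:
  assumes "integer_radon_measure \<mu>" "bounded C" "C \<in> sets borel" "\<And>x. emeasure \<mu> {x} \<le> 1"
  shows "emeasure \<mu> C = of_nat (card (points \<mu> \<inter> C))"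
proof -
  have "emeasure \<mu> {x} = 1" if "x \<in> points \<mu>" for x
    using that assms(4)[of x] integer_measure_cases[OF assms(1), of "{x}"] by (auto simp: points_def)
  thus ?thesis unfolding emeasure_eq_sum_points[OF assms(1-3)] by simp
qed

section \<open>Dyadic rounding\<close>

text \<open>
  The lower left corner of the dyadic square of side \<open>2\<^sup>-\<^sup>L\<close> that contains \<open>z\<close>. Correlation
  functions describe the numbers of points in disjoint sets; rounding expresses sums over the
  points of a configuration through such numbers.
\<close>

definition dyadic :: "nat \<Rightarrow> complex \<Rightarrow> complex" where
  "dyadic L z = Complex (of_int \<lfloor>2 ^ L * Re z\<rfloor> / 2 ^ L) (of_int \<lfloor>2 ^ L * Im z\<rfloor> / 2 ^ L)"

lemma dyadic_measurable [measurable]: "dyadic L \<in> borel_measurable borel"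
  unfolding dyadic_def Complex_eq by measurable

lemma abs_dyadic_floor: "\<bar>of_int \<lfloor>2 ^ L * x\<rfloor> / 2 ^ L - x\<bar> \<le> (1 / 2) ^ L" for x :: real
proof -
  have "of_int \<lfloor>2 ^ L * x\<rfloor> \<le> 2 ^ L * x" "2 ^ L * x < of_int \<lfloor>2 ^ L * x\<rfloor> + 1" by linarith+
  hence "\<bar>of_int \<lfloor>2 ^ L * x\<rfloor> - 2 ^ L * x\<bar> \<le> 1" by linarith
  moreover have "of_int \<lfloor>2 ^ L * x\<rfloor> / 2 ^ L - x = (of_int \<lfloor>2 ^ L * x\<rfloor> - 2 ^ L * x) / 2 ^ L"
    by (simp add: field_simps)
  ultimately show ?thesis by (simp add: abs_divide power_one_over divide_right_mono)
qed

lemma dyadic_tendsto: "(\<lambda>L. dyadic L z) \<longlonglongrightarrow> z"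
proof -
  have "(\<lambda>L. of_int \<lfloor>2 ^ L * x\<rfloor> / 2 ^ L) \<longlonglongrightarrow> x" for x :: real
  proof (rule LIM_zero_cancel, rule Lim_null_comparison)
    show "\<forall>\<^sub>F L in sequentially. norm (of_int \<lfloor>2 ^ L * x\<rfloor> / 2 ^ L - x) \<le> (1 / 2) ^ L"
      using abs_dyadic_floor by simp
    show "(\<lambda>L. (1 / 2 :: real) ^ L) \<longlonglongrightarrow> 0" by (rule LIMSEQ_power_zero) simp
  qed
  thus ?thesis by (auto simp: tendsto_complex_iff dyadic_def)
qed

lemma finite_dyadic_image:
  assumes "bounded B" shows "finite (dyadic L ` B)"
proof -
  obtain R where R: "\<And>z. z \<in> B \<Longrightarrow> norm z \<le> R" using assms by (auto simp: bounded_iff)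
  define m where "m = \<lceil>2 ^ L * R\<rceil> + 1"
  have in_range: "\<lfloor>2 ^ L * x\<rfloor> \<in> {-m..m}" if "\<bar>x\<bar> \<le> R" for x
  proof -
    have "2 ^ L * \<bar>x\<bar> \<le> 2 ^ L * R" using that by simp
    hence "\<bar>2 ^ L * x\<bar> \<le> 2 ^ L * R" by (simp add: abs_mult)
    thus ?thesis unfolding m_def by (simp; linarith)
  qed
  have "dyadic L ` B \<subseteq> (\<lambda>(i, j). Complex (of_int i / 2 ^ L) (of_int j / 2 ^ L)) ` ({-m..m} \<times> {-m..m})"
  proof
    fix w assume "w \<in> dyadic L ` B"
    then obtain z where z: "z \<in> B" "w = dyadic L z" by auto
    have "\<bar>Re z\<bar> \<le> R" "\<bar>Im z\<bar> \<le> R" using R[OF z(1)] abs_Re_le_cmod[of z] abs_Im_le_cmod[of z] by linarith+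
    hence "(\<lfloor>2 ^ L * Re z\<rfloor>, \<lfloor>2 ^ L * Im z\<rfloor>) \<in> {-m..m} \<times> {-m..m}" using in_range by blast
    thus "w \<in> (\<lambda>(i, j). Complex (of_int i / 2 ^ L) (of_int j / 2 ^ L)) ` ({-m..m} \<times> {-m..m})"
      by (rule rev_image_eqI) (simp add: z dyadic_def)
  qed
  thus ?thesis by (rule finite_subset) auto
qed

text \<open>
  Fine dyadic squares separate the points of a finite set, so that counting occupied squares
  amounts to counting points.
\<close>

lemma dyadic_eventually_inj:
  assumes "finite P" shows "\<forall>\<^sub>F L in sequentially. inj_on (dyadic L) P"
proof -
  have "\<forall>\<^sub>F L in sequentially. dyadic L x \<noteq> dyadic L y" if "x \<noteq> y" for x y
  proof -
    have "(\<lambda>L. dyadic L x - dyadic L y) \<longlonglongrightarrow> x - y" by (intro tendsto_intros dyadic_tendsto)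
    hence "\<forall>\<^sub>F L in sequentially. dyadic L x - dyadic L y \<noteq> 0"
      by (rule tendsto_imp_eventually_ne) (use that in simp)
    thus ?thesis by eventually_elim simp
  qed
  hence "\<forall>\<^sub>F L in sequentially. \<forall>p\<in>P \<times> P. fst p \<noteq> snd p \<longrightarrow> dyadic L (fst p) \<noteq> dyadic L (snd p)"
    using assms by (intro eventually_ball_finite) (auto simp: eventually_mono)
  thus ?thesis by eventually_elim (auto simp: inj_on_def)
qed

section \<open>Sums over tuples of distinct points\<close>

definition tuples :: "nat \<Rightarrow> 'a set \<Rightarrow> (nat \<Rightarrow> 'a) set" where
  "tuples n S = {x \<in> {..<n} \<rightarrow>\<^sub>E S. inj_on x {..<n}}"

lemma finite_tuples [simp]: "finite S \<Longrightarrow> finite (tuples n S)"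
  unfolding tuples_def by (rule finite_subset[of _ "{..<n} \<rightarrow>\<^sub>E S"]) (auto intro: finite_PiE)

lemma card_tuples: "finite S \<Longrightarrow> card (tuples n S) = (\<Prod>k<n. card S - k)"
  unfolding tuples_def by (subst card_inj_on_subset_funcset) (auto simp: atLeast0LessThan)

lemma tuples_empty_if_card_less:
  assumes "finite S" "card S < n" shows "tuples n S = {}"
proof -
  have "card (tuples n S) = 0" using assms by (auto simp: card_tuples intro!: bexI[of _ "card S"])
  thus ?thesis using finite_tuples[OF assms(1)] by auto
qed

text \<open>
  A set of \<open>n\<close> elements is the range of exactly \<open>n!\<close> tuples.
\<close>

lemma sum_tuples_prod:
  fixes a :: "'a \<Rightarrow> 'b :: {comm_ring_1, semiring_char_0}"
  assumes "finite P"
  shows "(\<Sum>x\<in>tuples n P. \<Prod>i<n. a (x i)) = fact n * (\<Sum>S | S \<subseteq> P \<and> card S = n. \<Prod>x\<in>S. a x)"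
proof -
  let ?I = "{S. S \<subseteq> P \<and> card S = n}"
  have "(\<Sum>x\<in>tuples n P. \<Prod>i<n. a (x i)) = (\<Sum>S\<in>?I. \<Sum>x\<in>{x \<in> tuples n P. x ` {..<n} = S}. \<Prod>i<n. a (x i))"
  proof (rule sum.group[symmetric])
    show "(\<lambda>x. x ` {..<n}) ` tuples n P \<subseteq> ?I"
    proof (rule image_subsetI)
      fix x assume "x \<in> tuples n P"
      hence "inj_on x {..<n}" "\<And>i. i < n \<Longrightarrow> x i \<in> P" by (auto simp: tuples_def)
      thus "x ` {..<n} \<in> ?I" using card_image[of x "{..<n}"] by auto
    qed
  qed (use assms in auto)
  also have "\<dots> = (\<Sum>S\<in>?I. fact n * (\<Prod>x\<in>S. a x))"
  proof (rule sum.cong[OF refl])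
    fix S assume S: "S \<in> ?I"
    have fS: "finite S" using S assms finite_subset by auto
    have eq: "{x \<in> tuples n P. x ` {..<n} = S} = tuples n S"
    proof (intro equalityI subsetI)
      fix x assume "x \<in> {x \<in> tuples n P. x ` {..<n} = S}" thus "x \<in> tuples n S" by (auto simp: tuples_def)
    next
      fix x assume x: "x \<in> tuples n S"
      hence inj: "inj_on x {..<n}" and mem: "\<And>i. i < n \<Longrightarrow> x i \<in> S" by (auto simp: tuples_def)
      have "x ` {..<n} \<subseteq> S" using mem by auto
      moreover have "card (x ` {..<n}) = card S" using S card_image[OF inj] by simp
      ultimately have "x ` {..<n} = S" by (rule card_subset_eq[OF fS])
      moreover have "x \<in> tuples n P" using x S by (auto simp: tuples_def PiE_def Pi_def)
      ultimately show "x \<in> {x \<in> tuples n P. x ` {..<n} = S}" by simp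
    qed
    have "(\<Sum>x\<in>{x \<in> tuples n P. x ` {..<n} = S}. \<Prod>i<n. a (x i)) = (\<Sum>x\<in>{x \<in> tuples n P. x ` {..<n} = S}. \<Prod>x\<in>S. a x)"
    proof (rule sum.cong[OF refl])
      fix x assume "x \<in> {x \<in> tuples n P. x ` {..<n} = S}"
      hence "inj_on x {..<n}" "x ` {..<n} = S" by (auto simp: tuples_def)
      thus "(\<Prod>i<n. a (x i)) = (\<Prod>x\<in>S. a x)" using prod.reindex[of x "{..<n}" a] by simp
    qed
    also have "\<dots> = of_nat (card (tuples n S)) * (\<Prod>x\<in>S. a x)" unfolding eq by simp
    also have "card (tuples n S) = fact n"
      using S by (simp add: card_tuples[OF fS] fact_prod_rev atLeast0LessThan)
    finally show "(\<Sum>x\<in>{x \<in> tuples n P. x ` {..<n} = S}. \<Prod>i<n. a (x i)) = fact n * (\<Prod>x\<in>S. a x)" by simp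
  qed
  finally show ?thesis by (simp add: sum_distrib_left)
qed

text \<open>
  The sequence \<open>c\<close> plays the role of \<open>1 / n!\<close>, which allows rings of power series as well as
  fields.
\<close>

lemma prod_one_plus_tuples:
  fixes a :: "'a \<Rightarrow> 'b :: {comm_ring_1, semiring_char_0}"
  assumes "finite P" "\<And>n. c n * fact n = 1"
  shows "(\<Prod>x\<in>P. 1 + a x) = (\<Sum>n\<le>card P. c n * (\<Sum>x\<in>tuples n P. \<Prod>i<n. a (x i)))"
proof -
  have "(\<Prod>x\<in>P. 1 + a x) = (\<Sum>S\<in>Pow P. \<Prod>x\<in>S. a x)"
    using prod_add[OF assms(1), of a "\<lambda>_. 1"] by (simp add: add.commute)
  also have "\<dots> = (\<Sum>n\<le>card P. \<Sum>S\<in>{S \<in> Pow P. card S = n}. \<Prod>x\<in>S. a x)"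
    by (rule sum.group[symmetric]) (use assms(1) card_mono in auto)
  also have "\<dots> = (\<Sum>n\<le>card P. c n * (\<Sum>x\<in>tuples n P. \<Prod>i<n. a (x i)))"
  proof (rule sum.cong[OF refl])
    fix n
    show "(\<Sum>S\<in>{S \<in> Pow P. card S = n}. \<Prod>x\<in>S. a x) = c n * (\<Sum>x\<in>tuples n P. \<Prod>i<n. a (x i))"
      unfolding sum_tuples_prod[OF assms(1)] mult.assoc[symmetric] assms(2) by simp
  qed
  finally show ?thesis .
qed

lemma tuples_image:
  assumes "inj_on r P"
  shows "bij_betw (\<lambda>x. restrict (r \<circ> x) {..<n}) (tuples n P) (tuples n (r ` P))"
proof (rule bij_betwI')
  fix x y assume x: "x \<in> tuples n P" and y: "y \<in> tuples n P"
  show "(restrict (r \<circ> x) {..<n} = restrict (r \<circ> y) {..<n}) = (x = y)"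
  proof
    assume eq: "restrict (r \<circ> x) {..<n} = restrict (r \<circ> y) {..<n}"
    show "x = y"
    proof (rule PiE_ext)
      show "x \<in> {..<n} \<rightarrow>\<^sub>E P" "y \<in> {..<n} \<rightarrow>\<^sub>E P" using x y by (auto simp: tuples_def)
      fix i assume i: "i \<in> {..<n}"
      hence "r (x i) = r (y i)" using fun_cong[OF eq, of i] by simp
      thus "x i = y i" using x y i assms by (auto simp: tuples_def inj_on_def PiE_def Pi_def)
    qed
  qed simp
next
  fix x assume x: "x \<in> tuples n P"
  thus "restrict (r \<circ> x) {..<n} \<in> tuples n (r ` P)"
    using assms by (auto simp: tuples_def inj_on_def PiE_def Pi_def)
next
  fix y assume y: "y \<in> tuples n (r ` P)"
  define x where "x = restrict (\<lambda>i. inv_into P r (y i)) {..<n}"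
  have yi: "y i \<in> r ` P" if "i < n" for i using y that by (auto simp: tuples_def)
  have "x \<in> tuples n P"
    using y yi by (auto simp: x_def tuples_def inj_on_def intro: inv_into_into dest!: inv_into_injective)
  moreover have "y = restrict (r \<circ> x) {..<n}"
  proof
    fix i show "y i = restrict (r \<circ> x) {..<n} i"
      using y yi f_inv_into_f[of "y i" r P] by (cases "i < n") (auto simp: x_def tuples_def)
  qed
  ultimately show "\<exists>x\<in>tuples n P. y = restrict (r \<circ> x) {..<n}" by blast
qed

section \<open>Campbell's formula for tuples of distinct points\<close>

abbreviation lebn :: "nat \<Rightarrow> (nat \<Rightarrow> complex) measure" where "lebn n \<equiv> PiM {..<n} (\<lambda>_. lborel)"

lemma product_sigma: "product_sigma_finite (\<lambda>_::nat. lborel :: complex measure)"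
  by (simp add: product_sigma_finite_def lborel.sigma_finite_measure_axioms)

text \<open>
  For a determinantal process whose kernel is bounded by \<open>\<Phi>\<close>, the Leibniz formula gives the
  bound \<open>n! \<Phi>\<^sup>n\<close>, and a determinant with two equal rows vanishes. The linear statistics under
  consideration live on the bounded set \<open>B\<close>.
\<close>

locale bounded_correlations =
  fixes M :: "'w measure" and X :: "'w \<Rightarrow> complex measure"
    and \<rho> :: "nat \<Rightarrow> (nat \<Rightarrow> complex) \<Rightarrow> real" and \<Phi> :: real and B :: "complex set"
  assumes simple: "simple_point_process M X"
    and corr: "\<And>n. correlation_function M X n (\<rho> n)"
    and rho_measurable [measurable]: "\<And>n. \<rho> n \<in> borel_measurable (PiM {..<n} (\<lambda>_. lborel))"
    and rho_nonneg: "\<And>n x. \<rho> n x \<ge> 0"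
    and rho_le: "\<And>n x. \<rho> n x \<le> fact n * \<Phi> ^ n"
    and rho_diag: "\<And>n x. \<not> inj_on x {..<n} \<Longrightarrow> \<rho> n x = 0"
    and B_borel [measurable]: "B \<in> sets borel" and B_bounded: "bounded B"
begin

sublocale prob_space M using simple by (simp add: simple_point_process_def)

lemma integer: "\<omega> \<in> space M \<Longrightarrow> integer_radon_measure (X \<omega>)"
  using simple by (simp add: simple_point_process_def)

lemma emeasure_measurable [measurable]: "E \<in> sets borel \<Longrightarrow> (\<lambda>\<omega>. emeasure (X \<omega>) E) \<in> borel_measurable M"
  using simple by (simp add: simple_point_process_def)

lemma measure_measurable [measurable]: "E \<in> sets borel \<Longrightarrow> (\<lambda>\<omega>. measure (X \<omega>) E) \<in> borel_measurable M"
  unfolding measure_def by (rule borel_measurable_enn2real[OF emeasure_measurable])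

lemma AE_simple: "AE \<omega> in M. \<forall>x. emeasure (X \<omega>) {x} \<le> 1"
  using simple by (simp add: simple_point_process_def)

definition cell :: "nat \<Rightarrow> complex \<Rightarrow> complex set" where
  "cell L p = {z \<in> B. dyadic L z = p}"

lemma cell_borel [measurable]: "cell L p \<in> sets borel"
proof -
  have "cell L p = B \<inter> (dyadic L -` {p} \<inter> space borel)" by (auto simp: cell_def)
  also have "\<dots> \<in> sets borel" by (intro sets.Int B_borel measurable_sets[OF dyadic_measurable]) auto
  finally show ?thesis .
qed

lemma cell_bounded: "bounded (cell L p)"
  using B_bounded by (rule bounded_subset) (auto simp: cell_def)

lemma emeasure_cell: "\<omega> \<in> space M \<Longrightarrow> emeasure (X \<omega>) (cell L p) = ennreal (measure (X \<omega>) (cell L p))"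
  using integer_measure_bounded_finite[OF integer cell_bounded cell_borel subset_refl, of \<omega> L p]
  by (intro emeasure_eq_ennreal_measure) (simp add: less_top)

abbreviation pts :: "'w \<Rightarrow> complex set" where "pts \<omega> \<equiv> points (X \<omega>) \<inter> B"

lemma finite_pts: "\<omega> \<in> space M \<Longrightarrow> finite (pts \<omega>)"
  by (rule finite_points_bounded[OF integer B_bounded])

lemma measure_cell_eq_card:
  assumes "\<omega> \<in> space M" "\<forall>x. emeasure (X \<omega>) {x} \<le> 1"
  shows "measure (X \<omega>) (cell L p) = card (pts \<omega> \<inter> cell L p)"
proof -
  have "points (X \<omega>) \<inter> cell L p = pts \<omega> \<inter> cell L p" by (auto simp: cell_def)
  thus ?thesis using emeasure_eq_card_points[OF integer cell_bounded cell_borel, of \<omega> L p] assms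
    unfolding measure_def by (simp flip: ennreal_of_nat_eq_real_of_nat)
qed

lemma measure_B_eq_card:
  assumes "\<omega> \<in> space M" "\<forall>x. emeasure (X \<omega>) {x} \<le> 1"
  shows "measure (X \<omega>) B = card (pts \<omega>)"
  using emeasure_eq_card_points[OF integer B_bounded B_borel, of \<omega>] assms
  unfolding measure_def by (simp flip: ennreal_of_nat_eq_real_of_nat)

text \<open>
  An approximation to the sum of \<open>h\<close> over the tuples of distinct points in \<open>B\<close>: a tuple of distinct
  cells contributes the value of \<open>h\<close> there times the number of ways to choose a point in each cell.
\<close>

definition cell_sum :: "nat \<Rightarrow> nat \<Rightarrow> ((nat \<Rightarrow> complex) \<Rightarrow> complex) \<Rightarrow> 'w \<Rightarrow> complex" where
  "cell_sum L n h \<omega> = (\<Sum>p\<in>tuples n (dyadic L ` B). (\<Prod>i<n. measure (X \<omega>) (cell L (p i))) *\<^sub>R h p)"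

definition tuple_sum :: "nat \<Rightarrow> ((nat \<Rightarrow> complex) \<Rightarrow> complex) \<Rightarrow> 'w \<Rightarrow> complex" where
  "tuple_sum n h \<omega> = (\<Sum>x\<in>tuples n (pts \<omega>). h x)"

text \<open>
  Sequential continuity in the coordinates below \<open>n\<close>, with no condition on the others: the
  rounded tuples converge in these coordinates only.
\<close>

definition seq_cont :: "nat \<Rightarrow> ((nat \<Rightarrow> complex) \<Rightarrow> complex) \<Rightarrow> bool" where
  "seq_cont n h \<longleftrightarrow> (\<forall>x y. (\<forall>i<n. (\<lambda>L. y L i) \<longlonglongrightarrow> x i) \<longrightarrow> (\<lambda>L::nat. h (y L)) \<longlonglongrightarrow> h x)"

lemma seq_contD:
  "seq_cont n h \<Longrightarrow> (\<And>i. i < n \<Longrightarrow> (\<lambda>L. y L i) \<longlonglongrightarrow> x i) \<Longrightarrow> (\<lambda>L. h (y L)) \<longlonglongrightarrow> h x"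
  unfolding seq_cont_def by blast

lemma finite_cell_tuples [simp]: "finite (tuples n (dyadic L ` B))"
  by (intro finite_tuples finite_dyadic_image B_bounded)

lemma cell_sum_measurable [measurable]: "cell_sum L n h \<in> borel_measurable M"
  unfolding cell_sum_def[abs_def]
  by (intro borel_measurable_sum borel_measurable_scaleR borel_measurable_prod measure_measurable cell_borel
        borel_measurable_const)

lemma cell_sum_eq:
  assumes w: "\<omega> \<in> space M" "\<forall>x. emeasure (X \<omega>) {x} \<le> 1" and inj: "inj_on (dyadic L) (pts \<omega>)"
  shows "cell_sum L n h \<omega> = (\<Sum>x\<in>tuples n (pts \<omega>). h (restrict (dyadic L \<circ> x) {..<n}))"
proof -
  let ?P = "pts \<omega>"
  have cell: "measure (X \<omega>) (cell L p) = (if p \<in> dyadic L ` ?P then 1 else 0)" for p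
  proof (cases "p \<in> dyadic L ` ?P")
    case True
    then obtain x where x: "x \<in> ?P" "p = dyadic L x" by auto
    hence "?P \<inter> cell L p = {x}" using inj by (auto simp: cell_def inj_on_def)
    thus ?thesis using True measure_cell_eq_card[OF w] by simp
  next
    case False
    hence "?P \<inter> cell L p = {}" by (auto simp: cell_def)
    thus ?thesis using False measure_cell_eq_card[OF w] by simp
  qed
  have "cell_sum L n h \<omega> = (\<Sum>p\<in>tuples n (dyadic L ` ?P). h p)"
    unfolding cell_sum_def
  proof (rule sum.mono_neutral_cong_right)
    show "tuples n (dyadic L ` ?P) \<subseteq> tuples n (dyadic L ` B)" by (auto simp: tuples_def PiE_def Pi_def)
    show "\<forall>p\<in>tuples n (dyadic L ` B) - tuples n (dyadic L ` ?P). (\<Prod>i<n. measure (X \<omega>) (cell L (p i))) *\<^sub>R h p = 0"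
    proof
      fix p assume p: "p \<in> tuples n (dyadic L ` B) - tuples n (dyadic L ` ?P)"
      then obtain i where "i < n" "p i \<notin> dyadic L ` ?P" by (auto simp: tuples_def PiE_def Pi_def)
      hence "(\<Prod>i<n. measure (X \<omega>) (cell L (p i))) = 0" by (auto simp: cell)
      thus "(\<Prod>i<n. measure (X \<omega>) (cell L (p i))) *\<^sub>R h p = 0" by simp
    qed
    fix p assume "p \<in> tuples n (dyadic L ` ?P)"
    hence "measure (X \<omega>) (cell L (p i)) = 1" if "i < n" for i
      using that by (auto simp: cell tuples_def PiE_def Pi_def)
    thus "(\<Prod>i<n. measure (X \<omega>) (cell L (p i))) *\<^sub>R h p = h p" by simp
  qed auto
  also have "\<dots> = (\<Sum>x\<in>tuples n ?P. h (restrict (dyadic L \<circ> x) {..<n}))"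
    by (rule sum.reindex_bij_betw[OF tuples_image[OF inj], symmetric])
  finally show ?thesis .
qed

text \<open>
  Once the cells separate the points, \<open>cell_sum\<close> is a sum over tuples of rounded points.
\<close>

lemma cell_sum_tendsto:
  assumes w: "\<omega> \<in> space M" "\<forall>x. emeasure (X \<omega>) {x} \<le> 1" and h: "seq_cont n h"
  shows "(\<lambda>L. cell_sum L n h \<omega>) \<longlonglongrightarrow> tuple_sum n h \<omega>"
proof -
  have "\<forall>\<^sub>F L in sequentially. (\<Sum>x\<in>tuples n (pts \<omega>). h (restrict (dyadic L \<circ> x) {..<n})) = cell_sum L n h \<omega>"
    using dyadic_eventually_inj[OF finite_pts[OF w(1)]] by eventually_elim (rule cell_sum_eq[OF w, symmetric])
  moreover have "(\<lambda>L. \<Sum>x\<in>tuples n (pts \<omega>). h (restrict (dyadic L \<circ> x) {..<n})) \<longlonglongrightarrow> tuple_sum n h \<omega>"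
    unfolding tuple_sum_def by (intro tendsto_sum seq_contD[OF h]) (simp add: dyadic_tendsto)
  ultimately show ?thesis by (rule Lim_transform_eventually[rotated])
qed

text \<open>
  The majorant for dominated convergence: dropping the condition that the cells be distinct, the
  sum over all tuples of cells factorises.
\<close>

lemma norm_cell_sum_le:
  assumes w: "\<omega> \<in> space M" and H: "\<And>x. norm (h x) \<le> H"
  shows "norm (cell_sum L n h \<omega>) \<le> H * measure (X \<omega>) B ^ n"
proof -
  have H0: "0 \<le> H" using H[of undefined] norm_ge_zero order_trans by blast
  have fin: "finite (dyadic L ` B)" by (rule finite_dyadic_image[OF B_bounded])
  have "norm (cell_sum L n h \<omega>) \<le> (\<Sum>p\<in>tuples n (dyadic L ` B). norm ((\<Prod>i<n. measure (X \<omega>) (cell L (p i))) *\<^sub>R h p))"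
    unfolding cell_sum_def by (rule norm_sum)
  also have "\<dots> \<le> (\<Sum>p\<in>tuples n (dyadic L ` B). (\<Prod>i<n. measure (X \<omega>) (cell L (p i))) * H)"
    by (intro sum_mono) (auto simp: abs_prod intro!: mult_left_mono H prod_nonneg)
  also have "\<dots> \<le> (\<Sum>p\<in>{..<n} \<rightarrow>\<^sub>E dyadic L ` B. (\<Prod>i<n. measure (X \<omega>) (cell L (p i))) * H)"
  proof (rule sum_mono2)
    show "finite ({..<n} \<rightarrow>\<^sub>E dyadic L ` B)" using fin by (intro finite_PiE) auto
    show "tuples n (dyadic L ` B) \<subseteq> {..<n} \<rightarrow>\<^sub>E dyadic L ` B" by (auto simp: tuples_def)
    show "0 \<le> (\<Prod>i<n. measure (X \<omega>) (cell L (p i))) * H" for p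
      using H0 by (intro mult_nonneg_nonneg prod_nonneg) auto
  qed
  also have "\<dots> = H * (\<Prod>i<n. \<Sum>p\<in>dyadic L ` B. measure (X \<omega>) (cell L p))"
    by (subst prod_sum_PiE) (auto simp: fin sum_distrib_left mult.commute)
  also have "(\<Sum>p\<in>dyadic L ` B. measure (X \<omega>) (cell L p)) = measure (X \<omega>) B"
  proof -
    have s: "sets (X \<omega>) = sets borel" using integer[OF w] by (simp add: integer_radon_measure_def)
    have "measure (X \<omega>) (\<Union>p\<in>dyadic L ` B. cell L p) = (\<Sum>p\<in>dyadic L ` B. measure (X \<omega>) (cell L p))"
    proof (rule measure_finite_Union[OF fin])
      show "disjoint_family_on (cell L) (dyadic L ` B)" by (auto simp: disjoint_family_on_def cell_def)
      show "cell L ` dyadic L ` B \<subseteq> sets (X \<omega>)" by (auto simp: s)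
      show "emeasure (X \<omega>) (cell L p) \<noteq> \<infinity>" for p using emeasure_cell[OF w] by simp
    qed
    also have "(\<Union>p\<in>dyadic L ` B. cell L p) = B" by (auto simp: cell_def)
    finally show ?thesis ..
  qed
  finally show ?thesis by simp
qed

lemma box_sets [measurable]: "(\<And>i. i < n \<Longrightarrow> E i \<in> sets borel) \<Longrightarrow> Pi\<^sub>E {..<n} E \<in> sets (lebn n)"
  by (intro sets_PiM_I_finite) auto

lemma lborel_B: "emeasure lborel B = ennreal (measure lborel B)"
  using emeasure_bounded_finite[OF B_bounded] by (intro emeasure_eq_ennreal_measure) auto

lemma emeasure_box_le:
  assumes "\<And>i. i < n \<Longrightarrow> E i \<in> sets borel" "\<And>i. i < n \<Longrightarrow> E i \<subseteq> B"
  shows "emeasure (lebn n) (Pi\<^sub>E {..<n} E) \<le> ennreal (measure lborel B ^ n)"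
proof -
  have "emeasure (lebn n) (Pi\<^sub>E {..<n} E) = (\<Prod>i<n. emeasure lborel (E i))"
    using assms by (intro product_sigma_finite.emeasure_PiM[OF product_sigma]) auto
  also have "\<dots> \<le> (\<Prod>i<n. emeasure lborel B)" using assms by (intro prod_mono_ennreal emeasure_mono) auto
  finally show ?thesis by (simp add: lborel_B ennreal_power)
qed

lemma rho_integrable:
  assumes "\<And>i. i < n \<Longrightarrow> E i \<in> sets borel" "\<And>i. i < n \<Longrightarrow> E i \<subseteq> B"
  shows "integrable (lebn n) (\<lambda>x. indicator (Pi\<^sub>E {..<n} E) x * \<rho> n x)"
    and "(\<integral>x. indicator (Pi\<^sub>E {..<n} E) x * \<rho> n x \<partial>lebn n) \<le> fact n * \<Phi> ^ n * measure lborel B ^ n"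
proof -
  have fin: "emeasure (lebn n) (Pi\<^sub>E {..<n} E) < \<infinity>"
    using emeasure_box_le[of n E, OF assms] by (auto intro: le_less_trans)
  have c0: "0 \<le> fact n * \<Phi> ^ n" using rho_nonneg[of n undefined] rho_le[of n undefined] by linarith
  have i1: "integrable (lebn n) (\<lambda>x. indicator (Pi\<^sub>E {..<n} E) x * (fact n * \<Phi> ^ n))"
    using fin assms by (intro integrable_mult_left integrable_real_indicator) auto
  show i2: "integrable (lebn n) (\<lambda>x. indicator (Pi\<^sub>E {..<n} E) x * \<rho> n x)"
  proof (rule Bochner_Integration.integrable_bound[OF i1])
    show "(\<lambda>x. indicator (Pi\<^sub>E {..<n} E) x * \<rho> n x) \<in> borel_measurable (lebn n)"
      using assms by measurable
  qed (use rho_nonneg rho_le c0 in \<open>auto simp: indicator_def\<close>)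
  have "(\<integral>x. indicator (Pi\<^sub>E {..<n} E) x * \<rho> n x \<partial>lebn n) \<le> (\<integral>x. indicator (Pi\<^sub>E {..<n} E) x * (fact n * \<Phi> ^ n) \<partial>lebn n)"
    using i1 i2 rho_le by (intro integral_mono) (auto simp: indicator_def)
  also have "\<dots> = measure (lebn n) (Pi\<^sub>E {..<n} E) * (fact n * \<Phi> ^ n)"
    using assms fin by (subst integral_mult_left_zero) (simp add: Int_absorb2 sets.sets_into_space box_sets)
  also have "\<dots> \<le> measure lborel B ^ n * (fact n * \<Phi> ^ n)"
  proof (rule mult_right_mono[OF _ c0])
    show "measure (lebn n) (Pi\<^sub>E {..<n} E) \<le> measure lborel B ^ n"
      using emeasure_box_le[of n E, OF assms] unfolding measure_def[of "lebn n"] by (intro enn2real_leI) auto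
  qed
  finally show "(\<integral>x. indicator (Pi\<^sub>E {..<n} E) x * \<rho> n x \<partial>lebn n) \<le> fact n * \<Phi> ^ n * measure lborel B ^ n"
    by (simp add: mult.commute)
qed

text \<open>
  The cells of a tuple of distinct indices are disjoint, as the definition of the correlation
  function requires.
\<close>

lemma expectation_cells:
  assumes p: "p \<in> tuples n (dyadic L ` B)"
  shows "integrable M (\<lambda>\<omega>. \<Prod>i<n. measure (X \<omega>) (cell L (p i)))"
    and "expectation (\<lambda>\<omega>. \<Prod>i<n. measure (X \<omega>) (cell L (p i))) =
      (\<integral>x. indicator (Pi\<^sub>E {..<n} (\<lambda>i. cell L (p i))) x * \<rho> n x \<partial>lebn n)"
proof -
  let ?E = "Pi\<^sub>E {..<n} (\<lambda>i. cell L (p i))"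
  have dj: "disjoint_family_on (\<lambda>i. cell L (p i)) {..<n}"
    using p by (auto simp: disjoint_family_on_def cell_def tuples_def inj_on_def)
  have sub: "cell L q \<subseteq> B" for q by (auto simp: cell_def)
  note int = rho_integrable[of n "\<lambda>i. cell L (p i)", OF cell_borel sub]
  have nn: "0 \<le> indicator ?E x * \<rho> n x" for x using rho_nonneg by simp
  have "(\<integral>\<^sup>+\<omega>. ennreal (\<Prod>i<n. measure (X \<omega>) (cell L (p i))) \<partial>M) = (\<integral>\<^sup>+\<omega>. (\<Prod>i<n. emeasure (X \<omega>) (cell L (p i))) \<partial>M)"
    by (intro nn_integral_cong) (simp add: emeasure_cell prod_ennreal)
  also have "\<dots> = (\<integral>\<^sup>+x\<in>?E. ennreal (\<rho> n x) \<partial>lebn n)"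
    using corr[of n] dj unfolding correlation_function_def by auto
  also have "\<dots> = (\<integral>\<^sup>+x. ennreal (indicator ?E x * \<rho> n x) \<partial>lebn n)"
    by (intro nn_integral_cong) (auto simp: indicator_def)
  also have "\<dots> = ennreal (\<integral>x. indicator ?E x * \<rho> n x \<partial>lebn n)"
    by (rule nn_integral_eq_integral[OF int(1)]) (use nn in auto)
  finally have eq: "(\<integral>\<^sup>+\<omega>. ennreal (\<Prod>i<n. measure (X \<omega>) (cell L (p i))) \<partial>M) = ennreal (\<integral>x. indicator ?E x * \<rho> n x \<partial>lebn n)" .
  show i: "integrable M (\<lambda>\<omega>. \<Prod>i<n. measure (X \<omega>) (cell L (p i)))"
    by (rule integrableI_nonneg) (auto simp: eq prod_nonneg)
  show "expectation (\<lambda>\<omega>. \<Prod>i<n. measure (X \<omega>) (cell L (p i))) = (\<integral>x. indicator ?E x * \<rho> n x \<partial>lebn n)"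
    by (subst integral_eq_nn_integral) (auto simp: eq prod_nonneg intro!: enn2real_ennreal Bochner_Integration.integral_nonneg nn)
qed

text \<open>
  The integrand for the expectation of a cell sum: \<open>\<rho>\<close> times \<open>h\<close> at the rounded tuple, restricted to
  the tuples in \<open>B\<close> whose coordinates lie in distinct cells.
\<close>

definition round_fun :: "nat \<Rightarrow> nat \<Rightarrow> ((nat \<Rightarrow> complex) \<Rightarrow> complex) \<Rightarrow> (nat \<Rightarrow> complex) \<Rightarrow> complex" where
  "round_fun L n h x = (\<Sum>p\<in>tuples n (dyadic L ` B). (indicator (Pi\<^sub>E {..<n} (\<lambda>i. cell L (p i))) x * \<rho> n x) *\<^sub>R h p)"

lemma expectation_cell_sum:
  "integrable M (cell_sum L n h)" "(\<integral>\<omega>. cell_sum L n h \<omega> \<partial>M) = (\<integral>x. round_fun L n h x \<partial>lebn n)"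
proof -
  have sub: "cell L q \<subseteq> B" for q by (auto simp: cell_def)
  have i: "integrable M (\<lambda>\<omega>. (\<Prod>i<n. measure (X \<omega>) (cell L (p i))) *\<^sub>R h p)" if "p \<in> tuples n (dyadic L ` B)" for p
    using expectation_cells(1)[OF that] by (rule integrable_scaleR_left)
  show "integrable M (cell_sum L n h)" unfolding cell_sum_def[abs_def] using i by auto
  have "(\<integral>\<omega>. cell_sum L n h \<omega> \<partial>M) =
     (\<Sum>p\<in>tuples n (dyadic L ` B). expectation (\<lambda>\<omega>. \<Prod>i<n. measure (X \<omega>) (cell L (p i))) *\<^sub>R h p)"
    unfolding cell_sum_def using i expectation_cells(1)
    by (simp add: Bochner_Integration.integral_sum integral_scaleR_left)
  also have "\<dots> = (\<Sum>p\<in>tuples n (dyadic L ` B). \<integral>x. (indicator (Pi\<^sub>E {..<n} (\<lambda>i. cell L (p i))) x * \<rho> n x) *\<^sub>R h p \<partial>lebn n)"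
    using rho_integrable(1)[of n "\<lambda>i. cell L (_ i)", OF cell_borel sub]
    by (intro sum.cong) (auto simp: expectation_cells(2))
  also have "\<dots> = (\<integral>x. round_fun L n h x \<partial>lebn n)"
    unfolding round_fun_def using rho_integrable(1)[of n "\<lambda>i. cell L (_ i)", OF cell_borel sub]
    by (intro Bochner_Integration.integral_sum[symmetric] integrable_scaleR_left) auto
  finally show "(\<integral>\<omega>. cell_sum L n h \<omega> \<partial>M) = (\<integral>x. round_fun L n h x \<partial>lebn n)" .
qed

lemma round_fun_eq:
  assumes x: "x \<in> {..<n} \<rightarrow>\<^sub>E UNIV"
  shows "round_fun L n h x = (if x \<in> {..<n} \<rightarrow>\<^sub>E B \<and> inj_on (dyadic L \<circ> x) {..<n}
      then \<rho> n x *\<^sub>R h (restrict (dyadic L \<circ> x) {..<n}) else 0)"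
proof -
  let ?q = "restrict (dyadic L \<circ> x) {..<n}"
  let ?I = "tuples n (dyadic L ` B)"
  have mem: "x \<in> Pi\<^sub>E {..<n} (\<lambda>i. cell L (p i)) \<longleftrightarrow> x \<in> {..<n} \<rightarrow>\<^sub>E B \<and> p = ?q" if p: "p \<in> ?I" for p
  proof -
    have ext: "p \<in> extensional {..<n}" using p by (auto simp: tuples_def PiE_def)
    have "p = ?q \<longleftrightarrow> (\<forall>i<n. dyadic L (x i) = p i)"
    proof
      assume *: "\<forall>i<n. dyadic L (x i) = p i"
      show "p = ?q" by (rule extensionalityI[OF ext]) (use * in auto)
    qed (auto simp: restrict_def)
    thus ?thesis using x by (auto simp: cell_def PiE_def Pi_def)
  qed
  have "round_fun L n h x = (\<Sum>p\<in>?I. if p = ?q then (if x \<in> {..<n} \<rightarrow>\<^sub>E B then \<rho> n x *\<^sub>R h ?q else 0) else 0)"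
    unfolding round_fun_def using mem by (intro sum.cong refl) (auto simp: indicator_def)
  also have "\<dots> = (if ?q \<in> ?I then (if x \<in> {..<n} \<rightarrow>\<^sub>E B then \<rho> n x *\<^sub>R h ?q else 0) else 0)"
    by (rule sum.delta) simp
  also have "inj_on ?q {..<n} \<longleftrightarrow> inj_on (dyadic L \<circ> x) {..<n}" by (auto simp: inj_on_def)
  hence "?q \<in> ?I \<longleftrightarrow> inj_on (dyadic L \<circ> x) {..<n}" if "x \<in> {..<n} \<rightarrow>\<^sub>E B"
    using that by (auto simp: tuples_def PiE_def Pi_def)
  ultimately show ?thesis by auto
qed

text \<open>
  A tuple with a repeated point is rounded to no tuple of distinct cells; there both sides
  vanish because \<open>\<rho>\<close> vanishes on the diagonals.
\<close>

lemma round_fun_tendsto: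
  assumes x: "x \<in> space (lebn n)" and h: "seq_cont n h"
  shows "(\<lambda>L. round_fun L n h x) \<longlonglongrightarrow> (indicator ({..<n} \<rightarrow>\<^sub>E B) x * \<rho> n x) *\<^sub>R h x"
proof -
  have x': "x \<in> {..<n} \<rightarrow>\<^sub>E UNIV" using x by (simp add: space_PiM)
  show ?thesis
  proof (cases "x \<in> {..<n} \<rightarrow>\<^sub>E B \<and> inj_on x {..<n}")
    case False
    hence "round_fun L n h x = 0" for L
      unfolding round_fun_eq[OF x'] using rho_diag[of x n] by (auto dest: inj_on_imageI2)
    moreover have "(indicator ({..<n} \<rightarrow>\<^sub>E B) x * \<rho> n x) *\<^sub>R h x = 0"
      using False rho_diag[of x n] by (auto simp: indicator_def)
    ultimately show ?thesis by (simp only: tendsto_const)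
  next
    case True
    have "\<forall>\<^sub>F L in sequentially. inj_on (dyadic L) (x ` {..<n})" by (rule dyadic_eventually_inj) simp
    hence "\<forall>\<^sub>F L in sequentially. \<rho> n x *\<^sub>R h (restrict (dyadic L \<circ> x) {..<n}) = round_fun L n h x"
      by eventually_elim (use True in \<open>simp add: round_fun_eq[OF x'] comp_inj_on\<close>)
    moreover have "(\<lambda>L. \<rho> n x *\<^sub>R h (restrict (dyadic L \<circ> x) {..<n})) \<longlonglongrightarrow> \<rho> n x *\<^sub>R h x"
      by (intro tendsto_scaleR tendsto_const seq_contD[OF h]) (simp add: dyadic_tendsto)
    ultimately show ?thesis using True by (auto intro: Lim_transform_eventually)
  qed
qed

lemma integral_round_fun_tendsto:
  assumes h: "seq_cont n h" and hm: "h \<in> borel_measurable (lebn n)" and H: "\<And>x. norm (h x) \<le> H"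
  shows "(\<lambda>L. \<integral>x. round_fun L n h x \<partial>lebn n) \<longlonglongrightarrow> (\<integral>x. (indicator ({..<n} \<rightarrow>\<^sub>E B) x * \<rho> n x) *\<^sub>R h x \<partial>lebn n)"
proof (rule integral_dominated_convergence)
  show "integrable (lebn n) (\<lambda>x. (indicator ({..<n} \<rightarrow>\<^sub>E B) x * \<rho> n x) * H)"
    by (intro integrable_mult_left rho_integrable(1)) auto
  show "AE x in lebn n. (\<lambda>L. round_fun L n h x) \<longlonglongrightarrow> (indicator ({..<n} \<rightarrow>\<^sub>E B) x * \<rho> n x) *\<^sub>R h x"
    using round_fun_tendsto[OF _ h] by (intro AE_I2)
  have H0: "0 \<le> H" using H[of undefined] norm_ge_zero order_trans by blast
  show "AE x in lebn n. norm (round_fun L n h x) \<le> (indicator ({..<n} \<rightarrow>\<^sub>E B) x * \<rho> n x) * H" for L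
  proof (rule AE_I2)
    fix x assume "x \<in> space (lebn n)"
    hence x: "x \<in> {..<n} \<rightarrow>\<^sub>E UNIV" by (simp add: space_PiM)
    show "norm (round_fun L n h x) \<le> (indicator ({..<n} \<rightarrow>\<^sub>E B) x * \<rho> n x) * H"
    proof (cases "x \<in> {..<n} \<rightarrow>\<^sub>E B \<and> inj_on (dyadic L \<circ> x) {..<n}")
      case True
      thus ?thesis unfolding round_fun_eq[OF x] using rho_nonneg[of n x] H by (simp add: mult_left_mono)
    next
      case False
      thus ?thesis unfolding round_fun_eq[OF x] using rho_nonneg[of n x] H0 by (simp only: if_False norm_zero) simp
    qed
  qed
  show "(\<lambda>x. (indicator ({..<n} \<rightarrow>\<^sub>E B) x * \<rho> n x) *\<^sub>R h x) \<in> borel_measurable (lebn n)"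
    using hm by measurable
  show "round_fun L n h \<in> borel_measurable (lebn n)" for L
    unfolding round_fun_def by measurable
qed

end

context bounded_correlations
begin

lemma norm_round_fun_le:
  assumes x: "x \<in> space (lebn n)" and H: "\<And>x. norm (h x) \<le> H"
  shows "norm (round_fun L n h x) \<le> (indicator ({..<n} \<rightarrow>\<^sub>E B) x * \<rho> n x) * H"
proof -
  have x': "x \<in> {..<n} \<rightarrow>\<^sub>E UNIV" using x by (simp add: space_PiM)
  have H0: "0 \<le> H" using H[of undefined] norm_ge_zero order_trans by blast
  show ?thesis
  proof (cases "x \<in> {..<n} \<rightarrow>\<^sub>E B \<and> inj_on (dyadic L \<circ> x) {..<n}")
    case True
    thus ?thesis unfolding round_fun_eq[OF x'] using rho_nonneg[of n x] H by (simp add: mult_left_mono)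
  next
    case False
    thus ?thesis unfolding round_fun_eq[OF x'] using rho_nonneg[of n x] H0 by (simp only: if_False norm_zero) simp
  qed
qed

lemma Phi_nonneg: "0 \<le> \<Phi>"
  using rho_nonneg[of 1 undefined] rho_le[of 1 undefined] by simp

text \<open>
  The number of \<open>n\<close>-tuples of distinct occupied cells has expectation at most \<open>n! (\<Phi> |B|)\<^sup>n\<close>,
  uniformly in the size of the cells.
\<close>

lemma factorial_moment_le:
  "(\<integral>\<^sup>+\<omega>. ennreal (Re (cell_sum L n (\<lambda>_. 1) \<omega>)) \<partial>M) \<le> ennreal (fact n * (\<Phi> * measure lborel B) ^ n)"
proof -
  have nn: "0 \<le> Re (cell_sum L n (\<lambda>_. 1) \<omega>)" for \<omega>
    unfolding cell_sum_def by (auto intro!: sum_nonneg prod_nonneg)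
  have ir: "integrable (lebn n) (\<lambda>x. indicator ({..<n} \<rightarrow>\<^sub>E B) x * \<rho> n x)" by (rule rho_integrable) auto
  have "(\<integral>\<^sup>+\<omega>. ennreal (Re (cell_sum L n (\<lambda>_. 1) \<omega>)) \<partial>M) = ennreal (\<integral>\<omega>. Re (cell_sum L n (\<lambda>_. 1) \<omega>) \<partial>M)"
    using expectation_cell_sum(1) by (intro nn_integral_eq_integral integrable_Re) (auto simp: nn)
  also have "(\<integral>\<omega>. Re (cell_sum L n (\<lambda>_. 1) \<omega>) \<partial>M) = Re (\<integral>x. round_fun L n (\<lambda>_. 1) x \<partial>lebn n)"
    using expectation_cell_sum[of L n "\<lambda>_. 1"] by simp
  also have "\<dots> \<le> norm (\<integral>x. round_fun L n (\<lambda>_. 1) x \<partial>lebn n)" by (rule complex_Re_le_cmod)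
  also have "\<dots> \<le> (\<integral>x. indicator ({..<n} \<rightarrow>\<^sub>E B) x * \<rho> n x \<partial>lebn n)"
  proof (rule order_trans[OF integral_norm_bound integral_mono[OF _ ir]])
    show "integrable (lebn n) (\<lambda>x. norm (round_fun L n (\<lambda>_. 1) x))"
      unfolding round_fun_def[abs_def]
      by (intro integrable_norm Bochner_Integration.integrable_sum integrable_scaleR_left rho_integrable(1)) (auto simp: cell_def)
    show "norm (round_fun L n (\<lambda>_. 1) x) \<le> indicator ({..<n} \<rightarrow>\<^sub>E B) x * \<rho> n x" if "x \<in> space (lebn n)" for x
      using norm_round_fun_le[OF that, of "\<lambda>_. 1" 1 L] by simp
  qed
  also have "\<dots> \<le> fact n * \<Phi> ^ n * measure lborel B ^ n" by (rule rho_integrable) auto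
  finally show ?thesis by (simp add: power_mult_distrib mult.assoc ennreal_leI)
qed

text \<open>
  For a configuration of \<open>N\<close> points, \<open>(1 + c)\<^sup>N\<close> is the sum over \<open>n\<close> of \<open>c\<^sup>n / n!\<close> times the
  number of \<open>n\<close>-tuples of distinct points, whose expectation is at most \<open>n! (\<Phi> |B|)\<^sup>n\<close> by
  Fatou's lemma. So the number of points in \<open>B\<close> has an exponential moment.
\<close>

lemma exponential_moment_count:
  obtains r where "r > 0" "integrable M (\<lambda>\<omega>. exp (r * measure (X \<omega>) B))"
proof -
  define b where "b = \<Phi> * measure lborel B"
  have b0: "b \<ge> 0" unfolding b_def using Phi_nonneg by simp
  \<comment> \<open>small enough for the geometric series in \<open>c b\<close> to converge\<close>
  define c where "c = 1 / (2 * (b + 1))"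
  have c: "c > 0" "c * b < 1" using b0 by (auto simp: c_def field_simps)
  have c1: "0 \<le> c * b" using c b0 by simp
  let ?I = "\<lambda>n \<omega>. liminf (\<lambda>L. ennreal (Re (cell_sum L n (\<lambda>_. 1) \<omega>)))"
  have AE: "AE \<omega> in M. ennreal ((1 + c) powr measure (X \<omega>) B) = (\<Sum>n. ennreal (c ^ n / fact n) * ?I n \<omega>)"
    using AE_simple AE_space
  proof eventually_elim
    case (elim \<omega>)
    let ?P = "pts \<omega>"
    have fin: "finite ?P" by (rule finite_pts[OF elim(2)])
    have I: "?I n \<omega> = ennreal (card (tuples n ?P))" for n
    proof -
      have "(\<lambda>L. cell_sum L n (\<lambda>_. 1) \<omega>) \<longlonglongrightarrow> tuple_sum n (\<lambda>_. 1) \<omega>"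
        by (rule cell_sum_tendsto[OF elim(2,1)]) (simp add: seq_cont_def)
      hence "(\<lambda>L. Re (cell_sum L n (\<lambda>_. 1) \<omega>)) \<longlonglongrightarrow> card (tuples n ?P)"
        using tendsto_Re by (fastforce simp: tuple_sum_def)
      thus ?thesis by (intro lim_imp_Liminf tendsto_ennrealI) auto
    qed
    have "(1 + c) powr measure (X \<omega>) B = (1 + c) ^ card ?P"
      using c unfolding measure_B_eq_card[OF elim(2,1)] by (simp add: powr_realpow)
    also have "\<dots> = (\<Prod>x\<in>?P. 1 + c)" by simp
    also have "\<dots> = (\<Sum>n\<le>card ?P. 1 / fact n * (\<Sum>x\<in>tuples n ?P. \<Prod>i<n. c))"
      by (rule prod_one_plus_tuples[OF fin]) simp
    also have "\<dots> = (\<Sum>n\<le>card ?P. c ^ n / fact n * card (tuples n ?P))"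
      by (intro sum.cong) auto
    finally have "ennreal ((1 + c) powr measure (X \<omega>) B) = ennreal (\<Sum>n\<le>card ?P. c ^ n / fact n * card (tuples n ?P))"
      by (rule arg_cong)
    also have "\<dots> = (\<Sum>n\<le>card ?P. ennreal (c ^ n / fact n * card (tuples n ?P)))"
      using c by (intro sum_ennreal[symmetric]) auto
    also have "\<dots> = (\<Sum>n\<le>card ?P. ennreal (c ^ n / fact n) * ?I n \<omega>)"
      unfolding I using c by (intro sum.cong refl ennreal_mult) auto
    also have "\<dots> = (\<Sum>n. ennreal (c ^ n / fact n) * ?I n \<omega>)"
    proof (rule suminf_finite[symmetric])
      fix n assume "n \<notin> {..card ?P}"
      thus "ennreal (c ^ n / fact n) * ?I n \<omega> = 0" using tuples_empty_if_card_less[OF fin] by (simp add: I)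
    qed simp
    finally show ?case .
  qed
  have "(\<integral>\<^sup>+\<omega>. ennreal ((1 + c) powr measure (X \<omega>) B) \<partial>M) = (\<integral>\<^sup>+\<omega>. (\<Sum>n. ennreal (c ^ n / fact n) * ?I n \<omega>) \<partial>M)"
    by (rule nn_integral_cong_AE[OF AE])
  also have "\<dots> = (\<Sum>n. ennreal (c ^ n / fact n) * (\<integral>\<^sup>+\<omega>. ?I n \<omega> \<partial>M))"
    by (simp add: nn_integral_suminf nn_integral_cmult)
  also have "\<dots> \<le> (\<Sum>n. ennreal (c ^ n / fact n) * ennreal (fact n * b ^ n))"
  proof (intro suminf_le mult_left_mono)
    fix n
    have "(\<integral>\<^sup>+\<omega>. ?I n \<omega> \<partial>M) \<le> liminf (\<lambda>L. \<integral>\<^sup>+\<omega>. ennreal (Re (cell_sum L n (\<lambda>_. 1) \<omega>)) \<partial>M)"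
      by (rule nn_integral_liminf) simp
    also have "\<dots> \<le> liminf (\<lambda>L::nat. ennreal (fact n * b ^ n))"
      unfolding b_def by (intro Liminf_mono always_eventually allI factorial_moment_le)
    finally show "(\<integral>\<^sup>+\<omega>. ?I n \<omega> \<partial>M) \<le> ennreal (fact n * b ^ n)" by (simp add: Liminf_const)
  qed auto
  also have "(\<lambda>n. ennreal (c ^ n / fact n) * ennreal (fact n * b ^ n)) = (\<lambda>n. ennreal ((c * b) ^ n))"
    using c b0 by (auto simp: fun_eq_iff ennreal_mult[symmetric] power_mult_distrib)
  also have "(\<Sum>n. ennreal ((c * b) ^ n)) = ennreal (\<Sum>n. (c * b) ^ n)"
    using c c1 by (intro suminf_ennreal2 summable_geometric) auto
  finally have fin: "(\<integral>\<^sup>+\<omega>. ennreal ((1 + c) powr measure (X \<omega>) B) \<partial>M) < \<infinity>"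
    by (auto intro: le_less_trans)
  have "integrable M (\<lambda>\<omega>. (1 + c) powr measure (X \<omega>) B)"
    by (rule integrableI_nonneg) (use fin measure_measurable[OF B_borel] in auto)
  hence "integrable M (\<lambda>\<omega>. exp (ln (1 + c) * measure (X \<omega>) B))" using c by (simp add: powr_def mult.commute)
  thus ?thesis by (rule that[rotated]) (use c in simp)
qed

lemma count_power_integrable: "integrable M (\<lambda>\<omega>. measure (X \<omega>) B ^ n)"
proof -
  obtain r where "r > 0" "integrable M (\<lambda>\<omega>. exp (r * measure (X \<omega>) B))" by (rule exponential_moment_count)
  thus ?thesis using moments_integrable(2)[of r "\<lambda>\<omega>. measure (X \<omega>) B" M n] measure_measurable[OF B_borel] by simp
qed

text \<open>
  Dominated convergence on both sides of the identity between cell sums and integrals of rounded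
  functions; the powers of the number of points that serve as majorants are integrable by the
  exponential moment. The statement is about a finite linear combination \<open>F\<close> because it is \<open>F\<close>
  whose measurability is available in the applications.
\<close>

lemma campbell:
  fixes F :: "'w \<Rightarrow> complex"
  assumes "finite I" and F: "F \<in> borel_measurable M"
    and eq: "AE \<omega> in M. F \<omega> = (\<Sum>n\<in>I. a n * tuple_sum n (h n) \<omega>)"
    and h: "\<And>n. n \<in> I \<Longrightarrow> seq_cont n (h n)" and hm: "\<And>n. n \<in> I \<Longrightarrow> h n \<in> borel_measurable (lebn n)"
    and H: "\<And>n x. n \<in> I \<Longrightarrow> norm (h n x) \<le> H n"
  shows "integrable M F"
    "(\<integral>\<omega>. F \<omega> \<partial>M) = (\<Sum>n\<in>I. a n * (\<integral>x. (indicator ({..<n} \<rightarrow>\<^sub>E B) x * \<rho> n x) *\<^sub>R h n x \<partial>lebn n))"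
proof -
  let ?s = "\<lambda>L \<omega>. \<Sum>n\<in>I. a n * cell_sum L n (h n) \<omega>"
  let ?w = "\<lambda>\<omega>. \<Sum>n\<in>I. norm (a n) * (H n * measure (X \<omega>) B ^ n)"
  have w: "integrable M ?w" by (intro Bochner_Integration.integrable_sum integrable_mult_right count_power_integrable)
  have lim: "AE \<omega> in M. (\<lambda>L. ?s L \<omega>) \<longlonglongrightarrow> F \<omega>"
    using eq AE_simple AE_space
  proof eventually_elim
    case (elim \<omega>)
    show ?case unfolding elim(1) by (intro tendsto_sum tendsto_mult_left cell_sum_tendsto[OF elim(3,2)] h)
  qed
  have bd: "AE \<omega> in M. norm (?s L \<omega>) \<le> ?w \<omega>" for L
    using AE_space
  proof eventually_elim
    case (elim \<omega>)
    have "norm (?s L \<omega>) \<le> (\<Sum>n\<in>I. norm (a n * cell_sum L n (h n) \<omega>))" by (rule norm_sum)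
    also have "\<dots> \<le> ?w \<omega>" unfolding norm_mult by (intro sum_mono mult_left_mono norm_cell_sum_le[OF elim] H) auto
    finally show ?case .
  qed
  have sm: "?s L \<in> borel_measurable M" for L by measurable
  note dct = integral_dominated_convergence[OF F sm w lim bd] integrable_dominated_convergence[OF F sm w lim bd]
  show "integrable M F" by (rule dct(2))
  have "(\<integral>\<omega>. ?s L \<omega> \<partial>M) = (\<Sum>n\<in>I. a n * (\<integral>x. round_fun L n (h n) x \<partial>lebn n))" for L
    using expectation_cell_sum by (simp add: Bochner_Integration.integral_sum)
  moreover have "(\<lambda>L. \<Sum>n\<in>I. a n * (\<integral>x. round_fun L n (h n) x \<partial>lebn n)) \<longlonglongrightarrow>
      (\<Sum>n\<in>I. a n * (\<integral>x. (indicator ({..<n} \<rightarrow>\<^sub>E B) x * \<rho> n x) *\<^sub>R h n x \<partial>lebn n))"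
    by (intro tendsto_sum tendsto_mult_left integral_round_fun_tendsto[OF h hm H])
  ultimately show "(\<integral>\<omega>. F \<omega> \<partial>M) = (\<Sum>n\<in>I. a n * (\<integral>x. (indicator ({..<n} \<rightarrow>\<^sub>E B) x * \<rho> n x) *\<^sub>R h n x \<partial>lebn n))"
    using dct(1) LIMSEQ_unique by fastforce
qed

end

section \<open>Moments of linear statistics\<close>

definition expm1_fps :: "real \<Rightarrow> complex fps" where
  "expm1_fps a = fps_exp (complex_of_real a) - 1"

lemma expm1_fps_nth: "expm1_fps a $ k = (if k = 0 then 0 else complex_of_real a ^ k / fact k)"
  by (simp add: expm1_fps_def)

lemma expm1_fps_0 [simp]: "expm1_fps 0 = 0"
  by (simp add: expm1_fps_def)

text \<open>
  The product of \<open>exp (t f(x\<^sub>i)) - 1\<close>, a power series in \<open>t\<close>. It is divisible by \<open>t\<^sup>n\<close>, which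
  makes Fredholm expansions finite in each degree.
\<close>

definition weight :: "(complex \<Rightarrow> real) \<Rightarrow> nat \<Rightarrow> (nat \<Rightarrow> complex) \<Rightarrow> complex fps" where
  "weight f n x = (\<Prod>i<n. expm1_fps (f (x i)))"

lemma weight_Suc: "weight f (Suc n) x = weight f n x * expm1_fps (f (x n))"
  by (simp add: weight_def)

lemma weight_nth_less: "k < n \<Longrightarrow> weight f n x $ k = 0"
proof (induction n arbitrary: k)
  case (Suc n)
  have "weight f n x $ i * expm1_fps (f (x n)) $ (k - i) = 0" if "i \<le> k" for i
    using Suc that by (cases "i = k") (auto simp: expm1_fps_nth)
  thus ?case unfolding weight_Suc fps_mult_nth by (intro sum.neutral) auto
qed simp

lemma weight_outside: "i < n \<Longrightarrow> f (x i) = 0 \<Longrightarrow> weight f n x = 0"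
  unfolding weight_def by (intro prod_zero bexI[of _ i]) auto

lemma weight_nth_measurable:
  assumes f: "f \<in> borel_measurable borel" and "n \<le> m"
  shows "(\<lambda>x. weight f n x $ k) \<in> borel_measurable (PiM {..<m} (\<lambda>_. lborel))"
  using assms(2)
proof (induction n arbitrary: k)
  case (Suc n)
  have [measurable]: "(\<lambda>x. f (x n)) \<in> borel_measurable (PiM {..<m} (\<lambda>_. lborel))"
    using Suc f by (intro measurable_compose[OF measurable_component_singleton]) auto
  have [measurable]: "(\<lambda>x. weight f n x $ i) \<in> borel_measurable (PiM {..<m} (\<lambda>_. lborel))" for i
    using Suc by simp
  show ?case unfolding weight_Suc fps_mult_nth expm1_fps_nth by measurable
qed (simp add: weight_def)

lemma weight_nth_bounded:
  assumes "\<And>z. \<bar>f z\<bar> \<le> m"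
  obtains H where "\<And>x. norm (weight f n x $ k) \<le> H"
proof -
  have m: "0 \<le> m" using assms[of undefined] by linarith
  have "\<exists>H. \<forall>x. norm (weight f n x $ k) \<le> H"
  proof (induction n arbitrary: k)
    case 0 thus ?case by (auto simp: weight_def fps_one_nth)
  next
    case (Suc n)
    then obtain H where H: "\<And>k x. norm (weight f n x $ k) \<le> H k" by metis
    have g: "norm (expm1_fps (f z) $ j) \<le> m ^ j" for z j
    proof -
      have "\<bar>f z\<bar> ^ j / fact j \<le> \<bar>f z\<bar> ^ j / 1" by (intro divide_left_mono) auto
      also have "\<dots> \<le> m ^ j" using assms by (simp add: power_mono)
      finally show ?thesis using m by (simp add: expm1_fps_nth norm_divide norm_power)
    qed
    have "norm (weight f (Suc n) x $ k) \<le> (\<Sum>i=0..k. H i * m ^ (k - i))" for x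
      unfolding weight_Suc fps_mult_nth
      by (intro sum_norm_le) (auto simp: norm_mult intro!: mult_mono H g order_trans[OF norm_ge_zero H])
    thus ?case by blast
  qed
  thus ?thesis using that by blast
qed

context bounded_correlations
begin

lemma seq_cont_weight:
  assumes f: "continuous_on UNIV f"
  shows "seq_cont n (\<lambda>x. weight f n x $ k)"
proof -
  have "(\<lambda>L. weight f n (y L) $ k) \<longlonglongrightarrow> weight f n x $ k" if "\<And>i. i < n \<Longrightarrow> (\<lambda>L. y L i) \<longlonglongrightarrow> x i"
    for x :: "nat \<Rightarrow> complex" and y :: "nat \<Rightarrow> nat \<Rightarrow> complex"
    using that
  proof (induction n arbitrary: k)
    case (Suc n)
    have "(\<lambda>L. f (y L n)) \<longlonglongrightarrow> f (x n)"
      using Suc.prems[of n] f by (intro continuous_on_tendsto_compose[OF f]) auto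
    hence "(\<lambda>L. expm1_fps (f (y L n)) $ j) \<longlonglongrightarrow> expm1_fps (f (x n)) $ j" for j
      unfolding expm1_fps_nth by (cases "j = 0") (auto intro!: tendsto_intros)
    thus ?case unfolding weight_Suc fps_mult_nth using Suc by (intro tendsto_sum tendsto_mult) auto
  qed (simp add: weight_def)
  thus ?thesis unfolding seq_cont_def by blast
qed

context
  fixes f :: "complex \<Rightarrow> real" and m :: real
  assumes f_cont: "continuous_on UNIV f" and f_supp: "\<And>z. z \<notin> B \<Longrightarrow> f z = 0" and f_bound: "\<And>z. \<bar>f z\<bar> \<le> m"
begin

lemma Tr_eq_sum: "\<omega> \<in> space M \<Longrightarrow> Tr X f \<omega> = (\<Sum>x\<in>pts \<omega>. f x)"
  unfolding Tr_def infsum_finite[OF finite_pts, symmetric]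
  by (rule infsum_cong_neutral) (use f_supp in auto)

text \<open>
  The statistic is the limit of sums over the occupied cells, each of which is a measurable
  condition on \<open>\<omega>\<close>.
\<close>

lemma Tr_measurable: "Tr X f \<in> borel_measurable M"
proof (rule borel_measurable_LIMSEQ_real)
  let ?s = "\<lambda>L \<omega>. \<Sum>p\<in>dyadic L ` B. (if emeasure (X \<omega>) (cell L p) = 0 then 0 else f p)"
  show "?s L \<in> borel_measurable M" for L
  proof (rule borel_measurable_sum)
    fix p
    have "{\<omega> \<in> space M. emeasure (X \<omega>) (cell L p) = 0} \<in> sets M"
      using emeasure_measurable[OF cell_borel, of L p] by measurable
    thus "(\<lambda>\<omega>. if emeasure (X \<omega>) (cell L p) = 0 then 0 else f p) \<in> borel_measurable M"
      by (intro measurable_If) auto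
  qed
  fix \<omega> assume w: "\<omega> \<in> space M"
  have "\<forall>\<^sub>F L in sequentially. (\<Sum>x\<in>pts \<omega>. f (dyadic L x)) = ?s L \<omega>"
    using dyadic_eventually_inj[OF finite_pts[OF w]]
  proof eventually_elim
    case (elim L)
    have "emeasure (X \<omega>) (cell L p) = 0 \<longleftrightarrow> p \<notin> dyadic L ` pts \<omega>" for p
      unfolding emeasure_eq_0_iff_no_points[OF integer[OF w] cell_bounded cell_borel] by (auto simp: cell_def)
    hence "?s L \<omega> = (\<Sum>p\<in>dyadic L ` B. if p \<notin> dyadic L ` pts \<omega> then 0 else f p)" by simp
    also have "\<dots> = (\<Sum>p\<in>dyadic L ` pts \<omega>. f p)"
      by (rule sum.mono_neutral_cong_right) (auto intro: finite_dyadic_image[OF B_bounded])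
    also have "\<dots> = (\<Sum>x\<in>pts \<omega>. f (dyadic L x))" by (simp add: sum.reindex[OF elim])
    finally show ?case ..
  qed
  moreover have "(\<lambda>L. \<Sum>x\<in>pts \<omega>. f (dyadic L x)) \<longlonglongrightarrow> (\<Sum>x\<in>pts \<omega>. f x)"
    by (intro tendsto_sum continuous_on_tendsto_compose[OF f_cont] dyadic_tendsto) auto
  ultimately show "(\<lambda>L. ?s L \<omega>) \<longlonglongrightarrow> Tr X f \<omega>"
    unfolding Tr_eq_sum[OF w] by (rule Lim_transform_eventually[rotated])
qed

lemma Tr_exponential_moment:
  obtains r where "r > 0" "integrable M (\<lambda>\<omega>. exp (r * \<bar>Tr X f \<omega>\<bar>))"
proof -
  obtain r where r: "r > 0" "integrable M (\<lambda>\<omega>. exp (r * measure (X \<omega>) B))" by (rule exponential_moment_count)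
  define s where "s = r / (m + 1)"
  have m: "0 \<le> m" using f_bound[of undefined] by linarith
  have s: "s > 0" "s * m \<le> r" using r m by (auto simp: s_def field_simps)
  have "integrable M (\<lambda>\<omega>. exp (s * \<bar>Tr X f \<omega>\<bar>))"
  proof (rule Bochner_Integration.integrable_bound[OF r(2)])
    show "(\<lambda>\<omega>. exp (s * \<bar>Tr X f \<omega>\<bar>)) \<in> borel_measurable M" using Tr_measurable by measurable
    show "AE \<omega> in M. norm (exp (s * \<bar>Tr X f \<omega>\<bar>)) \<le> norm (exp (r * measure (X \<omega>) B))"
      using AE_simple AE_space
    proof eventually_elim
      case (elim \<omega>)
      have "\<bar>Tr X f \<omega>\<bar> \<le> (\<Sum>x\<in>pts \<omega>. m)"
        unfolding Tr_eq_sum[OF elim(2)] by (intro order_trans[OF sum_abs] sum_mono f_bound)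
      also have "\<dots> = m * measure (X \<omega>) B" using measure_B_eq_card[OF elim(2,1)] by simp
      finally have "s * \<bar>Tr X f \<omega>\<bar> \<le> s * (m * measure (X \<omega>) B)" using s by (intro mult_left_mono) auto
      also have "\<dots> \<le> r * measure (X \<omega>) B" unfolding mult.assoc[symmetric] using s by (intro mult_right_mono) auto
      finally show ?case by simp
    qed
  qed
  thus ?thesis using that s by blast
qed

text \<open>
  The coefficient of \<open>t\<^sup>k\<close> in \<open>exp (t T) = (\<Prod>x. 1 + (exp (t f x) - 1))\<close>, expanded over tuples
  of distinct points, only involves tuples of length at most \<open>k\<close>.
\<close>

lemma moment_Tr:
  "complex_of_real (moment_fps M (Tr X f) $ k) =
     (\<Sum>n\<le>k. 1 / fact n * (\<integral>x. weight f n x $ k * complex_of_real (\<rho> n x) \<partial>lebn n))"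
proof -
  let ?F = "\<lambda>\<omega>. complex_of_real (Tr X f \<omega> ^ k / fact k)"
  let ?h = "\<lambda>n x. weight f n x $ k"
  have fm: "f \<in> borel_measurable borel" by (rule borel_measurable_continuous_onI[OF f_cont])
  have Fm: "?F \<in> borel_measurable M" using Tr_measurable by measurable
  have eq: "AE \<omega> in M. ?F \<omega> = (\<Sum>n\<le>k. 1 / fact n * tuple_sum n (?h n) \<omega>)"
    using AE_space
  proof eventually_elim
    case (elim \<omega>)
    let ?P = "pts \<omega>"
    have fin: "finite ?P" by (rule finite_pts[OF elim])
    have prod: "fps_exp (\<Sum>x\<in>A. complex_of_real (f x)) = (\<Prod>x\<in>A. 1 + expm1_fps (f x))" if "finite A" for A
      using that by induction (auto simp: fps_exp_add_mult expm1_fps_def)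
    have c: "fps_const (1 / fact n) * fact n = (1 :: complex fps)" for n
    proof -
      have "(fact n :: complex fps) = fps_const (fact n)"
        by (metis fps_of_nat of_nat_fact)
      thus ?thesis by simp
    qed
    have "?F \<omega> = fps_exp (\<Sum>x\<in>?P. complex_of_real (f x)) $ k"
      by (simp add: Tr_eq_sum[OF elim])
    also have "fps_exp (\<Sum>x\<in>?P. complex_of_real (f x)) =
        (\<Sum>n\<le>card ?P. fps_const (1 / fact n) * (\<Sum>x\<in>tuples n ?P. weight f n x))"
      unfolding prod[OF fin] prod_one_plus_tuples[OF fin c] weight_def ..
    also have "\<dots> $ k = (\<Sum>n\<le>card ?P. 1 / fact n * tuple_sum n (?h n) \<omega>)"
      by (simp add: fps_sum_nth tuple_sum_def)
    also have "\<dots> = (\<Sum>n\<le>max k (card ?P). 1 / fact n * tuple_sum n (?h n) \<omega>)"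
      by (rule sum.mono_neutral_left) (auto simp: tuple_sum_def tuples_empty_if_card_less[OF fin])
    also have "\<dots> = (\<Sum>n\<le>k. 1 / fact n * tuple_sum n (?h n) \<omega>)"
      by (rule sum.mono_neutral_right) (auto simp: tuple_sum_def weight_nth_less)
    finally show ?case .
  qed
  have "\<exists>H. \<forall>x. norm (?h n x) \<le> H" for n using weight_nth_bounded[of f m, OF f_bound] by metis
  then obtain H where H: "\<And>n x. norm (?h n x) \<le> H n" by metis
  have "complex_of_real (moment_fps M (Tr X f) $ k) = (\<integral>\<omega>. ?F \<omega> \<partial>M)"
    by (simp only: integral_complex_of_real) (simp add: moment_fps_def)
  also have "\<dots> = (\<Sum>n\<le>k. 1 / fact n * (\<integral>x. (indicator ({..<n} \<rightarrow>\<^sub>E B) x * \<rho> n x) *\<^sub>R ?h n x \<partial>lebn n))"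
    by (rule campbell(2)[OF _ Fm eq]) (auto intro: seq_cont_weight[OF f_cont] weight_nth_measurable[OF fm] H)
  also have "\<dots> = (\<Sum>n\<le>k. 1 / fact n * (\<integral>x. weight f n x $ k * complex_of_real (\<rho> n x) \<partial>lebn n))"
  proof (intro sum.cong refl arg_cong2[where f = "(*)"] Bochner_Integration.integral_cong)
    fix n x assume x: "x \<in> space (lebn n)"
    show "(indicator ({..<n} \<rightarrow>\<^sub>E B) x * \<rho> n x) *\<^sub>R ?h n x = weight f n x $ k * complex_of_real (\<rho> n x)"
    proof (cases "x \<in> {..<n} \<rightarrow>\<^sub>E B")
      case False
      then obtain i where "i < n" "x i \<notin> B" using x by (auto simp: space_PiM PiE_def Pi_def)
      thus ?thesis using weight_outside[of i n f x] f_supp by simp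
    qed (simp add: scaleR_conv_of_real)
  qed
  finally show ?thesis .
qed

end

end

section \<open>Separability of the space of integrable functions\<close>

text \<open>
  Every integrable function is approximated by a list of pairs of a coefficient and a set, where
  both range over countable families: an open set is the increasing union of the finite unions of
  sets of a countable basis.
\<close>

lemma ex_countable_dense_L1:
  obtains D :: "(complex \<Rightarrow> complex) set" where "countable D" "\<And>d. d \<in> D \<Longrightarrow> integrable lborel d"
    "\<And>g \<epsilon>. integrable lborel g \<Longrightarrow> 0 < \<epsilon> \<Longrightarrow> \<exists>d\<in>D. (\<integral>z. cmod (g z - d z) \<partial>lborel) < \<epsilon>"
proof -
  obtain Q :: "complex set" where Q: "countable Q" "\<And>S. open S \<Longrightarrow> S \<noteq> {} \<Longrightarrow> \<exists>q\<in>Q. q \<in> S"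
    by (rule countable_dense_setE) blast
  obtain b :: "complex set set" where b: "countable b" "topological_basis b" using ex_countable_basis by blast
  define \<U> where "\<U> = (\<lambda>(F, k). \<Union>F \<inter> ball (0::complex) (real k)) ` ({F. finite F \<and> F \<subseteq> b} \<times> (UNIV :: nat set))"
  have cU: "countable \<U>" unfolding \<U>_def
    by (intro countable_image countable_SIGMA countable_Collect_finite_subset b) auto
  define val where "val l z = (\<Sum>(q, U)\<leftarrow>l. indicat_real U z *\<^sub>R q)" for l :: "(complex \<times> complex set) list" and z :: complex
  define D where "D = val ` lists (Q \<times> \<U>)"
  have cD: "countable D" unfolding D_def by (intro countable_image countable_lists countable_SIGMA cU Q(1))
  have Ub: "U \<in> sets borel" "emeasure lborel U < \<infinity>" if U: "U \<in> \<U>" for U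
  proof -
    obtain F k where Fk: "F \<subseteq> b" "U = \<Union>F \<inter> ball 0 (real k)" using U by (auto simp: \<U>_def)
    have "open U" unfolding Fk(2) using Fk(1) b(2) topological_basis_open by (intro open_Int open_Union) auto
    thus "U \<in> sets borel" by simp
    have "bounded U" unfolding Fk(2) by (rule bounded_subset[OF bounded_ball]) auto
    thus "emeasure lborel U < \<infinity>" by (rule emeasure_bounded_finite)
  qed
  have int: "integrable lborel (val l)" if "l \<in> lists (Q \<times> \<U>)" for l
    using that
  proof (induction l rule: lists.induct)
    case Nil show ?case by (simp add: val_def[abs_def])
  next
    case (Cons a l)
    obtain q U where a: "a = (q, U)" "U \<in> \<U>" using Cons by (cases a) auto
    have "integrable lborel (\<lambda>z. indicat_real U z *\<^sub>R q)"
      using Ub[OF a(2)] by (intro integrable_scaleR_left integrable_real_indicator) auto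
    thus ?case using Cons.IH unfolding val_def[abs_def] by (simp add: a)
  qed
  have intD: "integrable lborel d" if "d \<in> D" for d using that int by (auto simp: D_def)
  have dense: "\<forall>\<epsilon>>0. \<exists>d\<in>D. (\<integral>z. cmod (g z - d z) \<partial>lborel) < \<epsilon>" if "integrable lborel g" for g
    using that
  proof (induction g rule: integrable_induct)
    case (base A c)
    show ?case
    proof (intro allI impI)
      fix \<epsilon> :: real assume e: "\<epsilon> > 0"
      define C where "C = cmod c + 1"
      have C: "C > 0" "cmod c \<le> C" unfolding C_def by (auto intro: add_nonneg_pos)
      define \<eta> where "\<eta> = \<epsilon> / (4 * C)"
      have eta0: "\<eta> > 0" unfolding \<eta>_def using \<open>\<epsilon> > 0\<close> C by simp
      have "cmod c * \<eta> \<le> C * \<eta>" using eta0 C by (intro mult_right_mono) auto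
      also have "\<dots> = \<epsilon> / 4" using C by (simp add: \<eta>_def)
      finally have eta: "\<eta> > 0" "cmod c * \<eta> \<le> \<epsilon> / 4" using eta0 by auto
      have A[measurable]: "A \<in> sets borel" using base by simp
      obtain U where U: "open U" "A \<subseteq> U" "emeasure lborel (U - A) < \<eta>"
        using outer_regular_lborel[OF A eta(1)] by blast
      have Ufin: "emeasure lborel U < \<infinity>"
      proof -
        have "A \<union> (U - A) = U" using U(2) by auto
        hence "emeasure lborel U = emeasure lborel A + emeasure lborel (U - A)"
          using U(1) plus_emeasure[of A lborel "U - A"] by auto
        also have "\<dots> < \<infinity>" using base U(3) by (auto intro: less_trans)
        finally show ?thesis .
      qed
      obtain b' where b': "b' \<subseteq> b" "\<Union>b' = U" using b(2) U(1) by (auto simp: topological_basis)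
      have cb': "countable b'" using b' b countable_subset by blast
      define e where "e i = (if b' = {} then {} else from_nat_into b' i)" for i
      have e_range: "(\<Union>i. e i) = U" using b' cb' range_from_nat_into[of b'] by (auto simp: e_def)
      define V where "V n = (\<Union>(e ` {..<n}) - (if b' = {} then UNIV else {})) \<inter> ball 0 (real n)" for n
      have V': "V n = \<Union>((\<lambda>i. e i) ` (if b' = {} then {} else {..<n})) \<inter> ball 0 (real n)" for n
        by (auto simp: V_def)
      have VU: "V n \<in> \<U>" for n
      proof -
        have "(\<lambda>i. e i) ` (if b' = {} then {} else {..<n}) \<subseteq> b"
          using b'(1) from_nat_into[of b'] by (auto simp: e_def)
        thus ?thesis unfolding \<U>_def V' by (intro rev_image_eqI[of "(_ ` _, n)"]) auto
      qed
      have Vsub: "V n \<subseteq> U" for n using e_range by (auto simp: V')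
      have [measurable]: "V n \<in> sets borel" "U \<in> sets borel" for n using Ub[OF VU] U(1) by auto
      have "(\<lambda>n. emeasure lborel (U - V n)) \<longlonglongrightarrow> emeasure lborel (\<Inter>n. U - V n)"
      proof (rule Lim_emeasure_decseq)
        have "V m \<subseteq> V n" if "m \<le> n" for m n using that by (fastforce simp: V' split: if_splits)
        thus "decseq (\<lambda>n. U - V n)" by (auto simp: decseq_def)
        show "emeasure lborel (U - V n) \<noteq> \<infinity>" for n
          using emeasure_mono[of "U - V n" U lborel] Ufin by (auto simp: top_unique)
      qed auto
      also have "(\<Inter>n. U - V n) = {}"
      proof -
        have "\<exists>n. z \<in> V n" if z: "z \<in> U" for z
        proof -
          obtain i where i: "z \<in> e i" using z e_range by auto
          hence ne: "b' \<noteq> {}" by (auto simp: e_def)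
          obtain k where k: "cmod z < real k" using reals_Archimedean2 by blast
          have "V n = \<Union>(e ` {..<n}) \<inter> ball 0 (real n)" for n using ne by (simp add: V')
          moreover have "z \<in> \<Union>(e ` {..<max (Suc i) k})" using i by (intro UN_I[of i]) auto
          moreover have "z \<in> ball 0 (real (max (Suc i) k))" using k by simp
          ultimately have "z \<in> V (max (Suc i) k)" by blast
          thus ?thesis by blast
        qed
        thus ?thesis by auto
      qed
      finally have "(\<lambda>n. emeasure lborel (U - V n)) \<longlonglongrightarrow> 0" by simp
      hence "\<forall>\<^sub>F n in sequentially. emeasure lborel (U - V n) < ennreal \<eta>"
        using eta by (intro order_tendstoD) auto
      then obtain n where n: "emeasure lborel (U - V n) < ennreal \<eta>" by (auto simp: eventually_sequentially)
      let ?m = "measure lborel (V n)"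
      have "0 < \<epsilon> / (4 * (?m + 1))" using \<open>\<epsilon> > 0\<close> by (intro divide_pos_pos mult_pos_pos add_nonneg_pos) auto
      then obtain q where q: "q \<in> Q" "q \<in> ball c (\<epsilon> / (4 * (?m + 1)))"
        using Q(2)[of "ball c (\<epsilon> / (4 * (?m + 1)))"] by auto
      have "val [(q, V n)] \<in> D" unfolding D_def using q(1) VU by (intro imageI) auto
      moreover have "(\<integral>z. cmod (indicat_real A z *\<^sub>R c - val [(q, V n)] z) \<partial>lborel) < \<epsilon>"
      proof -
        have mUA: "measure lborel (U - A) \<le> \<eta>" using U(3) eta(1) unfolding measure_def by (intro enn2real_leI) auto
        have mUV: "measure lborel (U - V n) \<le> \<eta>" using n eta(1) unfolding measure_def by (intro enn2real_leI) auto
        have fin: "emeasure lborel (U - A) < \<infinity>" "emeasure lborel (U - V n) < \<infinity>" "emeasure lborel (V n) < \<infinity>"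
          using U(3) n Ub[OF VU] by (auto intro: less_trans)
        let ?g = "\<lambda>z. cmod c * indicat_real (U - A) z + cmod c * indicat_real (U - V n) z + cmod (c - q) * indicat_real (V n) z"
        have gi: "integrable lborel ?g"
          using fin by (intro Bochner_Integration.integrable_add integrable_mult_right integrable_real_indicator) auto
        have "(\<integral>z. cmod (indicat_real A z *\<^sub>R c - val [(q, V n)] z) \<partial>lborel) \<le> (\<integral>z. ?g z \<partial>lborel)"
        proof (rule integral_mono_AE')
          show "AE z in lborel. cmod (indicat_real A z *\<^sub>R c - val [(q, V n)] z) \<le> ?g z"
            using U(2) Vsub[of n] norm_triangle_sub[of q c]
            by (intro AE_I2) (auto simp: val_def indicator_def norm_minus_commute)
        qed (use gi in auto)
        also have "\<dots> = cmod c * measure lborel (U - A) + cmod c * measure lborel (U - V n) + cmod (c - q) * ?m"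
          using fin by (simp add: integrable_real_indicator)
        also have "\<dots> \<le> \<epsilon> / 4 + \<epsilon> / 4 + \<epsilon> / 4"
        proof (intro add_mono)
          show "cmod c * measure lborel (U - A) \<le> \<epsilon> / 4" "cmod c * measure lborel (U - V n) \<le> \<epsilon> / 4"
            using mUA mUV eta(2) mult_left_mono[OF mUA, of "cmod c"] mult_left_mono[OF mUV, of "cmod c"] by auto
          have "cmod (c - q) * ?m \<le> \<epsilon> / (4 * (?m + 1)) * ?m"
            using q(2) by (intro mult_right_mono) (auto simp: dist_norm)
          also have "\<dots> = \<epsilon> / 4 * (?m / (?m + 1))" by simp
          also have "\<dots> \<le> \<epsilon> / 4 * 1" using \<open>\<epsilon> > 0\<close>
            by (intro mult_left_mono) (auto simp: divide_le_eq_1 add_nonneg_pos)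
          finally show "cmod (c - q) * ?m \<le> \<epsilon> / 4" by simp
        qed
        also have "\<dots> < \<epsilon>" using \<open>\<epsilon> > 0\<close> by simp
        finally show ?thesis .
      qed
      ultimately show "\<exists>d\<in>D. (\<integral>z. cmod (indicat_real A z *\<^sub>R c - d z) \<partial>lborel) < \<epsilon>" by blast
    qed
  next
    case (add f g)
    show ?case
    proof (intro allI impI)
      fix \<epsilon> :: real assume e: "\<epsilon> > 0"
      obtain d where d: "d \<in> D" "(\<integral>z. cmod (f z - d z) \<partial>lborel) < \<epsilon> / 2" using add e half_gt_zero by blast
      obtain d' where d': "d' \<in> D" "(\<integral>z. cmod (g z - d' z) \<partial>lborel) < \<epsilon> / 2" using add e half_gt_zero by blast
      obtain l l' where l: "l \<in> lists (Q \<times> \<U>)" "d = val l" "l' \<in> lists (Q \<times> \<U>)" "d' = val l'"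
        using d d' by (auto simp: D_def)
      have "(\<lambda>z. d z + d' z) = val (l @ l')" by (auto simp: l val_def fun_eq_iff)
      hence "(\<lambda>z. d z + d' z) \<in> D" unfolding D_def using l by (intro rev_image_eqI[of "l @ l'"]) auto
      moreover have "(\<integral>z. cmod (f z + g z - (d z + d' z)) \<partial>lborel) \<le> (\<integral>z. cmod (f z - d z) + cmod (g z - d' z) \<partial>lborel)"
        using add d d' intD
        by (intro integral_mono integrable_norm Bochner_Integration.integrable_diff Bochner_Integration.integrable_add)
           (auto simp: add_diff_add norm_triangle_ineq)
      hence "(\<integral>z. cmod (f z + g z - (d z + d' z)) \<partial>lborel) < \<epsilon>"
        using d d' add intD by (simp add: Bochner_Integration.integral_add)
      ultimately show "\<exists>d\<in>D. (\<integral>z. cmod (f z + g z - d z) \<partial>lborel) < \<epsilon>"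
        by (intro bexI[of _ "\<lambda>z. d z + d' z"])
    qed
  next
    case (lim f s)
    show ?case
    proof (intro allI impI)
      fix \<epsilon> :: real assume e: "\<epsilon> > 0"
      have [measurable]: "f \<in> borel_measurable borel" "s i \<in> borel_measurable borel" for i using lim by auto
      have "(\<lambda>i. \<integral>z. cmod (f z - s i z) \<partial>lborel) \<longlonglongrightarrow> (\<integral>z. 0 \<partial>(lborel :: complex measure))"
      proof (rule integral_dominated_convergence[where w = "\<lambda>z. 3 * cmod (f z)"])
        show "AE z in lborel. (\<lambda>i. cmod (f z - s i z)) \<longlonglongrightarrow> 0"
        proof (rule AE_I2)
          fix z :: complex
          have "(\<lambda>i. s i z) \<longlonglongrightarrow> f z" using lim by simp
          hence "(\<lambda>i. cmod (f z - s i z)) \<longlonglongrightarrow> cmod (f z - f z)" by (intro tendsto_intros)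
          thus "(\<lambda>i. cmod (f z - s i z)) \<longlonglongrightarrow> 0" by simp
        qed
        show "AE z in lborel. norm (cmod (f z - s i z)) \<le> 3 * cmod (f z)" for i
        proof (rule AE_I2)
          fix z :: complex
          have "cmod (s i z) \<le> 2 * cmod (f z)" using lim by simp
          thus "norm (cmod (f z - s i z)) \<le> 3 * cmod (f z)" using norm_triangle_ineq4[of "f z" "s i z"] by simp
        qed
      qed (use lim in auto)
      hence "\<forall>\<^sub>F i in sequentially. (\<integral>z. cmod (f z - s i z) \<partial>lborel) < \<epsilon> / 2" using e by (intro order_tendstoD) auto
      then obtain i where i: "(\<integral>z. cmod (f z - s i z) \<partial>lborel) < \<epsilon> / 2" by (auto simp: eventually_sequentially)
      obtain d where d: "d \<in> D" "(\<integral>z. cmod (s i z - d z) \<partial>lborel) < \<epsilon> / 2" using lim e half_gt_zero by blast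
      have "cmod (f z - d z) \<le> cmod (f z - s i z) + cmod (s i z - d z)" for z
        using norm_triangle_ineq[of "f z - s i z" "s i z - d z"] by simp
      hence "(\<integral>z. cmod (f z - d z) \<partial>lborel) \<le> (\<integral>z. cmod (f z - s i z) + cmod (s i z - d z) \<partial>lborel)"
        using lim d intD
        by (intro integral_mono integrable_norm Bochner_Integration.integrable_diff Bochner_Integration.integrable_add) auto
      also have "\<dots> < \<epsilon>" using i d lim intD by (simp add: Bochner_Integration.integral_add)
      finally show "\<exists>d\<in>D. (\<integral>z. cmod (f z - d z) \<partial>lborel) < \<epsilon>" using d by blast
    qed
  qed
  show ?thesis using that[OF cD intD] dense by blast
qed

section \<open>Reproducing kernels\<close>

text \<open>
  The symmetry and the projection identity come from the reproducing identity applied to the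
  functions \<open>K(\<cdot>,w)\<close>.
\<close>

lemma reproducing_kernelD:
  assumes "reproducing_kernel K"
  shows "(\<lambda>z. K z w) \<in> borel_measurable borel" "(\<lambda>z. K w z) \<in> borel_measurable borel" "integrable lborel (\<lambda>z. (cmod (K z w))\<^sup>2)"
    and "K w v = cnj (K v w)" and "K w v = (\<integral>u. K w u * K u v \<partial>lborel)"
proof -
  obtain H where H: "closed_subspace_cont_eval H" "\<And>w. (\<lambda>z. K z w) \<in> H"
    and rep: "\<And>f w. f \<in> H \<Longrightarrow> f w = (\<integral>z. f z * cnj (K z w) \<partial>lborel)"
    using assms by (auto simp: reproducing_kernel_def)
  have "(\<lambda>z. K z w) \<in> L2_plane" for w using H by (auto simp: closed_subspace_cont_eval_def)
  thus K: "(\<lambda>z. K z w) \<in> borel_measurable borel" "integrable lborel (\<lambda>z. (cmod (K z w))\<^sup>2)" for w by (auto simp: L2_plane_def)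
  have r: "K w v = (\<integral>z. K z v * cnj (K z w) \<partial>lborel)" for w v using rep[OF H(2)] .
  have h: "K w v = cnj (K v w)" for w v
  proof -
    have "cnj (K v w) = (\<integral>z. cnj (K z w * cnj (K z v)) \<partial>lborel)" unfolding r[of v w] by (rule Bochner_Integration.integral_cnj[symmetric])
    also have "\<dots> = K w v" unfolding r[of w v] by (simp add: mult.commute)
    finally show ?thesis ..
  qed
  show "K w v = cnj (K v w)" by (rule h)
  have "(\<lambda>z. cnj (K z w)) \<in> borel_measurable borel"
    by (rule measurable_compose[OF K(1) borel_measurable_continuous_onI]) (intro continuous_intros)
  thus "(\<lambda>z. K w z) \<in> borel_measurable borel" unfolding h[of w] .
  have "cnj (K z w) = K w z" for z using h[of w z] by simp
  thus "K w v = (\<integral>u. K w u * K u v \<partial>lborel)" using r[of w v] by (simp add: mult.commute)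
qed

text \<open>
  A kernel whose sections lie in \<open>L\<^sup>1\<close> is a priori only separately measurable, but the sections
  form a separable set. Since \<open>|K(z,w) - K(z,w')| \<le> \<Phi> \<parallel>K(\<cdot>,w) - K(\<cdot>,w')\<parallel>\<^sub>1\<close>, the kernel is a uniform limit
  of functions that depend on \<open>w\<close> only through a countable measurable partition.
\<close>

lemma reproducing_kernel_measurable:
  assumes K: "reproducing_kernel K" and bd: "\<And>z w. cmod (K z w) \<le> \<Phi>"
    and L1: "\<And>w. integrable lborel (\<lambda>z. K z w)"
  shows "(\<lambda>(z, w). K z w) \<in> borel_measurable (borel \<Otimes>\<^sub>M borel)"
proof -
  note herm = reproducing_kernelD(4)[OF K] and rep = reproducing_kernelD(5)[OF K]
  have [measurable]: "(\<lambda>z. K z w) \<in> borel_measurable borel" for w by (rule reproducing_kernelD(1)[OF K])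
  have [measurable]: "(\<lambda>w. K z w) \<in> borel_measurable borel" for z
    by (rule reproducing_kernelD(2)[OF K])
  have L1': "integrable lborel (\<lambda>u. K z u)" for z by (subst herm) (use L1 in simp)
  have Phi: "0 \<le> \<Phi>" using bd[of 0 0] norm_ge_zero order_trans by blast
  have diff: "cmod (K z w - K z w') \<le> \<Phi> * (\<integral>u. cmod (K u w - K u w') \<partial>lborel)" for z w w'
  proof -
    have i: "integrable lborel (\<lambda>u. K z u * K u v)" for v
    proof (rule Bochner_Integration.integrable_bound[OF integrable_mult_right[OF L1[of v]]])
      show "AE u in lborel. norm (K z u * K u v) \<le> norm (complex_of_real \<Phi> * K u v)"
      proof (rule AE_I2)
        fix u
        have "cmod (K z u) * cmod (K u v) \<le> \<Phi> * cmod (K u v)" by (rule mult_right_mono[OF bd]) simp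
        thus "norm (K z u * K u v) \<le> norm (complex_of_real \<Phi> * K u v)"
          using Phi by (simp only: norm_mult norm_of_real abs_of_nonneg)
      qed
    qed measurable
    have "K z w - K z w' = (\<integral>u. K z u * (K u w - K u w') \<partial>lborel)"
      unfolding rep[of z w] rep[of z w'] using i by (simp add: right_diff_distrib)
    also have "cmod \<dots> \<le> (\<integral>u. cmod (K z u * (K u w - K u w')) \<partial>lborel)" by (rule integral_norm_bound)
    also have "\<dots> \<le> (\<integral>u. \<Phi> * cmod (K u w - K u w') \<partial>lborel)"
    proof (rule integral_mono_AE')
      show "AE u in lborel. cmod (K z u * (K u w - K u w')) \<le> \<Phi> * cmod (K u w - K u w')"
        unfolding norm_mult by (intro AE_I2 mult_right_mono[OF bd]) simp
      show "integrable lborel (\<lambda>u. \<Phi> * cmod (K u w - K u w'))"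
        by (intro integrable_mult_right integrable_norm Bochner_Integration.integrable_diff L1)
      show "AE u in lborel. 0 \<le> \<Phi> * cmod (K u w - K u w')" using Phi by simp
    qed
    finally show ?thesis by simp
  qed
  obtain D :: "(complex \<Rightarrow> complex) set" where D: "countable D" "\<And>d. d \<in> D \<Longrightarrow> integrable lborel d"
    "\<And>g \<epsilon>. integrable lborel g \<Longrightarrow> 0 < \<epsilon> \<Longrightarrow> \<exists>d\<in>D. (\<integral>z. cmod (g z - d z) \<partial>lborel) < \<epsilon>"
    by (rule ex_countable_dense_L1) blast
  define near where "near d n w \<longleftrightarrow> (\<integral>z. cmod (K z w - d z) \<partial>lborel) < 1 / real (Suc n)" for d n w
  \<comment> \<open>one section of the kernel is chosen near each element of the dense set, whenever there is one\<close>
  define W where "W = (\<lambda>(d, n). SOME w. near d n w) ` (D \<times> (UNIV :: nat set))"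
  have cW: "countable W" unfolding W_def using D by (intro countable_image countable_SIGMA) auto
  have "D \<noteq> {}" using D(3)[OF L1[of 0], of 1] by auto
  hence W0: "W \<noteq> {}" by (auto simp: W_def)
  define s where "s = from_nat_into W"
  have dense: "\<exists>m. \<forall>z. cmod (K z w - K z (s m)) \<le> \<epsilon>" if e: "\<epsilon> > 0" for w \<epsilon>
  proof -
    have "0 < \<epsilon> / (2 * (\<Phi> + 1))" using e Phi by simp
    then obtain n where n: "1 / real (Suc n) < \<epsilon> / (2 * (\<Phi> + 1))"
      using reals_Archimedean by (metis inverse_eq_divide)
    obtain d where d: "d \<in> D" "(\<integral>z. cmod (K z w - d z) \<partial>lborel) < 1 / real (Suc n)"
      using D(3)[OF L1[of w], of "1 / real (Suc n)"] by auto
    define w' where "w' = (SOME w. near d n w)"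
    have "near d n w" using d by (simp add: near_def)
    hence w': "(\<integral>z. cmod (K z w' - d z) \<partial>lborel) < 1 / real (Suc n)"
      unfolding w'_def using someI[of "near d n" w] by (simp add: near_def)
    have "cmod (K u w - K u w') \<le> cmod (K u w - d u) + cmod (K u w' - d u)" for u
      using norm_triangle_ineq4[of "K u w - d u" "K u w' - d u"] by simp
    hence "(\<integral>u. cmod (K u w - K u w') \<partial>lborel) \<le> (\<integral>u. cmod (K u w - d u) + cmod (K u w' - d u) \<partial>lborel)"
      using L1 D(2)[OF d(1)]
      by (intro integral_mono integrable_norm Bochner_Integration.integrable_diff Bochner_Integration.integrable_add) auto
    also have "\<dots> \<le> 2 * (1 / real (Suc n))" using d(2) w' L1 D(2)[OF d(1)] by simp
    also have "\<dots> \<le> \<epsilon> / (\<Phi> + 1)" using n Phi by (simp add: field_simps)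
    finally have le: "(\<integral>u. cmod (K u w - K u w') \<partial>lborel) \<le> \<epsilon> / (\<Phi> + 1)" .
    have "cmod (K z w - K z w') \<le> \<epsilon>" for z
    proof -
      have "cmod (K z w - K z w') \<le> \<Phi> * (\<epsilon> / (\<Phi> + 1))"
        using diff[of z w w'] mult_left_mono[OF le Phi] by linarith
      also have "\<dots> \<le> \<epsilon>" using Phi e by (simp add: field_simps)
      finally show ?thesis .
    qed
    moreover have "w' \<in> W" unfolding W_def w'_def using d by (intro rev_image_eqI[of "(d, n)"]) auto
    then obtain m where "s m = w'" unfolding s_def using from_nat_into_surj[OF cW] by blast
    ultimately show ?thesis by blast
  qed
  \<comment> \<open>restricting the first variable to the countable set makes the condition measurable in \<open>w\<close>\<close>
  define good where "good j w m \<longleftrightarrow> (\<forall>l. cmod (K (s l) w - K (s l) (s m)) \<le> 1 / real (Suc j))" for j w m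
  define N where "N j w = (LEAST m. good j w m)" for j w
  have N: "good j w (N j w)" for j w
  proof -
    obtain m where "\<forall>z. cmod (K z w - K z (s m)) \<le> 1 / real (Suc j)" using dense[of "1 / real (Suc j)" w] by auto
    hence "good j w m" unfolding good_def by blast
    thus ?thesis unfolding N_def by (rule LeastI)
  qed
  have goodD: "cmod (K z w - K z (s m)) \<le> 3 * (1 / real (Suc j))" if "good j w m" for z w m j
  proof -
    obtain l where l: "\<forall>u. cmod (K u z - K u (s l)) \<le> 1 / real (Suc j)" using dense[of "1 / real (Suc j)" z] by auto
    have l': "cmod (K z u - K (s l) u) \<le> 1 / real (Suc j)" for u
    proof -
      have "K z u - K (s l) u = cnj (K u z - K u (s l))"
        unfolding complex_cnj_diff herm[of z u, symmetric] herm[of "s l" u, symmetric] ..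
      thus ?thesis using l complex_mod_cnj by metis
    qed
    have "K z w - K z (s m) = (K z w - K (s l) w) + (K (s l) w - K (s l) (s m)) - (K z (s m) - K (s l) (s m))" by simp
    also have "cmod \<dots> \<le> cmod (K z w - K (s l) w) + cmod (K (s l) w - K (s l) (s m)) + cmod (K z (s m) - K (s l) (s m))"
      by (rule order_trans[OF norm_triangle_ineq4 add_right_mono[OF norm_triangle_ineq]])
    also have "\<dots> \<le> 1 / real (Suc j) + 1 / real (Suc j) + 1 / real (Suc j)"
      by (intro add_mono l') (use that in \<open>unfold good_def, blast\<close>)
    also have "\<dots> = 3 * (1 / real (Suc j))" by simp
    finally show ?thesis .
  qed
  have [measurable]: "N j \<in> measurable borel (count_space UNIV)" for j
    unfolding N_def[abs_def] good_def by measurable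
  show ?thesis
  proof (rule borel_measurable_LIMSEQ_metric)
    show "(\<lambda>(z, w). K z (s (N j w))) \<in> borel_measurable (borel \<Otimes>\<^sub>M borel)" for j
    proof -
      have "(\<lambda>p. K (fst p) (s (N j (snd p)))) \<in> borel_measurable (borel \<Otimes>\<^sub>M borel)"
        by (rule measurable_compose_countable[where f = "\<lambda>i p. K (fst p) (s i)" and g = "\<lambda>p. N j (snd p)"]) measurable
      thus ?thesis by (simp add: case_prod_unfold)
    qed
    fix p :: "complex \<times> complex"
    obtain z w where p: "p = (z, w)" by (cases p)
    have "(\<lambda>j. K z w - K z (s (N j w))) \<longlonglongrightarrow> 0"
    proof (rule Lim_null_comparison)
      show "\<forall>\<^sub>F j in sequentially. cmod (K z w - K z (s (N j w))) \<le> 3 * (1 / real (Suc j))" using goodD[OF N] by simp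
      show "(\<lambda>j. 3 * (1 / real (Suc j))) \<longlonglongrightarrow> 0"
        using tendsto_mult_left[OF LIMSEQ_inverse_real_of_nat, of 3] by (simp add: inverse_eq_divide)
    qed
    from tendsto_diff[OF tendsto_const[of "K z w"] this] show "(\<lambda>j. case p of (z, w) \<Rightarrow> K z (s (N j w))) \<longlonglongrightarrow> (case p of (z, w) \<Rightarrow> K z w)"
      by (simp add: p)
  qed
qed

section \<open>Positivity of the correlation determinants\<close>

text \<open>
  Over the complex numbers the determinant is the product of the roots of the characteristic
  polynomial.
\<close>

lemma det_nonneg_if_eigenvalues_nonneg:
  fixes A :: "complex mat"
  assumes A: "A \<in> carrier_mat n n"
    and ev: "\<And>v a. v \<in> carrier_vec n \<Longrightarrow> v \<noteq> 0\<^sub>v n \<Longrightarrow> A *\<^sub>v v = a \<cdot>\<^sub>v v \<Longrightarrow> \<exists>r\<ge>0. a = complex_of_real r"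
  shows "\<exists>r\<ge>0. Determinant.det A = complex_of_real r"
proof -
  obtain as where as: "char_poly A = (\<Prod>a\<leftarrow>as. [:- a, 1:])" "length as = n" using char_poly_factorized[OF A] by blast
  have nn: "\<exists>r\<ge>0. a = complex_of_real r" if "a \<in> set as" for a
  proof -
    have "poly (char_poly A) a = 0" unfolding as using that by (induction as) auto
    hence "eigenvalue A a" using eigenvalue_root_char_poly[OF A] by simp
    thus ?thesis using A ev unfolding eigenvalue_def eigenvector_def by auto
  qed
  have prod: "\<exists>r\<ge>0. prod_list as = complex_of_real r"
    using nn
  proof (induction as)
    case Nil show ?case by (intro exI[of _ 1]) auto
  next
    case (Cons a as)
    then obtain r s where "r \<ge> 0" "prod_list as = complex_of_real r" "s \<ge> 0" "a = complex_of_real s" by force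
    thus ?case by (intro exI[of _ "s * r"]) auto
  qed
  have "poly (char_poly A) 0 = Determinant.det (- A)"
  proof -
    have "- (char_matrix A 0) = - A" unfolding char_matrix_def using A by (intro eq_matI) auto
    thus ?thesis using char_poly_matrix[OF A, of 0] by simp
  qed
  also have "- A = (- 1) \<cdot>\<^sub>m A" using A by (intro eq_matI) auto
  also have "Determinant.det \<dots> = (- 1) ^ n * Determinant.det A" using A by (simp add: det_smult)
  finally have "(- 1) ^ n * Determinant.det A = (\<Prod>a\<leftarrow>as. - a)" unfolding as by (simp add: poly_prod_list o_def)
  also have "(\<Prod>a\<leftarrow>as. - a) = (- 1) ^ length as * prod_list as" by (induction as) auto
  finally have "Determinant.det A = prod_list as" using as(2) by simp
  thus ?thesis using prod by simp
qed

text \<open>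
  A Gram matrix: for an eigenvector \<open>v\<close> with eigenvalue \<open>a\<close>, the reproducing identity yields
  \<open>a |v|\<^sup>2 = \<integral> |\<Sum>\<^sub>j K(u,x\<^sub>j) v\<^sub>j|\<^sup>2 du\<close>.
\<close>

lemma det_reproducing_kernel:
  assumes K: "reproducing_kernel K"
  shows "\<exists>r\<ge>0. Determinant.det (Matrix.mat n n (\<lambda>(k, j). K (x k) (x j))) = complex_of_real r"
proof (rule det_nonneg_if_eigenvalues_nonneg)
  let ?A = "Matrix.mat n n (\<lambda>(k, j). K (x k) (x j))"
  show "?A \<in> carrier_mat n n" by simp
  fix v a assume v: "v \<in> carrier_vec n" "v \<noteq> 0\<^sub>v n" and e: "?A *\<^sub>v v = a \<cdot>\<^sub>v v"
  note [measurable] = reproducing_kernelD(1)[OF K]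
  let ?v = "\<lambda>k. vec_index v k"
  have row: "(\<Sum>j<n. K (x k) (x j) * ?v j) = a * ?v k" if "k < n" for k
  proof -
    have "(\<Sum>j<n. K (x k) (x j) * ?v j) = vec_index (?A *\<^sub>v v) k"
      using that v by (simp add: scalar_prod_def atLeast0LessThan)
    thus ?thesis using that v unfolding e by simp
  qed
  have int: "integrable lborel (\<lambda>u. K (x k) u * K u (x j))" for k j
  proof (rule Bochner_Integration.integrable_bound)
    show "integrable lborel (\<lambda>u. (cmod (K u (x k)))\<^sup>2 + (cmod (K u (x j)))\<^sup>2)"
      by (intro Bochner_Integration.integrable_add reproducing_kernelD(3)[OF K])
    have "(\<lambda>u. K (x k) u) \<in> borel_measurable borel" by (rule reproducing_kernelD(2)[OF K])
    thus "(\<lambda>u. K (x k) u * K u (x j)) \<in> borel_measurable lborel" by measurable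
    have "s * t \<le> s\<^sup>2 + t\<^sup>2" for s t :: real
      using sum_squares_bound[of s t] zero_le_power2[of s] zero_le_power2[of t] by linarith
    moreover have "cmod (K (x k) u) = cmod (K u (x k))" for u
      using arg_cong[OF reproducing_kernelD(4)[OF K, of "x k" u], of cmod] by (simp only: complex_mod_cnj)
    ultimately show "AE u in lborel. norm (K (x k) u * K u (x j)) \<le> norm ((cmod (K u (x k)))\<^sup>2 + (cmod (K u (x j)))\<^sup>2)"
      by (intro AE_I2) (simp add: norm_mult)
  qed
  let ?s = "\<lambda>u. \<Sum>j<n. K u (x j) * ?v j"
  have cs: "cnj (?s u) = (\<Sum>k<n. cnj (?v k) * K (x k) u)" for u
  proof -
    have "cnj (K u (x k)) = K (x k) u" for k using reproducing_kernelD(4)[OF K, of "x k" u] by (rule sym)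
    thus ?thesis by (simp add: mult.commute)
  qed
  have "a * complex_of_real (\<Sum>k<n. (cmod (?v k))\<^sup>2) = (\<Sum>k<n. cnj (?v k) * (a * ?v k))"
    unfolding of_real_sum sum_distrib_left by (intro sum.cong refl) (simp add: complex_norm_square del: of_real_power)
  also have "\<dots> = (\<Sum>k<n. \<Sum>j<n. cnj (?v k) * ?v j * K (x k) (x j))"
    by (intro sum.cong refl) (simp add: row[symmetric] sum_distrib_left mult_ac)
  also have "\<dots> = (\<Sum>k<n. \<Sum>j<n. \<integral>u. cnj (?v k) * ?v j * (K (x k) u * K u (x j)) \<partial>lborel)"
    by (subst reproducing_kernelD(5)[OF K]) simp
  also have "\<dots> = (\<integral>u. (\<Sum>k<n. \<Sum>j<n. cnj (?v k) * ?v j * (K (x k) u * K u (x j))) \<partial>lborel)"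
    using int by (simp add: Bochner_Integration.integral_sum)
  also have "\<dots> = (\<integral>u. complex_of_real ((cmod (?s u))\<^sup>2) \<partial>lborel)"
  proof (intro Bochner_Integration.integral_cong refl)
    fix u
    have "(\<Sum>k<n. \<Sum>j<n. cnj (?v k) * ?v j * (K (x k) u * K u (x j))) = cnj (?s u) * ?s u"
      unfolding cs sum_product by (intro sum.cong refl) (simp add: mult_ac)
    thus "(\<Sum>k<n. \<Sum>j<n. cnj (?v k) * ?v j * (K (x k) u * K u (x j))) = complex_of_real ((cmod (?s u))\<^sup>2)"
      by (simp only: complex_norm_square mult.commute)
  qed
  also have "\<dots> = complex_of_real (\<integral>u. (cmod (?s u))\<^sup>2 \<partial>lborel)" by (rule integral_complex_of_real)
  finally have eq: "a * complex_of_real (\<Sum>k<n. (cmod (?v k))\<^sup>2) = complex_of_real (\<integral>u. (cmod (?s u))\<^sup>2 \<partial>lborel)" .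
  have "(\<Sum>k<n. (cmod (?v k))\<^sup>2) > 0"
  proof -
    obtain k where "k < n" "?v k \<noteq> 0" using v by (metis carrier_vecD eq_vecI index_zero_vec)
    thus ?thesis by (intro sum_pos2[of _ k]) auto
  qed
  hence "complex_of_real (\<Sum>k<n. (cmod (?v k))\<^sup>2) \<noteq> 0" by (simp del: of_real_sum)
  hence "a = complex_of_real ((\<integral>u. (cmod (?s u))\<^sup>2 \<partial>lborel) / (\<Sum>k<n. (cmod (?v k))\<^sup>2))"
    using eq unfolding of_real_divide by (subst nonzero_eq_divide_eq)
  moreover have "0 \<le> (\<integral>u. (cmod (?s u))\<^sup>2 \<partial>lborel) / (\<Sum>k<n. (cmod (?v k))\<^sup>2)"
    by (intro divide_nonneg_nonneg Bochner_Integration.integral_nonneg sum_nonneg) auto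
  ultimately show "\<exists>r\<ge>0. a = complex_of_real r" by blast
qed

section \<open>Coefficientwise integration of power series\<close>

definition fint :: "'a measure \<Rightarrow> ('a \<Rightarrow> complex fps) \<Rightarrow> complex fps" where
  "fint \<mu> h = Abs_fps (\<lambda>k. \<integral>x. h x $ k \<partial>\<mu>)"

definition fintegrable :: "'a measure \<Rightarrow> ('a \<Rightarrow> complex fps) \<Rightarrow> bool" where
  "fintegrable \<mu> h \<longleftrightarrow> (\<forall>k. integrable \<mu> (\<lambda>x. h x $ k))"

lemma fint_nth: "fint \<mu> h $ k = (\<integral>x. h x $ k \<partial>\<mu>)"
  by (simp add: fint_def)

lemma fint_cong: "(\<And>x. x \<in> space \<mu> \<Longrightarrow> h x = h' x) \<Longrightarrow> fint \<mu> h = fint \<mu> h'"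
  by (auto simp: fps_eq_iff fint_nth intro!: Bochner_Integration.integral_cong)

lemma fintegrable_add: "fintegrable \<mu> g \<Longrightarrow> fintegrable \<mu> h \<Longrightarrow> fintegrable \<mu> (\<lambda>x. g x + h x)"
  by (simp add: fintegrable_def)

lemma fintegrable_diff: "fintegrable \<mu> g \<Longrightarrow> fintegrable \<mu> h \<Longrightarrow> fintegrable \<mu> (\<lambda>x. g x - h x)"
  by (simp add: fintegrable_def)

lemma fintegrable_sum: "(\<And>i. i \<in> I \<Longrightarrow> fintegrable \<mu> (h i)) \<Longrightarrow> fintegrable \<mu> (\<lambda>x. \<Sum>i\<in>I. h i x)"
  by (simp add: fintegrable_def fps_sum_nth)

lemma fintegrable_mult_left: "fintegrable \<mu> h \<Longrightarrow> fintegrable \<mu> (\<lambda>x. c * h x)"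
  by (simp add: fintegrable_def fps_mult_nth)

lemma fint_add: "fintegrable \<mu> g \<Longrightarrow> fintegrable \<mu> h \<Longrightarrow> fint \<mu> (\<lambda>x. g x + h x) = fint \<mu> g + fint \<mu> h"
  by (simp add: fintegrable_def fps_eq_iff fint_nth)

lemma fint_diff: "fintegrable \<mu> g \<Longrightarrow> fintegrable \<mu> h \<Longrightarrow> fint \<mu> (\<lambda>x. g x - h x) = fint \<mu> g - fint \<mu> h"
  by (simp add: fintegrable_def fps_eq_iff fint_nth)

lemma fint_sum: "(\<And>i. i \<in> I \<Longrightarrow> fintegrable \<mu> (h i)) \<Longrightarrow> fint \<mu> (\<lambda>x. \<Sum>i\<in>I. h i x) = (\<Sum>i\<in>I. fint \<mu> (h i))"
  by (simp add: fintegrable_def fps_eq_iff fint_nth fps_sum_nth Bochner_Integration.integral_sum)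

lemma fint_mult_left: "fintegrable \<mu> h \<Longrightarrow> fint \<mu> (\<lambda>x. c * h x) = c * fint \<mu> h"
  by (simp add: fintegrable_def fps_eq_iff fint_nth fps_mult_nth Bochner_Integration.integral_sum)

lemma fint_deriv: "fps_deriv (fint \<mu> h) = fint \<mu> (\<lambda>x. fps_deriv (h x))"
  by (simp add: fps_eq_iff fint_nth)

section \<open>Determinants of kernels\<close>

definition kdet :: "(complex \<Rightarrow> complex \<Rightarrow> complex) \<Rightarrow> nat \<Rightarrow> (nat \<Rightarrow> complex) \<Rightarrow> (nat \<Rightarrow> complex) \<Rightarrow> complex" where
  "kdet K n r c = Determinant.det (Matrix.mat n n (\<lambda>(i, j). K (r i) (c j)))"

lemma kdet_cong:
  "(\<And>i. i < n \<Longrightarrow> r i = r' i) \<Longrightarrow> (\<And>i. i < n \<Longrightarrow> c i = c' i) \<Longrightarrow> kdet K n r c = kdet K n r' c'"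
  unfolding kdet_def by (intro arg_cong[of _ _ Determinant.det] eq_matI) auto

lemma kdet_sum: "kdet K n r c = (\<Sum>p | p permutes {0..<n}. signof p * (\<Prod>i=0..<n. K (r i) (c (p i))))"
  unfolding kdet_def
proof (subst det_def'[of _ n])
  show "(\<Sum>p | p permutes {0..<n}. signof p * (\<Prod>i = 0..<n. Matrix.mat n n (\<lambda>(i, j). K (r i) (c j)) $$ (i, p i))) =
    (\<Sum>p | p permutes {0..<n}. signof p * (\<Prod>i = 0..<n. K (r i) (c (p i))))"
    by (intro sum.cong refl arg_cong2[where f = "(*)"] prod.cong) (auto dest: permutes_in_image)
qed simp

lemma norm_kdet_le:
  assumes "\<And>z w. norm (K z w) \<le> \<Phi>"
  shows "norm (kdet K n r c) \<le> fact n * \<Phi> ^ n"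
proof -
  have "norm (kdet K n r c) \<le> (\<Sum>p | p permutes {0..<n}. \<Phi> ^ n)"
    unfolding kdet_sum
  proof (rule sum_norm_le)
    fix p
    have "norm (\<Prod>i = 0..<n. K (r i) (c (p i))) \<le> (\<Prod>i = 0..<n. \<Phi>)"
      unfolding prod_norm[symmetric] by (intro prod_mono) (auto intro: assms)
    moreover have "norm (signof p :: complex) = 1" by (cases p rule: sign_cases) auto
    ultimately show "norm (signof p * (\<Prod>i = 0..<n. K (r i) (c (p i)))) \<le> \<Phi> ^ n" by (simp add: norm_mult)
  qed
  thus ?thesis by (simp add: card_permutations)
qed

lemma kdet_measurable:
  assumes K: "(\<lambda>(z, w). K z w) \<in> borel_measurable (borel \<Otimes>\<^sub>M borel)"
    and r: "\<And>i. i < n \<Longrightarrow> (\<lambda>x. r x i) \<in> borel_measurable N" and c: "\<And>i. i < n \<Longrightarrow> (\<lambda>x. c x i) \<in> borel_measurable N"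
  shows "(\<lambda>x. kdet K n (r x) (c x)) \<in> borel_measurable N"
  unfolding kdet_sum
proof (intro borel_measurable_sum borel_measurable_times borel_measurable_const borel_measurable_prod)
  fix p i assume "p \<in> {p. p permutes {0..<n}}" "i \<in> {0..<n}"
  hence "i < n" "p i < n" using permutes_in_image[of p "{0..<n}" i] by auto
  hence "(\<lambda>x. (r x i, c x (p i))) \<in> N \<rightarrow>\<^sub>M borel \<Otimes>\<^sub>M borel" using r c by (intro measurable_Pair) auto
  from measurable_compose[OF this K] show "(\<lambda>x. K (r x i) (c x (p i))) \<in> borel_measurable N" by simp
qed

lemma det_conj_permutes:
  fixes A :: "nat \<Rightarrow> nat \<Rightarrow> complex"
  assumes p: "p permutes {0..<n}"
  shows "Determinant.det (Matrix.mat n n (\<lambda>(i, j). A (p i) (p j))) = Determinant.det (Matrix.mat n n (\<lambda>(i, j). A i j))"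
proof -
  have lt: "p i < n" if "i < n" for i using that permutes_in_image[OF p, of i] by auto
  let ?B = "Matrix.mat n n (\<lambda>(i, j). A i j)"
  let ?C = "Matrix.mat n n (\<lambda>(i, j). A i (p j))"
  have "Matrix.mat n n (\<lambda>(i, j). A (p i) (p j)) = Matrix.mat n n (\<lambda>(i, j). ?C $$ (p i, j))"
    by (intro eq_matI) (auto simp: lt)
  hence "Determinant.det (Matrix.mat n n (\<lambda>(i, j). A (p i) (p j))) = of_int (sign p) * Determinant.det ?C"
    using det_permute_rows[OF _ p, of ?C] by simp
  also have "Determinant.det ?C = Determinant.det (transpose_mat ?C)" by (rule det_transpose[of _ n, symmetric]) simp
  also have "transpose_mat ?C = Matrix.mat n n (\<lambda>(i, j). transpose_mat ?B $$ (p i, j))"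
    by (intro eq_matI) (auto simp: lt)
  also have "Determinant.det \<dots> = of_int (sign p) * Determinant.det (transpose_mat ?B)"
    by (rule det_permute_rows[of _ n, OF _ p]) simp
  also have "Determinant.det (transpose_mat ?B) = Determinant.det ?B" by (rule det_transpose[of _ n]) simp
  finally show ?thesis by (simp add: mult.assoc[symmetric] sign_def)
qed

text \<open>
  A simultaneous permutation of rows and columns multiplies the determinant by the square of a
  sign.
\<close>

lemma kdet_permutes:
  assumes "p permutes {0..<n}"
  shows "kdet K n (r \<circ> p) (c \<circ> p) = kdet K n r c"
  unfolding kdet_def o_def by (rule det_conj_permutes[OF assms])

text \<open>
  The determinant with last row replaced by the unit vector \<open>e\<^sub>j\<close>, that is, the cofactor of the
  entry \<open>(n, j)\<close>. In this form its equivariance under permutations is evident.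
\<close>

definition kcof :: "(complex \<Rightarrow> complex \<Rightarrow> complex) \<Rightarrow> nat \<Rightarrow> nat \<Rightarrow> (nat \<Rightarrow> complex) \<Rightarrow> (nat \<Rightarrow> complex) \<Rightarrow> complex" where
  "kcof K n j r c = Determinant.det (Matrix.mat (Suc n) (Suc n)
     (\<lambda>(i, l). if i = n then (if l = j then 1 else 0) else K (r i) (c l)))"

lemma kcof_cofactor:
  assumes "j \<le> n"
  shows "kcof K n j r c = cofactor (Matrix.mat (Suc n) (Suc n) (\<lambda>(i, l). K (r i) (c l))) n j"
proof -
  let ?A = "Matrix.mat (Suc n) (Suc n) (\<lambda>(i, l). if i = n then (if l = j then 1 else 0) else K (r i) (c l)) :: complex mat"
  let ?B = "Matrix.mat (Suc n) (Suc n) (\<lambda>(i, l). K (r i) (c l))"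
  have "kcof K n j r c = (\<Sum>l<Suc n. ?A $$ (n, l) * cofactor ?A n l)"
    unfolding kcof_def by (rule laplace_expansion_row[of _ "Suc n"]) auto
  also have "\<dots> = (\<Sum>l<Suc n. if l = j then cofactor ?A n l else 0)" by (intro sum.cong) auto
  also have "\<dots> = cofactor ?A n j" using assms by simp
  also have "mat_delete ?A n j = mat_delete ?B n j"
    unfolding mat_delete_def by (intro eq_matI) auto
  hence "cofactor ?A n j = cofactor ?B n j" by (simp add: cofactor_def)
  finally show ?thesis .
qed

lemma kdet_expand: "kdet K (Suc n) r c = (\<Sum>j\<le>n. K (r n) (c j) * kcof K n j r c)"
proof -
  let ?B = "Matrix.mat (Suc n) (Suc n) (\<lambda>(i, l). K (r i) (c l))"
  have "kdet K (Suc n) r c = (\<Sum>j<Suc n. ?B $$ (n, j) * cofactor ?B n j)"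
    unfolding kdet_def by (rule laplace_expansion_row) auto
  also have "\<dots> = (\<Sum>j\<le>n. K (r n) (c j) * kcof K n j r c)"
    unfolding lessThan_Suc_atMost by (intro sum.cong refl) (auto simp: kcof_cofactor)
  finally show ?thesis .
qed

lemma kcof_kdet:
  assumes "j \<le> n"
  shows "kcof K n j r c = (- 1) ^ (n + j) * kdet K n r (\<lambda>l. c (if l < j then l else Suc l))"
proof -
  have "mat_delete (Matrix.mat (Suc n) (Suc n) (\<lambda>(i, l). K (r i) (c l))) n j =
      Matrix.mat n n (\<lambda>(i, l). K (r i) (c (if l < j then l else Suc l)))"
    using assms unfolding mat_delete_def by (intro eq_matI) auto
  thus ?thesis using assms by (simp add: kcof_cofactor cofactor_def kdet_def)
qed

lemma kcof_last: "kcof K n n r c = kdet K n r c"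
proof -
  have "kdet K n r (\<lambda>l. c (if l < n then l else Suc l)) = kdet K n r c" by (rule kdet_cong) auto
  thus ?thesis by (simp add: kcof_kdet)
qed

text \<open>
  Deleting the next to last column leaves the last one in its place, with sign \<open>-1\<close>.
\<close>

lemma kcof_penultimate: "kcof K (Suc p) p r c = - kdet K (Suc p) r (c(p := c (Suc p)))"
proof -
  have "kdet K (Suc p) r (\<lambda>l. c (if l < p then l else Suc l)) = kdet K (Suc p) r (c(p := c (Suc p)))"
    by (rule kdet_cong) (auto simp: less_Suc_eq)
  thus ?thesis by (simp add: kcof_kdet)
qed

lemma kcof_permutes:
  assumes p: "p permutes {..<n}"
  shows "kcof K n (p j) r c = kcof K n j (r \<circ> p) (c \<circ> p)"
proof -
  have p': "p permutes {0..<Suc n}" using p by (rule permutes_subset) auto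
  have pn: "p n = n" using p by (auto simp: permutes_def)
  have inj: "p i = p l \<longleftrightarrow> i = l" for i l using permutes_inj[OF p] by (auto simp: inj_def)
  have inj_n: "p i = n \<longleftrightarrow> i = n" for i using inj[of i n] pn by simp
  show ?thesis unfolding kcof_def
    using det_conj_permutes[OF p', of "\<lambda>i l. if i = n then (if l = p j then 1 else 0) else K (r i) (c l)", unfolded inj inj_n]
    by (simp only: o_def)
qed

lemma kdet_0: "kdet K 0 r c = 1"
  unfolding kdet_sum by simp

lemma kdet_1: "kdet K (Suc 0) r c = K (r 0) (c 0)"
  using kdet_expand[of K 0 r c] by (simp add: kcof_last kdet_0)

section \<open>Permutation of integration variables\<close>

lemma lebn_transpose:
  assumes h: "h \<in> borel_measurable (lebn n)" and ij: "i < n" "j < n"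
  shows "(\<integral>x. h (restrict (x \<circ> Transposition.transpose i j) {..<n}) \<partial>lebn n) = (\<integral>x. (h x :: complex) \<partial>lebn n)"
proof -
  let ?t = "Transposition.transpose i j"
  let ?T = "\<lambda>x :: nat \<Rightarrow> complex. restrict (x \<circ> ?t) {..<n}"
  interpret product_sigma_finite "\<lambda>_::nat. lborel :: complex measure" by (rule product_sigma)
  have t: "?t k < n" if "k < n" for k using that ij by (auto simp: Transposition.transpose_def)
  have tt: "?t (?t k) = k" for k by simp
  have T: "?T \<in> lebn n \<rightarrow>\<^sub>M lebn n"
  proof (rule measurable_restrict)
    fix k assume "k \<in> {..<n}"
    hence "?t k \<in> {..<n}" using t by auto
    from measurable_component_singleton[OF this, of "\<lambda>_. lborel"] show "(\<lambda>x. (x \<circ> ?t) k) \<in> lebn n \<rightarrow>\<^sub>M lborel" by (simp add: o_def)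
  qed
  have "distr (lebn n) (lebn n) ?T = lebn n"
  proof (rule PiM_eqI)
    fix A :: "nat \<Rightarrow> complex set" assume A: "\<And>i. i \<in> {..<n} \<Longrightarrow> A i \<in> sets lborel"
    have "?T -` (Pi\<^sub>E {..<n} A) \<inter> space (lebn n) = Pi\<^sub>E {..<n} (A \<circ> ?t)"
    proof (intro equalityI subsetI)
      fix x assume x: "x \<in> ?T -` (Pi\<^sub>E {..<n} A) \<inter> space (lebn n)"
      have "x k \<in> A (?t k)" if "k < n" for k
      proof -
        have "?T x (?t k) \<in> A (?t k)" using x t[OF that] by (auto simp: PiE_def Pi_def)
        thus ?thesis using t[OF that] by simp
      qed
      thus "x \<in> Pi\<^sub>E {..<n} (A \<circ> ?t)" using x by (auto simp: space_PiM PiE_def)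
    next
      fix x assume x: "x \<in> Pi\<^sub>E {..<n} (A \<circ> ?t)"
      have "x (?t k) \<in> A k" if "k < n" for k
      proof -
        have "x (?t k) \<in> (A \<circ> ?t) (?t k)" using x t[OF that] by (auto simp: PiE_def Pi_def)
        thus ?thesis by simp
      qed
      thus "x \<in> ?T -` (Pi\<^sub>E {..<n} A) \<inter> space (lebn n)" using x by (auto simp: space_PiM PiE_def)
    qed
    hence "emeasure (distr (lebn n) (lebn n) ?T) (Pi\<^sub>E {..<n} A) = emeasure (lebn n) (Pi\<^sub>E {..<n} (A \<circ> ?t))"
      using A by (subst emeasure_distr[OF T]) (auto intro!: sets_PiM_I_finite)
    also have "\<dots> = (\<Prod>k<n. emeasure lborel ((A \<circ> ?t) k))" using A t by (intro emeasure_PiM) auto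
    also have "\<dots> = (\<Prod>k<n. emeasure lborel (A k))"
      by (rule prod.reindex_bij_witness[of _ ?t ?t]) (use t in auto)
    finally show "emeasure (distr (lebn n) (lebn n) ?T) (Pi\<^sub>E {..<n} A) = (\<Prod>k<n. emeasure lborel (A k))" .
  qed auto
  hence "(\<integral>x. h x \<partial>lebn n) = (\<integral>x. h x \<partial>distr (lebn n) (lebn n) ?T)" by simp
  also have "\<dots> = (\<integral>x. h (?T x) \<partial>lebn n)" by (rule integral_distr[OF T h])
  finally show ?thesis ..
qed

section \<open>Fredholm's expansion as a formal power series\<close>

definition bounded_coeffs :: "'a measure \<Rightarrow> ('a \<Rightarrow> complex fps) \<Rightarrow> bool" where
  "bounded_coeffs N Z \<longleftrightarrow> (\<forall>k. (\<lambda>u. Z u $ k) \<in> borel_measurable N \<and> (\<exists>C. \<forall>u. norm (Z u $ k) \<le> C))"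

lemma bounded_coeffs_mult:
  assumes "bounded_coeffs N Y" "bounded_coeffs N Z" shows "bounded_coeffs N (\<lambda>u. Y u * Z u)"
  unfolding bounded_coeffs_def
proof (intro allI conjI)
  fix k
  obtain C D where C: "\<And>k u. norm (Y u $ k) \<le> C k" and D: "\<And>k u. norm (Z u $ k) \<le> D k"
    using assms unfolding bounded_coeffs_def by metis
  have [measurable]: "(\<lambda>u. Y u $ k) \<in> borel_measurable N" "(\<lambda>u. Z u $ k) \<in> borel_measurable N" for k
    using assms by (auto simp: bounded_coeffs_def)
  show "(\<lambda>u. (Y u * Z u) $ k) \<in> borel_measurable N" unfolding fps_mult_nth by measurable
  have "norm ((Y u * Z u) $ k) \<le> (\<Sum>i=0..k. C i * D (k - i))" for u
    unfolding fps_mult_nth by (intro sum_norm_le) (auto simp: norm_mult intro!: mult_mono C D order_trans[OF norm_ge_zero C])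
  thus "\<exists>C. \<forall>u. norm ((Y u * Z u) $ k) \<le> C" by blast
qed

lemma bounded_coeffs_const:
  assumes "h \<in> borel_measurable N" "\<And>u. norm (h u) \<le> C"
  shows "bounded_coeffs N (\<lambda>u. fps_const (h u))"
  unfolding bounded_coeffs_def
proof (intro allI conjI)
  fix k :: nat
  show "(\<lambda>u. fps_const (h u) $ k) \<in> borel_measurable N" using assms(1) by (cases k) auto
  have "norm (fps_const (h u) $ k) \<le> max C 0" for u using assms(2)[of u] by (cases k) auto
  thus "\<exists>C. \<forall>u. norm (fps_const (h u) $ k) \<le> C" by blast
qed

lemma bounded_coeffs_deriv: "bounded_coeffs N Z \<Longrightarrow> bounded_coeffs N (\<lambda>u. fps_deriv (Z u))"
  unfolding bounded_coeffs_def
proof (intro allI conjI)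
  fix k assume *: "\<forall>k. (\<lambda>u. Z u $ k) \<in> borel_measurable N \<and> (\<exists>C. \<forall>u. norm (Z u $ k) \<le> C)"
  have "(\<lambda>u. Z u $ (k + 1)) \<in> borel_measurable N" using * by blast
  thus "(\<lambda>u. fps_deriv (Z u) $ k) \<in> borel_measurable N"
    unfolding fps_deriv_nth by (rule borel_measurable_times[OF borel_measurable_const])
  obtain C where "\<And>u. norm (Z u $ (k + 1)) \<le> C" using * by blast
  hence "norm (fps_deriv (Z u) $ k) \<le> real (k + 1) * C" for u
    unfolding fps_deriv_nth norm_mult norm_of_nat by (intro mult_left_mono) auto
  thus "\<exists>C. \<forall>u. norm (fps_deriv (Z u) $ k) \<le> C" by blast
qed

lemma bounded_coeffs_compose:
  assumes "bounded_coeffs borel Z" "g \<in> borel_measurable N" shows "bounded_coeffs N (\<lambda>x. Z (g x))"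
  unfolding bounded_coeffs_def
proof (intro allI conjI)
  fix k
  have "(\<lambda>u. Z u $ k) \<in> borel_measurable borel" using assms(1) by (simp add: bounded_coeffs_def)
  from measurable_compose[OF assms(2) this] show "(\<lambda>x. Z (g x) $ k) \<in> borel_measurable N" .
  show "\<exists>C. \<forall>x. norm (Z (g x) $ k) \<le> C" using assms(1) unfolding bounded_coeffs_def by blast
qed

lemma bounded_coeffs_prod:
  assumes "finite I" "\<And>i. i \<in> I \<Longrightarrow> bounded_coeffs N (Z i)" shows "bounded_coeffs N (\<lambda>x. \<Prod>i\<in>I. Z i x)"
  using assms
proof (induction rule: finite_induct)
  case empty
  have "bounded_coeffs N (\<lambda>x. fps_const 1)" by (rule bounded_coeffs_const[where C = 1]) auto
  thus ?case by simp
qed (auto intro: bounded_coeffs_mult)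

locale kernel_weight =
  fixes K :: "complex \<Rightarrow> complex \<Rightarrow> complex" and \<Phi> :: real and f :: "complex \<Rightarrow> real" and m :: real and B :: "complex set"
  assumes K_meas: "(\<lambda>(z, w). K z w) \<in> borel_measurable (borel \<Otimes>\<^sub>M borel)"
    and K_le: "\<And>z w. norm (K z w) \<le> \<Phi>"
    and f_meas [measurable]: "f \<in> borel_measurable borel"
    and f_supp: "\<And>z. z \<notin> B \<Longrightarrow> f z = 0" and f_bound: "\<And>z. \<bar>f z\<bar> \<le> m"
    and B_borel [measurable]: "B \<in> sets borel" and B_bounded: "bounded B"
begin

abbreviation G :: "complex \<Rightarrow> complex fps" where "G z \<equiv> expm1_fps (f z)"

lemma m_nonneg: "0 \<le> m" using f_bound[of undefined] by linarith

lemma norm_G_le: "norm (G z $ k) \<le> m ^ k"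
proof -
  have "\<bar>f z\<bar> ^ k / fact k \<le> \<bar>f z\<bar> ^ k / 1" by (intro divide_left_mono) auto
  also have "\<dots> \<le> m ^ k" using f_bound by (simp add: power_mono)
  finally show ?thesis using m_nonneg by (simp add: expm1_fps_nth norm_divide norm_power)
qed

lemma G_meas [measurable]: "(\<lambda>z. G z $ k) \<in> borel_measurable borel"
  unfolding expm1_fps_nth by (cases "k = 0") (simp_all, measurable)

lemma bounded_coeffs_G: "bounded_coeffs borel G"
  unfolding bounded_coeffs_def using norm_G_le by (auto intro!: G_meas)

lemma K_meas' [measurable]: "g \<in> borel_measurable N \<Longrightarrow> h \<in> borel_measurable N \<Longrightarrow> (\<lambda>x. K (g x) (h x)) \<in> borel_measurable N"
  using measurable_compose[OF measurable_Pair K_meas, of g N h] by simp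

lemma bounded_coeffs_K: "bounded_coeffs borel (\<lambda>u. fps_const (K a u))"
  by (rule bounded_coeffs_const[OF _ K_le]) measurable

lemma emeasure_B_finite: "emeasure lborel B < \<infinity>"
  by (rule emeasure_bounded_finite[OF B_bounded])

lemma fintegrable_supp:
  assumes Z: "bounded_coeffs borel Z" and s: "\<And>u. u \<notin> B \<Longrightarrow> Z u = 0"
  shows "fintegrable lborel Z"
  unfolding fintegrable_def
proof
  fix k
  obtain C where C: "\<And>u. norm (Z u $ k) \<le> C" using Z unfolding bounded_coeffs_def by blast
  have C0: "0 \<le> C" using C[of undefined] norm_ge_zero order_trans by blast
  have "integrable lborel (\<lambda>u. indicat_real B u * C)"
    using emeasure_B_finite by (intro integrable_mult_left integrable_real_indicator) auto
  thus "integrable lborel (\<lambda>u. Z u $ k)"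
  proof (rule Bochner_Integration.integrable_bound)
    show "(\<lambda>u. Z u $ k) \<in> borel_measurable lborel" using Z by (simp add: bounded_coeffs_def)
    show "AE u in lborel. norm (Z u $ k) \<le> norm (indicat_real B u * C)"
      using C C0 s by (intro AE_I2) (auto simp: indicator_def)
  qed
qed

lemma box_finite: "emeasure (lebn n) ({..<n} \<rightarrow>\<^sub>E B) < \<infinity>"
proof -
  interpret product_sigma_finite "\<lambda>_::nat. lborel :: complex measure" by (rule product_sigma)
  have "emeasure (lebn n) ({..<n} \<rightarrow>\<^sub>E B) = emeasure lborel B ^ n"
    using emeasure_PiM[of "{..<n}" "\<lambda>_. B"] by simp
  also have "emeasure lborel B = ennreal (measure lborel B)"
    using emeasure_B_finite by (intro emeasure_eq_ennreal_measure) auto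
  finally show ?thesis by (simp add: ennreal_power)
qed

lemma weight_integrable:
  assumes d: "d \<in> borel_measurable (lebn n)" "\<And>x. norm (d x) \<le> C" and H: "\<And>x. norm (weight f n x $ k) \<le> H"
  shows "integrable (lebn n) (\<lambda>x. weight f n x $ k * d x)"
    and "norm (\<integral>x. weight f n x $ k * d x \<partial>lebn n) \<le> H * C * measure (lebn n) ({..<n} \<rightarrow>\<^sub>E B)"
proof -
  have C0: "0 \<le> C" using d(2)[of undefined] norm_ge_zero order_trans by blast
  have H0: "0 \<le> H" using H[of undefined] norm_ge_zero order_trans by blast
  let ?E = "{..<n} \<rightarrow>\<^sub>E B"
  have E: "?E \<in> sets (lebn n)" by (intro sets_PiM_I_finite) auto
  have i: "integrable (lebn n) (\<lambda>x. H * C * indicat_real ?E x)"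
    using box_finite E by (intro integrable_mult_right integrable_real_indicator) auto
  have bd: "norm (weight f n x $ k * d x) \<le> H * C * indicat_real ?E x" if x: "x \<in> space (lebn n)" for x
  proof (cases "x \<in> ?E")
    case True
    thus ?thesis using H d(2) H0 by (simp add: norm_mult mult_mono)
  next
    case False
    then obtain i where "i < n" "x i \<notin> B" using x by (auto simp: space_PiM PiE_def Pi_def)
    thus ?thesis using weight_outside[of i n f x] f_supp H0 C0 by simp
  qed
  show int: "integrable (lebn n) (\<lambda>x. weight f n x $ k * d x)"
  proof (rule Bochner_Integration.integrable_bound[OF i])
    show "(\<lambda>x. weight f n x $ k * d x) \<in> borel_measurable (lebn n)"
      using weight_nth_measurable[OF f_meas order_refl] d(1) by measurable
    show "AE x in lebn n. norm (weight f n x $ k * d x) \<le> norm (H * C * indicat_real ?E x)"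
      using bd H0 C0 by (intro AE_I2) (simp add: abs_mult)
  qed
  have "norm (\<integral>x. weight f n x $ k * d x \<partial>lebn n) \<le> (\<integral>x. norm (weight f n x $ k * d x) \<partial>lebn n)" by (rule integral_norm_bound)
  also have "\<dots> \<le> (\<integral>x. H * C * indicat_real ?E x \<partial>lebn n)"
    using int i bd by (intro integral_mono integrable_norm) auto
  also have "\<dots> = H * C * measure (lebn n) ?E" using E box_finite by (simp add: integrable_real_indicator)
  finally show "norm (\<integral>x. weight f n x $ k * d x \<partial>lebn n) \<le> H * C * measure (lebn n) ?E" .
qed

lemma fintegrable_weight:
  assumes d: "d \<in> borel_measurable (lebn n)" "\<And>x. norm (d x) \<le> C"
  shows "fintegrable (lebn n) (\<lambda>x. weight f n x * fps_const (d x))"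
  unfolding fintegrable_def
proof
  fix k
  obtain H where "\<And>x. norm (weight f n x $ k) \<le> H" using weight_nth_bounded[of f m n k, OF f_bound] by blast
  from weight_integrable(1)[OF d this] show "integrable (lebn n) (\<lambda>x. (weight f n x * fps_const (d x)) $ k)" by simp
qed

text \<open>
  Up to the factor \<open>1 / n!\<close>, the terms of the Fredholm determinant and of the first Fredholm
  minor of the kernel \<open>K(x,y) G(y)\<close>; in the minor, \<open>a\<close> is an additional row and \<open>b\<close> an
  additional column.
\<close>

definition fred_term :: "nat \<Rightarrow> complex fps" where
  "fred_term n = fint (lebn n) (\<lambda>x. weight f n x * fps_const (kdet K n x x))"

definition minor_term :: "nat \<Rightarrow> complex \<Rightarrow> complex \<Rightarrow> complex fps" where
  "minor_term n a b = fint (lebn n) (\<lambda>x. weight f n x * fps_const (kdet K (Suc n) (x(n := a)) (x(n := b))))"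

lemma component_meas [measurable]: "i < n \<Longrightarrow> (\<lambda>x. x i) \<in> borel_measurable (lebn n)"
  using measurable_component_singleton[of i "{..<n}" "\<lambda>_. lborel :: complex measure"] by simp

lemma upd_meas: "i < Suc n \<Longrightarrow> (\<lambda>x. (x(n := a)) i) \<in> borel_measurable (lebn n)"
  by (cases "i = n") (auto intro: component_meas)

lemma kdet_meas_minor_term: "(\<lambda>x. kdet K (Suc n) (x(n := a)) (x(n := b))) \<in> borel_measurable (lebn n)"
  by (rule kdet_measurable[OF K_meas]) (auto intro!: upd_meas simp del: fun_upd_apply)

lemma kdet_meas_fred_term: "(\<lambda>x. kdet K n x x) \<in> borel_measurable (lebn n)"
  by (rule kdet_measurable[OF K_meas]) auto

lemma fintegrable_minor_term: "fintegrable (lebn n) (\<lambda>x. weight f n x * fps_const (kdet K (Suc n) (x(n := a)) (x(n := b))))"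
  by (rule fintegrable_weight[OF kdet_meas_minor_term norm_kdet_le[OF K_le]])

lemma fintegrable_fred_term: "fintegrable (lebn n) (\<lambda>x. weight f n x * fps_const (kdet K n x x))"
  by (rule fintegrable_weight[OF kdet_meas_fred_term norm_kdet_le[OF K_le]])

lemma minor_term_meas: "(\<lambda>p. minor_term n (fst p) (snd p) $ k) \<in> borel_measurable (borel \<Otimes>\<^sub>M borel)"
proof -
  interpret product_sigma_finite "\<lambda>_::nat. lborel :: complex measure" by (rule product_sigma)
  interpret sigma_finite_measure "lebn n" by (rule sigma_finite) simp
  have w: "(\<lambda>q. weight f n (snd q) $ k) \<in> borel_measurable ((borel \<Otimes>\<^sub>M borel) \<Otimes>\<^sub>M lebn n)"
    by (rule measurable_compose[OF measurable_snd weight_nth_measurable[OF f_meas order_refl]])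
  have c: "(\<lambda>q. snd q i) \<in> borel_measurable ((borel \<Otimes>\<^sub>M borel) \<Otimes>\<^sub>M lebn n)" if "i < n" for i
    by (rule measurable_compose[OF measurable_snd component_meas[OF that]])
  have "(\<lambda>q. kdet K (Suc n) ((snd q)(n := fst (fst q))) ((snd q)(n := snd (fst q)))) \<in> borel_measurable ((borel \<Otimes>\<^sub>M borel) \<Otimes>\<^sub>M lebn n)"
  proof (rule kdet_measurable[OF K_meas])
    fix i assume "i < Suc n"
    thus "(\<lambda>q. ((snd q)(n := fst (fst q))) i) \<in> borel_measurable ((borel \<Otimes>\<^sub>M borel) \<Otimes>\<^sub>M lebn n)"
      "(\<lambda>q. ((snd q)(n := snd (fst q))) i) \<in> borel_measurable ((borel \<Otimes>\<^sub>M borel) \<Otimes>\<^sub>M lebn n)"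
      by (cases "i = n"; simp add: c)+
  qed
  with w have "(\<lambda>q. weight f n (snd q) $ k * kdet K (Suc n) ((snd q)(n := fst (fst q))) ((snd q)(n := snd (fst q)))) \<in>
      borel_measurable ((borel \<Otimes>\<^sub>M borel) \<Otimes>\<^sub>M lebn n)" by measurable
  hence "(\<lambda>p. \<integral>x. weight f n x $ k * kdet K (Suc n) (x(n := fst p)) (x(n := snd p)) \<partial>lebn n) \<in> borel_measurable (borel \<Otimes>\<^sub>M borel)"
    by (intro borel_measurable_lebesgue_integral) (simp add: case_prod_unfold)
  thus ?thesis by (simp add: minor_term_def fint_nth)
qed

lemma minor_term_bounded: "\<exists>C. \<forall>a b. norm (minor_term n a b $ k) \<le> C"
proof -
  obtain H where H: "\<And>x. norm (weight f n x $ k) \<le> H" using weight_nth_bounded[of f m n k, OF f_bound] by blast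
  have "norm (minor_term n a b $ k) \<le> H * (fact (Suc n) * \<Phi> ^ Suc n) * measure (lebn n) ({..<n} \<rightarrow>\<^sub>E B)" for a b
    unfolding minor_term_def fint_nth fps_mult_right_const_nth
    by (rule weight_integrable(2)[OF kdet_meas_minor_term norm_kdet_le[OF K_le] H])
  thus ?thesis by blast
qed

lemma bounded_coeffs_minor_term: "bounded_coeffs borel (\<lambda>u. minor_term n u b)"
  unfolding bounded_coeffs_def
proof (intro allI conjI)
  fix k
  show "(\<lambda>u. minor_term n u b $ k) \<in> borel_measurable borel"
  proof -
    have "(\<lambda>u. (u, b)) \<in> borel \<rightarrow>\<^sub>M borel \<Otimes>\<^sub>M borel" by measurable
    from measurable_compose[OF this minor_term_meas] show ?thesis by simp
  qed
  show "\<exists>C. \<forall>u. norm (minor_term n u b $ k) \<le> C" using minor_term_bounded[of n k] by blast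
qed

lemma bounded_coeffs_minor_term_diag: "bounded_coeffs borel (\<lambda>u. minor_term n u u)"
  unfolding bounded_coeffs_def
proof (intro allI conjI)
  fix k
  show "(\<lambda>u. minor_term n u u $ k) \<in> borel_measurable borel"
  proof -
    have "(\<lambda>u. (u, u)) \<in> borel \<rightarrow>\<^sub>M borel \<Otimes>\<^sub>M borel" by measurable
    from measurable_compose[OF this minor_term_meas] show ?thesis by simp
  qed
  show "\<exists>C. \<forall>u. norm (minor_term n u u $ k) \<le> C" using minor_term_bounded[of n k] by blast
qed

lemma fint_lebn_Suc:
  assumes h: "fintegrable (lebn (Suc n)) h"
  shows "fint (lebn (Suc n)) h = fint lborel (\<lambda>a. fint (lebn n) (\<lambda>x. h (x(n := a))))"
proof -
  interpret product_sigma_finite "\<lambda>_::nat. lborel :: complex measure" by (rule product_sigma)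
  interpret sigma_finite_measure "lebn n" by (rule sigma_finite) simp
  have "(\<integral>x. h x $ k \<partial>lebn (Suc n)) = (\<integral>a. \<integral>x. h (x(n := a)) $ k \<partial>lebn n \<partial>lborel)" for k
  proof -
    let ?h = "\<lambda>x. h x $ k"
    have I: "{..<Suc n} = {n} \<union> {..<n}" "{..<Suc n} = insert n {..<n}" by auto
    have int: "integrable (PiM ({n} \<union> {..<n}) (\<lambda>_. lborel)) ?h"
      using h unfolding I(1)[symmetric] by (simp add: fintegrable_def)
    have hm: "?h \<in> borel_measurable (PiM (insert n {..<n}) (\<lambda>_. lborel))"
      using int unfolding I(1)[symmetric] I(2) by (rule borel_measurable_integrable)
    have "(\<lambda>p. (snd p, fst p)) \<in> lborel \<Otimes>\<^sub>M lebn n \<rightarrow>\<^sub>M lebn n \<Otimes>\<^sub>M lborel" by measurable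
    from measurable_compose[OF measurable_compose[OF this measurable_add_dim] hm]
    have "(\<lambda>(a, x). ?h (x(n := a))) \<in> borel_measurable (lborel \<Otimes>\<^sub>M lebn n)" by (simp add: case_prod_unfold)
    hence meas: "(\<lambda>a. \<integral>x. ?h (x(n := a)) \<partial>lebn n) \<in> borel_measurable lborel"
      by (rule borel_measurable_lebesgue_integral)
    have "(\<integral>x. ?h x \<partial>lebn (Suc n)) = (\<integral>x. \<integral>y. ?h (merge {n} {..<n} (x, y)) \<partial>lebn n \<partial>PiM {n} (\<lambda>_. lborel))"
      using product_integral_fold[OF _ _ _ int] by (simp add: I(2))
    also have "\<dots> = (\<integral>x. (\<integral>y. ?h (y(n := x n)) \<partial>lebn n) \<partial>PiM {n} (\<lambda>_. lborel))"
    proof (intro Bochner_Integration.integral_cong refl)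
      fix x :: "nat \<Rightarrow> complex" and y :: "nat \<Rightarrow> complex" assume "y \<in> space (lebn n)"
      hence "y \<in> extensional {..<n}" by (simp add: space_PiM PiE_def)
      hence "merge {n} {..<n} (x, y) = y(n := x n)" by (auto simp: merge_def fun_eq_iff extensional_def)
      thus "?h (merge {n} {..<n} (x, y)) = ?h (y(n := x n))" by simp
    qed
    also have "\<dots> = (\<integral>a. \<integral>x. ?h (x(n := a)) \<partial>lebn n \<partial>lborel)"
      by (rule product_integral_singleton[OF meas])
    finally show ?thesis .
  qed
  thus ?thesis by (simp add: fps_eq_iff fint_nth)
qed

lemma weight_upd: "weight f n (x(n := a)) = weight f n x"
  unfolding weight_def by (intro prod.cong) auto

lemma fint_transpose:
  assumes h: "fintegrable (lebn n) h" and ij: "i < n" "j < n"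
  shows "fint (lebn n) (\<lambda>x. h (restrict (x \<circ> Transposition.transpose i j) {..<n})) = fint (lebn n) h"
  unfolding fps_eq_iff fint_nth
  using lebn_transpose[OF _ ij, of "\<lambda>x. h x $ _"] h by (auto simp: fintegrable_def dest: borel_measurable_integrable)

lemma prod_transpose:
  assumes "i < n" "j < n"
  shows "(\<Prod>k<n. g (restrict (x \<circ> Transposition.transpose i j) {..<n} k)) = (\<Prod>k<n. (g (x k) :: complex fps))"
proof -
  have t: "Transposition.transpose i j k < n" if "k < n" for k
    using assms that by (auto simp: Transposition.transpose_def)
  show ?thesis
    by (rule prod.reindex_bij_witness[of _ "Transposition.transpose i j" "Transposition.transpose i j"]) (use t in auto)
qed

lemma transpose_permutes: "i < n \<Longrightarrow> j < n \<Longrightarrow> Transposition.transpose i j permutes {..<n}"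
  by (rule permutes_swap_id) auto

text \<open>
  Expanding along the row of \<open>a\<close>: the diagonal entry contributes \<open>K(a,b)\<close> times the
  determinant of order \<open>n\<close>, and by symmetry of the integral the \<open>n\<close> other entries contribute equally.
\<close>

lemma minor_term_Suc:
  "minor_term (Suc p) a b = fps_const (K a b) * fred_term (Suc p) - of_nat (Suc p) * fint lborel (\<lambda>u. fps_const (K a u) * G u * minor_term p u b)"
proof -
  let ?n = "Suc p"
  let ?r = "\<lambda>x. x(?n := a)" and ?c = "\<lambda>x. x(?n := b)"
  define F where "F j x = weight f ?n x * fps_const (K a (x j) * kcof K ?n j (?r x) (?c x))" for j x
  have exp: "kdet K (Suc ?n) (?r x) (?c x) = K a b * kdet K ?n x x + (\<Sum>j<?n. K a (x j) * kcof K ?n j (?r x) (?c x))" for x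
  proof -
    have "kdet K (Suc ?n) (?r x) (?c x) = (\<Sum>j\<le>?n. K a ((?c x) j) * kcof K ?n j (?r x) (?c x))"
      unfolding kdet_expand by simp
    also have "\<dots> = (\<Sum>j<?n. K a ((?c x) j) * kcof K ?n j (?r x) (?c x)) + K a b * kcof K ?n ?n (?r x) (?c x)"
      by (simp add: lessThan_Suc_atMost[symmetric])
    also have "(\<Sum>j<?n. K a ((?c x) j) * kcof K ?n j (?r x) (?c x)) = (\<Sum>j<?n. K a (x j) * kcof K ?n j (?r x) (?c x))"
      by (intro sum.cong) auto
    also have "kcof K ?n ?n (?r x) (?c x) = kdet K ?n x x" unfolding kcof_last by (rule kdet_cong) auto
    finally show ?thesis by (simp only: add.commute)
  qed
  have Fp: "F p x = weight f ?n x * fps_const (- (K a (x p) * kdet K ?n x (x(p := b))))" for x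
  proof -
    have "kdet K ?n (?r x) ((?c x)(p := ?c x ?n)) = kdet K ?n x (x(p := b))" by (rule kdet_cong) auto
    thus ?thesis unfolding F_def kcof_penultimate by simp
  qed
  have Fp_int: "fintegrable (lebn ?n) (F p)"
  proof -
    have "(\<lambda>x. (x(p := b)) i) \<in> borel_measurable (lebn ?n)" if "i < ?n" for i
      using that by (cases "i = p") (auto intro: component_meas)
    hence 1: "(\<lambda>x. kdet K ?n x (x(p := b))) \<in> borel_measurable (lebn ?n)"
      by (intro kdet_measurable[OF K_meas]) (auto intro: component_meas simp del: fun_upd_apply)
    have 2: "(\<lambda>x. K a (x p)) \<in> borel_measurable (lebn ?n)" by (intro K_meas') auto
    have "norm (- (K a (x p) * kdet K ?n x (x(p := b)))) \<le> \<Phi> * (fact ?n * \<Phi> ^ ?n)" for x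
      unfolding norm_minus_cancel norm_mult
      by (intro mult_mono K_le norm_kdet_le order_trans[OF norm_ge_zero K_le]) auto
    thus ?thesis unfolding Fp using 1 2 by (intro fintegrable_weight) (auto simp del: fact_Suc power_Suc)
  qed
  \<comment> \<open>The transposition of the variables \<open>j\<close> and \<open>p\<close> carries the term of the entry \<open>j\<close> to that of the entry \<open>p\<close>.\<close>
  have Fj: "F j x = F p (restrict (x \<circ> Transposition.transpose j p) {..<?n})" if j: "j < ?n" for j x
  proof -
    let ?t = "Transposition.transpose j p"
    let ?x = "restrict (x \<circ> ?t) {..<?n}"
    have t: "?t permutes {..<?n}" using j by (intro transpose_permutes) auto
    have tn: "?t ?n = ?n" and tl: "k < ?n \<Longrightarrow> ?t k < ?n" for k using j by (auto simp: Transposition.transpose_def)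
    have kc: "kcof K ?n j (?r x) (?c x) = kcof K ?n p (?r ?x) (?c ?x)"
    proof -
      have "kcof K ?n j (?r x) (?c x) = kcof K ?n (?t p) (?r x) (?c x)" by simp
      also have "\<dots> = kcof K ?n p (?r x \<circ> ?t) (?c x \<circ> ?t)" by (rule kcof_permutes[OF t])
      also have "\<dots> = kcof K ?n p (?r ?x) (?c ?x)"
        unfolding kcof_def
      proof (intro arg_cong[of _ _ Determinant.det] eq_matI, goal_cases)
        case (1 i l)
        have "(?c x \<circ> ?t) l = ?c ?x l" using 1 tn tl[of l] by (cases "l = ?n") auto
        moreover have "(?r x \<circ> ?t) i = ?r ?x i" using 1 tn tl[of i] by (cases "i = ?n") auto
        ultimately show ?case using 1 by (simp del: fun_upd_apply o_apply)
      qed auto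
      finally show ?thesis .
    qed
    have "weight f ?n ?x = weight f ?n x" unfolding weight_def by (rule prod_transpose) (use j in auto)
    moreover have "?x p = x j" by simp
    ultimately show ?thesis unfolding F_def kc by simp
  qed
  have fint_F: "fintegrable (lebn ?n) (F j)" "fint (lebn ?n) (F j) = fint (lebn ?n) (F p)" if "j < ?n" for j
  proof -
    have Feq: "F j = (\<lambda>x. F p (restrict (x \<circ> Transposition.transpose j p) {..<?n}))" using Fj[OF that] by auto
    show "fint (lebn ?n) (F j) = fint (lebn ?n) (F p)" unfolding Feq by (rule fint_transpose[OF Fp_int that]) simp
    let ?c' = "\<lambda>x l. ?c x (if l < j then l else Suc l)"
    have kc: "kcof K ?n j (?r x) (?c x) = (- 1) ^ (?n + j) * kdet K ?n (?r x) (?c' x)" for x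
      using that by (intro kcof_kdet) simp
    have 1: "(\<lambda>x. K a (x j) * kcof K ?n j (?r x) (?c x)) \<in> borel_measurable (lebn ?n)"
      unfolding kc
    proof (intro borel_measurable_times borel_measurable_const K_meas' kdet_measurable[OF K_meas])
      show "(\<lambda>x. x j) \<in> borel_measurable (lebn ?n)" using that by (rule component_meas)
      fix i assume i: "i < ?n"
      show "(\<lambda>x. (?r x) i) \<in> borel_measurable (lebn ?n)" by (rule upd_meas) (use i in simp)
      show "(\<lambda>x. ?c' x i) \<in> borel_measurable (lebn ?n)" by (rule upd_meas) (use i in simp)
    qed
    have 2: "norm (K a (x j) * kcof K ?n j (?r x) (?c x)) \<le> \<Phi> * (fact ?n * \<Phi> ^ ?n)" for x
    proof -
      have "norm (kcof K ?n j (?r x) (?c x)) \<le> fact ?n * \<Phi> ^ ?n"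
        unfolding kc norm_mult norm_power by (simp add: norm_kdet_le[OF K_le] del: fact_Suc power_Suc)
      thus ?thesis unfolding norm_mult by (intro mult_mono K_le order_trans[OF norm_ge_zero K_le]) auto
    qed
    show "fintegrable (lebn ?n) (F j)" unfolding F_def by (rule fintegrable_weight[OF 1 2])
  qed
  have fps_const_sum: "fps_const (\<Sum>j\<in>J. h j) = (\<Sum>j\<in>J. fps_const (h j))" for J :: "nat set" and h :: "nat \<Rightarrow> complex"
    by (simp add: fps_eq_iff fps_sum_nth)
  have "minor_term ?n a b = fint (lebn ?n) (\<lambda>x. fps_const (K a b) * (weight f ?n x * fps_const (kdet K ?n x x)) + (\<Sum>j<?n. F j x))"
    unfolding minor_term_def exp F_def
    unfolding fps_const_add[symmetric] fps_const_sum distrib_left sum_distrib_left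
    by (intro fint_cong arg_cong2[where f = "(+)"] refl) (simp add: mult_ac flip: fps_const_mult)
  also have "\<dots> = fps_const (K a b) * fred_term ?n + (\<Sum>j<?n. fint (lebn ?n) (F j))"
  proof -
    have 1: "fintegrable (lebn ?n) (\<lambda>x. fps_const (K a b) * (weight f ?n x * fps_const (kdet K ?n x x)))"
      by (rule fintegrable_mult_left[OF fintegrable_fred_term])
    have 2: "fintegrable (lebn ?n) (\<lambda>x. \<Sum>j<?n. F j x)" by (rule fintegrable_sum) (use fint_F(1) in auto)
    have 3: "fint (lebn ?n) (\<lambda>x. \<Sum>j<?n. F j x) = (\<Sum>j<?n. fint (lebn ?n) (F j))"
      by (rule fint_sum) (use fint_F(1) in auto)
    show ?thesis unfolding fint_add[OF 1 2] 3 fint_mult_left[OF fintegrable_fred_term] fred_term_def ..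
  qed
  also have "(\<Sum>j<?n. fint (lebn ?n) (F j)) = (\<Sum>j<?n. fint (lebn ?n) (F p))"
    by (intro sum.cong refl fint_F(2)) auto
  also have "\<dots> = of_nat ?n * fint (lebn ?n) (F p)" by simp
  also have "fint (lebn ?n) (F p) = fint lborel (\<lambda>u. fint (lebn p) (\<lambda>x. F p (x(p := u))))"
    by (rule fint_lebn_Suc[OF Fp_int])
  also have "\<dots> = fint lborel (\<lambda>u. - (fps_const (K a u) * G u * minor_term p u b))"
  proof (rule fint_cong)
    fix u
    have "F p (x(p := u)) = (- (fps_const (K a u) * G u)) * (weight f p x * fps_const (kdet K (Suc p) (x(p := u)) (x(p := b))))" for x
      unfolding Fp weight_Suc weight_upd by (simp add: mult_ac flip: fps_const_neg fps_const_mult)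
    hence "fint (lebn p) (\<lambda>x. F p (x(p := u))) = (- (fps_const (K a u) * G u)) * minor_term p u b"
      unfolding minor_term_def by (simp only: fint_mult_left[OF fintegrable_minor_term])
    thus "fint (lebn p) (\<lambda>x. F p (x(p := u))) = - (fps_const (K a u) * G u * minor_term p u b)" by simp
  qed
  also have "\<dots> = - fint lborel (\<lambda>u. fps_const (K a u) * G u * minor_term p u b)"
    by (simp add: fps_eq_iff fint_nth)
  finally show ?thesis by (simp add: algebra_simps)
qed

end

lemma fps_deriv_prod:
  fixes g :: "'i \<Rightarrow> complex fps"
  assumes "finite A"
  shows "fps_deriv (\<Prod>i\<in>A. g i) = (\<Sum>j\<in>A. fps_deriv (g j) * (\<Prod>i\<in>A - {j}. g i))"
  using assms
proof (induction rule: finite_induct)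
  case (insert a A)
  have "(\<Sum>j\<in>A. fps_deriv (g j) * (\<Prod>i\<in>insert a A - {j}. g i)) = (\<Sum>j\<in>A. g a * (fps_deriv (g j) * (\<Prod>i\<in>A - {j}. g i)))"
  proof (rule sum.cong[OF refl])
    fix j assume j: "j \<in> A"
    hence "insert a A - {j} = insert a (A - {j})" using insert by auto
    thus "fps_deriv (g j) * (\<Prod>i\<in>insert a A - {j}. g i) = g a * (fps_deriv (g j) * (\<Prod>i\<in>A - {j}. g i))"
      using insert by (simp add: mult_ac)
  qed
  thus ?case using insert by (simp add: sum_distrib_left mult_ac add.commute)
qed simp

context kernel_weight
begin

lemma fintegrable_lebn_supp:
  assumes h: "bounded_coeffs (lebn n) h" and s: "\<And>x. x \<in> space (lebn n) \<Longrightarrow> x \<notin> {..<n} \<rightarrow>\<^sub>E B \<Longrightarrow> h x = 0"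
  shows "fintegrable (lebn n) h"
  unfolding fintegrable_def
proof
  fix k
  let ?E = "{..<n} \<rightarrow>\<^sub>E B"
  have E: "?E \<in> sets (lebn n)" by (intro sets_PiM_I_finite) auto
  obtain C where C: "\<And>x. norm (h x $ k) \<le> C" using h unfolding bounded_coeffs_def by blast
  have C0: "0 \<le> C" using C[of undefined] norm_ge_zero order_trans by blast
  have "integrable (lebn n) (\<lambda>x. C * indicat_real ?E x)"
    using box_finite E by (intro integrable_mult_right integrable_real_indicator) auto
  thus "integrable (lebn n) (\<lambda>x. h x $ k)"
  proof (rule Bochner_Integration.integrable_bound)
    show "(\<lambda>x. h x $ k) \<in> borel_measurable (lebn n)" using h by (simp add: bounded_coeffs_def)
    show "AE x in lebn n. norm (h x $ k) \<le> norm (C * indicat_real ?E x)"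
      using s C C0 by (intro AE_I2) (simp add: indicator_def)
  qed
qed

lemma deriv_G: "fps_deriv (G z) = fps_const (complex_of_real (f z)) * (1 + G z)"
  by (simp add: expm1_fps_def)

lemma bounded_coeffs_deriv_G: "bounded_coeffs borel (\<lambda>z. fps_deriv (G z))"
  by (rule bounded_coeffs_deriv[OF bounded_coeffs_G])

text \<open>By symmetry of the integral, differentiating any of the \<open>n + 1\<close> factors has the same effect.\<close>

lemma deriv_fred_term_Suc: "fps_deriv (fred_term (Suc n)) = of_nat (Suc n) * fint lborel (\<lambda>a. fps_deriv (G a) * minor_term n a a)"
proof -
  let ?n = "Suc n"
  define H where "H j x = fps_deriv (G (x j)) * (\<Prod>i\<in>{..<?n} - {j}. G (x i)) * fps_const (kdet K ?n x x)" for j x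
  have int: "fintegrable (lebn ?n) (H j)" if j: "j < ?n" for j
  proof (rule fintegrable_lebn_supp)
    show "bounded_coeffs (lebn ?n) (H j)"
      unfolding H_def
      by (intro bounded_coeffs_mult bounded_coeffs_prod bounded_coeffs_compose[OF bounded_coeffs_G]
            bounded_coeffs_compose[OF bounded_coeffs_deriv_G] bounded_coeffs_const[OF kdet_meas_fred_term norm_kdet_le[OF K_le]])
         (use j in \<open>auto intro: component_meas\<close>)
    fix x assume "x \<in> space (lebn ?n)" "x \<notin> {..<?n} \<rightarrow>\<^sub>E B"
    then obtain i where i: "i < ?n" "x i \<notin> B" by (auto simp: space_PiM PiE_def Pi_def)
    hence z: "G (x i) = 0" by (simp add: f_supp)
    show "H j x = 0"
    proof (cases "i = j")
      case True thus ?thesis using z by (simp add: H_def)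
    next
      case False
      hence "(\<Prod>i\<in>{..<?n} - {j}. G (x i)) = 0" using i z by (intro prod_zero) (auto intro!: bexI[of _ i])
      thus ?thesis by (simp add: H_def)
    qed
  qed
  have Hj: "H j x = H n (restrict (x \<circ> Transposition.transpose j n) {..<?n})" if j: "j < ?n" for j x
  proof -
    let ?t = "Transposition.transpose j n"
    let ?x = "restrict (x \<circ> ?t) {..<?n}"
    have tl: "?t k < ?n" if "k < ?n" for k using that j by (auto simp: Transposition.transpose_def)
    have t: "?t permutes {0..<?n}" using transpose_permutes[of j ?n n] j by (simp add: atLeast0LessThan)
    have "kdet K ?n ?x ?x = kdet K ?n (x \<circ> ?t) (x \<circ> ?t)" by (rule kdet_cong) auto
    also have "\<dots> = kdet K ?n x x" by (rule kdet_permutes[OF t])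
    finally have 1: "kdet K ?n ?x ?x = kdet K ?n x x" .
    have 2: "(\<Prod>i\<in>{..<?n} - {n}. G (?x i)) = (\<Prod>i\<in>{..<?n} - {j}. G (x i))"
    proof (rule prod.reindex_bij_witness[of _ ?t ?t])
      fix i assume i: "i \<in> {..<?n} - {n}"
      have "?t i \<noteq> j"
      proof
        assume "?t i = j"
        hence "?t (?t i) = ?t j" by simp
        thus False using i by simp
      qed
      thus "?t i \<in> {..<?n} - {j}" using tl i by auto
    next
      fix i assume i: "i \<in> {..<?n} - {j}"
      have "?t i \<noteq> n"
      proof
        assume "?t i = n"
        hence "?t (?t i) = ?t n" by simp
        thus False using i by simp
      qed
      thus "?t i \<in> {..<?n} - {n}" using tl i by auto
    qed auto
    have "?x n = x j" by simp
    thus ?thesis unfolding H_def 1 2 by simp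
  qed
  have eq: "fint (lebn ?n) (H j) = fint (lebn ?n) (H n)" if "j < ?n" for j
  proof -
    have Feq: "H j = (\<lambda>x. H n (restrict (x \<circ> Transposition.transpose j n) {..<?n}))" using Hj[OF that] by auto
    show ?thesis unfolding Feq by (rule fint_transpose[OF int that]) auto
  qed
  have "fps_deriv (fred_term ?n) = fint (lebn ?n) (\<lambda>x. \<Sum>j<?n. H j x)"
    unfolding fred_term_def fint_deriv
    by (intro fint_cong) (simp add: weight_def fps_deriv_prod H_def sum_distrib_right del: prod.lessThan_Suc sum.lessThan_Suc)
  also have "\<dots> = (\<Sum>j<?n. fint (lebn ?n) (H j))" by (rule fint_sum) (use int in auto)
  also have "\<dots> = (\<Sum>j<?n. fint (lebn ?n) (H n))" by (intro sum.cong refl eq) auto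
  also have "\<dots> = of_nat ?n * fint (lebn ?n) (H n)" by simp
  also have "fint (lebn ?n) (H n) = fint lborel (\<lambda>a. fint (lebn n) (\<lambda>x. H n (x(n := a))))"
    by (rule fint_lebn_Suc[OF int]) simp
  also have "\<dots> = fint lborel (\<lambda>a. fps_deriv (G a) * minor_term n a a)"
  proof (rule fint_cong)
    fix a
    have "{..<?n} - {n} = {..<n}" by auto
    hence "H n (x(n := a)) = fps_deriv (G a) * (weight f n x * fps_const (kdet K ?n (x(n := a)) (x(n := a))))" for x
      unfolding H_def weight_def[symmetric] by (simp add: weight_upd mult.assoc flip: weight_def)
    thus "fint (lebn n) (\<lambda>x. H n (x(n := a))) = fps_deriv (G a) * minor_term n a a"
      unfolding minor_term_def by (simp only: fint_mult_left[OF fintegrable_minor_term])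
  qed
  finally show ?thesis .
qed

lemma fred_term_0: "fred_term 0 = 1"
  by (simp add: fred_term_def fps_eq_iff fint_nth weight_def kdet_0 PiM_empty lebesgue_integral_count_space_finite)

lemma minor_term_0: "minor_term 0 a b = fps_const (K a b)"
  by (simp add: minor_term_def fps_eq_iff fint_nth weight_def kdet_1 PiM_empty lebesgue_integral_count_space_finite)

lemma fred_term_nth_less: "k < n \<Longrightarrow> fred_term n $ k = 0"
  unfolding fred_term_def fint_nth by (simp add: weight_nth_less)

lemma minor_term_nth_less: "k < n \<Longrightarrow> minor_term n a b $ k = 0"
  unfolding minor_term_def fint_nth by (simp add: weight_nth_less)

definition fred_upto :: "nat \<Rightarrow> complex fps" where "fred_upto N = (\<Sum>n<N. fps_const (1 / fact n) * fred_term n)"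
definition minor_upto :: "nat \<Rightarrow> complex \<Rightarrow> complex \<Rightarrow> complex fps" where
  "minor_upto N a b = (\<Sum>n<N. fps_const (1 / fact n) * minor_term n a b)"

text \<open>
  The series \<open>fred\<close> and \<open>minor\<close> are the Fredholm determinant and the numerator of the Fredholm
  resolvent of \<open>K\<close> with weight \<open>exp (t f) - 1\<close>. Their partial sums stabilise coefficientwise.
\<close>

definition fred :: "complex fps" where "fred = Abs_fps (\<lambda>k. fred_upto (Suc k) $ k)"
definition minor :: "complex \<Rightarrow> complex \<Rightarrow> complex fps" where "minor a b = Abs_fps (\<lambda>k. minor_upto (Suc k) a b $ k)"

lemma fred_upto_nth: "k < N \<Longrightarrow> fred_upto N $ k = fred $ k"
  unfolding fred_def fred_upto_def fps_sum_nth fps_nth_Abs_fps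
  by (rule sum.mono_neutral_right) (auto simp: fred_term_nth_less)

lemma minor_upto_nth: "k < N \<Longrightarrow> minor_upto N a b $ k = minor a b $ k"
  unfolding minor_def minor_upto_def fps_sum_nth fps_nth_Abs_fps
  by (rule sum.mono_neutral_right) (auto simp: minor_term_nth_less)

lemma fact_cancel: "fps_const (1 / fact (Suc n)) * (of_nat (Suc n) * Z) = fps_const (1 / fact n) * (Z :: complex fps)"
proof -
  have "fps_const (1 / fact (Suc n)) * of_nat (Suc n) = (fps_const (1 / fact n) :: complex fps)"
    by (simp add: fps_of_nat[symmetric] field_simps del: of_nat_Suc)
  thus ?thesis by (simp only: mult.assoc[symmetric])
qed

lemma fintegrable_KGDk: "fintegrable lborel (\<lambda>u. fps_const (K a u) * G u * minor_term n u b)"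
  by (intro fintegrable_supp bounded_coeffs_mult bounded_coeffs_K bounded_coeffs_G bounded_coeffs_minor_term) (simp add: f_supp)

lemma minor_upto_Suc:
  "minor_upto (Suc N) a b = fps_const (K a b) * fred_upto (Suc N) - fint lborel (\<lambda>u. fps_const (K a u) * G u * minor_upto N u b)"
proof (induction N)
  case 0
  show ?case by (simp add: minor_upto_def fred_upto_def fred_term_0 minor_term_0 fps_eq_iff fint_nth)
next
  case (Suc N)
  have "fint lborel (\<lambda>u. fps_const (K a u) * G u * minor_upto (Suc N) u b) =
      fint lborel (\<lambda>u. \<Sum>n<Suc N. fps_const (1 / fact n) * (fps_const (K a u) * G u * minor_term n u b))"
    unfolding minor_upto_def by (intro fint_cong) (simp add: sum_distrib_left mult_ac del: sum.lessThan_Suc)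
  also have "\<dots> = (\<Sum>n<Suc N. fps_const (1 / fact n) * fint lborel (\<lambda>u. fps_const (K a u) * G u * minor_term n u b))"
    by (simp only: fint_sum[OF fintegrable_mult_left[OF fintegrable_KGDk]] fint_mult_left[OF fintegrable_KGDk])
  finally have 1: "fint lborel (\<lambda>u. fps_const (K a u) * G u * minor_upto (Suc N) u b) = \<dots>" .
  have 2: "fps_const (1 / fact (Suc n)) * minor_term (Suc n) a b = fps_const (K a b) * (fps_const (1 / fact (Suc n)) * fred_term (Suc n))
      - fps_const (1 / fact n) * fint lborel (\<lambda>u. fps_const (K a u) * G u * minor_term n u b)" for n
    unfolding minor_term_Suc right_diff_distrib fact_cancel by (simp add: mult_ac)
  have "minor_upto (Suc (Suc N)) a b = fps_const (1 / fact 0) * minor_term 0 a b + (\<Sum>n<Suc N. fps_const (1 / fact (Suc n)) * minor_term (Suc n) a b)"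
    unfolding minor_upto_def by (rule sum.lessThan_Suc_shift)
  also have "\<dots> = fps_const (K a b) * (fps_const (1 / fact 0) * fred_term 0 + (\<Sum>n<Suc N. fps_const (1 / fact (Suc n)) * fred_term (Suc n)))
      - (\<Sum>n<Suc N. fps_const (1 / fact n) * fint lborel (\<lambda>u. fps_const (K a u) * G u * minor_term n u b))"
    unfolding 2 sum_subtractf sum_distrib_left[symmetric] minor_term_0 fred_term_0
    by (simp add: distrib_left del: sum.lessThan_Suc)
  also have "fps_const (1 / fact 0) * fred_term 0 + (\<Sum>n<Suc N. fps_const (1 / fact (Suc n)) * fred_term (Suc n)) = fred_upto (Suc (Suc N))"
    unfolding fred_upto_def by (rule sum.lessThan_Suc_shift[symmetric])
  finally show ?case unfolding 1 .
qed

lemma deriv_fred_upto_Suc: "fps_deriv (fred_upto (Suc N)) = fint lborel (\<lambda>a. fps_deriv (G a) * minor_upto N a a)"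
proof -
  have i: "fintegrable lborel (\<lambda>a. fps_deriv (G a) * minor_term n a a)" for n
    by (intro fintegrable_supp bounded_coeffs_mult bounded_coeffs_deriv_G bounded_coeffs_minor_term_diag) (simp add: f_supp)
  have "fred_upto (Suc N) = fps_const (1 / fact 0) * fred_term 0 + (\<Sum>n<N. fps_const (1 / fact (Suc n)) * fred_term (Suc n))"
    unfolding fred_upto_def by (rule sum.lessThan_Suc_shift)
  hence "fps_deriv (fred_upto (Suc N)) = (\<Sum>n<N. fps_const (1 / fact (Suc n)) * fps_deriv (fred_term (Suc n)))"
    by (simp add: fred_term_0 fps_deriv_sum)
  also have "\<dots> = (\<Sum>n<N. fps_const (1 / fact n) * fint lborel (\<lambda>a. fps_deriv (G a) * minor_term n a a))"
    unfolding deriv_fred_term_Suc fact_cancel ..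
  also have "\<dots> = fint lborel (\<lambda>a. \<Sum>n<N. fps_const (1 / fact n) * (fps_deriv (G a) * minor_term n a a))"
    by (simp only: fint_sum[OF fintegrable_mult_left[OF i]] fint_mult_left[OF i])
  also have "\<dots> = fint lborel (\<lambda>a. fps_deriv (G a) * minor_upto N a a)"
    unfolding minor_upto_def by (intro fint_cong) (simp add: sum_distrib_left mult_ac)
  finally show ?thesis .
qed

text \<open>
  Fredholm's identity, the limit of the recursion for the partial sums. Coefficient \<open>k\<close> of the
  integral involves lower coefficients of the minor only, as \<open>G\<close> has no constant term.
\<close>

lemma minor_eq: "minor a b = fps_const (K a b) * fred - fint lborel (\<lambda>u. fps_const (K a u) * G u * minor u b)"
proof (rule fps_ext)
  fix k
  have "fint lborel (\<lambda>u. fps_const (K a u) * G u * minor_upto k u b) $ k = fint lborel (\<lambda>u. fps_const (K a u) * G u * minor u b) $ k"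
    unfolding fint_nth
  proof (intro Bochner_Integration.integral_cong refl)
    fix u
    have "G u $ i * minor_upto k u b $ (k - i) = G u $ i * minor u b $ (k - i)" if "i \<le> k" for i
      using that minor_upto_nth[of "k - i" k] by (cases "i = 0") (auto simp: expm1_fps_nth)
    hence "(G u * minor_upto k u b) $ k = (G u * minor u b) $ k" unfolding fps_mult_nth by (intro sum.cong refl) auto
    thus "(fps_const (K a u) * G u * minor_upto k u b) $ k = (fps_const (K a u) * G u * minor u b) $ k"
      by (simp only: mult.assoc fps_mult_left_const_nth)
  qed
  moreover have "minor a b $ k = minor_upto (Suc k) a b $ k" by (simp add: minor_def)
  moreover have "fred_upto (Suc k) $ k = fred $ k" by (rule fred_upto_nth) simp
  ultimately show "minor a b $ k = (fps_const (K a b) * fred - fint lborel (\<lambda>u. fps_const (K a u) * G u * minor u b)) $ k"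
    unfolding minor_upto_Suc by simp
qed

text \<open>
  Jacobi's formula for the derivative of a determinant, in which the minor takes the place of
  the adjugate.
\<close>

lemma deriv_fred: "fps_deriv fred = fint lborel (\<lambda>a. fps_deriv (G a) * minor a a)"
proof (rule fps_ext)
  fix k
  have "fps_deriv fred $ k = fps_deriv (fred_upto (Suc (Suc k))) $ k" using fred_upto_nth[of "Suc k" "Suc (Suc k)"] by simp
  also have "\<dots> = fint lborel (\<lambda>a. fps_deriv (G a) * minor a a) $ k"
    unfolding deriv_fred_upto_Suc fint_nth fps_mult_nth using minor_upto_nth
    by (intro Bochner_Integration.integral_cong refl sum.cong) auto
  finally show "fps_deriv fred $ k = fint lborel (\<lambda>a. fps_deriv (G a) * minor a a) $ k" .
qed

lemma fred_0: "fred $ 0 = 1"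
  by (simp add: fred_def fred_upto_def fred_term_0)

end

section \<open>Kernels with bounds on their size, mass and third moment\<close>

text \<open>
  For a kernel dominated by \<open>\<phi>(x - y)\<close> these are the quantities in the hypotheses of the
  theorem: \<open>\<rho>\<close> is the scale of the supremum, \<open>\<beta>\<close> that of the third moment. Rows and columns are
  both included to make the class closed under transposition and composition. The scale \<open>\<beta>\<close> is
  an extended number because the third moment may be infinite when \<open>\<rho>\<close> is small.
\<close>

definition kernel_bound :: "real \<Rightarrow> ennreal \<Rightarrow> real \<Rightarrow> (complex \<Rightarrow> complex \<Rightarrow> complex) \<Rightarrow> bool" where
  "kernel_bound \<rho> \<beta> c k \<longleftrightarrow> (\<lambda>(x, y). k x y) \<in> borel_measurable (borel \<Otimes>\<^sub>M borel) \<and> 0 \<le> c \<and>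
     (\<forall>x y. cmod (k x y) \<le> c * \<rho>) \<and>
     (\<forall>x. (\<integral>\<^sup>+y. ennreal (cmod (k x y)) \<partial>lborel) \<le> ennreal c) \<and>
     (\<forall>y. (\<integral>\<^sup>+x. ennreal (cmod (k x y)) \<partial>lborel) \<le> ennreal c) \<and>
     (\<forall>x. (\<integral>\<^sup>+y. ennreal (cmod (x - y) ^ 3 * cmod (k x y)) \<partial>lborel) \<le> ennreal c * \<beta>) \<and>
     (\<forall>y. (\<integral>\<^sup>+x. ennreal (cmod (x - y) ^ 3 * cmod (k x y)) \<partial>lborel) \<le> ennreal c * \<beta>)"

lemma kernel_boundD:
  assumes "kernel_bound \<rho> \<beta> c k"
  shows "(\<lambda>(x, y). k x y) \<in> borel_measurable (borel \<Otimes>\<^sub>M borel)" "0 \<le> c" "cmod (k x y) \<le> c * \<rho>"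
    "(\<integral>\<^sup>+y. ennreal (cmod (k x y)) \<partial>lborel) \<le> ennreal c" "(\<integral>\<^sup>+x. ennreal (cmod (k x y)) \<partial>lborel) \<le> ennreal c"
    "(\<integral>\<^sup>+y. ennreal (cmod (x - y) ^ 3 * cmod (k x y)) \<partial>lborel) \<le> ennreal c * \<beta>"
    "(\<integral>\<^sup>+x. ennreal (cmod (x - y) ^ 3 * cmod (k x y)) \<partial>lborel) \<le> ennreal c * \<beta>"
  using assms unfolding kernel_bound_def by blast+

lemma kernel_bound_measurable:
  assumes "kernel_bound \<rho> \<beta> c k" "g \<in> borel_measurable N" "h \<in> borel_measurable N"
  shows "(\<lambda>x. k (g x) (h x)) \<in> borel_measurable N"
  using measurable_compose[OF measurable_Pair[OF assms(2,3)] kernel_boundD(1)[OF assms(1)]] by simp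

lemma kernel_bound_transpose: "kernel_bound \<rho> \<beta> c k \<Longrightarrow> kernel_bound \<rho> \<beta> c (\<lambda>x y. k y x)"
proof -
  assume k: "kernel_bound \<rho> \<beta> c k"
  have m: "(\<lambda>p. k (snd p) (fst p)) \<in> borel_measurable (borel \<Otimes>\<^sub>M borel)"
    by (rule kernel_bound_measurable[OF k]) measurable
  show ?thesis unfolding kernel_bound_def
  proof (intro conjI allI)
    show "(\<lambda>(x, y). k y x) \<in> borel_measurable (borel \<Otimes>\<^sub>M borel)" unfolding case_prod_unfold by (rule m)
    show "(\<integral>\<^sup>+y. ennreal (cmod (x - y) ^ 3 * cmod (k y x)) \<partial>lborel) \<le> ennreal c * \<beta>"
      "(\<integral>\<^sup>+y. ennreal (cmod (y - x) ^ 3 * cmod (k x y)) \<partial>lborel) \<le> ennreal c * \<beta>" for x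
      using kernel_boundD(6,7)[OF k, of x] by (simp_all add: norm_minus_commute)
  qed (rule kernel_boundD[OF k])+
qed

lemma kernel_bound_0: "kernel_bound \<rho> \<beta> 0 (\<lambda>x y. 0)"
  by (simp add: kernel_bound_def)

lemma kernel_bound_le:
  assumes k: "kernel_bound \<rho> \<beta> c k" and h: "(\<lambda>(x, y). h x y) \<in> borel_measurable (borel \<Otimes>\<^sub>M borel)"
    and le: "\<And>x y. cmod (h x y) \<le> C * cmod (k x y)" and C: "0 \<le> C"
  shows "kernel_bound \<rho> \<beta> (C * c) h"
proof -
  have c: "0 \<le> c" by (rule kernel_boundD[OF k])
  note [measurable] = kernel_bound_measurable[OF k]
  have int: "(\<integral>\<^sup>+x. ennreal (w x * cmod (h' x)) \<partial>lborel) \<le> ennreal (C * c) * e"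
    if "(\<integral>\<^sup>+x. ennreal (w x * cmod (k' x)) \<partial>lborel) \<le> ennreal c * e" "\<And>x. cmod (h' x) \<le> C * cmod (k' x)" "\<And>x. 0 \<le> w x"
      "(\<lambda>x. w x * cmod (k' x)) \<in> borel_measurable borel"
    for w h' k' and e :: ennreal
  proof -
    have "(\<integral>\<^sup>+x. ennreal (w x * cmod (h' x)) \<partial>lborel) \<le> (\<integral>\<^sup>+x. ennreal C * ennreal (w x * cmod (k' x)) \<partial>lborel)"
    proof (rule nn_integral_mono)
      fix x
      have "w x * cmod (h' x) \<le> w x * (C * cmod (k' x))" using that by (intro mult_left_mono) auto
      thus "ennreal (w x * cmod (h' x)) \<le> ennreal C * ennreal (w x * cmod (k' x))"
        using C that(3) by (simp add: ennreal_mult[symmetric] ennreal_leI mult_ac)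
    qed
    also have "\<dots> = ennreal C * (\<integral>\<^sup>+x. ennreal (w x * cmod (k' x)) \<partial>lborel)" by (rule nn_integral_cmult) (use that(4) in simp)
    also have "\<dots> \<le> ennreal C * (ennreal c * e)" by (intro mult_left_mono that) simp
    also have "\<dots> = ennreal (C * c) * e" using C c by (simp add: ennreal_mult mult_ac)
    finally show ?thesis .
  qed
  have "cmod (h x y) \<le> C * c * \<rho>" for x y
    using order_trans[OF le mult_left_mono[OF kernel_boundD(3)[OF k] C]] by (simp add: mult_ac)
  moreover have "(\<integral>\<^sup>+y. ennreal (cmod (h x y)) \<partial>lborel) \<le> ennreal (C * c)"
    "(\<integral>\<^sup>+y. ennreal (cmod (h y x)) \<partial>lborel) \<le> ennreal (C * c)" for x
    using int[of "\<lambda>_. 1" "\<lambda>y. k x y" 1 "\<lambda>y. h x y"] int[of "\<lambda>_. 1" "\<lambda>y. k y x" 1 "\<lambda>y. h y x"] kernel_boundD[OF k] le by simp_all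
  moreover have "(\<integral>\<^sup>+y. ennreal (cmod (x - y) ^ 3 * cmod (h x y)) \<partial>lborel) \<le> ennreal (C * c) * \<beta>"
    "(\<integral>\<^sup>+y. ennreal (cmod (y - x) ^ 3 * cmod (h y x)) \<partial>lborel) \<le> ennreal (C * c) * \<beta>" for x
    using int[of "\<lambda>y. cmod (x - y) ^ 3" "\<lambda>y. k x y" \<beta> "\<lambda>y. h x y"]
      int[of "\<lambda>y. cmod (y - x) ^ 3" "\<lambda>y. k y x" \<beta> "\<lambda>y. h y x"] kernel_boundD[OF k] le by simp_all
  ultimately show ?thesis unfolding kernel_bound_def using h C c by auto
qed

lemma kernel_bound_mult:
  assumes k: "kernel_bound \<rho> \<beta> c k" and w: "(\<lambda>(x, y). w x y) \<in> borel_measurable (borel \<Otimes>\<^sub>M borel)"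
    and le: "\<And>x y. cmod (w x y) \<le> C"
  shows "kernel_bound \<rho> \<beta> (C * c) (\<lambda>x y. w x y * k x y)"
proof (rule kernel_bound_le[OF k])
  show "(\<lambda>(x, y). w x y * k x y) \<in> borel_measurable (borel \<Otimes>\<^sub>M borel)"
    using borel_measurable_times[OF w kernel_boundD(1)[OF k]] by (simp add: case_prod_unfold)
  show "cmod (w x y * k x y) \<le> C * cmod (k x y)" for x y unfolding norm_mult by (intro mult_right_mono le) simp
  show "0 \<le> C" using le[of undefined undefined] norm_ge_zero order_trans by blast
qed

lemma kernel_bound_add:
  assumes k: "kernel_bound \<rho> \<beta> c k" and h: "kernel_bound \<rho> \<beta> d h"
  shows "kernel_bound \<rho> \<beta> (c + d) (\<lambda>x y. k x y + h x y)"
proof -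
  have cd: "0 \<le> c" "0 \<le> d" by (rule kernel_boundD[OF k], rule kernel_boundD[OF h])
  note [measurable] = kernel_bound_measurable[OF k] kernel_bound_measurable[OF h]
  have int: "(\<integral>\<^sup>+x. ennreal (w x * cmod (k' x + h' x)) \<partial>lborel) \<le> ennreal (c + d) * e"
    if "(\<integral>\<^sup>+x. ennreal (w x * cmod (k' x)) \<partial>lborel) \<le> ennreal c * e" "(\<integral>\<^sup>+x. ennreal (w x * cmod (h' x)) \<partial>lborel) \<le> ennreal d * e"
      "\<And>x. 0 \<le> w x" "(\<lambda>x. w x * cmod (k' x)) \<in> borel_measurable borel" "(\<lambda>x. w x * cmod (h' x)) \<in> borel_measurable borel"
    for w k' h' and e :: ennreal
  proof -
    have "(\<integral>\<^sup>+x. ennreal (w x * cmod (k' x + h' x)) \<partial>lborel) \<le> (\<integral>\<^sup>+x. ennreal (w x * cmod (k' x)) + ennreal (w x * cmod (h' x)) \<partial>lborel)"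
    proof (rule nn_integral_mono)
      fix x
      have "w x * cmod (k' x + h' x) \<le> w x * (cmod (k' x) + cmod (h' x))" using that by (intro mult_left_mono norm_triangle_ineq) auto
      thus "ennreal (w x * cmod (k' x + h' x)) \<le> ennreal (w x * cmod (k' x)) + ennreal (w x * cmod (h' x))"
        using that(3) by (simp add: ennreal_plus[symmetric] ennreal_leI distrib_left del: ennreal_plus)
    qed
    also have "\<dots> = (\<integral>\<^sup>+x. ennreal (w x * cmod (k' x)) \<partial>lborel) + (\<integral>\<^sup>+x. ennreal (w x * cmod (h' x)) \<partial>lborel)"
      by (rule nn_integral_add) (use that(4,5) in simp_all)
    also have "\<dots> \<le> ennreal c * e + ennreal d * e" by (intro add_mono that)
    also have "\<dots> = ennreal (c + d) * e" using cd by (simp add: distrib_right)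
    finally show ?thesis .
  qed
  have "(\<lambda>(x, y). k x y + h x y) \<in> borel_measurable (borel \<Otimes>\<^sub>M borel)"
    using borel_measurable_add[OF kernel_boundD(1)[OF k] kernel_boundD(1)[OF h]] by (simp add: case_prod_unfold)
  moreover have "cmod (k x y + h x y) \<le> (c + d) * \<rho>" for x y
    using norm_triangle_ineq[of "k x y" "h x y"] kernel_boundD(3)[OF k, of x y] kernel_boundD(3)[OF h, of x y] by (simp add: distrib_right)
  moreover have "(\<integral>\<^sup>+y. ennreal (cmod (k x y + h x y)) \<partial>lborel) \<le> ennreal (c + d)"
    "(\<integral>\<^sup>+y. ennreal (cmod (k y x + h y x)) \<partial>lborel) \<le> ennreal (c + d)" for x
    using int[of "\<lambda>_. 1" "\<lambda>y. k x y" 1 "\<lambda>y. h x y"] int[of "\<lambda>_. 1" "\<lambda>y. k y x" 1 "\<lambda>y. h y x"] kernel_boundD[OF k] kernel_boundD[OF h] by simp_all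
  moreover have "(\<integral>\<^sup>+y. ennreal (cmod (x - y) ^ 3 * cmod (k x y + h x y)) \<partial>lborel) \<le> ennreal (c + d) * \<beta>"
    "(\<integral>\<^sup>+y. ennreal (cmod (y - x) ^ 3 * cmod (k y x + h y x)) \<partial>lborel) \<le> ennreal (c + d) * \<beta>" for x
    using int[of "\<lambda>y. cmod (x - y) ^ 3" "\<lambda>y. k x y" \<beta> "\<lambda>y. h x y"]
      int[of "\<lambda>y. cmod (y - x) ^ 3" "\<lambda>y. k y x" \<beta> "\<lambda>y. h y x"] kernel_boundD[OF k] kernel_boundD[OF h] by simp_all
  ultimately show ?thesis unfolding kernel_bound_def using cd by auto
qed

lemma kernel_bound_sum:
  assumes "finite I" "\<And>i. i \<in> I \<Longrightarrow> kernel_bound \<rho> \<beta> (c i) (k i)"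
  shows "kernel_bound \<rho> \<beta> (\<Sum>i\<in>I. c i) (\<lambda>x y. \<Sum>i\<in>I. k i x y)"
  using assms by (induction rule: finite_induct) (auto intro: kernel_bound_0 kernel_bound_add)

lemma kernel_bound_integrable:
  assumes k: "kernel_bound \<rho> \<beta> c k" and h: "kernel_bound \<rho> \<beta> d h"
  shows "integrable lborel (\<lambda>u. k x u * h u y)"
    "(\<integral>\<^sup>+u. ennreal (cmod (k x u * h u y)) \<partial>lborel) \<le> ennreal (c * d * \<rho>)"
proof -
  note [measurable] = kernel_bound_measurable[OF k] kernel_bound_measurable[OF h]
  have cd: "0 \<le> c" "0 \<le> d" by (rule kernel_boundD[OF k], rule kernel_boundD[OF h])
  have d0: "0 \<le> d * \<rho>" using kernel_boundD(3)[OF h] norm_ge_zero order_trans by blast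
  have "(\<integral>\<^sup>+u. ennreal (cmod (k x u * h u y)) \<partial>lborel) \<le> (\<integral>\<^sup>+u. ennreal (d * \<rho>) * ennreal (cmod (k x u)) \<partial>lborel)"
  proof (rule nn_integral_mono)
    fix u
    have "cmod (h u y) * cmod (k x u) \<le> d * \<rho> * cmod (k x u)" by (intro mult_right_mono kernel_boundD(3)[OF h]) simp
    thus "ennreal (cmod (k x u * h u y)) \<le> ennreal (d * \<rho>) * ennreal (cmod (k x u))"
      using d0 by (simp add: ennreal_mult[symmetric] norm_mult ennreal_leI mult.commute)
  qed
  also have "\<dots> = ennreal (d * \<rho>) * (\<integral>\<^sup>+u. ennreal (cmod (k x u)) \<partial>lborel)" by (rule nn_integral_cmult) simp
  also have "\<dots> \<le> ennreal (d * \<rho>) * ennreal c" by (intro mult_left_mono kernel_boundD(4)[OF k]) simp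
  also have "\<dots> = ennreal (c * d * \<rho>)" using cd d0 by (simp add: ennreal_mult[symmetric] mult_ac)
  finally show le: "(\<integral>\<^sup>+u. ennreal (cmod (k x u * h u y)) \<partial>lborel) \<le> ennreal (c * d * \<rho>)" .
  show "integrable lborel (\<lambda>u. k x u * h u y)"
    by (rule integrableI_bounded) (use le in \<open>auto intro: le_less_trans\<close>)
qed

lemma norm_integral_ennreal: "ennreal (cmod (\<integral>u. g u \<partial>N)) \<le> (\<integral>\<^sup>+u. ennreal (cmod (g u)) \<partial>N)"
  by (cases "integrable N g") (auto intro: integral_norm_bound_ennreal simp: not_integrable_integral_eq)

lemma cube_sum_le: "(a + b) ^ 3 \<le> 4 * (a ^ 3 + b ^ 3)" if "0 \<le> a" "0 \<le> b" for a b :: real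
proof -
  have "4 * (a ^ 3 + b ^ 3) - (a + b) ^ 3 = 3 * (a + b) * (a - b)\<^sup>2"
    by (simp add: power2_eq_square power3_eq_cube algebra_simps)
  also have "\<dots> \<ge> 0" using that by simp
  finally show ?thesis by simp
qed

lemma cube_dist_le: "cmod (x - y) ^ 3 \<le> 4 * (cmod (x - u) ^ 3 + cmod (u - y) ^ 3)"
proof -
  have "cmod (x - y) \<le> cmod (x - u) + cmod (u - y)" using norm_triangle_ineq[of "x - u" "u - y"] by simp
  hence "cmod (x - y) ^ 3 \<le> (cmod (x - u) + cmod (u - y)) ^ 3" by (intro power_mono) auto
  also have "\<dots> \<le> 4 * (cmod (x - u) ^ 3 + cmod (u - y) ^ 3)" by (rule cube_sum_le) auto
  finally show ?thesis .
qed

text \<open>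
  Applied with \<open>p\<close> and \<open>q\<close> equal to the modulus of a kernel, or to this modulus times a cubed distance.
\<close>

lemma nn_integral_comp_le:
  fixes p q :: "complex \<Rightarrow> complex \<Rightarrow> real"
  assumes [measurable]: "(\<lambda>(x, y). p x y) \<in> borel_measurable (borel \<Otimes>\<^sub>M borel)" "(\<lambda>(x, y). q x y) \<in> borel_measurable (borel \<Otimes>\<^sub>M borel)"
    and nn: "\<And>x y. 0 \<le> p x y" "\<And>x y. 0 \<le> q x y"
    and p: "(\<integral>\<^sup>+u. ennreal (p x u) \<partial>lborel) \<le> P" and q: "\<And>u. (\<integral>\<^sup>+y. ennreal (q u y) \<partial>lborel) \<le> R"
  shows "(\<integral>\<^sup>+y. \<integral>\<^sup>+u. ennreal (p x u * q u y) \<partial>lborel \<partial>lborel) \<le> P * R"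
proof -
  have [measurable]: "(\<lambda>u. p x u) \<in> borel_measurable borel"
    using measurable_compose[OF measurable_Pair[OF measurable_const measurable_ident_sets[OF refl]] assms(1), of x] by simp
  have [measurable]: "(\<lambda>y. q u y) \<in> borel_measurable borel" for u
    using measurable_compose[OF measurable_Pair[OF measurable_const measurable_ident_sets[OF refl]] assms(2), of u] by simp
  have "(\<lambda>z. p x (snd z)) \<in> borel_measurable (lborel \<Otimes>\<^sub>M lborel)" "(\<lambda>z. q (snd z) (fst z)) \<in> borel_measurable (lborel \<Otimes>\<^sub>M lborel)"
  proof -
    have 1: "(\<lambda>z. (x, snd z)) \<in> lborel \<Otimes>\<^sub>M (lborel :: complex measure) \<rightarrow>\<^sub>M borel \<Otimes>\<^sub>M borel"
      and 2: "(\<lambda>z. (snd z, fst z)) \<in> lborel \<Otimes>\<^sub>M lborel \<rightarrow>\<^sub>M borel \<Otimes>\<^sub>M (borel :: complex measure)" by measurable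
    show "(\<lambda>z. p x (snd z)) \<in> borel_measurable (lborel \<Otimes>\<^sub>M lborel)" using measurable_compose[OF 1 assms(1)] by simp
    show "(\<lambda>z. q (snd z) (fst z)) \<in> borel_measurable (lborel \<Otimes>\<^sub>M lborel)" using measurable_compose[OF 2 assms(2)] by simp
  qed
  hence m: "(\<lambda>(y, u). ennreal (p x u * q u y)) \<in> borel_measurable (lborel \<Otimes>\<^sub>M lborel)"
    unfolding case_prod_unfold by measurable
  have "(\<integral>\<^sup>+y. \<integral>\<^sup>+u. ennreal (p x u * q u y) \<partial>lborel \<partial>lborel) = (\<integral>\<^sup>+u. \<integral>\<^sup>+y. ennreal (p x u * q u y) \<partial>lborel \<partial>lborel)"
    using lborel_pair.Fubini'[OF m] by simp
  also have "\<dots> = (\<integral>\<^sup>+u. ennreal (p x u) * (\<integral>\<^sup>+y. ennreal (q u y) \<partial>lborel) \<partial>lborel)"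
    using nn by (simp add: ennreal_mult nn_integral_cmult)
  also have "\<dots> \<le> (\<integral>\<^sup>+u. ennreal (p x u) * R \<partial>lborel)" by (intro nn_integral_mono mult_left_mono q) simp
  also have "\<dots> = (\<integral>\<^sup>+u. ennreal (p x u) \<partial>lborel) * R" by (rule nn_integral_multc) simp
  also have "\<dots> \<le> P * R" by (intro mult_right_mono p) simp
  finally show ?thesis .
qed

lemma kernel_bound_comp_row:
  assumes k: "kernel_bound \<rho> \<beta> c k" and h: "kernel_bound \<rho> \<beta> d h"
  shows "(\<integral>\<^sup>+y. ennreal (cmod (\<integral>u. k x u * h u y \<partial>lborel)) \<partial>lborel) \<le> ennreal (c * d)"
    "(\<integral>\<^sup>+y. ennreal (cmod (x - y) ^ 3 * cmod (\<integral>u. k x u * h u y \<partial>lborel)) \<partial>lborel) \<le> ennreal (8 * c * d) * \<beta>"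
proof -
  have cd: "0 \<le> c" "0 \<le> d" by (rule kernel_boundD[OF k], rule kernel_boundD[OF h])
  have km: "(\<lambda>(x, y). cmod (k x y)) \<in> borel_measurable (borel \<Otimes>\<^sub>M borel)" and hm: "(\<lambda>(x, y). cmod (h x y)) \<in> borel_measurable (borel \<Otimes>\<^sub>M borel)"
    using measurable_compose[OF kernel_boundD(1)[OF k] borel_measurable_norm]
      measurable_compose[OF kernel_boundD(1)[OF h] borel_measurable_norm] by (simp_all add: case_prod_unfold)
  have dm: "(\<lambda>(x, y). cmod (x - y) ^ 3) \<in> borel_measurable (borel \<Otimes>\<^sub>M (borel :: complex measure))" by measurable
  have dkm: "(\<lambda>(x, y). cmod (x - y) ^ 3 * cmod (k x y)) \<in> borel_measurable (borel \<Otimes>\<^sub>M borel)"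
    and dhm: "(\<lambda>(x, y). cmod (x - y) ^ 3 * cmod (h x y)) \<in> borel_measurable (borel \<Otimes>\<^sub>M borel)"
    using borel_measurable_times[OF dm km] borel_measurable_times[OF dm hm] by (simp_all add: case_prod_unfold)
  have "(\<integral>\<^sup>+y. ennreal (cmod (\<integral>u. k x u * h u y \<partial>lborel)) \<partial>lborel) \<le> (\<integral>\<^sup>+y. \<integral>\<^sup>+u. ennreal (cmod (k x u) * cmod (h u y)) \<partial>lborel \<partial>lborel)"
    by (intro nn_integral_mono order_trans[OF norm_integral_ennreal]) (simp add: norm_mult)
  also have "\<dots> \<le> ennreal c * ennreal d"
    by (rule nn_integral_comp_le[OF km hm]) (auto intro: kernel_boundD(4)[OF k] kernel_boundD(4)[OF h])
  finally show "(\<integral>\<^sup>+y. ennreal (cmod (\<integral>u. k x u * h u y \<partial>lborel)) \<partial>lborel) \<le> ennreal (c * d)"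
    using cd by (simp add: ennreal_mult)
  note [measurable] = kernel_bound_measurable[OF k] kernel_bound_measurable[OF h]
  let ?A = "\<lambda>y u. ennreal (cmod (x - u) ^ 3 * cmod (k x u) * cmod (h u y))"
  let ?B = "\<lambda>y u. ennreal (cmod (k x u) * (cmod (u - y) ^ 3 * cmod (h u y)))"
  have meas: "(\<lambda>y. \<integral>\<^sup>+u. ?A y u \<partial>lborel) \<in> borel_measurable lborel" "(\<lambda>y. \<integral>\<^sup>+u. ?B y u \<partial>lborel) \<in> borel_measurable lborel"
    by (intro lborel.borel_measurable_nn_integral; measurable)+
  have "(\<integral>\<^sup>+y. ennreal (cmod (x - y) ^ 3 * cmod (\<integral>u. k x u * h u y \<partial>lborel)) \<partial>lborel) \<le>
      (\<integral>\<^sup>+y. 4 * (\<integral>\<^sup>+u. ?A y u \<partial>lborel) + 4 * (\<integral>\<^sup>+u. ?B y u \<partial>lborel) \<partial>lborel)"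
  proof (rule nn_integral_mono)
    fix y
    have "ennreal (cmod (x - y) ^ 3 * cmod (\<integral>u. k x u * h u y \<partial>lborel)) \<le>
        ennreal (cmod (x - y) ^ 3) * (\<integral>\<^sup>+u. ennreal (cmod (k x u * h u y)) \<partial>lborel)"
      unfolding ennreal_mult''[OF norm_ge_zero] by (intro mult_left_mono norm_integral_ennreal) simp
    also have "\<dots> = (\<integral>\<^sup>+u. ennreal (cmod (x - y) ^ 3) * ennreal (cmod (k x u * h u y)) \<partial>lborel)"
      by (rule nn_integral_cmult[symmetric]) measurable
    also have "\<dots> \<le> (\<integral>\<^sup>+u. 4 * ?A y u + 4 * ?B y u \<partial>lborel)"
    proof (rule nn_integral_mono)
      fix u
      have "cmod (x - y) ^ 3 * cmod (k x u * h u y) \<le> 4 * (cmod (x - u) ^ 3 + cmod (u - y) ^ 3) * cmod (k x u * h u y)"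
        by (intro mult_right_mono cube_dist_le) simp
      also have "\<dots> = 4 * (cmod (x - u) ^ 3 * cmod (k x u) * cmod (h u y)) + 4 * (cmod (k x u) * (cmod (u - y) ^ 3 * cmod (h u y)))"
        by (simp add: norm_mult algebra_simps)
      finally have "ennreal (cmod (x - y) ^ 3 * cmod (k x u * h u y)) \<le>
          ennreal (4 * (cmod (x - u) ^ 3 * cmod (k x u) * cmod (h u y)) + 4 * (cmod (k x u) * (cmod (u - y) ^ 3 * cmod (h u y))))"
        by (rule ennreal_leI)
      also have "\<dots> = 4 * ?A y u + 4 * ?B y u" by (simp add: ennreal_mult)
      finally show "ennreal (cmod (x - y) ^ 3) * ennreal (cmod (k x u * h u y)) \<le> 4 * ?A y u + 4 * ?B y u"
        by (simp add: ennreal_mult)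
    qed
    also have "\<dots> = 4 * (\<integral>\<^sup>+u. ?A y u \<partial>lborel) + 4 * (\<integral>\<^sup>+u. ?B y u \<partial>lborel)"
      by (subst nn_integral_add) (measurable, simp add: nn_integral_cmult)
    finally show "ennreal (cmod (x - y) ^ 3 * cmod (\<integral>u. k x u * h u y \<partial>lborel)) \<le> 4 * (\<integral>\<^sup>+u. ?A y u \<partial>lborel) + 4 * (\<integral>\<^sup>+u. ?B y u \<partial>lborel)" .
  qed
  also have "\<dots> = 4 * (\<integral>\<^sup>+y. \<integral>\<^sup>+u. ?A y u \<partial>lborel \<partial>lborel) + 4 * (\<integral>\<^sup>+y. \<integral>\<^sup>+u. ?B y u \<partial>lborel \<partial>lborel)"
    using meas by (simp add: nn_integral_add nn_integral_cmult)
  also have "\<dots> \<le> 4 * (ennreal c * \<beta> * ennreal d) + 4 * (ennreal c * (ennreal d * \<beta>))"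
  proof (intro add_mono mult_left_mono)
    show "(\<integral>\<^sup>+y. \<integral>\<^sup>+u. ?A y u \<partial>lborel \<partial>lborel) \<le> ennreal c * \<beta> * ennreal d"
      by (rule nn_integral_comp_le[OF dkm hm]) (auto intro: kernel_boundD(6)[OF k] kernel_boundD(4)[OF h])
    show "(\<integral>\<^sup>+y. \<integral>\<^sup>+u. ?B y u \<partial>lborel \<partial>lborel) \<le> ennreal c * (ennreal d * \<beta>)"
      by (rule nn_integral_comp_le[OF km dhm]) (auto intro: kernel_boundD(4)[OF k] kernel_boundD(6)[OF h])
  qed auto
  also have "\<dots> = ennreal (8 * c * d) * \<beta>"
  proof -
    have "ennreal (8 * c * d) = 4 * (ennreal c * ennreal d) + 4 * (ennreal c * ennreal d)"
      using cd by (simp add: ennreal_mult mult.assoc flip: distrib_right)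
    thus ?thesis by (simp add: distrib_right distrib_left mult_ac)
  qed
  finally show "(\<integral>\<^sup>+y. ennreal (cmod (x - y) ^ 3 * cmod (\<integral>u. k x u * h u y \<partial>lborel)) \<partial>lborel) \<le> ennreal (8 * c * d) * \<beta>" .
qed

text \<open>
  By \<open>|x - y|\<^sup>3 \<le> 4 (|x - u|\<^sup>3 + |u - y|\<^sup>3)\<close>, the third moment of a composition is linear in the
  third moments of the factors. Hence \<open>\<beta>\<close> enters to the first power, however many kernels are
  composed.
\<close>

lemma kernel_bound_comp:
  assumes k: "kernel_bound \<rho> \<beta> c k" and h: "kernel_bound \<rho> \<beta> d h"
  shows "kernel_bound \<rho> \<beta> (8 * c * d) (\<lambda>x y. \<integral>u. k x u * h u y \<partial>lborel)"
proof -
  have cd: "0 \<le> c" "0 \<le> d" by (rule kernel_boundD[OF k], rule kernel_boundD[OF h])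
  have cd8: "c * d \<le> 8 * c * d" using mult_nonneg_nonneg[OF cd] by simp
  have "0 \<le> d * \<rho>" using kernel_boundD(3)[OF h] norm_ge_zero order_trans by blast
  hence cdr: "0 \<le> c * (d * \<rho>)" using cd by simp
  note [measurable] = kernel_bound_measurable[OF k] kernel_bound_measurable[OF h]
  have "(\<lambda>p. \<integral>u. k (fst p) u * h u (snd p) \<partial>lborel) \<in> borel_measurable (borel \<Otimes>\<^sub>M borel)"
    by (intro lborel.borel_measurable_lebesgue_integral) measurable
  hence "(\<lambda>(x, y). \<integral>u. k x u * h u y \<partial>lborel) \<in> borel_measurable (borel \<Otimes>\<^sub>M borel)" by (simp add: case_prod_unfold)
  moreover have "cmod (\<integral>u. k x u * h u y \<partial>lborel) \<le> 8 * c * d * \<rho>" for x y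
  proof -
    have "ennreal (cmod (\<integral>u. k x u * h u y \<partial>lborel)) \<le> ennreal (c * d * \<rho>)"
      by (rule order_trans[OF norm_integral_ennreal kernel_bound_integrable(2)[OF k h]])
    thus ?thesis using cdr by (simp add: mult_ac ennreal_le_iff)
  qed
  moreover have "(\<integral>\<^sup>+y. ennreal (cmod (\<integral>u. k x u * h u y \<partial>lborel)) \<partial>lborel) \<le> ennreal (8 * c * d)"
    "(\<integral>\<^sup>+y. ennreal (cmod (\<integral>u. k y u * h u x \<partial>lborel)) \<partial>lborel) \<le> ennreal (8 * c * d)" for x
    using order_trans[OF kernel_bound_comp_row(1)[OF k h, of x] ennreal_leI[OF cd8]]
      order_trans[OF kernel_bound_comp_row(1)[OF kernel_bound_transpose[OF h] kernel_bound_transpose[OF k], of x] ennreal_leI[of "d * c" "8 * c * d"]] cd8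
    by (simp_all add: mult.commute[of "h _ _"] mult.commute[of d c])
  moreover have "(\<integral>\<^sup>+y. ennreal (cmod (x - y) ^ 3 * cmod (\<integral>u. k x u * h u y \<partial>lborel)) \<partial>lborel) \<le> ennreal (8 * c * d) * \<beta>"
    "(\<integral>\<^sup>+y. ennreal (cmod (y - x) ^ 3 * cmod (\<integral>u. k y u * h u x \<partial>lborel)) \<partial>lborel) \<le> ennreal (8 * c * d) * \<beta>" for x
  proof -
    show "(\<integral>\<^sup>+y. ennreal (cmod (x - y) ^ 3 * cmod (\<integral>u. k x u * h u y \<partial>lborel)) \<partial>lborel) \<le> ennreal (8 * c * d) * \<beta>"
      by (rule kernel_bound_comp_row(2)[OF k h])
    have "(\<integral>u. k y u * h u x \<partial>lborel) = (\<integral>u. h u x * k y u \<partial>lborel)" for y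
      by (intro Bochner_Integration.integral_cong refl mult.commute)
    hence "(\<integral>\<^sup>+y. ennreal (cmod (y - x) ^ 3 * cmod (\<integral>u. k y u * h u x \<partial>lborel)) \<partial>lborel) =
        (\<integral>\<^sup>+y. ennreal (cmod (x - y) ^ 3 * cmod (\<integral>u. h u x * k y u \<partial>lborel)) \<partial>lborel)"
      by (simp only: norm_minus_commute[of x])
    also have "\<dots> \<le> ennreal (8 * d * c) * \<beta>"
      by (rule kernel_bound_comp_row(2)[OF kernel_bound_transpose[OF h] kernel_bound_transpose[OF k]])
    finally show "(\<integral>\<^sup>+y. ennreal (cmod (y - x) ^ 3 * cmod (\<integral>u. k y u * h u x \<partial>lborel)) \<partial>lborel) \<le> ennreal (8 * c * d) * \<beta>"
      by (simp only: mult.assoc mult.commute[of d c])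
  qed
  ultimately show ?thesis unfolding kernel_bound_def using cd by auto
qed

section \<open>Composition of kernels with power series coefficients\<close>

definition fcomp :: "(complex \<Rightarrow> complex \<Rightarrow> complex fps) \<Rightarrow> (complex \<Rightarrow> complex \<Rightarrow> complex fps) \<Rightarrow> complex \<Rightarrow> complex \<Rightarrow> complex fps" where
  "fcomp Y Z x y = fint lborel (\<lambda>u. Y x u * Z u y)"

text \<open>
  The constants may depend on the coefficient, so no convergence of the series is implied.
\<close>

definition fkernel :: "real \<Rightarrow> ennreal \<Rightarrow> (complex \<Rightarrow> complex \<Rightarrow> complex fps) \<Rightarrow> bool" where
  "fkernel \<rho> \<beta> Z \<longleftrightarrow> (\<forall>k. \<exists>c. kernel_bound \<rho> \<beta> c (\<lambda>x y. Z x y $ k))"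

lemma fkernelD: "fkernel \<rho> \<beta> Z \<Longrightarrow> \<exists>c. kernel_bound \<rho> \<beta> c (\<lambda>x y. Z x y $ k)"
  by (simp add: fkernel_def)

lemma fkernel_const:
  assumes "kernel_bound \<rho> \<beta> c k" shows "fkernel \<rho> \<beta> (\<lambda>x y. fps_const (k x y))"
  unfolding fkernel_def
proof
  fix n :: nat
  show "\<exists>c. kernel_bound \<rho> \<beta> c (\<lambda>x y. fps_const (k x y) $ n)"
    using assms kernel_bound_0[of \<rho> \<beta>] by (cases n) auto
qed

lemma kernel_bound_minus: "kernel_bound \<rho> \<beta> c k \<Longrightarrow> kernel_bound \<rho> \<beta> c (\<lambda>x y. - k x y)"
  using kernel_bound_mult[of \<rho> \<beta> c k "\<lambda>_ _. - 1" 1] by simp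

lemma fkernel_diff:
  assumes "fkernel \<rho> \<beta> Y" "fkernel \<rho> \<beta> Z" shows "fkernel \<rho> \<beta> (\<lambda>x y. Y x y - Z x y)"
  unfolding fkernel_def
proof
  fix k
  obtain c d where "kernel_bound \<rho> \<beta> c (\<lambda>x y. Y x y $ k)" "kernel_bound \<rho> \<beta> d (\<lambda>x y. Z x y $ k)"
    using fkernelD[OF assms(1)] fkernelD[OF assms(2)] by blast
  from kernel_bound_add[OF this(1) kernel_bound_minus[OF this(2)]]
  show "\<exists>c. kernel_bound \<rho> \<beta> c (\<lambda>x y. (Y x y - Z x y) $ k)" by auto
qed

lemma fkernel_deriv:
  assumes "fkernel \<rho> \<beta> Z" shows "fkernel \<rho> \<beta> (\<lambda>x y. fps_deriv (Z x y))"
  unfolding fkernel_def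
proof
  fix k
  obtain c where "kernel_bound \<rho> \<beta> c (\<lambda>x y. Z x y $ (k + 1))" using fkernelD[OF assms] by blast
  from kernel_bound_mult[OF this, of "\<lambda>_ _. of_nat (k + 1)" "real (k + 1)"]
  show "\<exists>c. kernel_bound \<rho> \<beta> c (\<lambda>x y. fps_deriv (Z x y) $ k)" by (auto simp del: of_nat_Suc)
qed

lemma fkernel_mult_right:
  assumes Z: "fkernel \<rho> \<beta> Z" and w: "bounded_coeffs borel w"
  shows "fkernel \<rho> \<beta> (\<lambda>x y. Z x y * w y)"
  unfolding fkernel_def
proof
  fix k
  obtain c where c: "\<And>i. kernel_bound \<rho> \<beta> (c i) (\<lambda>x y. Z x y $ i)" using fkernelD[OF Z] by metis
  obtain C where C: "\<And>i y. norm (w y $ i) \<le> C i" using w unfolding bounded_coeffs_def by metis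
  have wm: "(\<lambda>(x, y). w y $ i) \<in> borel_measurable (borel \<Otimes>\<^sub>M borel)" for i
  proof -
    have "(\<lambda>y. w y $ i) \<in> borel_measurable borel" using w by (simp add: bounded_coeffs_def)
    from measurable_compose[OF measurable_snd this] show ?thesis by (simp add: case_prod_unfold)
  qed
  have "kernel_bound \<rho> \<beta> (\<Sum>i=0..k. C (k - i) * c i) (\<lambda>x y. \<Sum>i=0..k. w y $ (k - i) * Z x y $ i)"
    by (intro kernel_bound_sum kernel_bound_mult[OF c wm C]) simp
  moreover have "(Z x y * w y) $ k = (\<Sum>i=0..k. w y $ (k - i) * Z x y $ i)" for x y
    unfolding fps_mult_nth by (intro sum.cong refl mult.commute)
  ultimately show "\<exists>c. kernel_bound \<rho> \<beta> c (\<lambda>x y. (Z x y * w y) $ k)" by auto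
qed

lemma fintegrable_fcomp:
  assumes "fkernel \<rho> \<beta> Y" "fkernel \<rho> \<beta> Z" shows "fintegrable lborel (\<lambda>u. Y x u * Z u y)"
  unfolding fintegrable_def fps_mult_nth
proof (intro allI Bochner_Integration.integrable_sum)
  fix k i
  obtain c d where "kernel_bound \<rho> \<beta> c (\<lambda>x y. Y x y $ i)" "kernel_bound \<rho> \<beta> d (\<lambda>x y. Z x y $ (k - i))"
    using fkernelD[OF assms(1)] fkernelD[OF assms(2)] by blast
  from kernel_bound_integrable(1)[OF this] show "integrable lborel (\<lambda>u. Y x u $ i * Z u y $ (k - i))" .
qed

lemma fcomp_nth:
  assumes "fkernel \<rho> \<beta> Y" "fkernel \<rho> \<beta> Z"
  shows "fcomp Y Z x y $ k = (\<Sum>i=0..k. \<integral>u. Y x u $ i * Z u y $ (k - i) \<partial>lborel)"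
  unfolding fcomp_def fint_nth fps_mult_nth
proof (rule Bochner_Integration.integral_sum)
  fix i
  obtain c d where "kernel_bound \<rho> \<beta> c (\<lambda>x y. Y x y $ i)" "kernel_bound \<rho> \<beta> d (\<lambda>x y. Z x y $ (k - i))"
    using fkernelD[OF assms(1)] fkernelD[OF assms(2)] by blast
  from kernel_bound_integrable(1)[OF this] show "integrable lborel (\<lambda>u. Y x u $ i * Z u y $ (k - i))" .
qed

lemma fkernel_fcomp:
  assumes "fkernel \<rho> \<beta> Y" "fkernel \<rho> \<beta> Z" shows "fkernel \<rho> \<beta> (fcomp Y Z)"
  unfolding fkernel_def
proof
  fix k
  obtain c where c: "\<And>i. kernel_bound \<rho> \<beta> (c i) (\<lambda>x y. Y x y $ i)" using fkernelD[OF assms(1)] by metis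
  obtain d where d: "\<And>i. kernel_bound \<rho> \<beta> (d i) (\<lambda>x y. Z x y $ i)" using fkernelD[OF assms(2)] by metis
  have "kernel_bound \<rho> \<beta> (\<Sum>i=0..k. 8 * c i * d (k - i)) (\<lambda>x y. \<Sum>i=0..k. \<integral>u. Y x u $ i * Z u y $ (k - i) \<partial>lborel)"
    by (intro kernel_bound_sum kernel_bound_comp c d) simp
  thus "\<exists>c. kernel_bound \<rho> \<beta> c (\<lambda>x y. fcomp Y Z x y $ k)" unfolding fcomp_nth[OF assms] by blast
qed

lemma fcomp_diff_left:
  assumes "fkernel \<rho> \<beta> X" "fkernel \<rho> \<beta> Y" "fkernel \<rho> \<beta> Z"
  shows "fcomp (\<lambda>x y. X x y - Y x y) Z x y = fcomp X Z x y - fcomp Y Z x y"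
  unfolding fcomp_def left_diff_distrib
  by (rule fint_diff[OF fintegrable_fcomp[OF assms(1,3)] fintegrable_fcomp[OF assms(2,3)]])

lemma fcomp_diff_right:
  assumes "fkernel \<rho> \<beta> X" "fkernel \<rho> \<beta> Y" "fkernel \<rho> \<beta> Z"
  shows "fcomp Z (\<lambda>x y. X x y - Y x y) x y = fcomp Z X x y - fcomp Z Y x y"
  unfolding fcomp_def right_diff_distrib
  by (rule fint_diff[OF fintegrable_fcomp[OF assms(3,1)] fintegrable_fcomp[OF assms(3,2)]])

lemma fcomp_mult_right:
  assumes "fkernel \<rho> \<beta> Y" "fkernel \<rho> \<beta> Z"
  shows "fcomp Y (\<lambda>x y. Z x y * w y) x y = fcomp Y Z x y * w y"
proof -
  have "fcomp Y (\<lambda>x y. Z x y * w y) x y = fint lborel (\<lambda>u. w y * (Y x u * Z u y))"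
    unfolding fcomp_def by (intro fint_cong) (simp add: mult_ac)
  also have "\<dots> = w y * fcomp Y Z x y" unfolding fcomp_def by (rule fint_mult_left[OF fintegrable_fcomp[OF assms]])
  finally show ?thesis by (simp add: mult.commute)
qed

lemma fcomp_deriv:
  assumes "fkernel \<rho> \<beta> Y" "fkernel \<rho> \<beta> Z"
  shows "fps_deriv (fcomp Y Z x y) = fcomp (\<lambda>x y. fps_deriv (Y x y)) Z x y + fcomp Y (\<lambda>x y. fps_deriv (Z x y)) x y"
proof -
  have "fps_deriv (fcomp Y Z x y) = fint lborel (\<lambda>u. fps_deriv (Y x u) * Z u y + Y x u * fps_deriv (Z u y))"
    unfolding fcomp_def fint_deriv by (intro fint_cong) (simp add: add.commute)
  also have "\<dots> = fcomp (\<lambda>x y. fps_deriv (Y x y)) Z x y + fcomp Y (\<lambda>x y. fps_deriv (Z x y)) x y"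
    unfolding fcomp_def
    by (rule fint_add[OF fintegrable_fcomp[OF fkernel_deriv[OF assms(1)] assms(2)] fintegrable_fcomp[OF assms(1) fkernel_deriv[OF assms(2)]]])
  finally show ?thesis .
qed

lemma fint_pair:
  assumes "fintegrable (lborel \<Otimes>\<^sub>M lborel) (\<lambda>(u, v). H u v)"
  shows "fint (lborel \<Otimes>\<^sub>M lborel) (\<lambda>(u, v). H u v) = fint lborel (\<lambda>u. fint (lborel :: complex measure) (\<lambda>v. H u v))"
    "fint (lborel \<Otimes>\<^sub>M lborel) (\<lambda>(u, v). H u v) = fint lborel (\<lambda>v. fint (lborel :: complex measure) (\<lambda>u. H u v))"
proof -
  have "integrable (lborel \<Otimes>\<^sub>M lborel) (\<lambda>(u, v). H u v $ k)" for k
    using assms by (simp add: fintegrable_def case_prod_unfold)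
  from lborel_pair.integral_fst'[OF this] lborel_pair.integral_snd[OF this]
  show "fint (lborel \<Otimes>\<^sub>M lborel) (\<lambda>(u, v). H u v) = fint lborel (\<lambda>u. fint lborel (\<lambda>v. H u v))"
    "fint (lborel \<Otimes>\<^sub>M lborel) (\<lambda>(u, v). H u v) = fint lborel (\<lambda>v. fint lborel (\<lambda>u. H u v))"
    by (simp_all add: fps_eq_iff fint_nth case_prod_unfold)
qed

lemma kernel_bound_triple_integrable:
  assumes p: "kernel_bound \<rho> \<beta> a p" and q: "kernel_bound \<rho> \<beta> b q" and r: "kernel_bound \<rho> \<beta> c r"
  shows "integrable (lborel \<Otimes>\<^sub>M lborel) (\<lambda>(u, v). p x u * q u v * r v y)"
proof (rule integrableI_bounded)
  note [measurable] = kernel_bound_measurable[OF p] kernel_bound_measurable[OF q] kernel_bound_measurable[OF r]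
  show m: "(\<lambda>(u, v). p x u * q u v * r v y) \<in> borel_measurable (lborel \<Otimes>\<^sub>M lborel)"
    unfolding case_prod_unfold by measurable
  have "(\<integral>\<^sup>+z. ennreal (cmod (case z of (u, v) \<Rightarrow> p x u * q u v * r v y)) \<partial>(lborel \<Otimes>\<^sub>M lborel)) =
      (\<integral>\<^sup>+u. \<integral>\<^sup>+v. ennreal (cmod (p x u * q u v * r v y)) \<partial>lborel \<partial>lborel)"
  proof -
    have "(\<lambda>z. ennreal (cmod (case z of (u, v) \<Rightarrow> p x u * q u v * r v y))) \<in> borel_measurable (lborel \<Otimes>\<^sub>M lborel)" using m by measurable
    from lborel.nn_integral_fst[OF this] show ?thesis by simp
  qed
  also have "\<dots> = (\<integral>\<^sup>+u. ennreal (cmod (p x u)) * (\<integral>\<^sup>+v. ennreal (cmod (q u v * r v y)) \<partial>lborel) \<partial>lborel)"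
    by (intro nn_integral_cong) (simp add: norm_mult mult.assoc ennreal_mult nn_integral_cmult[symmetric])
  also have "\<dots> \<le> (\<integral>\<^sup>+u. ennreal (cmod (p x u)) * ennreal (b * c * \<rho>) \<partial>lborel)"
    by (intro nn_integral_mono mult_left_mono kernel_bound_integrable(2)[OF q r]) simp
  also have "\<dots> = (\<integral>\<^sup>+u. ennreal (cmod (p x u)) \<partial>lborel) * ennreal (b * c * \<rho>)" by (rule nn_integral_multc) simp
  also have "\<dots> \<le> ennreal a * ennreal (b * c * \<rho>)" by (intro mult_right_mono kernel_boundD(4)[OF p]) simp
  also have "\<dots> < \<infinity>" by (simp add: ennreal_mult_less_top)
  finally show "(\<integral>\<^sup>+z. ennreal (cmod (case z of (u, v) \<Rightarrow> p x u * q u v * r v y)) \<partial>(lborel \<Otimes>\<^sub>M lborel)) < \<infinity>" .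
qed

lemma fcomp_assoc:
  assumes X: "fkernel \<rho> \<beta> X" and Y: "fkernel \<rho> \<beta> Y" and Z: "fkernel \<rho> \<beta> Z"
  shows "fcomp (fcomp X Y) Z x y = fcomp X (fcomp Y Z) x y"
proof -
  have int: "fintegrable (lborel \<Otimes>\<^sub>M lborel) (\<lambda>(u, v). X x u * Y u v * Z v y)"
    unfolding fintegrable_def case_prod_unfold fps_mult_nth sum_distrib_right
  proof (intro allI Bochner_Integration.integrable_sum)
    fix k i j
    obtain a b c where "kernel_bound \<rho> \<beta> a (\<lambda>x y. X x y $ j)" "kernel_bound \<rho> \<beta> b (\<lambda>x y. Y x y $ (i - j))"
      "kernel_bound \<rho> \<beta> c (\<lambda>x y. Z x y $ (k - i))" using fkernelD[OF X] fkernelD[OF Y] fkernelD[OF Z] by blast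
    from kernel_bound_triple_integrable[OF this]
    show "integrable (lborel \<Otimes>\<^sub>M lborel) (\<lambda>p. X x (fst p) $ j * Y (fst p) (snd p) $ (i - j) * Z (snd p) y $ (k - i))"
      by (simp add: case_prod_unfold)
  qed
  have "fcomp (fcomp X Y) Z x y = fint lborel (\<lambda>v. Z v y * fint lborel (\<lambda>u. X x u * Y u v))"
    unfolding fcomp_def by (simp add: mult.commute)
  also have "\<dots> = fint lborel (\<lambda>v. fint lborel (\<lambda>u. X x u * Y u v * Z v y))"
    unfolding fint_mult_left[OF fintegrable_fcomp[OF X Y], symmetric] by (simp add: mult_ac)
  also have "\<dots> = fint lborel (\<lambda>u. fint lborel (\<lambda>v. X x u * Y u v * Z v y))"
    unfolding fint_pair(2)[OF int, symmetric] fint_pair(1)[OF int] ..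
  also have "\<dots> = fint lborel (\<lambda>u. X x u * fint lborel (\<lambda>v. Y u v * Z v y))"
    unfolding fint_mult_left[OF fintegrable_fcomp[OF Y Z], symmetric] by (simp add: mult_ac)
  finally show ?thesis unfolding fcomp_def .
qed

section \<open>The tilted projections\<close>

text \<open>
  The recursion mirrors the equation \<open>Q = K (1 + G) - KG Q\<close>; the factor \<open>8\<close> is the cost of a
  composition.
\<close>

fun tilted_bound :: "real \<Rightarrow> real \<Rightarrow> nat \<Rightarrow> real" where
  "tilted_bound A m k = m ^ k * A + (\<Sum>i<k. 8 * (m ^ (k - i) * A) * tilted_bound A m i)"

declare tilted_bound.simps [simp del]

locale projection_weight = kernel_weight K \<Phi> f m B
  for K \<Phi> f m B +
  fixes \<rho> :: real and \<beta> :: ennreal and A :: real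
  assumes K_bound: "kernel_bound \<rho> \<beta> A K" and K_proj: "\<And>x y. K x y = (\<integral>u. K x u * K u y \<partial>lborel)"
begin

abbreviation "Kc \<equiv> (\<lambda>x y. fps_const (K x y))"
abbreviation "KG \<equiv> (\<lambda>x y. fps_const (K x y) * G y)"

text \<open>
  The kernel \<open>(1 + KG)\<^sup>-\<^sup>1 K (1 + G)\<close>, where \<open>(1 + KG)\<^sup>-\<^sup>1 K\<close> is the quotient of the Fredholm
  minor by the Fredholm determinant.
\<close>

definition Q :: "complex \<Rightarrow> complex \<Rightarrow> complex fps" where "Q x y = minor x y * (1 + G y) * inverse fred"

lemma bounded_coeffs_minor: "bounded_coeffs borel (\<lambda>u. minor u b)"
  unfolding bounded_coeffs_def
proof (intro allI conjI)
  fix k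
  have eq: "minor u b $ k = (\<Sum>n<Suc k. 1 / fact n * minor_term n u b $ k)" for u
    by (simp add: minor_def minor_upto_def fps_sum_nth)
  have *: "(\<lambda>u. minor_term n u b $ k) \<in> borel_measurable borel" for n using bounded_coeffs_minor_term[of n b] by (simp add: bounded_coeffs_def)
  show "(\<lambda>u. minor u b $ k) \<in> borel_measurable borel"
    unfolding eq by (intro borel_measurable_sum borel_measurable_times borel_measurable_const *)
  obtain C where C: "\<And>n u. norm (minor_term n u b $ k) \<le> C n" using minor_term_bounded[of _ k] by metis
  have "norm (minor u b $ k) \<le> (\<Sum>n<Suc k. 1 / fact n * C n)" for u
    unfolding eq by (intro sum_norm_le) (auto simp: norm_mult norm_divide intro!: mult_left_mono divide_right_mono C)
  thus "\<exists>C. \<forall>u. norm (minor u b $ k) \<le> C" by blast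
qed

lemma fred_inverse: "fred * inverse fred = 1"
  by (rule inverse_mult_eq_1') (simp add: fred_0)

lemma fintegrable_KG_minor: "fintegrable lborel (\<lambda>u. KG a u * minor u b)"
  by (intro fintegrable_supp bounded_coeffs_mult bounded_coeffs_K bounded_coeffs_G bounded_coeffs_minor) (simp add: f_supp)

lemma Q_eq: "Q x y = Kc x y * (1 + G y) - fcomp KG Q x y"
proof -
  let ?c = "(1 + G y) * inverse fred"
  have "fcomp KG Q x y = fint lborel (\<lambda>u. ?c * (KG x u * minor u y))"
    unfolding fcomp_def Q_def by (intro fint_cong) (simp add: mult_ac)
  also have "\<dots> = ?c * fint lborel (\<lambda>u. KG x u * minor u y)" by (rule fint_mult_left[OF fintegrable_KG_minor])
  finally have 1: "fcomp KG Q x y = ?c * fint lborel (\<lambda>u. KG x u * minor u y)" .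
  have "Q x y = ?c * minor x y" by (simp add: Q_def mult_ac)
  also have "\<dots> = Kc x y * (1 + G y) * (fred * inverse fred) - ?c * fint lborel (\<lambda>u. KG x u * minor u y)"
    unfolding minor_eq[of x y] by (simp add: algebra_simps)
  finally show ?thesis unfolding 1 fred_inverse by simp
qed

lemma KG_bound: "kernel_bound \<rho> \<beta> (m ^ i * A) (\<lambda>x y. KG x y $ i)"
proof -
  have "(\<lambda>p. G (snd p) $ i) \<in> borel_measurable (borel \<Otimes>\<^sub>M borel)"
    by (rule measurable_compose[OF measurable_snd G_meas])
  hence "kernel_bound \<rho> \<beta> (m ^ i * A) (\<lambda>x y. G y $ i * K x y)"
    by (intro kernel_bound_mult[OF K_bound] norm_G_le) (simp add: case_prod_unfold)
  thus ?thesis by (simp add: mult.commute)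
qed

lemma norm_1_G_le: "norm ((1 + G y) $ k) \<le> m ^ k"
  using norm_G_le[of y k] by (cases "k = 0") (auto simp: expm1_fps_nth)

lemma K1G_bound: "kernel_bound \<rho> \<beta> (m ^ k * A) (\<lambda>x y. (Kc x y * (1 + G y)) $ k)"
proof -
  have "(\<lambda>z. (1 + G z) $ k) \<in> borel_measurable borel" using G_meas[of k] by (cases "k = 0") simp_all
  from measurable_compose[OF measurable_snd this]
  have "kernel_bound \<rho> \<beta> (m ^ k * A) (\<lambda>x y. (1 + G y) $ k * K x y)"
    by (intro kernel_bound_mult[OF K_bound] norm_1_G_le) (simp add: case_prod_unfold)
  thus ?thesis unfolding fps_mult_left_const_nth by (simp only: mult.commute)
qed

text \<open>
  Induction along \<open>Q = K (1 + G) - KG Q\<close>, where \<open>G\<close> has no constant term.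
  The constants do not depend on \<open>\<rho>\<close> and \<open>\<beta>\<close>: this is what makes the estimates uniform.
\<close>

lemma Q_bound: "kernel_bound \<rho> \<beta> (tilted_bound A m k) (\<lambda>x y. Q x y $ k)"
proof (induction k rule: less_induct)
  case (less k)
  have eq: "Q x y $ k = (Kc x y * (1 + G y)) $ k + (\<Sum>i<k. - (\<integral>u. KG x u $ (k - i) * Q u y $ i \<partial>lborel))" for x y
  proof -
    have "fcomp KG Q x y $ k = (\<integral>u. (\<Sum>i<k. KG x u $ (k - i) * Q u y $ i) \<partial>lborel)"
      unfolding fcomp_def fint_nth
    proof (intro Bochner_Integration.integral_cong refl)
      fix u
      have "(KG x u * Q u y) $ k = (\<Sum>i=0..k. Q u y $ i * KG x u $ (k - i))" unfolding mult.commute[of "KG x u"] fps_mult_nth ..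
      also have "\<dots> = (\<Sum>i<k. Q u y $ i * KG x u $ (k - i))"
        by (rule sum.mono_neutral_right) (auto simp: expm1_fps_nth not_less)
      finally show "(KG x u * Q u y) $ k = (\<Sum>i<k. KG x u $ (k - i) * Q u y $ i)" by (simp only: mult.commute)
    qed
    also have "\<dots> = (\<Sum>i<k. \<integral>u. KG x u $ (k - i) * Q u y $ i \<partial>lborel)"
      by (rule Bochner_Integration.integral_sum) (use kernel_bound_integrable(1)[OF KG_bound less] in auto)
    finally show ?thesis by (subst Q_eq) (simp add: sum_negf)
  qed
  have "kernel_bound \<rho> \<beta> (tilted_bound A m k) (\<lambda>x y. (Kc x y * (1 + G y)) $ k + (\<Sum>i<k. - (\<integral>u. KG x u $ (k - i) * Q u y $ i \<partial>lborel)))"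
    unfolding tilted_bound.simps[of A m k]
    by (intro kernel_bound_add K1G_bound kernel_bound_sum kernel_bound_minus kernel_bound_comp KG_bound less) auto
  thus ?case unfolding eq .
qed

lemma fk_Q: "fkernel \<rho> \<beta> Q" unfolding fkernel_def using Q_bound by blast
lemma fk_Kc: "fkernel \<rho> \<beta> Kc" by (rule fkernel_const[OF K_bound])
lemma fk_KG: "fkernel \<rho> \<beta> KG" unfolding fkernel_def using KG_bound by blast
lemma fk_K1G: "fkernel \<rho> \<beta> (\<lambda>x y. Kc x y * (1 + G y))" unfolding fkernel_def using K1G_bound by blast

lemma fcomp_KcKc: "fcomp Kc Kc = Kc"
  by (intro ext) (simp add: fcomp_def fps_eq_iff fint_nth K_proj[symmetric])

text \<open>
  \<open>K\<close> is a projection and both terms of \<open>Q = K (1 + G) - KG Q\<close> start with \<open>K\<close>.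
\<close>

lemma Kc_Q: "fcomp Kc Q x y = Q x y"
proof -
  have KKG: "fcomp Kc KG = KG"
    using fcomp_mult_right[OF fk_Kc fk_Kc, of G] by (intro ext) (simp add: fcomp_KcKc)
  have KK1G: "fcomp Kc (\<lambda>x y. Kc x y * (1 + G y)) x y = Kc x y * (1 + G y)"
    using fcomp_mult_right[OF fk_Kc fk_Kc, of "\<lambda>y. 1 + G y"] by (simp add: fcomp_KcKc)
  have "fcomp Kc Q x y = fcomp Kc (\<lambda>x y. Kc x y * (1 + G y) - fcomp KG Q x y) x y"
    by (intro arg_cong[where f = "\<lambda>Z. fcomp Kc Z x y"] ext Q_eq)
  also have "\<dots> = Kc x y * (1 + G y) - fcomp Kc (fcomp KG Q) x y"
    unfolding fcomp_diff_right[OF fk_K1G fkernel_fcomp[OF fk_KG fk_Q] fk_Kc] KK1G ..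
  also have "fcomp Kc (fcomp KG Q) x y = fcomp KG Q x y"
    using fcomp_assoc[OF fk_Kc fk_KG fk_Q, of x y] unfolding KKG by simp
  finally show ?thesis using Q_eq[of x y] by simp
qed

text \<open>Since \<open>KG\<close> has no constant coefficient, \<open>1 + KG\<close> is injective.\<close>

lemma fcomp_KG_unique:
  assumes "\<And>x y. Z x y = - fcomp KG Z x y"
  shows "Z x y = 0"
proof -
  have "\<forall>x y. Z x y $ k = 0" for k
  proof (induction k rule: less_induct)
    case (less k)
    have "(KG x u * Z u y) $ k = 0" for x u y
      unfolding fps_mult_nth[of _ "Z u y"]
    proof (intro sum.neutral ballI)
      fix i assume "i \<in> {0..k}"
      show "KG x u $ i * Z u y $ (k - i) = 0" using less[of "k - i"] \<open>i \<in> {0..k}\<close> by (cases "i = 0") (auto simp: expm1_fps_nth)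
    qed
    thus ?case by (subst assms) (simp add: fcomp_def fint_nth)
  qed
  thus ?thesis by (simp add: fps_eq_iff)
qed

text \<open>
  From \<open>K Q = Q\<close> one gets \<open>(1 + KG) Q Q = K (1 + G) Q = Q + KG Q = (1 + KG) Q\<close>, and \<open>1 + KG\<close> is
  injective.
\<close>

lemma Q_idem: "fcomp Q Q x y = Q x y"
proof -
  have QQ: "fcomp Q Q x y = Q x y + fcomp KG Q x y - fcomp KG (fcomp Q Q) x y" for x y
  proof -
    have K1G_Q: "fcomp (\<lambda>x y. Kc x y * (1 + G y)) Q x y = Q x y + fcomp KG Q x y"
    proof -
      have "fcomp (\<lambda>x y. Kc x y * (1 + G y)) Q x y = fint lborel (\<lambda>u. Kc x u * Q u y + KG x u * Q u y)"
        unfolding fcomp_def by (intro fint_cong) (simp add: algebra_simps)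
      also have "\<dots> = fcomp Kc Q x y + fcomp KG Q x y"
        unfolding fcomp_def by (rule fint_add[OF fintegrable_fcomp[OF fk_Kc fk_Q] fintegrable_fcomp[OF fk_KG fk_Q]])
      finally show ?thesis unfolding Kc_Q .
    qed
    have "fcomp Q Q x y = fcomp (\<lambda>x y. Kc x y * (1 + G y) - fcomp KG Q x y) Q x y"
      by (intro arg_cong[where f = "\<lambda>Z. fcomp Z Q x y"] ext Q_eq)
    also have "\<dots> = fcomp (\<lambda>x y. Kc x y * (1 + G y)) Q x y - fcomp (fcomp KG Q) Q x y"
      by (rule fcomp_diff_left[OF fk_K1G fkernel_fcomp[OF fk_KG fk_Q] fk_Q])
    finally show ?thesis unfolding K1G_Q fcomp_assoc[OF fk_KG fk_Q fk_Q] .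
  qed
  have "fcomp Q Q x y - Q x y = 0"
  proof (rule fcomp_KG_unique[where Z = "\<lambda>x y. fcomp Q Q x y - Q x y"])
    fix x y
    show "fcomp Q Q x y - Q x y = - fcomp KG (\<lambda>x y. fcomp Q Q x y - Q x y) x y"
      unfolding fcomp_diff_right[OF fkernel_fcomp[OF fk_Q fk_Q] fk_Q fk_KG] using QQ[of x y] by simp
  qed
  thus ?thesis by simp
qed

abbreviation fc :: "complex \<Rightarrow> complex fps" where "fc y \<equiv> fps_const (complex_of_real (f y))"
abbreviation "Qf \<equiv> (\<lambda>x y. Q x y * fc y)"
abbreviation "dQ \<equiv> (\<lambda>x y. fps_deriv (Q x y))"

lemma bounded_coeffs_fc: "bounded_coeffs borel fc"
  by (rule bounded_coeffs_const[where C = m]) (use f_bound in auto)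

lemma fk_Qf: "fkernel \<rho> \<beta> Qf" by (rule fkernel_mult_right[OF fk_Q bounded_coeffs_fc])
lemma fk_dQ: "fkernel \<rho> \<beta> dQ" by (rule fkernel_deriv[OF fk_Q])

text \<open>
  Differentiating \<open>(1 + KG) Q = K (1 + G)\<close> with \<open>G' = (1 + G) f\<close> gives
  \<open>(1 + KG) Q' = K (1 + G) f - K (1 + G) f Q = (1 + KG) (Q f - Q f Q)\<close>.
\<close>

lemma Q_ode: "dQ x y = Qf x y - fcomp Qf Q x y"
proof -
  define S where "S x y = Qf x y - fcomp Qf Q x y" for x y
  let ?KG' = "\<lambda>x y. Kc x y * fps_deriv (G y)"
  have fkKG': "fkernel \<rho> \<beta> ?KG'" by (rule fkernel_mult_right[OF fk_Kc bounded_coeffs_deriv_G])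
  have fkS: "fkernel \<rho> \<beta> S" unfolding S_def[abs_def] by (intro fkernel_diff fk_Qf fkernel_fcomp fk_Q)
  have dKG: "(\<lambda>x y. fps_deriv (KG x y)) = ?KG'" by (intro ext) simp
  have 1: "dQ x y = ?KG' x y - fcomp ?KG' Q x y - fcomp KG dQ x y" for x y
  proof -
    have "dQ x y = fps_deriv (Kc x y * (1 + G y) - fcomp KG Q x y)" by (subst Q_eq) (rule refl)
    also have "\<dots> = ?KG' x y - fps_deriv (fcomp KG Q x y)" by simp
    also have "fps_deriv (fcomp KG Q x y) = fcomp ?KG' Q x y + fcomp KG dQ x y"
      unfolding fcomp_deriv[OF fk_KG fk_Q] dKG ..
    finally show ?thesis by simp
  qed
  have QfKG: "Qf x y = ?KG' x y - fcomp KG Qf x y" for x y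
  proof -
    have "Qf x y = (Kc x y * (1 + G y) - fcomp KG Q x y) * fc y" by (subst Q_eq) (rule refl)
    also have "\<dots> = ?KG' x y - fcomp KG Q x y * fc y" by (simp add: deriv_G algebra_simps)
    finally show ?thesis unfolding fcomp_mult_right[OF fk_KG fk_Q, of fc] .
  qed
  have 2: "S x y = ?KG' x y - fcomp ?KG' Q x y - fcomp KG S x y" for x y
  proof -
    have "fcomp Qf Q x y = fcomp (\<lambda>x y. ?KG' x y - fcomp KG Qf x y) Q x y"
      by (intro arg_cong[where f = "\<lambda>Z. fcomp Z Q x y"] ext QfKG)
    also have "\<dots> = fcomp ?KG' Q x y - fcomp (fcomp KG Qf) Q x y"
      by (rule fcomp_diff_left[OF fkKG' fkernel_fcomp[OF fk_KG fk_Qf] fk_Q])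
    finally have "fcomp Qf Q x y = fcomp ?KG' Q x y - fcomp KG (fcomp Qf Q) x y"
      unfolding fcomp_assoc[OF fk_KG fk_Qf fk_Q] .
    moreover have "fcomp KG S x y = fcomp KG Qf x y - fcomp KG (fcomp Qf Q) x y"
      unfolding S_def[abs_def] by (rule fcomp_diff_right[OF fk_Qf fkernel_fcomp[OF fk_Qf fk_Q] fk_KG])
    ultimately show ?thesis unfolding S_def using QfKG[of x y] by simp
  qed
  have "dQ x y - S x y = 0"
  proof (rule fcomp_KG_unique[where Z = "\<lambda>x y. dQ x y - S x y"])
    fix x y
    show "dQ x y - S x y = - fcomp KG (\<lambda>x y. dQ x y - S x y) x y"
      unfolding fcomp_diff_right[OF fk_dQ fkS fk_KG] using 1[of x y] 2[of x y] by simp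
  qed
  thus ?thesis by (simp add: S_def)
qed

end

section \<open>The third derivative of the cumulant generating series\<close>

lemma kernel_bound_pair_integrable:
  fixes w :: "complex \<Rightarrow> complex \<Rightarrow> real"
  assumes p: "kernel_bound \<rho> \<beta> c p" and r: "kernel_bound \<rho> \<beta> d r"
    and w: "(\<lambda>(x, y). w x y) \<in> borel_measurable (borel \<Otimes>\<^sub>M borel)" "\<And>x y. \<bar>w x y\<bar> \<le> C" "\<And>x y. x \<notin> B \<Longrightarrow> w x y = 0"
    and B: "B \<in> sets borel" "emeasure lborel B < \<infinity>"
  shows "integrable (lborel \<Otimes>\<^sub>M lborel) (\<lambda>(x, y). complex_of_real (w x y) * p x y * r y x)"
proof (rule integrableI_bounded)
  note [measurable] = kernel_bound_measurable[OF p] kernel_bound_measurable[OF r]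
  have w' [measurable]: "g \<in> borel_measurable N \<Longrightarrow> h \<in> borel_measurable N \<Longrightarrow> (\<lambda>x. w (g x) (h x)) \<in> borel_measurable N" for g h and N :: "'c measure"
    using measurable_compose[OF measurable_Pair w(1), of g N h] by simp
  have C0: "0 \<le> C" using w(2)[of undefined undefined] by linarith
  show m: "(\<lambda>(x, y). complex_of_real (w x y) * p x y * r y x) \<in> borel_measurable (lborel \<Otimes>\<^sub>M lborel)"
    unfolding case_prod_unfold
    by (intro borel_measurable_times kernel_bound_measurable[OF p] kernel_bound_measurable[OF r] borel_measurable_of_real w')
       measurable
  have "(\<lambda>z. ennreal (cmod (case z of (x, y) \<Rightarrow> complex_of_real (w x y) * p x y * r y x))) \<in> borel_measurable (lborel \<Otimes>\<^sub>M lborel)"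
    using m by measurable
  from lborel.nn_integral_fst[OF this, symmetric]
  have "(\<integral>\<^sup>+z. ennreal (cmod (case z of (x, y) \<Rightarrow> complex_of_real (w x y) * p x y * r y x)) \<partial>(lborel \<Otimes>\<^sub>M lborel)) =
      (\<integral>\<^sup>+x. \<integral>\<^sup>+y. ennreal (cmod (complex_of_real (w x y) * p x y * r y x)) \<partial>lborel \<partial>lborel)"
    by simp
  also have "\<dots> \<le> (\<integral>\<^sup>+x. ennreal (C * c * d * \<rho>) * indicator B x \<partial>lborel)"
  proof (rule nn_integral_mono)
    fix x
    show "(\<integral>\<^sup>+y. ennreal (cmod (complex_of_real (w x y) * p x y * r y x)) \<partial>lborel) \<le> ennreal (C * c * d * \<rho>) * indicator B x"
    proof (cases "x \<in> B")
      case True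
      have "(\<integral>\<^sup>+y. ennreal (cmod (complex_of_real (w x y) * p x y * r y x)) \<partial>lborel) \<le> (\<integral>\<^sup>+y. ennreal C * ennreal (cmod (p x y * r y x)) \<partial>lborel)"
      proof (rule nn_integral_mono)
        fix y
        have "\<bar>w x y\<bar> * cmod (p x y * r y x) \<le> C * cmod (p x y * r y x)" by (intro mult_right_mono w) simp
        thus "ennreal (cmod (complex_of_real (w x y) * p x y * r y x)) \<le> ennreal C * ennreal (cmod (p x y * r y x))"
          using C0 by (simp add: ennreal_mult[symmetric] ennreal_leI norm_mult mult_ac)
      qed
      also have "\<dots> = ennreal C * (\<integral>\<^sup>+y. ennreal (cmod (p x y * r y x)) \<partial>lborel)" by (rule nn_integral_cmult) measurable
      also have "\<dots> \<le> ennreal C * ennreal (c * d * \<rho>)" by (intro mult_left_mono kernel_bound_integrable(2)[OF p r]) simp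
      also have "\<dots> = ennreal (C * c * d * \<rho>)" using C0 by (simp add: ennreal_mult'[symmetric] mult_ac)
      finally show ?thesis using True by simp
    qed (use w(3) in simp)
  qed
  also have "\<dots> = ennreal (C * c * d * \<rho>) * emeasure lborel B" using B(1) by (intro nn_integral_cmult_indicator) simp
  also have "\<dots> < \<infinity>" using B(2) by (simp add: ennreal_mult_less_top)
  finally show "(\<integral>\<^sup>+z. ennreal (cmod (case z of (x, y) \<Rightarrow> complex_of_real (w x y) * p x y * r y x)) \<partial>(lborel \<Otimes>\<^sub>M lborel)) < \<infinity>" .
qed

context projection_weight
begin

text \<open>
  The trace of the kernel \<open>f Q\<close>.
\<close>

definition log_deriv :: "complex fps" where "log_deriv = fint lborel (\<lambda>x. fc x * Q x x)"

lemma fkernel_diag: "fkernel \<rho> \<beta> Z \<Longrightarrow> bounded_coeffs borel (\<lambda>x. Z x x)"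
  unfolding bounded_coeffs_def
proof (intro allI conjI)
  fix k assume "fkernel \<rho> \<beta> Z"
  then obtain c where c: "kernel_bound \<rho> \<beta> c (\<lambda>x y. Z x y $ k)" using fkernelD by blast
  show "(\<lambda>u. Z u u $ k) \<in> borel_measurable borel" by (rule kernel_bound_measurable[OF c]) auto
  show "\<exists>C. \<forall>u. cmod (Z u u $ k) \<le> C" using kernel_boundD(3)[OF c] by blast
qed

lemma fintegrable_fc: "bounded_coeffs borel Z \<Longrightarrow> fintegrable lborel (\<lambda>x. fc x * Z x)"
  by (rule fintegrable_supp[OF bounded_coeffs_mult[OF bounded_coeffs_fc]]) (simp_all add: f_supp)

text \<open>
  \<open>G' = f (1 + G)\<close> turns the minor in Jacobi's formula into \<open>Q\<close>.
\<close>

lemma deriv_fred_eq: "fps_deriv fred = log_deriv * fred"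
proof -
  have "fps_deriv fred = fint lborel (\<lambda>x. fred * (fc x * Q x x))"
    unfolding deriv_fred
  proof (intro fint_cong)
    fix x
    have "fred * Q x x = minor x x * (1 + G x) * (fred * inverse fred)" by (simp only: Q_def mult_ac)
    thus "fps_deriv (G x) * minor x x = fred * (fc x * Q x x)"
      unfolding fred_inverse deriv_G by (simp add: mult_ac)
  qed
  also have "\<dots> = fred * log_deriv" unfolding log_deriv_def by (rule fint_mult_left[OF fintegrable_fc[OF fkernel_diag[OF fk_Q]]])
  finally show ?thesis by (simp add: mult.commute)
qed

definition pairing :: "(complex \<Rightarrow> complex \<Rightarrow> real) \<Rightarrow> (complex \<Rightarrow> complex \<Rightarrow> complex fps) \<Rightarrow> (complex \<Rightarrow> complex \<Rightarrow> complex fps) \<Rightarrow> complex \<Rightarrow> complex \<Rightarrow> complex fps" where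
  "pairing w Y Z x y = fps_const (complex_of_real (w x y)) * Y x y * Z y x"

lemma pairing_fintegrable:
  assumes Y: "fkernel \<rho> \<beta> Y" and Z: "fkernel \<rho> \<beta> Z"
    and w: "(\<lambda>(x, y). w x y) \<in> borel_measurable (borel \<Otimes>\<^sub>M borel)" "\<And>x y. \<bar>w x y\<bar> \<le> C" "\<And>x y. x \<notin> B \<Longrightarrow> w x y = 0"
  shows "fintegrable (lborel \<Otimes>\<^sub>M lborel) (\<lambda>(x, y). pairing w Y Z x y)"
    and "fintegrable (lborel \<Otimes>\<^sub>M lborel) (\<lambda>(x, y). pairing w Y Z y x)"
proof -
  have i: "integrable (lborel \<Otimes>\<^sub>M lborel) (\<lambda>(x, y). pairing w Y Z x y $ k)"
    for k
  proof -
    have eq: "(\<lambda>(x, y). pairing w Y Z x y $ k) = (\<lambda>p. \<Sum>i=0..k. complex_of_real (w (fst p) (snd p)) * (Y (fst p) (snd p) $ i * Z (snd p) (fst p) $ (k - i)))"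
      by (simp only: pairing_def mult.assoc fps_mult_left_const_nth fps_mult_nth[of "Y _ _"] sum_distrib_left case_prod_unfold)
    show ?thesis unfolding eq
  proof (intro Bochner_Integration.integrable_sum)
    fix i
    obtain c d where "kernel_bound \<rho> \<beta> c (\<lambda>x y. Y x y $ i)" "kernel_bound \<rho> \<beta> d (\<lambda>x y. Z x y $ (k - i))"
      using fkernelD[OF Y] fkernelD[OF Z] by blast
    from kernel_bound_pair_integrable[OF this w B_borel emeasure_B_finite]
    show "integrable (lborel \<Otimes>\<^sub>M lborel) (\<lambda>p. complex_of_real (w (fst p) (snd p)) * (Y (fst p) (snd p) $ i * Z (snd p) (fst p) $ (k - i)))"
      by (simp add: case_prod_unfold mult.assoc)
  qed
  qed
  from i show "fintegrable (lborel \<Otimes>\<^sub>M lborel) (\<lambda>(x, y). pairing w Y Z x y)" by (simp add: fintegrable_def case_prod_unfold)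
  from lborel_pair.integrable_product_swap[OF i] show "fintegrable (lborel \<Otimes>\<^sub>M lborel) (\<lambda>(x, y). pairing w Y Z y x)"
    by (simp add: fintegrable_def case_prod_unfold)
qed

lemma fint_swap:
  assumes "fintegrable (lborel \<Otimes>\<^sub>M lborel) (\<lambda>(x, y). H x y)" "fintegrable (lborel \<Otimes>\<^sub>M lborel) (\<lambda>(x, y). H y x)"
  shows "fint (lborel \<Otimes>\<^sub>M lborel) (\<lambda>(x, y). H y x) = fint (lborel \<Otimes>\<^sub>M lborel) (\<lambda>(x, y). H (x::complex) (y::complex))"
  unfolding fint_pair(1)[OF assms(1)] fint_pair(2)[OF assms(2)] ..

abbreviation w_sq :: "complex \<Rightarrow> complex \<Rightarrow> real" where "w_sq \<equiv> (\<lambda>x y. (f x)\<^sup>2)"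
abbreviation w_prod :: "complex \<Rightarrow> complex \<Rightarrow> real" where "w_prod \<equiv> (\<lambda>x y. f x * f y)"
abbreviation w_diff :: "complex \<Rightarrow> complex \<Rightarrow> real" where "w_diff \<equiv> (\<lambda>x y. (f x - f y)\<^sup>2)"

lemma w_sq_props: "(\<lambda>(x, y). w_sq x y) \<in> borel_measurable (borel \<Otimes>\<^sub>M borel)" "\<bar>w_sq x y\<bar> \<le> m\<^sup>2" "x \<notin> B \<Longrightarrow> w_sq x y = 0"
  using power_mono[OF f_bound[of x], of 2] f_supp[of x] by (auto simp: case_prod_unfold)

lemma w_prod_props: "(\<lambda>(x, y). w_prod x y) \<in> borel_measurable (borel \<Otimes>\<^sub>M borel)" "\<bar>w_prod x y\<bar> \<le> m\<^sup>2" "x \<notin> B \<Longrightarrow> w_prod x y = 0"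
  using f_bound[of x] f_bound[of y] f_supp[of x]
  by (auto simp: case_prod_unfold abs_mult power2_eq_square m_nonneg intro!: mult_mono)

lemma pairing_w_sq:
  assumes "fkernel \<rho> \<beta> Y" "fkernel \<rho> \<beta> Z"
  shows "fintegrable (lborel \<Otimes>\<^sub>M lborel) (\<lambda>(x, y). pairing w_sq Y Z x y)"
    and "fintegrable (lborel \<Otimes>\<^sub>M lborel) (\<lambda>(x, y). pairing w_sq Y Z y x)"
proof -
  show "fintegrable (lborel \<Otimes>\<^sub>M lborel) (\<lambda>(x, y). pairing w_sq Y Z x y)"
    using w_sq_props by (rule pairing_fintegrable(1)[OF assms])
  show "fintegrable (lborel \<Otimes>\<^sub>M lborel) (\<lambda>(x, y). pairing w_sq Y Z y x)"
    using w_sq_props by (rule pairing_fintegrable(2)[OF assms, where w = w_sq])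
qed

lemma pairing_w_prod:
  assumes "fkernel \<rho> \<beta> Y" "fkernel \<rho> \<beta> Z"
  shows "fintegrable (lborel \<Otimes>\<^sub>M lborel) (\<lambda>(x, y). pairing w_prod Y Z x y)"
  using w_prod_props by (rule pairing_fintegrable(1)[OF assms])

text \<open>
  Expanding the square; the terms in \<open>f(x)\<^sup>2\<close> and \<open>f(y)\<^sup>2\<close> are interchanged by swapping the
  variables and the two kernels.
\<close>

lemma w_diff_fint:
  assumes Y: "fkernel \<rho> \<beta> Y" and Z: "fkernel \<rho> \<beta> Z"
  shows "fintegrable (lborel \<Otimes>\<^sub>M lborel) (\<lambda>(x, y). pairing w_diff Y Z x y)"
    and "fint (lborel \<Otimes>\<^sub>M lborel) (\<lambda>(x, y). pairing w_diff Y Z x y) =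
      fint (lborel \<Otimes>\<^sub>M lborel) (\<lambda>(x, y). pairing w_sq Y Z x y) + fint (lborel \<Otimes>\<^sub>M lborel) (\<lambda>(x, y). pairing w_sq Z Y x y)
      - 2 * fint (lborel \<Otimes>\<^sub>M lborel) (\<lambda>(x, y). pairing w_prod Y Z x y)"
proof -
  have eq: "(\<lambda>(x, y). pairing w_diff Y Z x y) = (\<lambda>p. (case p of (x, y) \<Rightarrow> pairing w_sq Y Z x y) + (case p of (x, y) \<Rightarrow> pairing w_sq Z Y y x)
      - 2 * (case p of (x, y) \<Rightarrow> pairing w_prod Y Z x y))"
  proof (intro ext, clarify)
    fix x y
    have "fps_const (complex_of_real (w_diff x y)) = fps_const (complex_of_real ((f x)\<^sup>2)) + fps_const (complex_of_real ((f y)\<^sup>2))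
        - 2 * fps_const (complex_of_real (f x * f y))"
      by (simp add: fps_eq_iff fps_numeral_nth power2_diff algebra_simps numeral_fps_const)
    hence "pairing w_diff Y Z x y = (fps_const (complex_of_real ((f x)\<^sup>2)) + fps_const (complex_of_real ((f y)\<^sup>2))
        - 2 * fps_const (complex_of_real (f x * f y))) * Y x y * Z y x" by (simp only: pairing_def)
    thus "pairing w_diff Y Z x y = pairing w_sq Y Z x y + pairing w_sq Z Y y x - 2 * pairing w_prod Y Z x y"
      by (simp only: pairing_def algebra_simps)
  qed
  note i1 = pairing_w_sq(1)[OF Y Z] and i2 = pairing_w_sq[OF Z Y]
    and i3 = pairing_w_prod[OF Y Z]
  note i12 = fintegrable_add[OF i1 i2(2)] and i3' = fintegrable_mult_left[OF i3, of 2]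
  show "fintegrable (lborel \<Otimes>\<^sub>M lborel) (\<lambda>(x, y). pairing w_diff Y Z x y)"
    unfolding eq by (rule fintegrable_diff[OF i12 i3'])
  show "fint (lborel \<Otimes>\<^sub>M lborel) (\<lambda>(x, y). pairing w_diff Y Z x y) =
      fint (lborel \<Otimes>\<^sub>M lborel) (\<lambda>(x, y). pairing w_sq Y Z x y) + fint (lborel \<Otimes>\<^sub>M lborel) (\<lambda>(x, y). pairing w_sq Z Y x y)
      - 2 * fint (lborel \<Otimes>\<^sub>M lborel) (\<lambda>(x, y). pairing w_prod Y Z x y)"
    unfolding eq by (rule trans[OF fint_diff[OF i12 i3']], rule arg_cong2[where f = "(-)"],
        rule trans[OF fint_add[OF i1 i2(2)]], rule arg_cong2[where f = "(+)"], rule refl,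
        rule fint_swap[OF i2], rule fint_mult_left[OF i3])
qed

text \<open>
  \<open>\<integral> f Q'(x,x) = \<integral> f\<^sup>2 Q(x,x) - \<integral>\<integral> f(x) f(y) Q(x,y) Q(y,x)\<close>, and \<open>Q Q = Q\<close> rewrites the first
  term as a double integral of the same kind, which completes the square.
\<close>

lemma deriv_log_deriv: "2 * fps_deriv log_deriv = fint (lborel \<Otimes>\<^sub>M lborel) (\<lambda>(x, y). pairing w_diff Q Q x y)"
proof -
  have fc2: "fps_const (complex_of_real ((f x)\<^sup>2)) = fc x * fc x" for x by (simp add: power2_eq_square)
  have P1: "fint (lborel \<Otimes>\<^sub>M lborel) (\<lambda>(x, y). pairing w_sq Q Q x y) = fint lborel (\<lambda>x. fc x * (fc x * Q x x))"
  proof (rule trans[OF fint_pair(1)[OF pairing_w_sq(1)[OF fk_Q fk_Q]]], rule fint_cong)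
    fix x
    have "fint lborel (\<lambda>y. pairing w_sq Q Q x y) = fint lborel (\<lambda>y. (fc x * fc x) * (Q x y * Q y x))"
      unfolding pairing_def fc2 by (simp only: mult.assoc)
    also have "\<dots> = (fc x * fc x) * fcomp Q Q x x" unfolding fcomp_def by (rule fint_mult_left[OF fintegrable_fcomp[OF fk_Q fk_Q]])
    finally show "fint lborel (\<lambda>y. pairing w_sq Q Q x y) = fc x * (fc x * Q x x)" unfolding Q_idem by (simp only: mult.assoc)
  qed
  have P3: "fint (lborel \<Otimes>\<^sub>M lborel) (\<lambda>(x, y). pairing w_prod Q Q x y) = fint lborel (\<lambda>x. fc x * fcomp Qf Q x x)"
  proof (rule trans[OF fint_pair(1)[OF pairing_w_prod[OF fk_Q fk_Q]]], rule fint_cong)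
    fix x
    have "fint lborel (\<lambda>y. pairing w_prod Q Q x y) = fint lborel (\<lambda>y. fc x * (Qf x y * Q y x))"
      unfolding pairing_def by (intro fint_cong) (simp add: mult_ac flip: fps_const_mult)
    also have "\<dots> = fc x * fcomp Qf Q x x" unfolding fcomp_def by (rule fint_mult_left[OF fintegrable_fcomp[OF fk_Qf fk_Q]])
    finally show "fint lborel (\<lambda>y. pairing w_prod Q Q x y) = fc x * fcomp Qf Q x x" .
  qed
  have "fps_deriv log_deriv = fint lborel (\<lambda>x. fc x * (fc x * Q x x) - fc x * fcomp Qf Q x x)"
    unfolding log_deriv_def fint_deriv by (intro fint_cong) (simp add: Q_ode algebra_simps)
  also have "\<dots> = fint lborel (\<lambda>x. fc x * (fc x * Q x x)) - fint lborel (\<lambda>x. fc x * fcomp Qf Q x x)"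
    by (intro fint_diff fintegrable_fc bounded_coeffs_mult bounded_coeffs_fc fkernel_diag fk_Q fkernel_fcomp fk_Qf)
  finally show ?thesis unfolding w_diff_fint(2)[OF fk_Q fk_Q] P1 P3 by (simp only: right_diff_distrib mult_2)
qed

text \<open>
  The two factors \<open>Q\<close> contribute equally, because the weight is symmetric.
\<close>

lemma deriv2_log_deriv: "fps_deriv (fps_deriv log_deriv) = fint (lborel \<Otimes>\<^sub>M lborel) (\<lambda>(x, y). pairing w_diff Q dQ x y)"
proof -
  note i1 = w_diff_fint(1)[OF fk_dQ fk_Q] and i2 = w_diff_fint(1)[OF fk_Q fk_dQ]
  have sym: "pairing w_diff Y Z y x = pairing w_diff Z Y x y" for Y Z x y
    unfolding pairing_def power2_commute[of "f y"] by (simp only: mult_ac)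
  have "2 * fps_deriv (fps_deriv log_deriv) = fps_deriv (2 * fps_deriv log_deriv)" by (simp add: fps_deriv_mult)
  also have "\<dots> = fint (lborel \<Otimes>\<^sub>M lborel) (\<lambda>p. (case p of (x, y) \<Rightarrow> pairing w_diff dQ Q x y) + (case p of (x, y) \<Rightarrow> pairing w_diff Q dQ x y))"
    unfolding deriv_log_deriv fint_deriv by (intro fint_cong) (auto simp: pairing_def algebra_simps)
  also have "\<dots> = fint (lborel \<Otimes>\<^sub>M lborel) (\<lambda>(x, y). pairing w_diff dQ Q x y) + fint (lborel \<Otimes>\<^sub>M lborel) (\<lambda>(x, y). pairing w_diff Q dQ x y)"
    by (rule fint_add[OF i1 i2])
  also have "fint (lborel \<Otimes>\<^sub>M lborel) (\<lambda>(x, y). pairing w_diff dQ Q x y) = fint (lborel \<Otimes>\<^sub>M lborel) (\<lambda>(x, y). pairing w_diff Q dQ x y)"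
  proof -
    have "fint (lborel \<Otimes>\<^sub>M lborel) (\<lambda>(x, y). pairing w_diff Q dQ y x) = fint (lborel \<Otimes>\<^sub>M lborel) (\<lambda>(x, y). pairing w_diff Q dQ x y)"
      by (rule fint_swap[OF i2]) (use i1 in \<open>simp add: sym\<close>)
    thus ?thesis by (simp add: sym)
  qed
  finally have "2 * fps_deriv (fps_deriv log_deriv) = 2 * fint (lborel \<Otimes>\<^sub>M lborel) (\<lambda>(x, y). pairing w_diff Q dQ x y)" by simp
  thus ?thesis by simp
qed

text \<open>
  By \<open>Q = Q Q\<close>, \<open>Q' = Q Q f - Q f Q\<close>.
\<close>

lemma deriv_Q_eq: "dQ y x = fint lborel (\<lambda>z. fps_const (complex_of_real (f x - f z)) * (Q y z * Q z x))"
proof -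
  have "dQ y x = fc x * fcomp Q Q y x - fcomp Qf Q y x" unfolding Q_ode Q_idem by (simp add: mult.commute)
  also have "fc x * fcomp Q Q y x = fint lborel (\<lambda>z. fc x * (Q y z * Q z x))"
    unfolding fcomp_def by (rule fint_mult_left[OF fintegrable_fcomp[OF fk_Q fk_Q], symmetric])
  also have "\<dots> - fcomp Qf Q y x = fint lborel (\<lambda>z. fc x * (Q y z * Q z x) - Qf y z * Q z x)"
    unfolding fcomp_def
    by (rule fint_diff[OF fintegrable_mult_left[OF fintegrable_fcomp[OF fk_Q fk_Q]] fintegrable_fcomp[OF fk_Qf fk_Q], symmetric])
  also have "\<dots> = fint lborel (\<lambda>z. fps_const (complex_of_real (f x - f z)) * (Q y z * Q z x))"
    by (intro fint_cong) (simp add: algebra_simps flip: fps_const_sub)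
  finally show ?thesis .
qed

end

text \<open>
  The moment is carried by a kernel that contains the variable \<open>x\<close> confined to \<open>B\<close>: integrate
  \<open>z\<close> with one mass and one supremum, then \<open>y\<close> with the moment, then \<open>x\<close> over \<open>B\<close>.
\<close>

lemma cyclic_moment_adjacent:
  assumes q: "kernel_bound \<rho> \<beta> c q" and r: "kernel_bound \<rho> \<beta> d r" and s: "kernel_bound \<rho> \<beta> e s"
    and B [measurable]: "B \<in> sets borel" and \<rho>: "0 \<le> \<rho>"
  shows "(\<integral>\<^sup>+x. \<integral>\<^sup>+y. \<integral>\<^sup>+z. indicator B x * ennreal (cmod (x - y) ^ 3 * (cmod (q x y) * cmod (r y z) * cmod (s z x)))
      \<partial>lborel \<partial>lborel \<partial>lborel) \<le> ennreal (c * d * e) * (ennreal \<rho> * \<beta>) * emeasure lborel B"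
proof -
  note [measurable] = kernel_bound_measurable[OF q] kernel_bound_measurable[OF r] kernel_bound_measurable[OF s]
  have cde: "0 \<le> c" "0 \<le> d" "0 \<le> e" by (rule kernel_boundD[OF q], rule kernel_boundD[OF r], rule kernel_boundD[OF s])
  have "(\<integral>\<^sup>+x. \<integral>\<^sup>+y. \<integral>\<^sup>+z. indicator B x * ennreal (cmod (x - y) ^ 3 * (cmod (q x y) * cmod (r y z) * cmod (s z x)))
      \<partial>lborel \<partial>lborel \<partial>lborel) \<le> (\<integral>\<^sup>+x. (ennreal (c * d * e) * (ennreal \<rho> * \<beta>)) * indicator B x \<partial>lborel)"
  proof (rule nn_integral_mono)
    fix x
    have "(\<integral>\<^sup>+y. \<integral>\<^sup>+z. indicator B x * ennreal (cmod (x - y) ^ 3 * (cmod (q x y) * cmod (r y z) * cmod (s z x))) \<partial>lborel \<partial>lborel)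
        \<le> (\<integral>\<^sup>+y. (indicator B x * ennreal (d * e * \<rho>)) * ennreal (cmod (x - y) ^ 3 * cmod (q x y)) \<partial>lborel)"
    proof (rule nn_integral_mono)
      fix y
      have "(\<integral>\<^sup>+z. indicator B x * ennreal (cmod (x - y) ^ 3 * (cmod (q x y) * cmod (r y z) * cmod (s z x))) \<partial>lborel) =
          (\<integral>\<^sup>+z. (indicator B x * ennreal (cmod (x - y) ^ 3 * cmod (q x y))) * ennreal (cmod (r y z * s z x)) \<partial>lborel)"
        by (intro nn_integral_cong) (simp add: norm_mult ennreal_mult mult_ac)
      also have "\<dots> = (indicator B x * ennreal (cmod (x - y) ^ 3 * cmod (q x y))) * (\<integral>\<^sup>+z. ennreal (cmod (r y z * s z x)) \<partial>lborel)"
        by (rule nn_integral_cmult) measurable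
      also have "\<dots> \<le> (indicator B x * ennreal (cmod (x - y) ^ 3 * cmod (q x y))) * ennreal (d * e * \<rho>)"
        by (intro mult_left_mono kernel_bound_integrable(2)[OF r s]) simp
      finally show "(\<integral>\<^sup>+z. indicator B x * ennreal (cmod (x - y) ^ 3 * (cmod (q x y) * cmod (r y z) * cmod (s z x))) \<partial>lborel)
          \<le> (indicator B x * ennreal (d * e * \<rho>)) * ennreal (cmod (x - y) ^ 3 * cmod (q x y))" by (simp add: mult_ac)
    qed
    also have "\<dots> = (indicator B x * ennreal (d * e * \<rho>)) * (\<integral>\<^sup>+y. ennreal (cmod (x - y) ^ 3 * cmod (q x y)) \<partial>lborel)"
      by (rule nn_integral_cmult) measurable
    also have "\<dots> \<le> (indicator B x * ennreal (d * e * \<rho>)) * (ennreal c * \<beta>)"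
      by (intro mult_left_mono kernel_boundD(6)[OF q]) simp
    also have "\<dots> = (ennreal (c * d * e) * (ennreal \<rho> * \<beta>)) * indicator B x" using cde \<rho> by (simp add: ennreal_mult mult_ac)
    finally show "(\<integral>\<^sup>+y. \<integral>\<^sup>+z. indicator B x * ennreal (cmod (x - y) ^ 3 * (cmod (q x y) * cmod (r y z) * cmod (s z x))) \<partial>lborel \<partial>lborel)
        \<le> (ennreal (c * d * e) * (ennreal \<rho> * \<beta>)) * indicator B x" .
  qed
  also have "\<dots> = ennreal (c * d * e) * (ennreal \<rho> * \<beta>) * emeasure lborel B" by (intro nn_integral_cmult_indicator) simp
  finally show ?thesis .
qed

text \<open>
  The moment is carried by the kernel that does not contain \<open>x\<close>: bound \<open>s\<close> by its supremum, then
  integrate \<open>z\<close> with the moment and \<open>y\<close> with a mass.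
\<close>

lemma cyclic_moment_opposite:
  assumes q: "kernel_bound \<rho> \<beta> c q" and r: "kernel_bound \<rho> \<beta> d r" and s: "kernel_bound \<rho> \<beta> e s"
    and B [measurable]: "B \<in> sets borel" and \<rho>: "0 \<le> \<rho>"
  shows "(\<integral>\<^sup>+x. \<integral>\<^sup>+y. \<integral>\<^sup>+z. indicator B x * ennreal (cmod (y - z) ^ 3 * (cmod (q x y) * cmod (r y z) * cmod (s z x)))
      \<partial>lborel \<partial>lborel \<partial>lborel) \<le> ennreal (c * d * e) * (ennreal \<rho> * \<beta>) * emeasure lborel B"
proof -
  note [measurable] = kernel_bound_measurable[OF q] kernel_bound_measurable[OF r] kernel_bound_measurable[OF s]
  have cde: "0 \<le> c" "0 \<le> d" "0 \<le> e" by (rule kernel_boundD[OF q], rule kernel_boundD[OF r], rule kernel_boundD[OF s])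
  have "(\<integral>\<^sup>+x. \<integral>\<^sup>+y. \<integral>\<^sup>+z. indicator B x * ennreal (cmod (y - z) ^ 3 * (cmod (q x y) * cmod (r y z) * cmod (s z x)))
      \<partial>lborel \<partial>lborel \<partial>lborel) \<le> (\<integral>\<^sup>+x. (ennreal (c * d * e) * (ennreal \<rho> * \<beta>)) * indicator B x \<partial>lborel)"
  proof (rule nn_integral_mono)
    fix x
    have "(\<integral>\<^sup>+y. \<integral>\<^sup>+z. indicator B x * ennreal (cmod (y - z) ^ 3 * (cmod (q x y) * cmod (r y z) * cmod (s z x))) \<partial>lborel \<partial>lborel)
        \<le> (\<integral>\<^sup>+y. (indicator B x * (ennreal (e * \<rho>) * (ennreal d * \<beta>))) * ennreal (cmod (q x y)) \<partial>lborel)"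
    proof (rule nn_integral_mono)
      fix y
      have "(\<integral>\<^sup>+z. indicator B x * ennreal (cmod (y - z) ^ 3 * (cmod (q x y) * cmod (r y z) * cmod (s z x))) \<partial>lborel) \<le>
          (\<integral>\<^sup>+z. (indicator B x * ennreal (cmod (q x y)) * ennreal (e * \<rho>)) * ennreal (cmod (y - z) ^ 3 * cmod (r y z)) \<partial>lborel)"
      proof (rule nn_integral_mono)
        fix z
        have "ennreal (cmod (s z x)) \<le> ennreal (e * \<rho>)" by (intro ennreal_leI kernel_boundD(3)[OF s])
        from mult_left_mono[OF this, of "indicator B x * (ennreal (cmod (q x y)) * ennreal (cmod (y - z) ^ 3 * cmod (r y z)))"]
        show "indicator B x * ennreal (cmod (y - z) ^ 3 * (cmod (q x y) * cmod (r y z) * cmod (s z x))) \<le>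
          (indicator B x * ennreal (cmod (q x y)) * ennreal (e * \<rho>)) * ennreal (cmod (y - z) ^ 3 * cmod (r y z))"
          by (simp add: ennreal_mult mult_ac)
      qed
      also have "\<dots> = (indicator B x * ennreal (cmod (q x y)) * ennreal (e * \<rho>)) * (\<integral>\<^sup>+z. ennreal (cmod (y - z) ^ 3 * cmod (r y z)) \<partial>lborel)"
        by (rule nn_integral_cmult) measurable
      also have "\<dots> \<le> (indicator B x * ennreal (cmod (q x y)) * ennreal (e * \<rho>)) * (ennreal d * \<beta>)"
        by (intro mult_left_mono kernel_boundD(6)[OF r]) simp
      finally show "(\<integral>\<^sup>+z. indicator B x * ennreal (cmod (y - z) ^ 3 * (cmod (q x y) * cmod (r y z) * cmod (s z x))) \<partial>lborel)
          \<le> (indicator B x * (ennreal (e * \<rho>) * (ennreal d * \<beta>))) * ennreal (cmod (q x y))" by (simp add: mult_ac)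
    qed
    also have "\<dots> = (indicator B x * (ennreal (e * \<rho>) * (ennreal d * \<beta>))) * (\<integral>\<^sup>+y. ennreal (cmod (q x y)) \<partial>lborel)"
      by (rule nn_integral_cmult) measurable
    also have "\<dots> \<le> (indicator B x * (ennreal (e * \<rho>) * (ennreal d * \<beta>))) * ennreal c"
      by (intro mult_left_mono kernel_boundD(4)[OF q]) simp
    also have "\<dots> = (ennreal (c * d * e) * (ennreal \<rho> * \<beta>)) * indicator B x" using cde \<rho> by (simp add: ennreal_mult mult_ac)
    finally show "(\<integral>\<^sup>+y. \<integral>\<^sup>+z. indicator B x * ennreal (cmod (y - z) ^ 3 * (cmod (q x y) * cmod (r y z) * cmod (s z x))) \<partial>lborel \<partial>lborel)
        \<le> (ennreal (c * d * e) * (ennreal \<rho> * \<beta>)) * indicator B x" .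
  qed
  also have "\<dots> = ennreal (c * d * e) * (ennreal \<rho> * \<beta>) * emeasure lborel B" by (intro nn_integral_cmult_indicator) simp
  finally show ?thesis .
qed

text \<open>
  The increment between \<open>x\<close> and \<open>y\<close> vanishes unless one of them lies in \<open>B\<close>, and
  \<open>a\<^sup>2 b \<le> a\<^sup>3 + b\<^sup>3\<close> for nonnegative numbers.
\<close>

lemma cubic_increment_le:
  assumes f: "\<And>x y. \<bar>f x - f y\<bar> \<le> L * cmod (x - y)" and supp: "\<And>x. x \<notin> B \<Longrightarrow> f x = (0::real)" and L: "0 \<le> L"
  shows "(f x - f y)\<^sup>2 * \<bar>f x - f z\<bar> \<le> L ^ 3 * ((indicator B x + indicator B y) * (cmod (x - y) ^ 3 + cmod (x - z) ^ 3))"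
proof (cases "x \<in> B \<or> y \<in> B")
  case True
  have sq: "a\<^sup>2 * b \<le> a ^ 3 + b ^ 3" if "0 \<le> a" "0 \<le> b" for a b :: real
  proof (cases "b \<le> a")
    case True
    hence "a\<^sup>2 * b \<le> a\<^sup>2 * a" by (intro mult_left_mono) auto
    thus ?thesis using zero_le_power[OF that(2), of 3] by (simp add: power2_eq_square power3_eq_cube)
  next
    case False
    hence "a\<^sup>2 * b \<le> b\<^sup>2 * b" using that by (intro mult_right_mono power_mono) auto
    thus ?thesis using zero_le_power[OF that(1), of 3] by (simp add: power2_eq_square power3_eq_cube)
  qed
  have "(f x - f y)\<^sup>2 * \<bar>f x - f z\<bar> = \<bar>f x - f y\<bar>\<^sup>2 * \<bar>f x - f z\<bar>" by simp
  also have "\<dots> \<le> (L * cmod (x - y))\<^sup>2 * (L * cmod (x - z))" by (intro mult_mono power_mono f) auto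
  also have "\<dots> = L ^ 3 * ((cmod (x - y))\<^sup>2 * cmod (x - z))" by (simp add: power2_eq_square power3_eq_cube)
  also have "\<dots> \<le> L ^ 3 * (1 * (cmod (x - y) ^ 3 + cmod (x - z) ^ 3))"
    using L sq[of "cmod (x - y)" "cmod (x - z)"] by (intro mult_left_mono) auto
  also have "\<dots> \<le> L ^ 3 * ((indicator B x + indicator B y) * (cmod (x - y) ^ 3 + cmod (x - z) ^ 3))"
    using L True by (intro mult_left_mono mult_right_mono) (auto simp: indicator_def)
  finally show ?thesis .
qed (use supp in simp)

text \<open>
  The four products of an indicator and a cubed distance are treated separately. After renaming
  the variables so that the one in \<open>B\<close> comes first, and transposing the kernels accordingly,
  each is an instance of one of the two preceding estimates.
\<close>

lemma cyclic_increment_bound: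
  assumes q: "kernel_bound \<rho> \<beta> c q" and r: "kernel_bound \<rho> \<beta> d r" and s: "kernel_bound \<rho> \<beta> e s"
    and B [measurable]: "B \<in> sets borel" and \<rho>: "0 \<le> \<rho>"
    and f: "\<And>x y. \<bar>f x - f y\<bar> \<le> L * cmod (x - y)" and supp: "\<And>x. x \<notin> B \<Longrightarrow> f x = (0::real)" and L: "0 \<le> L"
  shows "(\<integral>\<^sup>+x. \<integral>\<^sup>+y. \<integral>\<^sup>+z. ennreal ((f x - f y)\<^sup>2 * \<bar>f x - f z\<bar> * (cmod (q x y) * cmod (r y z) * cmod (s z x)))
      \<partial>lborel \<partial>lborel \<partial>lborel) \<le> ennreal (4 * L ^ 3 * (c * d * e)) * (ennreal \<rho> * \<beta>) * emeasure lborel B"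
proof -
  note [measurable] = kernel_bound_measurable[OF q] kernel_bound_measurable[OF r] kernel_bound_measurable[OF s]
  have cde: "0 \<le> c" "0 \<le> d" "0 \<le> e" by (rule kernel_boundD[OF q], rule kernel_boundD[OF r], rule kernel_boundD[OF s])
  define h where "h x y z = cmod (q x y) * cmod (r y z) * cmod (s z x)" for x y z
  have [measurable]: "(\<lambda>p. h (u p) (v p) (w p)) \<in> borel_measurable N"
    if [measurable]: "u \<in> borel_measurable N" "v \<in> borel_measurable N" "w \<in> borel_measurable N" for u v w and N :: "'c measure"
    unfolding h_def by measurable
  define I where "I F = (\<integral>\<^sup>+x. \<integral>\<^sup>+y. \<integral>\<^sup>+z. F x y z \<partial>lborel \<partial>lborel \<partial>(lborel :: complex measure))" for F :: "complex \<Rightarrow> complex \<Rightarrow> complex \<Rightarrow> ennreal"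
  define R where "R = ennreal (c * d * e) * (ennreal \<rho> * \<beta>) * emeasure lborel B"
  define T1 :: "complex \<Rightarrow> complex \<Rightarrow> complex \<Rightarrow> ennreal" where "T1 = (\<lambda>x y z. indicator B x * ennreal (cmod (x - y) ^ 3 * h x y z))"
  define T2 :: "complex \<Rightarrow> complex \<Rightarrow> complex \<Rightarrow> ennreal" where "T2 = (\<lambda>x y z. indicator B x * ennreal (cmod (x - z) ^ 3 * h x y z))"
  define T3 :: "complex \<Rightarrow> complex \<Rightarrow> complex \<Rightarrow> ennreal" where "T3 = (\<lambda>x y z. indicator B y * ennreal (cmod (x - y) ^ 3 * h x y z))"
  define T4 :: "complex \<Rightarrow> complex \<Rightarrow> complex \<Rightarrow> ennreal" where "T4 = (\<lambda>x y z. indicator B y * ennreal (cmod (x - z) ^ 3 * h x y z))"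
  have [measurable]: "(\<lambda>p. T1 (u p) (v p) (w p)) \<in> borel_measurable N" "(\<lambda>p. T2 (u p) (v p) (w p)) \<in> borel_measurable N"
    "(\<lambda>p. T3 (u p) (v p) (w p)) \<in> borel_measurable N" "(\<lambda>p. T4 (u p) (v p) (w p)) \<in> borel_measurable N"
    if [measurable]: "u \<in> borel_measurable N" "v \<in> borel_measurable N" "w \<in> borel_measurable N" for u v w and N :: "'c measure"
    unfolding T1_def T2_def T3_def T4_def by measurable
  have "I T1 \<le> R" unfolding I_def R_def T1_def h_def by (rule cyclic_moment_adjacent[OF q r s B \<rho>])
  \<comment> \<open>exchange \<open>y\<close> and \<open>z\<close>, which reverses the cycle\<close>
  moreover have "I T2 \<le> R"
  proof -
    have "I T2 = (\<integral>\<^sup>+x. \<integral>\<^sup>+z. \<integral>\<^sup>+y. T2 x y z \<partial>lborel \<partial>lborel \<partial>lborel)"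
      unfolding I_def by (intro nn_integral_cong lborel_pair.Fubini') measurable
    also have "\<dots> = (\<integral>\<^sup>+x. \<integral>\<^sup>+z. \<integral>\<^sup>+y. indicator B x * ennreal (cmod (x - z) ^ 3 * (cmod (s z x) * cmod (r y z) * cmod (q x y)))
      \<partial>lborel \<partial>lborel \<partial>lborel)" unfolding T2_def h_def by (simp only: mult_ac)
    also have "\<dots> \<le> ennreal (e * d * c) * (ennreal \<rho> * \<beta>) * emeasure lborel B"
      by (rule cyclic_moment_adjacent[OF kernel_bound_transpose[OF s] kernel_bound_transpose[OF r] kernel_bound_transpose[OF q] B \<rho>])
    also have "e * d * c = c * d * e" by simp
    finally show ?thesis unfolding R_def .
  qed
  \<comment> \<open>exchange \<open>x\<close> and \<open>y\<close>\<close>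
  moreover have "I T3 \<le> R"
  proof -
    have "I T3 = (\<integral>\<^sup>+y. \<integral>\<^sup>+x. \<integral>\<^sup>+z. T3 x y z \<partial>lborel \<partial>lborel \<partial>lborel)"
      unfolding I_def by (intro lborel_pair.Fubini') measurable
    also have "\<dots> = (\<integral>\<^sup>+y. \<integral>\<^sup>+x. \<integral>\<^sup>+z. indicator B y * ennreal (cmod (y - x) ^ 3 * (cmod (q x y) * cmod (s z x) * cmod (r y z)))
      \<partial>lborel \<partial>lborel \<partial>lborel)" unfolding T3_def h_def by (simp only: mult_ac norm_minus_commute)
    also have "\<dots> \<le> ennreal (c * e * d) * (ennreal \<rho> * \<beta>) * emeasure lborel B"
      by (rule cyclic_moment_adjacent[OF kernel_bound_transpose[OF q] kernel_bound_transpose[OF s] kernel_bound_transpose[OF r] B \<rho>])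
    also have "c * e * d = c * d * e" by simp
    finally show ?thesis unfolding R_def .
  qed
  \<comment> \<open>exchange \<open>x\<close> and \<open>y\<close>; the distance now is the one opposite to the confined variable\<close>
  moreover have "I T4 \<le> R"
  proof -
    have "I T4 = (\<integral>\<^sup>+y. \<integral>\<^sup>+x. \<integral>\<^sup>+z. T4 x y z \<partial>lborel \<partial>lborel \<partial>lborel)"
      unfolding I_def by (intro lborel_pair.Fubini') measurable
    also have "\<dots> = (\<integral>\<^sup>+y. \<integral>\<^sup>+x. \<integral>\<^sup>+z. indicator B y * ennreal (cmod (x - z) ^ 3 * (cmod (q x y) * cmod (s z x) * cmod (r y z)))
      \<partial>lborel \<partial>lborel \<partial>lborel)" unfolding T4_def h_def by (simp only: mult_ac)
    also have "\<dots> \<le> ennreal (c * e * d) * (ennreal \<rho> * \<beta>) * emeasure lborel B"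
      by (rule cyclic_moment_opposite[OF kernel_bound_transpose[OF q] kernel_bound_transpose[OF s] kernel_bound_transpose[OF r] B \<rho>])
    also have "c * e * d = c * d * e" by simp
    finally show ?thesis unfolding R_def .
  qed
  ultimately have T: "I T1 + I T2 + I T3 + I T4 \<le> R + R + R + R" by (intro add_mono)
  have "I (\<lambda>x y z. ennreal ((f x - f y)\<^sup>2 * \<bar>f x - f z\<bar> * h x y z)) \<le>
      I (\<lambda>x y z. ennreal (L ^ 3) * (T1 x y z + T2 x y z + T3 x y z + T4 x y z))"
    unfolding I_def
  proof (intro nn_integral_mono)
    fix x y z
    have h0: "0 \<le> h x y z" by (simp add: h_def)
    have "(f x - f y)\<^sup>2 * \<bar>f x - f z\<bar> * h x y z \<le> L ^ 3 * ((indicator B x + indicator B y) * (cmod (x - y) ^ 3 + cmod (x - z) ^ 3)) * h x y z"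
      by (intro mult_right_mono cubic_increment_le f supp L h0)
    also have "\<dots> = L ^ 3 * (indicator B x * (cmod (x - y) ^ 3 * h x y z) + indicator B x * (cmod (x - z) ^ 3 * h x y z)
        + indicator B y * (cmod (x - y) ^ 3 * h x y z) + indicator B y * (cmod (x - z) ^ 3 * h x y z))"
      by (simp add: algebra_simps)
    finally have "ennreal ((f x - f y)\<^sup>2 * \<bar>f x - f z\<bar> * h x y z) \<le> ennreal \<dots>" by (rule ennreal_leI)
    also have "\<dots> = ennreal (L ^ 3) * (T1 x y z + T2 x y z + T3 x y z + T4 x y z)"
      unfolding T1_def T2_def T3_def T4_def using L h0 by (auto simp: ennreal_mult ennreal_plus indicator_def)
    finally show "ennreal ((f x - f y)\<^sup>2 * \<bar>f x - f z\<bar> * h x y z) \<le> ennreal (L ^ 3) * (T1 x y z + T2 x y z + T3 x y z + T4 x y z)" .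
  qed
  also have "\<dots> = ennreal (L ^ 3) * (I T1 + I T2 + I T3 + I T4)"
    unfolding I_def by (simp add: nn_integral_add nn_integral_cmult)
  also have "\<dots> \<le> ennreal (L ^ 3) * (R + R + R + R)" by (intro mult_left_mono T) simp
  also have "\<dots> = ennreal (L ^ 3) * (ennreal 4 * R)"
  proof -
    have "(4 :: ennreal) = 1 + 1 + 1 + 1" by simp
    hence "ennreal 4 * R = (1 + 1 + 1 + 1) * R" by simp
    thus ?thesis by (simp only: distrib_right mult_1)
  qed
  also have "\<dots> = ennreal (4 * L ^ 3 * (c * d * e)) * (ennreal \<rho> * \<beta>) * emeasure lborel B"
    unfolding R_def using cde L by (simp add: ennreal_mult mult_ac)
  finally show ?thesis unfolding I_def h_def .
qed

text \<open>
  The sum of the constants for the coefficient of \<open>t\<^sup>n\<close> of the triple integral, per unit of area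
  of the support; it involves neither \<open>\<rho>\<close> nor \<open>\<beta>\<close>.
\<close>

definition cumulant_bound :: "real \<Rightarrow> real \<Rightarrow> real \<Rightarrow> nat \<Rightarrow> real" where
  "cumulant_bound A m L n = (\<Sum>i=0..n. \<Sum>a=0..n - i. 4 * L ^ 3 * (tilted_bound A m i * tilted_bound A m a * tilted_bound A m (n - i - a)))"

context projection_weight
begin

lemma deriv2_log_deriv_bound:
  assumes L: "\<And>x y. \<bar>f x - f y\<bar> \<le> L * cmod (x - y)" "0 \<le> L" and \<rho>: "0 \<le> \<rho>"
  shows "ennreal (cmod (fps_deriv (fps_deriv log_deriv) $ n)) \<le> ennreal (cumulant_bound A m L n) * (ennreal \<rho> * \<beta>) * emeasure lborel B"
proof -
  let ?t = "tilted_bound A m"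
  have t0: "0 \<le> ?t k" for k by (rule kernel_boundD(2)[OF Q_bound])
  define q where "q k x y = Q x y $ k" for k x y
  have qb: "kernel_bound \<rho> \<beta> (?t k) (q k)" for k using Q_bound[of k] unfolding q_def .
  note [measurable] = kernel_bound_measurable[OF qb]
  define H where "H i a b x y z = (f x - f y)\<^sup>2 * \<bar>f x - f z\<bar> * (cmod (q i x y) * cmod (q a y z) * cmod (q b z x))" for i a b x y z
  have H0: "0 \<le> H i a b x y z" for i a b x y z by (simp add: H_def)
  have [measurable]: "(\<lambda>p. H i a b (u p) (v p) (w p)) \<in> borel_measurable N"
    if [measurable]: "u \<in> borel_measurable N" "v \<in> borel_measurable N" "w \<in> borel_measurable N" for i a b u v w and N :: "'c measure"
    unfolding H_def by measurable
  have J [measurable]: "(\<lambda>z. ennreal (\<bar>f x - f z\<bar> * (cmod (q a y z) * cmod (q b z x)))) \<in> borel_measurable lborel" for a b x y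
  proof -
    have "(\<lambda>z. cmod (q a y z)) \<in> borel_measurable lborel" "(\<lambda>z. cmod (q b z x)) \<in> borel_measurable lborel"
      by (rule measurable_compose[OF _ borel_measurable_norm], rule kernel_bound_measurable[OF qb]; simp)+
    moreover have "f \<in> borel_measurable lborel" using f_meas by simp
    ultimately show ?thesis
      by (intro measurable_compose[OF _ measurable_ennreal] borel_measurable_times borel_measurable_abs borel_measurable_diff
          borel_measurable_const)
  qed
  have dQn: "ennreal (cmod (dQ y x $ k)) \<le> (\<Sum>a=0..k. \<integral>\<^sup>+z. ennreal (\<bar>f x - f z\<bar> * (cmod (q a y z) * cmod (q (k - a) z x))) \<partial>lborel)" for y x k
  proof -
    have "dQ y x $ k = (\<integral>z. (\<Sum>a=0..k. complex_of_real (f x - f z) * (q a y z * q (k - a) z x)) \<partial>lborel)"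
      unfolding deriv_Q_eq fint_nth fps_mult_left_const_nth fps_mult_nth[of "Q _ _"] sum_distrib_left q_def ..
    hence "ennreal (cmod (dQ y x $ k)) \<le> (\<integral>\<^sup>+z. ennreal (cmod (\<Sum>a=0..k. complex_of_real (f x - f z) * (q a y z * q (k - a) z x))) \<partial>lborel)"
      using norm_integral_ennreal by simp
    also have "\<dots> \<le> (\<integral>\<^sup>+z. (\<Sum>a=0..k. ennreal (\<bar>f x - f z\<bar> * (cmod (q a y z) * cmod (q (k - a) z x)))) \<partial>lborel)"
    proof (rule nn_integral_mono)
      fix z
      have "cmod (\<Sum>a=0..k. complex_of_real (f x - f z) * (q a y z * q (k - a) z x)) \<le> (\<Sum>a=0..k. cmod (complex_of_real (f x - f z) * (q a y z * q (k - a) z x)))"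
        by (rule norm_sum)
      also have "\<dots> = (\<Sum>a=0..k. \<bar>f x - f z\<bar> * (cmod (q a y z) * cmod (q (k - a) z x)))"
        by (simp only: norm_mult norm_of_real real_norm_def)
      finally have "ennreal (cmod (\<Sum>a=0..k. complex_of_real (f x - f z) * (q a y z * q (k - a) z x))) \<le>
          ennreal (\<Sum>a=0..k. \<bar>f x - f z\<bar> * (cmod (q a y z) * cmod (q (k - a) z x)))" by (rule ennreal_leI)
      also have "\<dots> = (\<Sum>a=0..k. ennreal (\<bar>f x - f z\<bar> * (cmod (q a y z) * cmod (q (k - a) z x))))"
        by (rule sum_ennreal[symmetric]) simp
      finally show "ennreal (cmod (\<Sum>a=0..k. complex_of_real (f x - f z) * (q a y z * q (k - a) z x))) \<le> \<dots>" .
    qed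
    also have "\<dots> = (\<Sum>a=0..k. \<integral>\<^sup>+z. ennreal (\<bar>f x - f z\<bar> * (cmod (q a y z) * cmod (q (k - a) z x))) \<partial>lborel)"
      by (rule nn_integral_sum[OF J])
    finally show ?thesis .
  qed
  have pn: "ennreal (cmod (pairing w_diff Q dQ x y $ n)) \<le> (\<Sum>i=0..n. \<Sum>a=0..n - i. \<integral>\<^sup>+z. ennreal (H i a (n - i - a) x y z) \<partial>lborel)" for x y
  proof -
    have "pairing w_diff Q dQ x y $ n = (\<Sum>i=0..n. complex_of_real (w_diff x y) * (q i x y * dQ y x $ (n - i)))"
      by (simp only: pairing_def mult.assoc fps_mult_left_const_nth fps_mult_nth[of "Q _ _"] sum_distrib_left q_def)
    also have "cmod \<dots> \<le> (\<Sum>i=0..n. cmod (complex_of_real (w_diff x y) * (q i x y * dQ y x $ (n - i))))" by (rule norm_sum)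
    also have "\<dots> = (\<Sum>i=0..n. w_diff x y * cmod (q i x y) * cmod (dQ y x $ (n - i)))"
      by (simp only: norm_mult norm_of_real mult.assoc abs_power2)
    finally have "ennreal (cmod (pairing w_diff Q dQ x y $ n)) \<le> ennreal (\<Sum>i=0..n. w_diff x y * cmod (q i x y) * cmod (dQ y x $ (n - i)))"
      by (rule ennreal_leI)
    also have "\<dots> = (\<Sum>i=0..n. ennreal (w_diff x y * cmod (q i x y) * cmod (dQ y x $ (n - i))))"
      by (rule sum_ennreal[symmetric]) simp
    also have "\<dots> = (\<Sum>i=0..n. ennreal (w_diff x y * cmod (q i x y)) * ennreal (cmod (dQ y x $ (n - i))))"
      by (intro sum.cong refl ennreal_mult) auto
    also have "\<dots> \<le> (\<Sum>i=0..n. ennreal (w_diff x y * cmod (q i x y)) *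
        (\<Sum>a=0..n - i. \<integral>\<^sup>+z. ennreal (\<bar>f x - f z\<bar> * (cmod (q a y z) * cmod (q (n - i - a) z x))) \<partial>lborel))"
      by (intro sum_mono mult_left_mono dQn) simp
    also have "\<dots> = (\<Sum>i=0..n. \<Sum>a=0..n - i. \<integral>\<^sup>+z. ennreal (w_diff x y * cmod (q i x y)) * ennreal (\<bar>f x - f z\<bar> * (cmod (q a y z) * cmod (q (n - i - a) z x))) \<partial>lborel)"
      unfolding sum_distrib_left by (intro sum.cong refl nn_integral_cmult[symmetric] J)
    also have "\<dots> = (\<Sum>i=0..n. \<Sum>a=0..n - i. \<integral>\<^sup>+z. ennreal (H i a (n - i - a) x y z) \<partial>lborel)"
      by (intro sum.cong refl nn_integral_cong) (simp add: H_def ennreal_mult[symmetric] mult_ac)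
    finally show ?thesis .
  qed
  have int: "fintegrable (lborel \<Otimes>\<^sub>M lborel) (\<lambda>(x, y). pairing w_diff Q dQ x y)" by (rule w_diff_fint(1)[OF fk_Q fk_dQ])
  have pm: "(\<lambda>p. ennreal (cmod ((case p of (x, y) \<Rightarrow> pairing w_diff Q dQ x y) $ n))) \<in> borel_measurable (lborel \<Otimes>\<^sub>M lborel)"
  proof -
    have "integrable (lborel \<Otimes>\<^sub>M lborel) (\<lambda>p. (case p of (x, y) \<Rightarrow> pairing w_diff Q dQ x y) $ n)"
      using int unfolding fintegrable_def by blast
    from borel_measurable_integrable[OF this] show ?thesis
      by (intro measurable_compose[OF _ measurable_ennreal] measurable_compose[OF _ borel_measurable_norm])
  qed
  have "ennreal (cmod (fps_deriv (fps_deriv log_deriv) $ n)) \<le> (\<integral>\<^sup>+p. ennreal (cmod ((case p of (x, y) \<Rightarrow> pairing w_diff Q dQ x y) $ n)) \<partial>(lborel \<Otimes>\<^sub>M lborel))"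
    unfolding deriv2_log_deriv fint_nth by (rule norm_integral_ennreal)
  also have "\<dots> = (\<integral>\<^sup>+x. \<integral>\<^sup>+y. ennreal (cmod (pairing w_diff Q dQ x y $ n)) \<partial>lborel \<partial>lborel)"
    using lborel.nn_integral_fst[OF pm] by simp
  also have "\<dots> \<le> (\<integral>\<^sup>+x. \<integral>\<^sup>+y. (\<Sum>i=0..n. \<Sum>a=0..n - i. \<integral>\<^sup>+z. ennreal (H i a (n - i - a) x y z) \<partial>lborel) \<partial>lborel \<partial>lborel)"
    by (intro nn_integral_mono pn)
  also have "\<dots> = (\<Sum>i=0..n. \<Sum>a=0..n - i. \<integral>\<^sup>+x. \<integral>\<^sup>+y. \<integral>\<^sup>+z. ennreal (H i a (n - i - a) x y z) \<partial>lborel \<partial>lborel \<partial>lborel)"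
    by (simp add: nn_integral_sum)
  also have "\<dots> \<le> (\<Sum>i=0..n. \<Sum>a=0..n - i. ennreal (4 * L ^ 3 * (?t i * ?t a * ?t (n - i - a))) * (ennreal \<rho> * \<beta>) * emeasure lborel B)"
    unfolding H_def by (intro sum_mono cyclic_increment_bound qb B_borel \<rho> L f_supp)
  also have "\<dots> = ennreal (cumulant_bound A m L n) * (ennreal \<rho> * \<beta>) * emeasure lborel B"
    unfolding cumulant_bound_def sum_distrib_right[symmetric] using t0 L(2)
    by (simp add: sum_ennreal sum_nonneg)
  finally show ?thesis .
qed

end

section \<open>Cumulants of a linear statistic\<close>

lemma nn_integral_lborel_translate:
  fixes F :: "'a::euclidean_space \<Rightarrow> ennreal"
  assumes [measurable]: "F \<in> borel_measurable borel"
  shows "(\<integral>\<^sup>+x. F (x - y) \<partial>lborel) = (\<integral>\<^sup>+x. F x \<partial>lborel)" "(\<integral>\<^sup>+x. F (y - x) \<partial>lborel) = (\<integral>\<^sup>+x. F x \<partial>lborel)"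
proof -
  have "(\<integral>\<^sup>+x. F x \<partial>lborel) = (\<integral>\<^sup>+x. F x \<partial>distr lborel borel ((+) (- y)))" unfolding lborel_distr_plus ..
  also have "\<dots> = (\<integral>\<^sup>+x. F (- y + x) \<partial>lborel)" by (rule nn_integral_distr) auto
  finally show "(\<integral>\<^sup>+x. F (x - y) \<partial>lborel) = (\<integral>\<^sup>+x. F x \<partial>lborel)" by simp
  have l: "lborel = distr lborel borel (\<lambda>x. y + (- 1) *\<^sub>R x)"
    by (subst lborel_affine[of "-1" y]) (auto simp: density_1)
  have "(\<integral>\<^sup>+x. F x \<partial>lborel) = (\<integral>\<^sup>+x. F x \<partial>distr lborel borel (\<lambda>x. y + (- 1) *\<^sub>R x))" using l by simp
  also have "\<dots> = (\<integral>\<^sup>+x. F (y + (- 1) *\<^sub>R x) \<partial>lborel)" by (rule nn_integral_distr) auto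
  finally show "(\<integral>\<^sup>+x. F (y - x) \<partial>lborel) = (\<integral>\<^sup>+x. F x \<partial>lborel)" by simp
qed

text \<open>
  The condition \<open>1 \<le> A\<close> makes the third moment of \<open>\<phi>\<close> itself an admissible scale \<open>\<beta>\<close>.
\<close>

lemma kernel_bound_convolution:
  assumes K: "(\<lambda>(z, w). K z w) \<in> borel_measurable (borel \<Otimes>\<^sub>M borel)"
    and \<phi> [measurable]: "\<phi> \<in> borel_measurable borel" and nn: "\<And>z. 0 \<le> \<phi> z" and le: "\<And>z w. cmod (K z w) \<le> \<phi> (z - w)"
    and sup: "\<And>z. \<phi> z \<le> A * \<rho>" and int: "(\<integral>\<^sup>+z. ennreal (\<phi> z) \<partial>lborel) \<le> ennreal A" and A: "1 \<le> A"
  shows "kernel_bound \<rho> (\<integral>\<^sup>+z. ennreal (cmod z ^ 3 * \<phi> z) \<partial>lborel) A K"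
proof -
  let ?\<beta> = "\<integral>\<^sup>+z. ennreal (cmod z ^ 3 * \<phi> z) \<partial>lborel"
  have A\<beta>: "?\<beta> \<le> ennreal A * ?\<beta>" using mult_right_mono[of 1 "ennreal A" ?\<beta>] A by simp
  have a: "(\<integral>\<^sup>+y. ennreal (cmod (K x y)) \<partial>lborel) \<le> ennreal A" for x
  proof -
    have "(\<integral>\<^sup>+y. ennreal (cmod (K x y)) \<partial>lborel) \<le> (\<integral>\<^sup>+y. ennreal (\<phi> (x - y)) \<partial>lborel)"
      by (intro nn_integral_mono ennreal_leI le)
    also have "\<dots> = (\<integral>\<^sup>+y. ennreal (\<phi> y) \<partial>lborel)" by (rule nn_integral_lborel_translate(2)) measurable
    finally show ?thesis using int by (rule order_trans)
  qed
  have b: "(\<integral>\<^sup>+x. ennreal (cmod (K x y)) \<partial>lborel) \<le> ennreal A" for y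
  proof -
    have "(\<integral>\<^sup>+x. ennreal (cmod (K x y)) \<partial>lborel) \<le> (\<integral>\<^sup>+x. ennreal (\<phi> (x - y)) \<partial>lborel)"
      by (intro nn_integral_mono ennreal_leI le)
    also have "\<dots> = (\<integral>\<^sup>+y. ennreal (\<phi> y) \<partial>lborel)" by (rule nn_integral_lborel_translate(1)) measurable
    finally show ?thesis using int by (rule order_trans)
  qed
  have c: "(\<integral>\<^sup>+y. ennreal (cmod (x - y) ^ 3 * cmod (K x y)) \<partial>lborel) \<le> ennreal A * ?\<beta>" for x
  proof -
    have "(\<integral>\<^sup>+y. ennreal (cmod (x - y) ^ 3 * cmod (K x y)) \<partial>lborel) \<le> (\<integral>\<^sup>+y. ennreal (cmod (x - y) ^ 3 * \<phi> (x - y)) \<partial>lborel)"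
      by (intro nn_integral_mono ennreal_leI mult_left_mono le) simp
    also have "\<dots> = ?\<beta>" by (rule nn_integral_lborel_translate(2)) measurable
    finally show ?thesis using A\<beta> by (rule order_trans)
  qed
  have d: "(\<integral>\<^sup>+x. ennreal (cmod (x - y) ^ 3 * cmod (K x y)) \<partial>lborel) \<le> ennreal A * ?\<beta>" for y
  proof -
    have "(\<integral>\<^sup>+x. ennreal (cmod (x - y) ^ 3 * cmod (K x y)) \<partial>lborel) \<le> (\<integral>\<^sup>+x. ennreal (cmod (x - y) ^ 3 * \<phi> (x - y)) \<partial>lborel)"
      by (intro nn_integral_mono ennreal_leI mult_left_mono le) simp
    also have "\<dots> = ?\<beta>" by (rule nn_integral_lborel_translate(1)) measurable
    finally show ?thesis using A\<beta> by (rule order_trans)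
  qed
  have e: "cmod (K x y) \<le> A * \<rho>" for x y using le sup by (rule order_trans)
  show ?thesis unfolding kernel_bound_def using K A a b c d e by simp
qed

lemma kdet_not_inj:
  assumes "\<not> inj_on x {..<n}"
  shows "kdet K n x x = 0"
proof -
  obtain i j where ij: "i < n" "j < n" "i \<noteq> j" "x i = x j" using assms by (auto simp: inj_on_def)
  let ?A = "Matrix.mat n n (\<lambda>(i, j). K (x i) (x j))"
  have "row ?A i = row ?A j" using ij by (intro eq_vecI) auto
  thus ?thesis unfolding kdet_def using ij by (intro det_identical_rows[of ?A n i j]) auto
qed

text \<open>
  The Fredholm determinant is the moment series, so its logarithmic derivative \<open>\<Lambda>\<close> gives the
  cumulants \<open>C\<^sub>k = (k - 1)! \<Lambda>\<^sub>k\<^sub>-\<^sub>1\<close>, and \<open>\<Lambda>''\<close> controls all of them from order \<open>3\<close> on. The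
  kernel enters the estimate through \<open>A\<close>, \<open>\<rho>\<close> and the third moment alone.
\<close>

lemma determinantal_cumulants:
  assumes K: "reproducing_kernel K"
    and \<phi>: "\<phi> \<in> borel_measurable borel" "\<And>z. 0 \<le> \<phi> z" "\<And>z w. cmod (K z w) \<le> \<phi> (z - w)"
    and sup: "\<And>z. \<phi> z \<le> A * \<rho>" and int: "(\<integral>\<^sup>+z. ennreal (\<phi> z) \<partial>lborel) \<le> ennreal A" and A: "1 \<le> A" and \<rho>: "0 \<le> \<rho>"
    and X: "determinantal M X K"
    and f: "continuous_on UNIV f" "\<And>z. z \<notin> B \<Longrightarrow> f z = 0" "\<And>z. \<bar>f z\<bar> \<le> m"
    and L: "\<And>x y. \<bar>f x - f y\<bar> \<le> L * cmod (x - y)" "0 \<le> L"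
    and B: "B \<in> sets borel" "bounded B"
  obtains C where "has_cumulants M (Tr X f) C"
    "\<And>k. k \<ge> 3 \<Longrightarrow> ennreal \<bar>C k\<bar> \<le> ennreal (fact (k - 1) * cumulant_bound A m L (k - 3)) *
        (ennreal \<rho> * (\<integral>\<^sup>+z. ennreal (cmod z ^ 3 * \<phi> z) \<partial>lborel)) * emeasure lborel B"
proof -
  let ?\<beta> = "\<integral>\<^sup>+z. ennreal (cmod z ^ 3 * \<phi> z) \<partial>lborel"
  have K_le: "norm (K z w) \<le> A * \<rho>" for z w using \<phi>(3) sup by (rule order_trans)
  have L1: "integrable lborel (\<lambda>z. K z w)" for w
  proof (rule integrableI_bounded)
    show "(\<lambda>z. K z w) \<in> borel_measurable lborel" using reproducing_kernelD(1)[OF K] by simp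
    have "(\<integral>\<^sup>+z. ennreal (cmod (K z w)) \<partial>lborel) \<le> (\<integral>\<^sup>+z. ennreal (\<phi> (z - w)) \<partial>lborel)"
      by (intro nn_integral_mono ennreal_leI \<phi>)
    also have "\<dots> = (\<integral>\<^sup>+z. ennreal (\<phi> z) \<partial>lborel)" by (rule nn_integral_lborel_translate(1)) (use \<phi>(1) in measurable)
    also have "\<dots> \<le> ennreal A" by (rule int)
    also have "\<dots> < \<infinity>" by simp
    finally show "(\<integral>\<^sup>+z. ennreal (cmod (K z w)) \<partial>lborel) < \<infinity>" .
  qed
  have K_meas: "(\<lambda>(z, w). K z w) \<in> borel_measurable (borel \<Otimes>\<^sub>M borel)" by (rule reproducing_kernel_measurable[OF K K_le L1])
  have f_meas: "f \<in> borel_measurable borel" by (rule borel_measurable_continuous_onI[OF f(1)])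
  define r where "r n x = Re (kdet K n x x)" for n x
  have r: "kdet K n x x = complex_of_real (r n x)" and r0: "0 \<le> r n x" for n x
    using det_reproducing_kernel[OF K, of n x] unfolding r_def kdet_def by auto
  interpret W: projection_weight K "A * \<rho>" f m B \<rho> ?\<beta> A
  proof (intro projection_weight.intro kernel_weight.intro projection_weight_axioms.intro)
    show "kernel_bound \<rho> ?\<beta> A K" by (rule kernel_bound_convolution[OF K_meas \<phi> sup int A])
    show "K x y = (\<integral>u. K x u * K u y \<partial>lborel)" for x y by (rule reproducing_kernelD(5)[OF K])
    show "(\<lambda>(z, w). K z w) \<in> borel_measurable (borel \<Otimes>\<^sub>M borel)" by (rule K_meas)
    show "norm (K z w) \<le> A * \<rho>" for z w by (rule K_le)
    show "f \<in> borel_measurable borel" by (rule f_meas)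
    show "f z = 0" if "z \<notin> B" for z using that by (rule f(2))
    show "\<bar>f z\<bar> \<le> m" for z by (rule f(3))
    show "B \<in> sets borel" "bounded B" by (rule B)+
  qed
  interpret P: bounded_correlations M X r "A * \<rho>" B
  proof (rule bounded_correlations.intro)
    show "simple_point_process M X" using X by (simp add: determinantal_def)
    show "correlation_function M X n (r n)" for n using X unfolding determinantal_def r_def kdet_def by simp
    show "r n \<in> borel_measurable (lebn n)" for n
      unfolding r_def by (rule measurable_compose[OF kdet_measurable[OF K_meas] borel_measurable_Re]) auto
    show "0 \<le> r n x" for n x by (rule r0)
    show "r n x \<le> fact n * (A * \<rho>) ^ n" for n x
      unfolding r_def using complex_Re_le_cmod norm_kdet_le[OF K_le] by (rule order_trans)
    show "r n x = 0" if "\<not> inj_on x {..<n}" for n x using kdet_not_inj[OF that, of K] by (simp add: r_def)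
    show "B \<in> sets borel" "bounded B" by (rule B)+
  qed
  let ?F = "moment_fps M (Tr X f)"
  have mom: "W.fred $ k = complex_of_real (?F $ k)" for k
  proof -
    have "W.fred $ k = (\<Sum>n\<le>k. 1 / fact n * (\<integral>x. weight f n x $ k * complex_of_real (r n x) \<partial>lebn n))"
      unfolding W.fred_def W.fred_upto_def W.fred_term_def fps_nth_Abs_fps fps_sum_nth fps_mult_left_const_nth fint_nth
        fps_mult_right_const_nth r lessThan_Suc_atMost ..
    also have "\<dots> = complex_of_real (?F $ k)" by (rule P.moment_Tr[OF f, symmetric])
    finally show ?thesis .
  qed
  \<comment> \<open>the moments are real, so the real parts of the coefficients satisfy the same equation\<close>
  define G :: "real fps" where "G = Abs_fps (\<lambda>n. Re (W.log_deriv $ n))"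
  have "fps_deriv ?F = G * ?F"
  proof (rule fps_ext)
    fix n
    have "fps_deriv W.fred $ n = (\<Sum>i=0..n. W.log_deriv $ i * W.fred $ (n - i))" unfolding W.deriv_fred_eq by (rule fps_mult_nth)
    hence "Re (fps_deriv W.fred $ n) = Re (\<Sum>i=0..n. W.log_deriv $ i * W.fred $ (n - i))" by simp
    thus "fps_deriv ?F $ n = (G * ?F) $ n" by (simp add: mom fps_mult_nth G_def del: of_nat_Suc)
  qed
  moreover obtain e where "e > 0" "integrable M (\<lambda>\<omega>. exp (e * \<bar>Tr X f \<omega>\<bar>))" by (rule P.Tr_exponential_moment[OF f])
  ultimately have cum: "has_cumulants M (Tr X f) (\<lambda>k. if k = 0 then 0 else fact (k - 1) * G $ (k - 1))"
    by (intro has_cumulants_from_moment_fps P.prob_space_axioms P.Tr_measurable[OF f])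
  show thesis
  proof (rule that[OF cum])
    fix k :: nat assume k: "k \<ge> 3"
    then obtain j where j: "k = j + 3" by (metis le_Suc_ex add.commute)
    have "fps_deriv (fps_deriv W.log_deriv) $ j = of_nat ((j + 1) * (j + 2)) * W.log_deriv $ (j + 2)"
      by (simp only: fps_deriv_nth add.assoc of_nat_mult mult.assoc one_add_one)
    hence "cmod (fps_deriv (fps_deriv W.log_deriv) $ j) = real ((j + 1) * (j + 2)) * cmod (W.log_deriv $ (j + 2))"
      by (simp only: norm_mult norm_of_nat)
    moreover have "1 * cmod (W.log_deriv $ (j + 2)) \<le> real ((j + 1) * (j + 2)) * cmod (W.log_deriv $ (j + 2))"
      by (intro mult_right_mono) auto
    moreover have "\<bar>G $ (j + 2)\<bar> \<le> cmod (W.log_deriv $ (j + 2))" unfolding G_def by (simp add: abs_Re_le_cmod)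
    ultimately have "\<bar>G $ (j + 2)\<bar> \<le> cmod (fps_deriv (fps_deriv W.log_deriv) $ j)" by linarith
    hence "\<bar>fact (j + 2) * G $ (j + 2)\<bar> \<le> fact (j + 2) * cmod (fps_deriv (fps_deriv W.log_deriv) $ j)" by (simp add: abs_mult)
    hence "ennreal \<bar>fact (j + 2) * G $ (j + 2)\<bar> \<le> ennreal (fact (j + 2)) * ennreal (cmod (fps_deriv (fps_deriv W.log_deriv) $ j))"
      by (simp add: ennreal_mult[symmetric] ennreal_leI)
    also have "\<dots> \<le> ennreal (fact (j + 2)) * (ennreal (cumulant_bound A m L j) * (ennreal \<rho> * ?\<beta>) * emeasure lborel B)"
      by (intro mult_left_mono W.deriv2_log_deriv_bound L \<rho>) simp
    also have "\<dots> = ennreal (fact (j + 2) * cumulant_bound A m L j) * (ennreal \<rho> * ?\<beta>) * emeasure lborel B"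
      by (simp only: ennreal_mult'[of "fact (j + 2)"] fact_ge_zero mult.assoc)
    finally show "ennreal \<bar>if k = 0 then 0 else fact (k - 1) * G $ (k - 1)\<bar> \<le> ennreal (fact (k - 1) * cumulant_bound A m L (k - 3)) *
        (ennreal \<rho> * ?\<beta>) * emeasure lborel B" unfolding j by simp
  qed
qed

lemma C_k_imp_continuous: "C_k k f \<Longrightarrow> continuous_on UNIV f"
  by (cases k) (auto simp: continuous_on_eq_continuous_at differentiable_imp_continuous_within)

lemma compactly_supported_bounded:
  fixes f :: "'a::euclidean_space \<Rightarrow> real"
  assumes "continuous_on UNIV f" "compact S" "\<And>x. x \<notin> S \<Longrightarrow> f x = 0"
  obtains m where "0 \<le> m" "\<And>x. \<bar>f x\<bar> \<le> m"
proof -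
  have "compact (f ` S)" by (rule compact_continuous_image[OF continuous_on_subset[OF assms(1) subset_UNIV] assms(2)])
  from compact_imp_bounded[OF this] obtain m where m: "\<And>y. y \<in> f ` S \<Longrightarrow> norm y \<le> m"
    unfolding bounded_iff by blast
  have "\<bar>f x\<bar> \<le> max m 0" for x using m[of "f x"] assms(3)[of x] by (cases "x \<in> S") auto
  thus ?thesis using that[of "max m 0"] by simp
qed

text \<open>
  The partial derivatives are continuous and vanish outside \<open>S\<close>, hence are bounded.
\<close>

lemma compactly_supported_C1_lipschitz:
  fixes f :: "'a::euclidean_space \<Rightarrow> real"
  assumes "C_k (Suc k) f" "compact S" "\<And>x. x \<notin> S \<Longrightarrow> f x = 0"
  obtains L where "0 \<le> L" "\<And>x y. \<bar>f x - f y\<bar> \<le> L * norm (x - y)"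
proof -
  let ?D = "\<lambda>x. frechet_derivative f (at x)"
  have der: "(f has_derivative ?D x) (at x)" for x using assms(1) frechet_derivative_works by auto
  have cont: "continuous_on UNIV (\<lambda>x. ?D x v)" for v using assms(1) C_k_imp_continuous by auto
  have out: "?D x v = 0" if "x \<notin> S" for x v
  proof -
    have "open (- S)" using assms(2) compact_imp_closed by auto
    hence "((\<lambda>_. 0) has_derivative ?D x) (at x)"
      using has_derivative_transform_within_open[OF der[of x], of "- S" "\<lambda>_. 0"] assms(3) that by auto
    from has_derivative_unique[OF this has_derivative_const] have "?D x = (\<lambda>_. 0)" .
    thus ?thesis by simp
  qed
  have "\<exists>m. \<forall>x. \<bar>?D x v\<bar> \<le> m" for v
  proof -
    obtain m where "\<And>x. \<bar>?D x v\<bar> \<le> m" using compactly_supported_bounded[OF cont assms(2) out, of v] by blast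
    thus ?thesis by blast
  qed
  then obtain m where m: "\<And>x v. \<bar>?D x v\<bar> \<le> m v" by metis
  have m0: "0 \<le> m v" for v using m[of undefined v] by linarith
  let ?L = "\<Sum>i\<in>Basis. m i"
  have "onorm (?D x) \<le> ?L" for x
  proof -
    have "bounded_linear (?D x)" by (rule has_derivative_bounded_linear[OF der])
    hence "onorm (?D x) \<le> (\<Sum>i\<in>Basis. norm (?D x i))" by (rule onorm_componentwise)
    also have "\<dots> \<le> ?L" using m by (intro sum_mono) simp
    finally show ?thesis .
  qed
  hence "norm (f x - f y) \<le> ?L * norm (x - y)" for x y
    by (rule differentiable_bound[OF convex_UNIV der]) simp_all
  moreover have "0 \<le> ?L" using m0 by (rule sum_nonneg)
  ultimately show ?thesis using that[of ?L] by simp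
qed

section \<open>The limit theorems\<close>

lemma weak_conv_at_top_cong:
  assumes "eventually (\<lambda>\<rho>. \<mu> \<rho> = \<mu>' \<rho>) at_top" "weak_conv_at_top \<mu> \<nu>"
  shows "weak_conv_at_top \<mu>' \<nu>"
  unfolding weak_conv_at_top_def
proof (intro allI impI)
  fix x assume "isCont (cdf \<nu>) x"
  hence "((\<lambda>\<rho>. cdf (\<mu> \<rho>) x) \<longlongrightarrow> cdf \<nu> x) at_top" using assms(2) by (simp add: weak_conv_at_top_def)
  thus "((\<lambda>\<rho>. cdf (\<mu>' \<rho>) x) \<longlongrightarrow> cdf \<nu> x) at_top"
    by (rule Lim_transform_eventually) (use assms(1) in eventually_elim, simp)
qed

text \<open>
  Scaling by the bounded factors \<open>s(\<rho>)\<close> does not spoil the decay of the higher cumulants. Both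
  parts of the limit theorem are instances: \<open>s = 1\<close>, and \<open>s = 1 / sqrt V\<close> when \<open>V\<close> is bounded
  away from \<open>0\<close>.
\<close>

lemma has_normal_limit_if_cumulants:
  fixes N :: "real \<Rightarrow> 'w measure" and Y :: "real \<Rightarrow> 'w \<Rightarrow> real" and s :: "real \<Rightarrow> real"
  assumes P: "eventually P at_top"
    and ps: "\<And>\<rho>. P \<rho> \<Longrightarrow> prob_space (N \<rho>)" and cum: "\<And>\<rho>. P \<rho> \<Longrightarrow> has_cumulants (N \<rho>) (Y \<rho>) (C \<rho>)"
    and s: "\<And>\<rho>. P \<rho> \<Longrightarrow> 0 < s \<rho>" "\<And>\<rho>. P \<rho> \<Longrightarrow> s \<rho> \<le> b"
    and C2: "((\<lambda>\<rho>. (s \<rho>)\<^sup>2 * C \<rho> 2) \<longlongrightarrow> \<sigma>\<^sup>2) at_top" and C3: "\<And>k. k \<ge> 3 \<Longrightarrow> ((\<lambda>\<rho>. C \<rho> k) \<longlongrightarrow> 0) at_top" and \<sigma>: "0 \<le> \<sigma>"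
  shows "weak_conv_at_top (\<lambda>\<rho>. distr (N \<rho>) borel (\<lambda>\<omega>. s \<rho> * (Y \<rho> \<omega> - C \<rho> 1))) (normal_distribution 0 \<sigma>)"
proof (rule weak_conv_at_topI[OF P])
  fix u :: "nat \<Rightarrow> real" assume u: "filterlim u at_top sequentially" and Pu: "\<And>i. P (u i)"
  show "weak_conv_m (\<lambda>i. distr (N (u i)) borel (\<lambda>\<omega>. s (u i) * (Y (u i) \<omega> - C (u i) 1))) (normal_distribution 0 \<sigma>)"
  proof (rule weak_conv_normal_if_cumulants[where C = "\<lambda>i k. if k = 1 then 0 else s (u i) ^ k * C (u i) k"])
    show "prob_space (N (u i))" for i by (rule ps[OF Pu])
    show "has_cumulants (N (u i)) (\<lambda>\<omega>. s (u i) * (Y (u i) \<omega> - C (u i) 1)) (\<lambda>k. if k = 1 then 0 else s (u i) ^ k * C (u i) k)" for i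
      using s(1)[OF Pu[of i]] by (intro has_cumulants_affine ps[OF Pu] cum[OF Pu]) auto
    show "(\<lambda>i. if (2::nat) = 1 then 0 else s (u i) ^ 2 * C (u i) 2) \<longlonglongrightarrow> \<sigma>\<^sup>2"
      using filterlim_compose[OF C2 u] by simp
    show "(\<lambda>i. if k = 1 then 0 else s (u i) ^ k * C (u i) k) \<longlonglongrightarrow> 0" if k: "k \<ge> 3" for k
    proof -
      have "(\<lambda>i. s (u i) ^ k * C (u i) k) \<longlonglongrightarrow> 0"
      proof (rule Lim_null_comparison)
        have "norm (s (u i) ^ k * C (u i) k) \<le> b ^ k * \<bar>C (u i) k\<bar>" for i
        proof -
          have "s (u i) ^ k \<le> b ^ k" using s[OF Pu[of i]] by (intro power_mono) auto
          thus ?thesis using s(1)[OF Pu[of i]] by (simp add: abs_mult mult_right_mono)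
        qed
        thus "\<forall>\<^sub>F i in sequentially. norm (s (u i) ^ k * C (u i) k) \<le> b ^ k * \<bar>C (u i) k\<bar>" by simp
        show "(\<lambda>i. b ^ k * \<bar>C (u i) k\<bar>) \<longlonglongrightarrow> 0"
          by (rule tendsto_mult_right_zero[OF tendsto_rabs_zero[OF filterlim_compose[OF C3[OF k] u]]])
      qed
      thus ?thesis using k by simp
    qed
  qed (use \<sigma> in simp_all)
qed

theorem theorem2p2:
  fixes K :: "real \<Rightarrow> complex \<Rightarrow> complex \<Rightarrow> complex"
    and \<phi> :: "real \<Rightarrow> complex \<Rightarrow> real"
    and M :: "real \<Rightarrow> 'w measure"
    and X :: "real \<Rightarrow> 'w \<Rightarrow> complex measure"
    and f :: "complex \<Rightarrow> real"
  assumes "\<And>\<rho>. \<rho> > 0 \<Longrightarrow> reproducing_kernel (K \<rho>)"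
    and "\<And>\<rho>. \<rho> > 0 \<Longrightarrow> continuous_on UNIV (\<phi> \<rho>)"
    and "\<And>\<rho> z. \<rho> > 0 \<Longrightarrow> \<phi> \<rho> z \<ge> 0"
    and "\<And>\<rho> z w. \<rho> > 0 \<Longrightarrow> cmod (K \<rho> z w) \<le> \<phi> \<rho> (z - w)"
    and "(SUP \<rho>\<in>{0<..}. SUP z. ennreal (\<phi> \<rho> z / \<rho>)) < \<infinity>"
    and "(SUP \<rho>\<in>{0<..}. \<integral>\<^sup>+z. ennreal (\<phi> \<rho> z) \<partial>lborel) < \<infinity>"
    and "((\<lambda>\<rho>. ennreal \<rho> * (\<integral>\<^sup>+z. ennreal (cmod z ^ 3 * \<phi> \<rho> z) \<partial>lborel)) \<longlongrightarrow> 0) at_top"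
    and "\<And>\<rho>. \<rho> > 0 \<Longrightarrow> determinantal (M \<rho>) (X \<rho>) (K \<rho>)"
    and "compactly_supported f"
    and "C_k 3 f"
  defines "T \<equiv> \<lambda>\<rho>. Tr (X \<rho>) f"
  defines "E \<equiv> \<lambda>\<rho>. prob_space.expectation (M \<rho>) (T \<rho>)"
    and "V \<equiv> \<lambda>\<rho>. prob_space.variance (M \<rho>) (T \<rho>)"
  shows "(\<forall>\<rho>>0. has_cumulants (M \<rho>) (T \<rho>) (cumulant (M \<rho>) (T \<rho>)))
    \<and> (\<forall>k\<ge>3. ((\<lambda>\<rho>. cumulant (M \<rho>) (T \<rho>) k) \<longlongrightarrow> 0) at_top)
    \<and> (\<forall>\<sigma>\<ge>0. (V \<longlongrightarrow> \<sigma>\<^sup>2) at_top \<longrightarrow>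
         weak_conv_at_top (\<lambda>\<rho>. distr (M \<rho>) borel (\<lambda>\<omega>. T \<rho> \<omega> - E \<rho>)) (normal_distribution 0 \<sigma>))
    \<and> (Liminf at_top (\<lambda>\<rho>. ereal (V \<rho>)) > 0 \<longrightarrow>
         weak_conv_at_top (\<lambda>\<rho>. distr (M \<rho>) borel (\<lambda>\<omega>. (T \<rho> \<omega> - E \<rho>) / sqrt (V \<rho>)))
           (normal_distribution 0 1))"
proof -
  let ?\<beta> = "\<lambda>\<rho>. \<integral>\<^sup>+z. ennreal (cmod z ^ 3 * \<phi> \<rho> z) \<partial>lborel"
  define S where "S = closure {x. f x \<noteq> 0}"
  have S: "compact S" using assms(9) by (simp add: compactly_supported_def S_def)
  have f_S: "f z = 0" if "z \<notin> S" for z using that closure_subset[of "{x. f x \<noteq> 0}"] by (auto simp: S_def)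
  have f_cont: "continuous_on UNIV f" by (rule C_k_imp_continuous[OF assms(10)])
  obtain m where m: "\<And>x. \<bar>f x\<bar> \<le> m" using compactly_supported_bounded[OF f_cont S f_S] by blast
  have "C_k (Suc 2) f" using assms(10) by (simp add: numeral_3_eq_3 numeral_2_eq_2)
  then obtain L where L: "0 \<le> L" "\<And>x y. \<bar>f x - f y\<bar> \<le> L * cmod (x - y)"
    using compactly_supported_C1_lipschitz[of 2 f, OF _ S f_S] by blast
  define a where "a = enn2real (SUP \<rho>\<in>{0<..}. SUP z. ennreal (\<phi> \<rho> z / \<rho>))"
  define b where "b = enn2real (SUP \<rho>\<in>{0<..}. \<integral>\<^sup>+z. ennreal (\<phi> \<rho> z) \<partial>lborel)"
  \<comment> \<open>a common constant for the supremum and the mass\<close>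
  define A where "A = max 1 (max a b)"
  have sup: "\<phi> \<rho> z \<le> A * \<rho>" if "\<rho> > 0" for \<rho> z
  proof -
    have "ennreal (\<phi> \<rho> z / \<rho>) \<le> (SUP z. ennreal (\<phi> \<rho> z / \<rho>))" by (rule SUP_upper) simp
    also have "\<dots> \<le> (SUP \<rho>\<in>{0<..}. SUP z. ennreal (\<phi> \<rho> z / \<rho>))" using that by (intro SUP_upper) simp
    also have "\<dots> = ennreal a" unfolding a_def using assms(5) by simp
    finally have "\<phi> \<rho> z / \<rho> \<le> a" by (simp add: a_def)
    also have "\<dots> \<le> A" by (simp add: A_def)
    finally show ?thesis using that by (simp add: field_simps)
  qed
  have int: "(\<integral>\<^sup>+z. ennreal (\<phi> \<rho> z) \<partial>lborel) \<le> ennreal A" if "\<rho> > 0" for \<rho>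
  proof -
    have "(\<integral>\<^sup>+z. ennreal (\<phi> \<rho> z) \<partial>lborel) \<le> (SUP \<rho>\<in>{0<..}. \<integral>\<^sup>+z. ennreal (\<phi> \<rho> z) \<partial>lborel)" using that by (intro SUP_upper) simp
    also have "\<dots> = ennreal b" unfolding b_def using assms(6) by simp
    also have "\<dots> \<le> ennreal A" by (intro ennreal_leI) (simp add: A_def)
    finally show ?thesis .
  qed
  have ps: "prob_space (M \<rho>)" if "\<rho> > 0" for \<rho>
    using assms(8)[OF that] by (simp add: determinantal_def simple_point_process_def)
  define C where "C = (\<lambda>\<rho>. cumulant (M \<rho>) (T \<rho>))"
  have cum: "has_cumulants (M \<rho>) (T \<rho>) (C \<rho>)"
    and bound: "k \<ge> 3 \<Longrightarrow> ennreal \<bar>C \<rho> k\<bar> \<le> ennreal (fact (k - 1) * cumulant_bound A m L (k - 3)) * (ennreal \<rho> * ?\<beta> \<rho>) * emeasure lborel S"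
    if \<rho>: "\<rho> > 0" for \<rho> k
  proof -
    have \<phi>m: "\<phi> \<rho> \<in> borel_measurable borel" by (rule borel_measurable_continuous_onI[OF assms(2)[OF \<rho>]])
    have A1: "1 \<le> A" by (simp add: A_def)
    have S': "S \<in> sets borel" "bounded S" using S compact_imp_bounded by (auto intro: borel_compact)
    obtain D where D: "has_cumulants (M \<rho>) (Tr (X \<rho>) f) D"
      "\<And>k. k \<ge> 3 \<Longrightarrow> ennreal \<bar>D k\<bar> \<le> ennreal (fact (k - 1) * cumulant_bound A m L (k - 3)) * (ennreal \<rho> * ?\<beta> \<rho>) * emeasure lborel S"
      using determinantal_cumulants[OF assms(1)[OF \<rho>] \<phi>m assms(3)[OF \<rho>] assms(4)[OF \<rho>] sup[OF \<rho>] int[OF \<rho>] A1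
        less_imp_le[OF \<rho>] assms(8)[OF \<rho>] f_cont f_S m L(2) L(1) S'] by blast
    have "C \<rho> = D" unfolding C_def T_def by (rule cumulant_eqI[OF ps[OF \<rho>] D(1)])
    thus "has_cumulants (M \<rho>) (T \<rho>) (C \<rho>)"
      "k \<ge> 3 \<Longrightarrow> ennreal \<bar>C \<rho> k\<bar> \<le> ennreal (fact (k - 1) * cumulant_bound A m L (k - 3)) * (ennreal \<rho> * ?\<beta> \<rho>) * emeasure lborel S"
      using D by (simp_all add: T_def)
  qed
  have EC: "C \<rho> 1 = E \<rho>" and VC: "C \<rho> 2 = V \<rho>" if "\<rho> > 0" for \<rho>
    using cumulants_mean_variance[OF ps[OF that] cum[OF that]] by (simp_all add: E_def V_def)
  have pos: "eventually (\<lambda>\<rho>::real. \<rho> > 0) at_top" by (rule eventually_gt_at_top)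
  have C3: "((\<lambda>\<rho>. C \<rho> k) \<longlongrightarrow> 0) at_top" if k: "k \<ge> 3" for k
  proof -
    let ?c = "ennreal (fact (k - 1) * cumulant_bound A m L (k - 3))"
    have S_fin: "emeasure lborel S < \<infinity>" by (rule emeasure_bounded_finite[OF compact_imp_bounded[OF S]])
    have "((\<lambda>\<rho>. emeasure lborel S * (?c * (ennreal \<rho> * ?\<beta> \<rho>))) \<longlongrightarrow> emeasure lborel S * (?c * 0)) at_top"
      using S_fin by (intro ennreal_tendsto_cmult assms(7)) auto
    hence "((\<lambda>\<rho>. ?c * (ennreal \<rho> * ?\<beta> \<rho>) * emeasure lborel S) \<longlongrightarrow> 0) at_top" by (simp add: mult.commute)
    hence "((\<lambda>\<rho>. ennreal \<bar>C \<rho> k\<bar>) \<longlongrightarrow> 0) at_top"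
    proof (rule tendsto_sandwich[OF _ _ tendsto_const, rotated 2])
      show "\<forall>\<^sub>F \<rho> in at_top. ennreal \<bar>C \<rho> k\<bar> \<le> ?c * (ennreal \<rho> * ?\<beta> \<rho>) * emeasure lborel S"
        using pos by eventually_elim (rule bound[OF _ k])
    qed simp
    hence "((\<lambda>\<rho>. ennreal \<bar>C \<rho> k\<bar>) \<longlongrightarrow> ennreal 0) at_top" by simp
    hence "((\<lambda>\<rho>. \<bar>C \<rho> k\<bar>) \<longlongrightarrow> 0) at_top" by (rule tendsto_ennrealD) simp_all
    thus ?thesis by (rule tendsto_rabs_zero_cancel)
  qed
  have clt: "weak_conv_at_top (\<lambda>\<rho>. distr (M \<rho>) borel (\<lambda>\<omega>. T \<rho> \<omega> - E \<rho>)) (normal_distribution 0 \<sigma>)"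
    if \<sigma>: "0 \<le> \<sigma>" and V: "(V \<longlongrightarrow> \<sigma>\<^sup>2) at_top" for \<sigma>
  proof -
    have "((\<lambda>\<rho>. 1\<^sup>2 * C \<rho> 2) \<longlongrightarrow> \<sigma>\<^sup>2) at_top"
      by (rule Lim_transform_eventually[OF V]) (use pos in eventually_elim, simp add: VC)
    from has_normal_limit_if_cumulants[OF pos ps cum _ _ this C3 \<sigma>, of 1]
    have "weak_conv_at_top (\<lambda>\<rho>. distr (M \<rho>) borel (\<lambda>\<omega>. 1 * (T \<rho> \<omega> - C \<rho> 1))) (normal_distribution 0 \<sigma>)" by simp
    thus ?thesis by (rule weak_conv_at_top_cong[rotated]) (use pos in eventually_elim, simp add: EC[unfolded One_nat_def])
  qed
  have clt': "weak_conv_at_top (\<lambda>\<rho>. distr (M \<rho>) borel (\<lambda>\<omega>. (T \<rho> \<omega> - E \<rho>) / sqrt (V \<rho>))) (normal_distribution 0 1)"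
    if V: "Liminf at_top (\<lambda>\<rho>. ereal (V \<rho>)) > 0"
  proof -
    obtain c where c: "0 < ereal c" "ereal c < Liminf at_top (\<lambda>\<rho>. ereal (V \<rho>))" using ereal_dense2[OF V] by blast
    have P: "eventually (\<lambda>\<rho>. \<rho> > 0 \<and> c < V \<rho>) at_top"
      using pos less_LiminfD[OF c(2)] by eventually_elim simp
    have c0: "0 < c" using c(1) by simp
    have s2: "((\<lambda>\<rho>. (1 / sqrt (V \<rho>))\<^sup>2 * C \<rho> 2) \<longlongrightarrow> 1\<^sup>2) at_top"
    proof (rule Lim_transform_eventually[OF tendsto_const])
      show "\<forall>\<^sub>F \<rho> in at_top. 1\<^sup>2 = (1 / sqrt (V \<rho>))\<^sup>2 * C \<rho> 2"
        using P by eventually_elim (use c0 in \<open>simp add: VC power_divide\<close>)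
    qed
    have "weak_conv_at_top (\<lambda>\<rho>. distr (M \<rho>) borel (\<lambda>\<omega>. 1 / sqrt (V \<rho>) * (T \<rho> \<omega> - C \<rho> 1))) (normal_distribution 0 1)"
    proof (rule has_normal_limit_if_cumulants[where P = "\<lambda>\<rho>. \<rho> > 0 \<and> c < V \<rho>" and s = "\<lambda>\<rho>. 1 / sqrt (V \<rho>)" and C = C and \<sigma> = 1 and b = "1 / sqrt c", OF P _ _ _ _ s2 C3])
      show "1 / sqrt (V \<rho>) \<le> 1 / sqrt c" if "\<rho> > 0 \<and> c < V \<rho>" for \<rho>
        using that c0 by (intro divide_left_mono) auto
    qed (use ps cum c0 in auto)
    thus ?thesis by (rule weak_conv_at_top_cong[rotated]) (use pos in eventually_elim, simp add: EC[unfolded One_nat_def])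
  qed
  show ?thesis using cum C3 clt clt' unfolding C_def by blast
qed

end
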